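(* Let $d\ge3$ and let $X$ be the plane curve given by $h=x^{d-1}y+y^{d-1}z+z^{d-1}x$ over an algebraically closed field $k$ of characteristic $p\ge d^2$. Let $V$ be the bundle defined by the canonical sequence $$0\to V\to H^0(X,\mathcal{O}_X(1))\otimes\mathcal{O}_X\to\mathcal{O}_X(1)\to0.$$ Put $\alpha=d-2$ and $\lambda=d^2-3d+3$. (1) If $p\equiv\pm1\pmod\lambda$, then $V$ is strongly semistable. (2) Suppose $p\equiv\pm2\pmod\lambda$ and $d$ is even. (a) If $d=4$, then $F^*V$ is semistable and the Harder–Narasimhan (HN) filtration of $F^{2*}V$ is $0\subset\mathcal{L}\subset F^{2*}V$ with $\mu(\mathcal{L})=\mu(F^{2*}V)+2$. (b) Let $d\ge6$ and $m\ge2$. If $3\cdot2^{m-2}\le d-1<2^m$, then $F^{(m-1)*}V$ is semistable and the HN filtration of $F^{m*}V$ is $0\subset\mathcal{L}\subset F^{m*}V$ with $$\mu(\mathcal{L})=\mu(F^{m*}V)+2\alpha(d-1-3\cdot2^{m-2})+2.$$ If $2^m\le d-1<3\cdot2^{m-1}$, then $F^{(m-1)*}V$ is semistable and the HN filtration of $F^{m*}V$ is $0\subset\mathcal{L}\subset F^{m*}V$ with $$\mu(\mathcal{L})=\mu(F^{m*}V)+\alpha(3\cdot2^{m-1}-(d-1))-1.$$ (3) Suppose $p\equiv\pm2\pmod\lambda$ and $d$ is odd. (a) If $d\ge7$, then $V$ is semistable and the HN filtration of $F^*V$ is $0\subset\mathcal{L}\subset F^*V$ with $\mu(\mathcal{L})=\mu(F^*V)+\frac{\lambda-6\alpha}{2}$.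 (b) If $d=5$, then $F^{2*}V$ is semistable and the HN filtration of $F^{3*}V$ is $0\subset\mathcal{L}\subset F^{3*}V$ with $\mu(\mathcal{L})=\mu(F^{3*}V)+\frac72$.
   Context: $F$ is the Frobenius morphism of $X$, $\mu=\deg/\mathrm{rank}$, and a bundle $V$ is strongly semistable if $F^{s*}V$ is semistable for all $s\ge0$. The sub-bundles $\mathcal{L}$ are line bundles. *)

theory Defs
  imports
    "HOL-Computational_Algebra.Computational_Algebra"
    "HOL-Number_Theory.Cong"
    "Jordan_Normal_Form.Determinant"
begin

text \<open>
  Classical language of varieties over an algebraically closed field.

  A projective variety in the projective plane is represented by the punctured cone over it, a set
  of nonzero vectors of homogeneous coordinates closed under nonzero scalars; an open subset is
  likewise represented by the cone over it.  In this way a section of O(m) is literally a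
  function on the cone (a local quotient of forms, of degree m), not only a section of O = O(0).

  All sheaves of modules are sheaves of functions on the cone with values in the vector space of
  sequences in k.  This covers all vector bundles: X is reduced, so a section of a locally
  free sheaf is determined by its values in the fibres E(P), which are finite-dimensional over k
  and can be placed inside the space of sequences.  A section over U is extended by 0
  outside U, so that equality of sections is equality of functions.
\<close>

type_synonym 'k pt = "'k \<times> 'k \<times> 'k"
type_synonym 'k sheaf_section = "'k pt \<Rightarrow> nat \<Rightarrow> 'k"
type_synonym 'k sheaf = "'k pt set \<Rightarrow> 'k sheaf_section set"

subsection \<open>Varieties, open sets, regular functions\<close>

definition form :: "nat \<Rightarrow> ('k::field pt \<Rightarrow> 'k) \<Rightarrow> bool" where
  "form n F \<longleftrightarrow> (\<exists>c :: nat \<Rightarrow> nat \<Rightarrow> 'k.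
     F = (\<lambda>(x, y, z). \<Sum>i\<le>n. \<Sum>j\<le>n - i. c i j * x ^ i * y ^ j * z ^ (n - i - j)))"

text \<open>Only the underlying variety is recorded, which is the scheme h = 0 when h is reduced.\<close>

definition plane_curve :: "('k::field pt \<Rightarrow> 'k) \<Rightarrow> 'k pt set" where
  "plane_curve h = {v. v \<noteq> (0, 0, 0) \<and> h v = 0}"

definition proj_point :: "'k::field pt \<Rightarrow> 'k pt set" where
  "proj_point v = (case v of (x, y, z) \<Rightarrow> {(c * x, c * y, c * z) | c. c \<noteq> 0})"

definition points :: "'k::field pt set \<Rightarrow> 'k pt set set" where
  "points X = proj_point ` X"

definition zopen :: "'k::field pt set \<Rightarrow> 'k pt set \<Rightarrow> bool" where
  "zopen X U \<longleftrightarrow> (\<exists>\<F>. (\<forall>F\<in>\<F>. \<exists>n. form n F) \<and> U = {v \<in> X. \<exists>F\<in>\<F>. F v \<noteq> 0})"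

text \<open>The sections over U of the sheaf O(m) of X, in particular the ring O(U) for m = 0.\<close>

definition twisted_functions :: "'k::field pt set \<Rightarrow> int \<Rightarrow> 'k pt set \<Rightarrow> ('k pt \<Rightarrow> 'k) set" where
  "twisted_functions X m U = {f. (\<forall>v. v \<notin> U \<longrightarrow> f v = 0) \<and>
     (\<forall>v\<in>U. \<exists>W a b F G. zopen X W \<and> v \<in> W \<and> W \<subseteq> U \<and> form a F \<and> form b G \<and> int a - int b = m \<and>
        (\<forall>w\<in>W. G w \<noteq> 0 \<and> f w = F w / G w))}"

abbreviation regular :: "'k::field pt set \<Rightarrow> 'k pt set \<Rightarrow> ('k pt \<Rightarrow> 'k) set" where
  "regular X U \<equiv> twisted_functions X 0 U"

subsection \<open>Vector bundles\<close>

definition restr :: "'k::field pt set \<Rightarrow> 'k sheaf_section \<Rightarrow> 'k sheaf_section" where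
  "restr W s = (\<lambda>v j. if v \<in> W then s v j else 0)"

definition module_sheaf :: "'k::field pt set \<Rightarrow> 'k sheaf \<Rightarrow> bool" where
  "module_sheaf X E \<longleftrightarrow> (\<forall>U. zopen X U \<longrightarrow>
     (\<forall>s\<in>E U. \<forall>v. v \<notin> U \<longrightarrow> (\<forall>j. s v j = 0)) \<and>
     (\<lambda>v j. 0) \<in> E U \<and>
     (\<forall>s\<in>E U. \<forall>t\<in>E U. (\<lambda>v j. s v j + t v j) \<in> E U) \<and>
     (\<forall>f\<in>regular X U. \<forall>s\<in>E U. (\<lambda>v j. f v * s v j) \<in> E U) \<and>
     (\<forall>W s. zopen X W \<and> W \<subseteq> U \<and> s \<in> E U \<longrightarrow> restr W s \<in> E W) \<and>
     (\<forall>s. (\<forall>v. v \<notin> U \<longrightarrow> (\<forall>j. s v j = 0)) \<and>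
          (\<forall>v\<in>U. \<exists>W. zopen X W \<and> v \<in> W \<and> W \<subseteq> U \<and> restr W s \<in> E W) \<longrightarrow> s \<in> E U))"

definition independent_values :: "nat \<Rightarrow> (nat \<Rightarrow> 'k::field sheaf_section) \<Rightarrow> 'k pt \<Rightarrow> bool" where
  "independent_values r e v \<longleftrightarrow>
     (\<forall>c :: nat \<Rightarrow> 'k. (\<forall>j. (\<Sum>i<r. c i * e i v j) = 0) \<longrightarrow> (\<forall>i<r. c i = 0))"

definition local_frame ::
    "'k::field pt set \<Rightarrow> 'k sheaf \<Rightarrow> nat \<Rightarrow> 'k pt set \<Rightarrow> (nat \<Rightarrow> 'k sheaf_section) \<Rightarrow> bool" where
  "local_frame X E r U e \<longleftrightarrow> zopen X U \<and> (\<forall>i<r. e i \<in> E U) \<and> (\<forall>v\<in>U. independent_values r e v) \<and>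
     (\<forall>W s. zopen X W \<and> W \<subseteq> U \<and> s \<in> E W \<longrightarrow>
        (\<exists>f. (\<forall>i<r. f i \<in> regular X W) \<and> s = (\<lambda>v j. \<Sum>i<r. f i v * e i v j)))"

definition vector_bundle_rank :: "'k::field pt set \<Rightarrow> nat \<Rightarrow> 'k sheaf \<Rightarrow> bool" where
  "vector_bundle_rank X r E \<longleftrightarrow>
     module_sheaf X E \<and> (\<forall>v\<in>X. \<exists>U e. v \<in> U \<and> local_frame X E r U e)"

definition vector_bundle :: "'k::field pt set \<Rightarrow> 'k sheaf \<Rightarrow> bool" where
  "vector_bundle X E \<longleftrightarrow> (\<exists>r. vector_bundle_rank X r E)"

definition bundle_rank :: "'k::field pt set \<Rightarrow> 'k sheaf \<Rightarrow> nat" where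
  "bundle_rank X E = (THE r. vector_bundle_rank X r E)"

abbreviation line_bundle :: "'k::field pt set \<Rightarrow> 'k sheaf \<Rightarrow> bool" where
  "line_bundle X L \<equiv> vector_bundle_rank X 1 L"

definition zero_bundle :: "'k::field sheaf" where
  "zero_bundle = (\<lambda>U. {\<lambda>v j. 0})"

definition trivial_bundle :: "'k::field pt set \<Rightarrow> nat \<Rightarrow> 'k sheaf" where
  "trivial_bundle X n U =
     {s. (\<forall>i<n. (\<lambda>v. s v i) \<in> regular X U) \<and> (\<forall>v. \<forall>i\<ge>n. s v i = 0)}"

text \<open>
  Values of a local frame of W are independent in the fibre, so a vector bundle W
  contained in E maps injectively on fibres: this is the notion of sub-bundle, not just of a
  locally free subsheaf.
\<close>

definition subbundle :: "'k::field pt set \<Rightarrow> 'k sheaf \<Rightarrow> 'k sheaf \<Rightarrow> bool" where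
  "subbundle X W E \<longleftrightarrow> vector_bundle X W \<and> vector_bundle X E \<and> (\<forall>U. zopen X U \<longrightarrow> W U \<subseteq> E U)"

definition sheaf_hom ::
    "'k::field pt set \<Rightarrow> 'k sheaf \<Rightarrow> 'k sheaf \<Rightarrow> ('k pt set \<Rightarrow> 'k sheaf_section \<Rightarrow> 'k sheaf_section) \<Rightarrow> bool" where
  "sheaf_hom X E Q \<phi> \<longleftrightarrow> (\<forall>U. zopen X U \<longrightarrow>
     (\<forall>s\<in>E U. \<phi> U s \<in> Q U) \<and>
     (\<forall>s\<in>E U. \<forall>t\<in>E U. \<phi> U (\<lambda>v j. s v j + t v j) = (\<lambda>v j. \<phi> U s v j + \<phi> U t v j)) \<and>
     (\<forall>f\<in>regular X U. \<forall>s\<in>E U. \<phi> U (\<lambda>v j. f v * s v j) = (\<lambda>v j. f v * \<phi> U s v j)) \<and>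
     (\<forall>W s. zopen X W \<and> W \<subseteq> U \<and> s \<in> E U \<longrightarrow> \<phi> W (restr W s) = restr W (\<phi> U s)))"

text \<open>Q is (isomorphic to) the quotient E/W: there is an exact sequence
  0 \<open>\<rightarrow>\<close> W \<open>\<rightarrow>\<close> E \<open>\<rightarrow>\<close> Q \<open>\<rightarrow>\<close> 0 of sheaves whose first map is the inclusion.\<close>

definition quotient_bundle :: "'k::field pt set \<Rightarrow> 'k sheaf \<Rightarrow> 'k sheaf \<Rightarrow> 'k sheaf \<Rightarrow> bool" where
  "quotient_bundle X E W Q \<longleftrightarrow> subbundle X W E \<and> vector_bundle X Q \<and>
     (\<exists>\<phi>. sheaf_hom X E Q \<phi> \<and>
       (\<forall>U. zopen X U \<longrightarrow> {s \<in> E U. \<phi> U s = (\<lambda>v j. 0)} = W U) \<and>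
       (\<forall>U t v. zopen X U \<and> t \<in> Q U \<and> v \<in> U \<longrightarrow>
          (\<exists>U' s. zopen X U' \<and> v \<in> U' \<and> U' \<subseteq> U \<and> s \<in> E U' \<and> \<phi> U' s = restr U' t)))"

subsection \<open>Degree and slope on a nonsingular projective curve\<close>

definition uniformizer :: "'k::field pt set \<Rightarrow> 'k pt set \<Rightarrow> 'k pt set \<Rightarrow> ('k pt \<Rightarrow> 'k) \<Rightarrow> bool" where
  "uniformizer X P W t \<longleftrightarrow> zopen X W \<and> P \<subseteq> W \<and> t \<in> regular X W \<and> (\<forall>v\<in>P. t v = 0) \<and>
     (\<forall>W' f. zopen X W' \<and> P \<subseteq> W' \<and> W' \<subseteq> W \<and> f \<in> regular X W' \<and> (\<forall>v\<in>P. f v = 0) \<longrightarrow>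
        (\<exists>W'' g. zopen X W'' \<and> P \<subseteq> W'' \<and> W'' \<subseteq> W' \<and> g \<in> regular X W'' \<and>
           (\<forall>w\<in>W''. f w = g w * t w)))"

text \<open>
  The order at P of a nonzero rational function g.  Its values are only used on a punctured
  neighbourhood of P, so g may have been extended by 0 outside its domain of definition.
\<close>

definition ord_at :: "'k::field pt set \<Rightarrow> 'k pt set \<Rightarrow> ('k pt \<Rightarrow> 'k) \<Rightarrow> int" where
  "ord_at X P g = (THE n. \<exists>W t u. uniformizer X P W t \<and> u \<in> regular X W \<and> (\<forall>w\<in>W. u w \<noteq> 0) \<and>
     (\<forall>w\<in>W - P. t w \<noteq> 0 \<and> g w = u w * t w powi n))"

text \<open>
  The order at P of the rational section \<open>s\<^sub>0 \<and> \<dots> \<and> s\<^sub>r\<^sub>-\<^sub>1\<close> of det E, for sections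
  \<open>s\<^sub>i\<close> of E over a nonempty open set U: the order of the determinant of the transition
  matrix from a local frame of E at P to s.
\<close>

definition det_ord ::
    "'k::field pt set \<Rightarrow> 'k sheaf \<Rightarrow> nat \<Rightarrow> 'k pt set \<Rightarrow> (nat \<Rightarrow> 'k sheaf_section) \<Rightarrow> 'k pt set \<Rightarrow> int" where
  "det_ord X E r U s P = (THE n. \<exists>W e a. P \<subseteq> W \<and> local_frame X E r W e \<and>
     (\<forall>i<r. \<forall>j<r. a i j \<in> regular X (U \<inter> W)) \<and>
     (\<forall>v\<in>U \<inter> W. \<forall>j<r. \<forall>l. s j v l = (\<Sum>i<r. a i j v * e i v l)) \<and>
     n = ord_at X P (\<lambda>v. det (mat r r (\<lambda>(i, j). a i j v))))"

text \<open>deg E = deg(det E), the degree of the divisor of a nonzero rational section of det E.\<close>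

definition bundle_degree :: "'k::field pt set \<Rightarrow> 'k sheaf \<Rightarrow> int" where
  "bundle_degree X E = (THE D. \<exists>U s. U \<noteq> {} \<and> local_frame X E (bundle_rank X E) U s \<and>
     D = (\<Sum>P\<in>{P \<in> points X. det_ord X E (bundle_rank X E) U s P \<noteq> 0}.
            det_ord X E (bundle_rank X E) U s P))"

definition slope :: "'k::field pt set \<Rightarrow> 'k sheaf \<Rightarrow> rat" where
  "slope X E = of_int (bundle_degree X E) / of_nat (bundle_rank X E)"

subsection \<open>Semistability, Harder--Narasimhan filtration, Frobenius\<close>

definition semistable :: "'k::field pt set \<Rightarrow> 'k sheaf \<Rightarrow> bool" where
  "semistable X E \<longleftrightarrow> vector_bundle X E \<and>
     (\<forall>W. subbundle X W E \<and> bundle_rank X W > 0 \<longrightarrow> slope X W \<le> slope X E)"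

definition HN_filtration :: "'k::field pt set \<Rightarrow> 'k sheaf \<Rightarrow> 'k sheaf list \<Rightarrow> bool" where
  "HN_filtration X E Es \<longleftrightarrow> Es \<noteq> [] \<and> hd Es = zero_bundle \<and> last Es = E \<and>
     (\<exists>Qs. length Es = Suc (length Qs) \<and>
       (\<forall>i<length Qs. quotient_bundle X (Es ! Suc i) (Es ! i) (Qs ! i) \<and>
          bundle_rank X (Qs ! i) > 0 \<and> semistable X (Qs ! i)) \<and>
       (\<forall>i. Suc i < length Qs \<longrightarrow> slope X (Qs ! i) > slope X (Qs ! Suc i)))"

text \<open>
  The absolute Frobenius F is the identity on points and the p-th power map on functions,
  and the pull-back of E is the sheaf associated to \<open>U \<mapsto> O(U) \<otimes> E(U)\<close>, where O(U) is
  an O(U)-module via the p-th power map.  For a vector bundle E it is realised inside sequence-valued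
  functions by sending \<open>1 \<otimes> e\<close> to the coordinatewise p-th power of e; this is injective
  since independent vectors have independent p-th powers.
\<close>

definition frobenius_pullback :: "'k::field pt set \<Rightarrow> 'k sheaf \<Rightarrow> 'k sheaf" where
  "frobenius_pullback X E U = {s. (\<forall>v. v \<notin> U \<longrightarrow> (\<forall>j. s v j = 0)) \<and>
     (\<forall>v\<in>U. \<exists>W n f e. zopen X W \<and> v \<in> W \<and> W \<subseteq> U \<and>
        (\<forall>i<n. f i \<in> regular X W \<and> e i \<in> E W) \<and>
        (\<forall>w\<in>W. \<forall>j. s w j = (\<Sum>i<(n::nat). f i w * e i w j ^ CHAR('k))))}"

definition frobenius_pullback_iter :: "'k::field pt set \<Rightarrow> nat \<Rightarrow> 'k sheaf \<Rightarrow> 'k sheaf" where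
  "frobenius_pullback_iter X m E = (frobenius_pullback X ^^ m) E"

definition strongly_semistable :: "'k::field pt set \<Rightarrow> 'k sheaf \<Rightarrow> bool" where
  "strongly_semistable X E \<longleftrightarrow> (\<forall>m. semistable X (frobenius_pullback_iter X m E))"

subsection \<open>The syzygy bundle\<close>

definition global_sections_basis ::
    "'k::field pt set \<Rightarrow> int \<Rightarrow> nat \<Rightarrow> (nat \<Rightarrow> 'k pt \<Rightarrow> 'k) \<Rightarrow> bool" where
  "global_sections_basis X m n S \<longleftrightarrow> (\<forall>i<n. S i \<in> twisted_functions X m X) \<and>
     (\<forall>c. (\<forall>v. (\<Sum>i<n. c i * S i v) = 0) \<longrightarrow> (\<forall>i<n. c i = 0)) \<and>
     (\<forall>f\<in>twisted_functions X m X. \<exists>c. f = (\<lambda>v. \<Sum>i<n. c i * S i v))"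

text \<open>
  The kernel of the evaluation map from \<open>H\<^sup>0(X, O(1)) \<otimes> O\<close> to O(1), where
  \<open>H\<^sup>0(X, O(1)) \<otimes> O\<close> is identified with the trivial bundle of rank n by a basis
  \<open>S\<^sub>0, \<dots>, S\<^sub>n\<^sub>-\<^sub>1\<close> of \<open>H\<^sup>0(X, O(1))\<close>.
\<close>

definition evaluation_kernel ::
    "'k::field pt set \<Rightarrow> nat \<Rightarrow> (nat \<Rightarrow> 'k pt \<Rightarrow> 'k) \<Rightarrow> 'k sheaf" where
  "evaluation_kernel X n S U =
     {g \<in> trivial_bundle X n U. \<forall>v\<in>U. (\<Sum>i<n. g v i * S i v) = 0}"

end

theory Submission
  imports Defs
begin

text \<open>
  Put \<open>q = p ^ s\<close>, \<open>\<alpha> = d - 2\<close> and \<open>\<lambda> = d\<^sup>2 - 3 * d + 3\<close>. The pull-back of \<open>V\<close> under the \<open>s\<close>-th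
  Frobenius power is the bundle of syzygies of \<open>x ^ q, y ^ q, z ^ q\<close>. A diagonal cyclic group of order \<open>\<lambda>\<close> acts
  on \<open>X\<close> with quotient a projective line, on which the three terms of the equation become \<open>t, 1, - 1 - t\<close>.
  A line sub-bundle that differs from one of its translates is not destabilising, because the cross product with the
  translate is a nonzero function; an invariant one comes from coprime polynomials \<open>A\<close>, \<open>B\<close>, \<open>- A - B\<close> in \<open>t\<close>, and
  its degree is determined by \<open>max (deg A) (deg B)\<close> and by the orders of vanishing \<open>n\<^sub>1, n\<^sub>2, n\<^sub>3\<close> of the
  three polynomials at the three branch points. Unless all of them are \<open>p\<close>-th powers, in which case \<open>s\<close> can be
  lowered, their Wronskian is nonzero and gives the Mason-Stothers inequality. Hence if no earlier pull-back is
  destabilised, then a destabilising sub-bundle forces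
  \<open>|\<lambda> n\<^sub>1 - q \<alpha>| + |\<lambda> n\<^sub>2 - q \<alpha>| + |\<lambda> n\<^sub>3 - q \<alpha>| < \<lambda>\<close> for some \<open>n\<^sub>1, n\<^sub>2, n\<^sub>3\<close> with odd sum. Conversely
  a dimension count produces such polynomials when \<open>q \<alpha>\<close> is within \<open>\<lambda> / 3\<close> of an odd multiple of \<open>\<lambda>\<close>,
  and the degree of the sub-bundle is then exactly determined. Finally \<open>q \<alpha>\<close> modulo \<open>2 * \<lambda>\<close> is computed from
  the residue of \<open>p\<close> modulo \<open>\<lambda>\<close>.
\<close>

section \<open>Forms and regular functions\<close>

text \<open>The map \<open>tt\<close> from X to the projective line is a Kummer cover of degree
  \<open>lam\<close>, totally ramified over 0, -1 and infinity and unramified elsewhere. The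
  geometry of X is read off this cover: irreducibility from expansions in \<open>yy\<close>, orders
  and the product formula from norms, and H^0(X, O(1)) from eigenspaces. The bound p \<ge> d^2
  matters mainly in two places: it keeps \<open>lam\<close> invertible, so that the group has full
  order and averaging is possible, and it gives nonconstant p-th powers too large a degree to
  destabilise V itself. The offset q \<alpha> arises because at each branch point two of the three
  entries of an invariant syzygy differ in order by q \<alpha>, up to multiples of
  \<open>lam\<close>. If m is the larger degree and no polynomial is zero, 2 deg L - deg E is
  \<open>lam\<close> (n1 + n2 + n3 - 2 m) minus the three distances. The Wronskian gives n1 + n2 +
  n3 \<le> 2 m + 1, so positivity forces equality: hence the odd sum. The same formula turns the
  lower bound of the dimension count into an equality, since only n1 = n2 = n3 comes close
  enough.\<close>

abbreviation cy :: "'k::field pt \<Rightarrow> 'k" where "cy v \<equiv> fst (snd v)"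
abbreviation cz :: "'k::field pt \<Rightarrow> 'k" where "cz v \<equiv> snd (snd v)"
abbreviation pord :: "'k::idom \<Rightarrow> 'k poly \<Rightarrow> nat" where "pord \<equiv> Polynomial.order"

definition monom3 :: "nat \<Rightarrow> nat \<Rightarrow> nat \<Rightarrow> 'k::field pt \<Rightarrow> 'k" where
 "monom3 i j l v = fst v ^ i * cy v ^ j * cz v ^ l"

definition pscale :: "'k::field \<Rightarrow> 'k pt \<Rightarrow> 'k pt" where
 "pscale c v = (c * fst v, c * cy v, c * cz v)"

lemma form_iff:
 "form n F \<longleftrightarrow> (\<exists>c. F = (\<lambda>v. \<Sum>i\<le>n. \<Sum>j\<le>n - i. c i j * monom3 i j (n - i - j) v))"
 unfolding form_def monom3_def by (simp add: case_prod_unfold mult.assoc)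

lemma form_zero [simp]: "form n (\<lambda>v. 0)" unfolding form_iff by (rule exI[of _ "\<lambda>_ _. 0"]) simp

lemma form_add [intro]: "form n F \<Longrightarrow> form n G \<Longrightarrow> form n (\<lambda>v. F v + G v)" unfolding form_iff
proof (elim exE)
 fix c e
 assume "F = (\<lambda>v. \<Sum>i\<le>n. \<Sum>j\<le>n - i. c i j * monom3 i j (n - i - j) v)"
  "G = (\<lambda>v. \<Sum>i\<le>n. \<Sum>j\<le>n - i. e i j * monom3 i j (n - i - j) v)"
 then show "\<exists>c. (\<lambda>v. F v + G v) = (\<lambda>v. \<Sum>i\<le>n. \<Sum>j\<le>n - i. c i j * monom3 i j (n - i - j) v)"
  by (intro exI[of _ "\<lambda>i j. c i j + e i j"]) (simp add: sum.distrib distrib_right)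
qed

lemma form_cmult [intro]: "form n F \<Longrightarrow> form n (\<lambda>v. a * F v)" unfolding form_iff
proof (elim exE)
 fix c
 assume "F = (\<lambda>v. \<Sum>i\<le>n. \<Sum>j\<le>n - i. c i j * monom3 i j (n - i - j) v)"
 then show "\<exists>c. (\<lambda>v. a * F v) = (\<lambda>v. \<Sum>i\<le>n. \<Sum>j\<le>n - i. c i j * monom3 i j (n - i - j) v)"
  by (intro exI[of _ "\<lambda>i j. a * c i j"]) (simp add: sum_distrib_left mult.assoc)
qed

lemma form_monom3: assumes "i + j + l = n" shows "form n (monom3 i j l)" unfolding form_iff
proof (rule exI[of _ "\<lambda>i' j'. if i' = i then (if j' = j then 1 else 0) else 0"], rule ext)
 fix v :: "'k::field pt"
 have "(\<Sum>i'\<le>n. \<Sum>j'\<le>n - i'. (if i' = i then (if j' = j then 1 else 0) else 0) * monom3 i' j' (n - i' - j') v)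
   = (\<Sum>i'\<le>n. if i' = i then (\<Sum>j'\<le>n - i. if j' = j then monom3 i j l v else 0) else 0)"
  using assms by (intro sum.cong refl) (auto intro!: sum.cong simp del: sum.delta sum.delta')
 also have "\<dots> = monom3 i j l v" using assms by (simp add: sum.delta)
 finally show "monom3 i j l v = (\<Sum>i'\<le>n. \<Sum>j'\<le>n - i'. (if i' = i then (if j' = j then 1 else 0) else 0) * monom3 i' j' (n - i' - j') v)"
  by simp
qed

lemma form_sum: "(\<And>i. i \<in> A \<Longrightarrow> form n (F i)) \<Longrightarrow> form n (\<lambda>v. \<Sum>i\<in>A. F i v)"
 by (induction A rule: infinite_finite_induct) auto

text \<open>Properties that respect sums need only be checked on one monomial; products,
  substitutions and values on the curve are all treated this way, without the double sum of the
  definition.\<close>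

lemma form_induct [consumes 1, case_names zero add mono]:
 assumes "form n F" and zero: "P (\<lambda>v. 0)"
  and add: "\<And>F G. form n F \<Longrightarrow> form n G \<Longrightarrow> P F \<Longrightarrow> P G \<Longrightarrow> P (\<lambda>v. F v + G v)"
  and mono: "\<And>c i j l. i + j + l = n \<Longrightarrow> P (\<lambda>v. c * monom3 i j l v)" shows "P F"
proof -
 have sm: "P (\<lambda>v. \<Sum>i\<in>A. F i v)" if "\<And>i. i \<in> A \<Longrightarrow> form n (F i) \<and> P (F i)"
  for F :: "nat \<Rightarrow> 'a pt \<Rightarrow> 'a" and A using that
 proof (induction A rule: infinite_finite_induct)
  case (insert x A)
  then show ?case using add[of "F x" "\<lambda>v. \<Sum>i\<in>A. F i v"] form_sum[of A n F] by auto
 qed (auto simp: zero)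
 obtain c where c: "F = (\<lambda>v. \<Sum>i\<le>n. \<Sum>j\<le>n - i. c i j * monom3 i j (n - i - j) v)"
  using assms(1) unfolding form_iff by blast
 show ?thesis unfolding c by (intro sm conjI form_sum form_cmult form_monom3 mono) auto
qed

lemma monom3_mult: "monom3 i j l v * monom3 i' j' l' v = monom3 (i + i') (j + j') (l + l') v"
 by (simp add: monom3_def power_add algebra_simps)

lemma form_mult [intro]:
 assumes "form n F" "form m G" shows "form (n + m) (\<lambda>v. F v * G v)" using assms(1)
proof (induction rule: form_induct)
 case (mono c i j l)
 show ?case using assms(2)
 proof (induction rule: form_induct)
  case (mono e i' j' l')
  then show ?case using form_cmult[OF form_monom3[of "i+i'" "j+j'" "l+l'" "n+m"], of "c*e"] \<open>i + j + l = n\<close>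
   by (simp add: monom3_mult[symmetric] algebra_simps)
 qed (auto simp: distrib_left intro: form_add)
qed (auto simp: distrib_right intro: form_add)

lemma form_const [simp]: "form 0 (\<lambda>v. c)"
 using form_cmult[OF form_monom3[of 0 0 0 0], of c] by (simp add: monom3_def)

lemma form_power [intro]: "form n F \<Longrightarrow> form (n * k) (\<lambda>v. F v ^ k)" by (induction k) (auto dest: form_mult)

lemma form_diff [intro]: "form n F \<Longrightarrow> form n G \<Longrightarrow> form n (\<lambda>v. F v - G v)"
 using form_add[of n F "\<lambda>v. - 1 * G v"] form_cmult[of n G "- 1"] by simp

lemma form_prod: "finite A \<Longrightarrow> (\<And>i. i \<in> A \<Longrightarrow> form n (F i)) \<Longrightarrow> form (n * card A) (\<lambda>v. \<Prod>i\<in>A. F i v)"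
proof (induction A rule: finite_induct)
 case (insert x A)
 then show ?case using form_mult[of n "F x" "n * card A"] by simp
qed simp

lemma form_fst [simp]: "form (Suc 0) (\<lambda>v. fst v)"
 and form_snd1 [simp]: "form (Suc 0) (\<lambda>v. cy v)"
 and form_snd2 [simp]: "form (Suc 0) (\<lambda>v. cz v)"
 using form_monom3[of 1 0 0 1] form_monom3[of 0 1 0 1] form_monom3[of 0 0 1 1] by (simp_all add: monom3_def[abs_def])

section \<open>Forms under linear substitutions and scaling\<close>

lemma form_comp_linear:
 assumes "form n F" "form (Suc 0) (\<lambda>v. fst (\<phi> v))" "form (Suc 0) (\<lambda>v. cy (\<phi> v))"
  "form (Suc 0) (\<lambda>v. cz (\<phi> v))" shows "form n (\<lambda>v. F (\<phi> v))" using assms(1)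
proof (induction rule: form_induct)
 case (mono c i j l)
 have "form (Suc 0 * i + Suc 0 * j + Suc 0 * l) (\<lambda>v. monom3 i j l (\<phi> v))"
  unfolding monom3_def using assms by (intro form_mult form_power)
 then show ?case using mono by (auto intro: form_cmult)
qed (auto)

lemma form_pscale: "form n F \<Longrightarrow> F (pscale c v) = c ^ n * F v"
 by (induction rule: form_induct) (auto simp: pscale_def monom3_def power_mult_distrib power_add algebra_simps)

lemma proj_point_alt: "proj_point v = {pscale c v | c. c \<noteq> 0}"
 by (auto simp: proj_point_def pscale_def split: prod.splits)

lemma pscale_pscale [simp]: "pscale a (pscale b v) = pscale (a * b) v" by (simp add: pscale_def mult.assoc)

lemma pscale_1 [simp]: "pscale 1 v = v" by (simp add: pscale_def)

lemma proj_point_self [simp]: "v \<in> proj_point v" unfolding proj_point_alt by (auto intro!: exI[of _ 1])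

lemma proj_point_pscale [simp]: assumes "c \<noteq> 0" shows "proj_point (pscale c v) = proj_point v"
proof
 show "proj_point (pscale c v) \<subseteq> proj_point v" unfolding proj_point_alt using assms by auto
 show "proj_point v \<subseteq> proj_point (pscale c v)"
 proof
  fix w assume "w \<in> proj_point v"
  then obtain e where "e \<noteq> 0" "w = pscale e v" unfolding proj_point_alt by blast
  then show "w \<in> proj_point (pscale c v)" unfolding proj_point_alt using assms
   by (auto intro!: exI[of _ "e / c"])
 qed
qed

lemma proj_pointE:
 assumes "w \<in> proj_point v" obtains c where "c \<noteq> 0" "w = pscale c v"
 using assms unfolding proj_point_alt by blast

lemma proj_point_eq: assumes "w \<in> proj_point v" shows "proj_point w = proj_point v"
 using proj_pointE[OF assms] proj_point_pscale by metis

lemma form_proj_point: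
 "form n F \<Longrightarrow> w \<in> proj_point v \<Longrightarrow> F w = 0 \<longleftrightarrow> F v = 0" unfolding proj_point_alt by (auto simp: form_pscale)

section \<open>Zariski open sets\<close>

lemma zopen_sub: "zopen X U \<Longrightarrow> U \<subseteq> X" unfolding zopen_def by auto

lemma zopen_basic:
 "zopen X U \<Longrightarrow> v \<in> U \<Longrightarrow> \<exists>n F. form n F \<and> F v \<noteq> 0 \<and> {w \<in> X. F w \<noteq> 0} \<subseteq> U" unfolding zopen_def by blast

lemma zopenI:
 assumes "U \<subseteq> X" "\<And>v. v \<in> U \<Longrightarrow> \<exists>n F. form n F \<and> F v \<noteq> 0 \<and> {w \<in> X. F w \<noteq> 0} \<subseteq> U" shows "zopen X U"
 unfolding zopen_def by (rule exI[of _ "{F. (\<exists>n. form n F) \<and> {w \<in> X. F w \<noteq> 0} \<subseteq> U}"]) (use assms in blast)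

lemma zopen_D: "form n F \<Longrightarrow> zopen X {v \<in> X. F v \<noteq> 0}" by (rule zopenI) auto

lemma zopen_X [simp]: "zopen X X" using zopen_D[of 0 "\<lambda>v. 1"] by simp

lemma zopen_Int [intro]: assumes "zopen X U" "zopen X V" shows "zopen X (U \<inter> V)"
proof (rule zopenI)
 show "U \<inter> V \<subseteq> X" using zopen_sub assms by blast
 fix v assume "v \<in> U \<inter> V"
 then have v: "v \<in> U" "v \<in> V" by auto
 obtain n F where F: "form n F" "F v \<noteq> 0" "{w \<in> X. F w \<noteq> 0} \<subseteq> U" using zopen_basic[OF assms(1) v(1)] by blast
 obtain m G where G: "form m G" "G v \<noteq> 0" "{w \<in> X. G w \<noteq> 0} \<subseteq> V" using zopen_basic[OF assms(2) v(2)] by blast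
 have "form (n + m) (\<lambda>v. F v * G v)" using F(1) G(1) by (rule form_mult)
 moreover have "{w \<in> X. F w * G w \<noteq> 0} \<subseteq> U \<inter> V" using F(3) G(3) by auto
 ultimately show "\<exists>n F. form n F \<and> F v \<noteq> 0 \<and> {w \<in> X. F w \<noteq> 0} \<subseteq> U \<inter> V"
  using F(2) G(2) by (intro exI[of _ "n + m"] exI[of _ "\<lambda>v. F v * G v"]) simp
qed

lemma zopen_cone:
 assumes "zopen X U" "v \<in> U" "w \<in> proj_point v" "w \<in> X" shows "w \<in> U"
proof -
 obtain n F where "form n F" "F v \<noteq> 0" "{w \<in> X. F w \<noteq> 0} \<subseteq> U" using zopen_basic[OF assms(1,2)] by blast
 then show ?thesis using form_proj_point[OF _ assms(3)] assms(4) by blast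
qed

section \<open>Sections of the twisting sheaves\<close>

lemma tf_out: "f \<in> twisted_functions X m U \<Longrightarrow> v \<notin> U \<Longrightarrow> f v = 0" unfolding twisted_functions_def by blast

lemma tf_local:
 assumes "f \<in> twisted_functions X m U" "v \<in> U"
 obtains W a b F G where "zopen X W" "v \<in> W" "W \<subseteq> U" "form a F" "form b G" "int a - int b = m"
  "\<And>w. w \<in> W \<Longrightarrow> G w \<noteq> 0 \<and> f w = F w / G w" using assms unfolding twisted_functions_def by blast

lemma tfI:
 assumes "\<And>v. v \<notin> U \<Longrightarrow> f v = 0"
  "\<And>v. v \<in> U \<Longrightarrow> \<exists>W a b F G. zopen X W \<and> v \<in> W \<and> W \<subseteq> U \<and> form a F \<and> form b G \<and> int a - int b = m \<and>
    (\<forall>w\<in>W. G w \<noteq> 0 \<and> f w = F w / G w)" shows "f \<in> twisted_functions X m U"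
 using assms unfolding twisted_functions_def by blast

lemma tf_glue:
 assumes "\<And>v. v \<notin> U \<Longrightarrow> f v = 0"
  "\<And>v. v \<in> U \<Longrightarrow> \<exists>W g. zopen X W \<and> v \<in> W \<and> W \<subseteq> U \<and> g \<in> twisted_functions X m W \<and> (\<forall>w\<in>W. f w = g w)"
 shows "f \<in> twisted_functions X m U"
proof (rule tfI)
 fix v assume "v \<in> U"
 then obtain W g where W: "zopen X W" "v \<in> W" "W \<subseteq> U" "g \<in> twisted_functions X m W" "\<forall>w\<in>W. f w = g w"
  using assms(2) by blast
 obtain W' a b F G where "zopen X W'" "v \<in> W'" "W' \<subseteq> W" "form a F" "form b G" "int a - int b = m"
  "\<And>w. w \<in> W' \<Longrightarrow> G w \<noteq> 0 \<and> g w = F w / G w" using tf_local[OF W(4,2)] by metis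
 then show "\<exists>W a b F G. zopen X W \<and> v \<in> W \<and> W \<subseteq> U \<and> form a F \<and> form b G \<and> int a - int b = m \<and>
    (\<forall>w\<in>W. G w \<noteq> 0 \<and> f w = F w / G w)" using W by (metis subset_iff subset_trans)
qed (rule assms(1))

lemma tf_add:
 assumes "f \<in> twisted_functions X m U" "g \<in> twisted_functions X m U"
 shows "(\<lambda>v. f v + g v) \<in> twisted_functions X m U"
proof (rule tfI)
 fix v assume v: "v \<in> U"
 obtain W a b F G where 1: "zopen X W" "v \<in> W" "W \<subseteq> U" "form a F" "form b G" "int a - int b = m"
  "\<And>w. w \<in> W \<Longrightarrow> G w \<noteq> 0 \<and> f w = F w / G w" using tf_local[OF assms(1) v] by metis
 obtain W' a' b' F' G' where 2: "zopen X W'" "v \<in> W'" "W' \<subseteq> U" "form a' F'" "form b' G'" "int a' - int b' = m"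
  "\<And>w. w \<in> W' \<Longrightarrow> G' w \<noteq> 0 \<and> g w = F' w / G' w" using tf_local[OF assms(2) v] by metis
 \<comment> \<open>Equal twists make both products in the common numerator forms of the same degree,
   so their sum is again a form.\<close>
 have e: "b + a' = a + b'" using 1 2 by linarith
 have "form (a + b') (\<lambda>w. F w * G' w + G w * F' w)"
  by (rule form_add[OF form_mult[OF 1(4) 2(5)] form_mult[OF 1(5) 2(4), unfolded e]])
 moreover have "form (b + b') (\<lambda>w. G w * G' w)" using 1 2 by auto
 ultimately show "\<exists>W a b F G. zopen X W \<and> v \<in> W \<and> W \<subseteq> U \<and> form a F \<and> form b G \<and> int a - int b = m \<and>
    (\<forall>w\<in>W. G w \<noteq> 0 \<and> f w + g w = F w / G w)" using 1 2
  by (intro exI[of _ "W \<inter> W'"] exI[of _ "a + b'"] exI[of _ "b + b'"] exI[of _ "\<lambda>w. F w * G' w + G w * F' w"]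
    exI[of _ "\<lambda>w. G w * G' w"]) (auto simp: field_simps)
qed (simp add: tf_out[OF assms(1)] tf_out[OF assms(2)])

lemma tf_mult:
 assumes "f \<in> twisted_functions X m U" "g \<in> twisted_functions X m' U"
 shows "(\<lambda>v. f v * g v) \<in> twisted_functions X (m + m') U"
proof (rule tfI)
 fix v assume v: "v \<in> U"
 obtain W a b F G where 1: "zopen X W" "v \<in> W" "W \<subseteq> U" "form a F" "form b G" "int a - int b = m"
  "\<And>w. w \<in> W \<Longrightarrow> G w \<noteq> 0 \<and> f w = F w / G w" using tf_local[OF assms(1) v] by metis
 obtain W' a' b' F' G' where 2: "zopen X W'" "v \<in> W'" "W' \<subseteq> U" "form a' F'" "form b' G'" "int a' - int b' = m'"
  "\<And>w. w \<in> W' \<Longrightarrow> G' w \<noteq> 0 \<and> g w = F' w / G' w" using tf_local[OF assms(2) v] by metis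
 show "\<exists>W a b F G. zopen X W \<and> v \<in> W \<and> W \<subseteq> U \<and> form a F \<and> form b G \<and> int a - int b = m + m' \<and>
    (\<forall>w\<in>W. G w \<noteq> 0 \<and> f w * g w = F w / G w)" using 1 2
  by (intro exI[of _ "W \<inter> W'"] exI[of _ "a + a'"] exI[of _ "b + b'"] exI[of _ "\<lambda>w. F w * F' w"]
    exI[of _ "\<lambda>w. G w * G' w"]) (auto simp: field_simps)
qed (simp add: tf_out[OF assms(1)] tf_out[OF assms(2)])

lemma tf_frac:
 assumes "zopen X U" "form a F" "form b G" "int a - int b = m" "\<And>v. v \<in> U \<Longrightarrow> G v \<noteq> 0 \<and> f v = F v / G v"
  "\<And>v. v \<notin> U \<Longrightarrow> f v = 0" shows "f \<in> twisted_functions X m U"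
proof (rule tfI)
 show "f v = 0" if "v \<notin> U" for v using assms(6) that by simp
 fix v assume "v \<in> U"
 then show "\<exists>W a b F G. zopen X W \<and> v \<in> W \<and> W \<subseteq> U \<and> form a F \<and> form b G \<and> int a - int b = m \<and>
    (\<forall>w\<in>W. G w \<noteq> 0 \<and> f w = F w / G w)"
  using assms(1-5) by (intro exI[of _ U] exI[of _ a] exI[of _ b] exI[of _ F] exI[of _ G]) simp
qed

lemma tf_const: "zopen X U \<Longrightarrow> (\<lambda>v. if v \<in> U then c else 0) \<in> regular X U"
 by (rule tf_frac[of _ _ 0 "\<lambda>v. c" 0 "\<lambda>v. 1"]) auto

lemma regular_zero [simp]: "zopen X U \<Longrightarrow> (\<lambda>v. 0) \<in> regular X U" using tf_const[of X U 0] by simp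

lemma tf_cmult:
 assumes "f \<in> twisted_functions X m U" "zopen X U" shows "(\<lambda>v. c * f v) \<in> twisted_functions X m U"
proof -
 have "(\<lambda>v. (if v \<in> U then c else 0) * f v) = (\<lambda>v. c * f v)" using tf_out[OF assms(1)] by auto
 then show ?thesis using tf_mult[OF tf_const[OF assms(2), of c] assms(1)] by simp
qed

lemma tf_diff:
 assumes "f \<in> twisted_functions X m U" "g \<in> twisted_functions X m U" "zopen X U"
 shows "(\<lambda>v. f v - g v) \<in> twisted_functions X m U"
 using tf_add[OF assms(1) tf_cmult[OF assms(2,3), of "-1"]] by simp

lemma tf_sum:
 assumes "finite A" "A \<noteq> {}" "\<And>i. i \<in> A \<Longrightarrow> f i \<in> twisted_functions X m U"
 shows "(\<lambda>v. \<Sum>i\<in>A. f i v) \<in> twisted_functions X m U"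
 using assms by (induction A rule: finite_ne_induct) (auto intro: tf_add)

lemma regular_sum:
 assumes "zopen X U" "\<And>i. i \<in> A \<Longrightarrow> f i \<in> regular X U" shows "(\<lambda>v. \<Sum>i\<in>A. f i v) \<in> regular X U"
 using assms(2) by (induction A rule: infinite_finite_induct) (auto intro: tf_add regular_zero[OF assms(1)])

lemma regular_mult: "f \<in> regular X U \<Longrightarrow> g \<in> regular X U \<Longrightarrow> (\<lambda>v. f v * g v) \<in> regular X U"
 using tf_mult[of f X 0 U g 0] by simp

lemma regular_prod:
 assumes "zopen X U" "finite A" "A \<noteq> {}" "\<And>i. i \<in> A \<Longrightarrow> f i \<in> regular X U"
 shows "(\<lambda>v. \<Prod>i\<in>A. f i v) \<in> regular X U"
 using assms(2-4) by (induction A rule: finite_ne_induct) (auto intro: regular_mult)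

lemma regular_power:
 assumes "f \<in> regular X U" "n > 0" shows "(\<lambda>v. f v ^ n) \<in> regular X U" using assms(2)
proof (induction n rule: nat_induct_non_zero)
 case 1
 show ?case using assms(1) by simp
next
 case (Suc n)
 then show ?case using regular_mult[OF assms(1) Suc.IH] by simp
qed

lemma tf_inverse:
 assumes "f \<in> twisted_functions X m U" "\<And>v. v \<in> U \<Longrightarrow> f v \<noteq> 0"
 shows "(\<lambda>v. inverse (f v)) \<in> twisted_functions X (-m) U"
proof (rule tfI)
 fix v assume v: "v \<in> U"
 obtain W a b F G where 1: "zopen X W" "v \<in> W" "W \<subseteq> U" "form a F" "form b G" "int a - int b = m"
  "\<And>w. w \<in> W \<Longrightarrow> G w \<noteq> 0 \<and> f w = F w / G w" using tf_local[OF assms(1) v] by metis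
 have "\<forall>w\<in>W. F w \<noteq> 0 \<and> inverse (f w) = G w / F w"
 proof
  fix w assume w: "w \<in> W"
  then have "f w \<noteq> 0" using 1(3) assms(2) by blast
  then show "F w \<noteq> 0 \<and> inverse (f w) = G w / F w" using 1(7)[OF w] by auto
 qed
 then show "\<exists>W a b F G. zopen X W \<and> v \<in> W \<and> W \<subseteq> U \<and> form a F \<and> form b G \<and> int a - int b = - m \<and>
    (\<forall>w\<in>W. G w \<noteq> 0 \<and> inverse (f w) = F w / G w)"
  using 1 by (intro exI[of _ W] exI[of _ b] exI[of _ a] exI[of _ G] exI[of _ F]) auto
qed (simp add: tf_out[OF assms(1)])

lemma tf_restrict:
 assumes "f \<in> twisted_functions X m U" "zopen X W" "W \<subseteq> U"
 shows "(\<lambda>v. if v \<in> W then f v else 0) \<in> twisted_functions X m W"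
proof (rule tfI)
 fix v assume v: "v \<in> W"
 then have "v \<in> U" using assms(3) by blast
 obtain W' a b F G where 1: "zopen X W'" "v \<in> W'" "W' \<subseteq> U" "form a F" "form b G" "int a - int b = m"
  "\<And>w. w \<in> W' \<Longrightarrow> G w \<noteq> 0 \<and> f w = F w / G w" using tf_local[OF assms(1) \<open>v \<in> U\<close>] by metis
 then show "\<exists>W' a b F G. zopen X W' \<and> v \<in> W' \<and> W' \<subseteq> W \<and> form a F \<and> form b G \<and> int a - int b = m \<and>
    (\<forall>w\<in>W'. G w \<noteq> 0 \<and> (if w \<in> W then f w else 0) = F w / G w)" using v assms(2)
  by (intro exI[of _ "W' \<inter> W"] exI[of _ a] exI[of _ b] exI[of _ F] exI[of _ G]) auto
qed auto

section \<open>The trinomial curve\<close>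

text \<open>Separability of T^n - c: a double root would be a root of the derivative n T^(n-1),
  hence 0 because n is nonzero in the field, and 0 is not a root because c is nonzero.\<close>

lemma card_nth_roots:
 fixes c :: "'k::alg_closed_field"
 assumes "c \<noteq> 0" "n > 0" "of_nat n \<noteq> (0::'k)" shows "card {y. y ^ n = c} = n" "finite {y. y ^ n = c}"
proof -
 define q :: "'k poly" where "q = monom 1 n - [:c:]"
 have dq: "degree q = n" using assms(2) unfolding q_def
  by (subst diff_conv_add_uminus, subst degree_add_eq_left) (auto simp: degree_monom_eq)
 have q0: "q \<noteq> 0" using dq assms(2) by auto
 have pq: "poly q y = y ^ n - c" for y by (simp add: q_def poly_monom)
 have roots: "{y. y ^ n = c} = {y. poly q y = 0}" by (simp add: pq)
 show fin: "finite {y. y ^ n = c}" unfolding roots using q0 by (rule poly_roots_finite)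
 obtain A where A: "size A = degree q" "q = Polynomial.smult (lead_coeff q) (\<Prod>x\<in>#A. [:-x, 1:])"
  using alg_closed_imp_factorization[OF q0] by blast
 have dist: "count A x \<le> 1" for x
 proof (rule ccontr)
  assume "\<not> count A x \<le> 1"
  then obtain B where B: "A = {#x, x#} + B"
  proof -
   assume *: "\<And>B. A = {#x, x#} + B \<Longrightarrow> thesis"
   have "{#x, x#} \<subseteq># A" using \<open>\<not> count A x \<le> 1\<close> by (auto simp: subseteq_mset_def)
   then show thesis by (intro *[of "A - {#x, x#}"]) (simp only: subset_mset.add_diff_inverse)
  qed
  have "q = [:-x,1:] * ([:-x,1:] * Polynomial.smult (lead_coeff q) (\<Prod>x\<in>#B. [:-x, 1:]))"
   by (subst A(2)) (simp add: B algebra_simps)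
  then obtain r where r: "q = [:-x,1:] * ([:-x,1:] * r)" by blast
  have "poly (pderiv q) x = 0" unfolding r pderiv_mult poly_add poly_mult by simp
  moreover have "poly (pderiv q) x = of_nat n * x ^ (n - 1)"
   by (simp add: q_def pderiv_diff pderiv_monom poly_monom pderiv_pCons)
  ultimately have "x = 0" using assms(3) by auto
  moreover have "poly q x = 0" unfolding r by simp
  ultimately show False using assms(1,2) by (simp add: pq power_0_left)
 qed
 have rt: "{y. poly q y = 0} = set_mset A"
  by (subst A(2)) (use q0 in \<open>auto simp: poly_prod_mset prod_mset_zero_iff image_iff\<close>)
 have "size A = (\<Sum>x\<in>set_mset A. count A x)" by (simp add: size_multiset_overloaded_eq)
 also have "\<dots> = (\<Sum>x\<in>set_mset A. 1)"
 proof (rule sum.cong)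
  fix x assume "x \<in> set_mset A"
  then have "count A x > 0" by simp
  then show "count A x = 1" using dist[of x] by linarith
 qed simp
 finally show "card {y. y ^ n = c} = n" using A(1) dq unfolding roots rt by simp
qed

text \<open>Euclid's argument: over a finite field the product of all T - a, plus 1, would be a
  nonconstant polynomial without a root.\<close>

lemma infinite_alg_closed: "infinite (UNIV :: 'k::alg_closed_field set)"
proof
 assume fin: "finite (UNIV :: 'k set)"
 define q :: "'k poly" where "q = (\<Prod>a\<in>UNIV. [:-a, 1:]) + 1"
 have "degree (\<Prod>a\<in>UNIV. [:-a, 1::'k:]) = card (UNIV::'k set)"
  using degree_prod_eq_sum_degree[of UNIV "\<lambda>a. [:-a, 1::'k:]"] by simp
 then have dg: "degree (\<Prod>a\<in>UNIV. [:-a, 1::'k:]) > 0" using fin by (simp add: finite_UNIV_card_ge_0)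
 then have "degree q > 0" unfolding q_def by (subst degree_add_eq_left) auto
 then obtain x where "poly q x = 0" using alg_closed_imp_poly_has_root by blast
 moreover have "poly q x = 1" using fin by (simp add: q_def poly_prod)
 ultimately show False by simp
qed

lemma poly_zero_infinite:
 fixes q :: "'k::alg_closed_field poly"
 assumes "finite A" "\<And>t. t \<notin> A \<Longrightarrow> poly q t = 0" shows "q = 0"
proof (rule ccontr)
 assume "q \<noteq> 0"
 then have "finite ({x. poly q x = 0} \<union> A)" using assms(1) poly_roots_finite by blast
 moreover have "UNIV \<subseteq> {x. poly q x = 0} \<union> A" using assms(2) by blast
 ultimately show False using infinite_alg_closed finite_subset by blast
qed

locale trinomial_curve =
 fixes d :: nat and X :: "'k::alg_closed_field pt set"
 assumes d3: "d \<ge> 3" and char_big: "CHAR('k) \<ge> d\<^sup>2"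
  and X_eq: "X = plane_curve (\<lambda>(x, y, z). x ^ (d - 1) * y + y ^ (d - 1) * z + z ^ (d - 1) * x)"
begin

definition al :: nat where "al = d - 2"
definition ee :: nat where "ee = d - 1"
text \<open>Equal to d^2 - 3 d + 3. The product form makes the identity
  \<open>ee * ee + 1 = lam + ee\<close> visible, on which both the parametrisation of X and the
  group action rest.\<close>

definition lam :: nat where "lam = ee * al + 1"

lemma d_eq: "d = ee + 1" and d1_eq: "d - 1 = ee" and al_pos: "al \<ge> 1" and ee_eq: "ee = al + 1" and ee_pos [simp]: "ee > 0"
 using d3 by (auto simp: al_def ee_def)

lemma lam_pos [simp]: "lam > 0" by (simp add: lam_def)

lemma lam_gt: "lam > ee"
proof -
 have "ee * 1 \<le> ee * al" using al_pos by (intro mult_le_mono) auto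
 then show ?thesis unfolding lam_def by linarith
qed

text \<open>Here p \<ge> d^2 is used: \<open>lam\<close> is smaller than d^2, so p cannot divide it,
  and the cover of the line by X is tame.\<close>

lemma lam_nz: "of_nat lam \<noteq> (0::'k)"
proof
 assume "of_nat lam = (0::'k)"
 then have "CHAR('k) dvd lam" by (simp add: of_nat_eq_0_iff_char_dvd)
 then have "CHAR('k) \<le> lam" using lam_pos by (rule dvd_imp_le)
 moreover have "lam < d\<^sup>2"
 proof -
  have "d\<^sup>2 = (al + 2)\<^sup>2" using d_eq ee_eq by simp
  then show ?thesis by (simp add: lam_def ee_eq power2_eq_square)
 qed
 ultimately show False using char_big by linarith
qed

lemma X_iff: "v \<in> X \<longleftrightarrow> v \<noteq> (0, 0, 0) \<and>
  fst v ^ ee * cy v + cy v ^ ee * cz v + cz v ^ ee * fst v = 0"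
 unfolding X_eq plane_curve_def d1_eq by (simp add: case_prod_unfold)

text \<open>The part of X inside the torus. On X the vanishing of one coordinate forces a second one
  to vanish, so only the vertices (1:0:0), (0:1:0) and (0:0:1) are left out.\<close>

definition Xo :: "'k pt set" where
 "Xo = {v \<in> X. fst v \<noteq> 0 \<and> cy v \<noteq> 0 \<and> cz v \<noteq> 0}"

text \<open>The three terms of the equation of \<open>X\<close> are in the ratio \<open>tt : 1 : - 1 - tt\<close>, and \<open>tt\<close> is a
 coordinate on the quotient of \<open>X\<close> by the diagonal cyclic group of order \<open>lam\<close>.\<close>

definition tt :: "'k pt \<Rightarrow> 'k" where
 "tt v = fst v ^ ee * cy v / (cy v ^ ee * cz v)"

definition yy :: "'k pt \<Rightarrow> 'k" where "yy v = cy v / cz v"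

lemma Xo_X: "v \<in> Xo \<Longrightarrow> v \<in> X" by (simp add: Xo_def)

lemma Xo_one_tt: assumes "v \<in> Xo" shows "1 + tt v = - (cz v ^ ee * fst v / (cy v ^ ee * cz v))"
proof -
 have "cy v ^ ee * cz v \<noteq> 0" using assms by (auto simp: Xo_def)
 then show ?thesis using assms unfolding tt_def Xo_def X_iff
  by (auto simp: divide_simps) (metis add.commute add.left_commute add_eq_0_iff)
qed

lemma Xo_nz: assumes "v \<in> Xo" shows "tt v \<noteq> 0" "tt v \<noteq> -1" "1 + tt v \<noteq> 0" "yy v \<noteq> 0"
proof -
 show "tt v \<noteq> 0" "yy v \<noteq> 0" using assms by (auto simp: tt_def yy_def Xo_def)
 show 1: "1 + tt v \<noteq> 0" using Xo_one_tt[OF assms] assms by (auto simp: Xo_def)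
 show "tt v \<noteq> -1" using 1 by auto
qed

lemma Xo_xz: assumes "v \<in> Xo" shows "fst v / cz v = - (1 + tt v) * yy v ^ ee"
proof -
 obtain x y z where v: "v = (x, y, z)" by (metis prod.collapse)
 have nz: "x \<noteq> 0" "y \<noteq> 0" "z \<noteq> 0" using assms by (auto simp: Xo_def v)
 have 1: "- (1 + tt v) = z ^ ee * x / (y ^ ee * z)" unfolding Xo_one_tt[OF assms] by (simp add: v)
 show ?thesis unfolding 1 yy_def using nz by (simp add: v power_divide)
qed

text \<open>The equation of X in the coordinates \<open>tt\<close> and \<open>yy\<close>: a
  \<open>lam\<close>-th root of t / (-(1 + t))^\<open>ee\<close> is adjoined to k(t). This Kummer
  equation is the source of all counts of points and all expansions.\<close>

lemma Xo_yy: assumes "v \<in> Xo" shows "yy v ^ lam * (- (1 + tt v)) ^ ee = tt v"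
proof -
 define A Y where "A = fst v / cz v" and "Y = yy v"
 have Y: "Y \<noteq> 0" using Xo_nz(4)[OF assms] by (simp add: Y_def)
 have 1: "- (1 + tt v) = A / Y ^ ee" using Xo_xz[OF assms] Y by (simp add: A_def Y_def)
 have t: "tt v = A ^ ee * Y / Y ^ ee"
  using assms by (simp add: tt_def A_def Y_def yy_def power_divide Xo_def)
 have e: "ee * ee = ee * al + ee" by (simp add: ee_eq)
 have "Y ^ lam * (A / Y ^ ee) ^ ee = Y ^ lam * A ^ ee / Y ^ (ee * ee)" by (simp add: power_divide power_mult)
 also have "\<dots> = A ^ ee * Y / Y ^ ee" unfolding e lam_def using Y by (simp add: power_add)
 finally have "Y ^ lam * (A / Y ^ ee) ^ ee = tt v" unfolding t .
 then show ?thesis unfolding 1 by (simp only: Y_def)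
qed

text \<open>Converse of the Kummer equation: normalising z = 1, a solution (t, y) determines x, so
  the fibres of \<open>tt\<close> can be enumerated by roots.\<close>

lemma Xo_param:
 assumes "t \<noteq> 0" "t \<noteq> -1" "y ^ lam * (- (1 + t)) ^ ee = t"
 defines "v \<equiv> (- (1 + t) * y ^ ee, y, 1)" shows "v \<in> Xo" "tt v = t" "yy v = y"
proof -
 have t1: "1 + t \<noteq> 0" using assms(2) by (simp add: eq_neg_iff_add_eq_0 add.commute)
 have y: "y \<noteq> 0"
 proof
  assume "y = 0"
  then have "y ^ lam = 0" using lam_pos by (simp only: zero_power)
  then show False using assms(1,3) by (metis mult_zero_left)
 qed
 have t2: "(- (1 + t)) ^ ee * y ^ (ee * ee + 1) = t * y ^ ee"
 proof -
  have "ee * ee + 1 = lam + ee" by (simp add: lam_def ee_eq)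
  then have "(- (1 + t)) ^ ee * y ^ (ee * ee + 1) = (y ^ lam * (- (1 + t)) ^ ee) * y ^ ee"
   by (simp only: power_add mult.assoc mult.commute mult.left_commute)
  then show ?thesis by (simp only: assms(3))
 qed
 have e: "fst v ^ ee * cy v = t * y ^ ee"
  unfolding t2[symmetric] v_def by (simp only: fst_conv snd_conv power_mult_distrib power_mult[symmetric] power_add power_one_right mult.assoc)
 have "t * y ^ ee + y ^ ee * 1 + 1 ^ ee * (- (1 + t) * y ^ ee) = 0" by (simp add: algebra_simps)
 then have "v \<in> X" unfolding X_iff e by (simp add: v_def)
 then show "v \<in> Xo" using y assms(2) by (auto simp: Xo_def v_def)
 show "tt v = t" unfolding tt_def e using y by (simp add: v_def)
 show "yy v = y" by (simp add: yy_def v_def)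
qed

lemma Xo_norm: assumes "v \<in> Xo" shows "v = pscale (cz v) (- (1 + tt v) * yy v ^ ee, yy v, 1)"
proof -
 obtain x y z where v: "v = (x, y, z)" by (metis prod.collapse)
 have z: "z \<noteq> 0" using assms by (simp add: Xo_def v)
 have "pscale z (x / z, y / z, 1) = v" using z by (simp add: pscale_def v)
 moreover have "x / z = - (1 + tt v) * yy v ^ ee" using Xo_xz[OF assms] by (simp add: v)
 moreover have "y / z = yy v" by (simp add: yy_def v)
 ultimately show ?thesis by (simp add: v)
qed

lemma card_fibre_roots:
 fixes t :: 'k
 assumes "t \<noteq> 0" "t \<noteq> -1"
 shows "card {y. y ^ lam * (- (1 + t)) ^ ee = t} = lam" "finite {y. y ^ lam * (- (1 + t)) ^ ee = t}"
proof -
 have t1: "1 + t \<noteq> 0" using assms(2) by (simp add: eq_neg_iff_add_eq_0 add.commute)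
 define c where "c = (- (1 + t)) ^ ee"
 have c: "c \<noteq> 0" unfolding c_def using t1 by (intro power_not_zero) (simp only: neg_equal_0_iff_equal not_False_eq_True)
 have "y ^ lam * c = t \<longleftrightarrow> y ^ lam = t / c" for y using c by (simp add: field_simps)
 then have e: "{y. y ^ lam * c = t} = {y. y ^ lam = t / c}" by blast
 have "t / c \<noteq> 0" using c assms(1) by simp
 then show "card {y. y ^ lam * (- (1 + t)) ^ ee = t} = lam" "finite {y. y ^ lam * (- (1 + t)) ^ ee = t}"
  unfolding c_def[symmetric] e by (rule card_nth_roots[OF _ lam_pos lam_nz]; assumption)+
qed

end

declare split_paired_All [simp del] split_paired_Ex [simp del]

section \<open>Expansions in powers of the Kummer generator, and irreducibility\<close>

context trinomial_curve
begin

lemma ee_nz [simp]: "ee \<noteq> 0" and zero_pow_ee [simp]: "(0::'k) ^ ee = 0" and zero_pow_lam [simp]: "(0::'k) ^ lam = 0"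
 using ee_pos lam_pos by (simp_all only: zero_power)

text \<open>Functions on \<open>Xo\<close> are expanded in the basis \<open>1, yy, \<dots>, yy ^ (lam - 1)\<close>; the constant term of
 the zeroth coefficient is the value at the vertex (0 : 0 : 1).\<close>

lemma expansion_unique:
 assumes "\<And>v. v \<in> Xo \<Longrightarrow> (\<Sum>i<lam. poly (b i) (tt v) * yy v ^ i) = 0" "i < lam" shows "b i = 0"
proof (rule poly_zero_infinite[of "{0, -1}"])
 fix t :: 'k assume t: "t \<notin> {0, -1}"
 \<comment> \<open>Over a fixed t the expansion is a polynomial in y of degree below
   \<open>lam\<close> that has the \<open>lam\<close> points of the fibre as roots.\<close>
 define q where "q = (\<Sum>i<lam. monom (poly (b i) t) i)"
 define Y where "Y = {y. y ^ lam * (- (1 + t)) ^ ee = t}"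
 have Y: "card Y = lam" "finite Y" using card_fibre_roots[of t] t by (auto simp: Y_def)
 have pq: "poly q y = (\<Sum>i<lam. poly (b i) t * y ^ i)" for y by (simp add: q_def poly_sum poly_monom)
 have z: "poly q y = 0" if "y \<in> Y" for y
  using assms(1)[OF Xo_param(1)[of t y]] Xo_param(2,3)[of t y] t that unfolding pq Y_def by simp
 have dq: "degree q \<le> lam - 1" unfolding q_def
  by (intro degree_sum_le) (auto intro: order_trans[OF degree_monom_le])
 have "q = 0"
 proof (rule ccontr)
  assume q: "q \<noteq> 0"
  have "Y \<subseteq> {x. poly q x = 0}" using z by blast
  then have "card Y \<le> card {x. poly q x = 0}" using q poly_roots_finite by (intro card_mono) auto
  also have "\<dots> \<le> degree q" using q by (rule card_poly_roots_bound)
  finally show False using Y(1) dq lam_pos by linarith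
 qed
 then have "coeff q i = 0" by simp
 then show "poly (b i) t = 0" using assms(2) by (simp add: q_def coeff_sum)
qed simp

text \<open>Powers of 1 + t are allowed as denominators: the Kummer equation expresses
  y^\<open>lam\<close> as t divided by (-(1 + t))^\<open>ee\<close>, and 1 + t does not vanish at
  (0:0:1), so the value c there is unaffected.\<close>

definition rep0 :: "('k pt \<Rightarrow> 'k) \<Rightarrow> 'k \<Rightarrow> bool" where
 "rep0 g c \<longleftrightarrow> (\<exists>b m. (\<forall>v\<in>Xo. g v * (1 + tt v) ^ m = (\<Sum>i<lam. poly (b i) (tt v) * yy v ^ i)) \<and> poly (b 0) 0 = c)"

lemma rep0E:
 assumes "rep0 g c"
 obtains b m where "\<And>v. v \<in> Xo \<Longrightarrow> g v * (1 + tt v) ^ m = (\<Sum>i<lam. poly (b i) (tt v) * yy v ^ i)" "poly (b 0) 0 = c"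
 using assms unfolding rep0_def by blast

lemma rep0_unique: assumes "rep0 g c" "\<And>v. v \<in> Xo \<Longrightarrow> g v = 0" shows "c = 0"
proof -
 obtain b m where b: "\<And>v. v \<in> Xo \<Longrightarrow> g v * (1 + tt v) ^ m = (\<Sum>i<lam. poly (b i) (tt v) * yy v ^ i)" "poly (b 0) 0 = c"
  using rep0E[OF assms(1)] by blast
 have "b 0 = 0" using b(1) assms(2) by (intro expansion_unique) auto
 then show ?thesis using b(2) by simp
qed

lemma rep0_cong: assumes "rep0 g c" "\<And>v. v \<in> Xo \<Longrightarrow> h v = g v" shows "rep0 h c"
 using assms unfolding rep0_def by simp

lemma rep0_const: "rep0 (\<lambda>v. c) c"
proof -
 have "(\<Sum>i<lam. poly (if i = 0 then [:c:] else 0) t * y ^ i) = c" for t y :: 'k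
 proof -
  have "(\<Sum>i<lam. poly (if i = 0 then [:c:] else 0) t * y ^ i) = (\<Sum>i<lam. if i = 0 then c else 0)"
   by (intro sum.cong) auto
  then show ?thesis by (simp add: sum.delta)
 qed
 then show ?thesis unfolding rep0_def by (intro exI[of _ "\<lambda>i. if i = 0 then [:c:] else 0"] exI[of _ 0]) simp
qed

lemma rep0_add: assumes "rep0 g c" "rep0 h e" shows "rep0 (\<lambda>v. g v + h v) (c + e)"
proof -
 obtain b m where b: "\<And>v. v \<in> Xo \<Longrightarrow> g v * (1 + tt v) ^ m = (\<Sum>i<lam. poly (b i) (tt v) * yy v ^ i)" "poly (b 0) 0 = c"
  using rep0E[OF assms(1)] by blast
 obtain b' m' where b': "\<And>v. v \<in> Xo \<Longrightarrow> h v * (1 + tt v) ^ m' = (\<Sum>i<lam. poly (b' i) (tt v) * yy v ^ i)" "poly (b' 0) 0 = e"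
  using rep0E[OF assms(2)] by blast
 have "(g v + h v) * (1 + tt v) ^ (m + m') = (\<Sum>i<lam. poly (b i * [:1,1:] ^ m' + b' i * [:1,1:] ^ m) (tt v) * yy v ^ i)"
  if v: "v \<in> Xo" for v
 proof -
  have "(g v + h v) * (1 + tt v) ^ (m + m') = (1 + tt v) ^ m' * (g v * (1 + tt v) ^ m) + (1 + tt v) ^ m * (h v * (1 + tt v) ^ m')"
   by (simp add: power_add algebra_simps)
  also have "\<dots> = (\<Sum>i<lam. poly (b i * [:1,1:] ^ m' + b' i * [:1,1:] ^ m) (tt v) * yy v ^ i)"
   unfolding b(1)[OF v] b'(1)[OF v] by (simp add: sum_distrib_left sum.distrib algebra_simps)
  finally show ?thesis .
 qed
 then show ?thesis unfolding rep0_def using b(2) b'(2)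
  by (intro exI[of _ "\<lambda>i. b i * [:1,1:] ^ m' + b' i * [:1,1:] ^ m"] exI[of _ "m + m'"]) simp
qed

lemma rep0_sum: "finite A \<Longrightarrow> (\<And>i. i \<in> A \<Longrightarrow> rep0 (g i) (c i)) \<Longrightarrow> rep0 (\<lambda>v. \<Sum>i\<in>A. g i v) (\<Sum>i\<in>A. c i)"
proof (induction A rule: finite_induct)
 case (insert x A)
 then have "rep0 (g x) (c x)" "rep0 (\<lambda>v. \<Sum>i\<in>A. g i v) (\<Sum>i\<in>A. c i)" by simp_all
 from rep0_add[OF this] show ?case using insert.hyps by simp
qed (use rep0_const[of 0] in simp)

lemma rep0_poly: assumes "rep0 g c" shows "rep0 (\<lambda>v. poly q (tt v) * g v) (poly q 0 * c)"
proof -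
 obtain b m where b: "\<And>v. v \<in> Xo \<Longrightarrow> g v * (1 + tt v) ^ m = (\<Sum>i<lam. poly (b i) (tt v) * yy v ^ i)" "poly (b 0) 0 = c"
  using rep0E[OF assms(1)] by blast
 then show ?thesis unfolding rep0_def
  by (intro exI[of _ "\<lambda>i. q * b i"] exI[of _ m]) (simp add: sum_distrib_left mult.assoc)
qed

lemma rep0_div: assumes "rep0 g c" shows "rep0 (\<lambda>v. g v / (1 + tt v) ^ k) c"
proof -
 obtain b m where b: "\<And>v. v \<in> Xo \<Longrightarrow> g v * (1 + tt v) ^ m = (\<Sum>i<lam. poly (b i) (tt v) * yy v ^ i)" "poly (b 0) 0 = c"
  using rep0E[OF assms(1)] by blast
 have "g v / (1 + tt v) ^ k * (1 + tt v) ^ (k + m) = g v * (1 + tt v) ^ m" if "v \<in> Xo" for v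
  using Xo_nz(3)[OF that] by (simp add: power_add)
 then show ?thesis unfolding rep0_def using b by (intro exI[of _ b] exI[of _ "k + m"]) simp
qed

lemma rep0_yy: assumes "rep0 g c" shows "rep0 (\<lambda>v. yy v * g v) 0"
proof -
 obtain b m where b: "\<And>v. v \<in> Xo \<Longrightarrow> g v * (1 + tt v) ^ m = (\<Sum>i<lam. poly (b i) (tt v) * yy v ^ i)" "poly (b 0) 0 = c"
  using rep0E[OF assms(1)] by blast
 \<comment> \<open>Multiplication by y shifts the coefficients up by one. The top one wraps around
   through the Kummer equation and acquires a factor t, so the new constant term vanishes at t =
   0.\<close>
 define b' where "b' i = (if i = 0 then Polynomial.smult ((-1) ^ ee) ([:0,1:] * b (lam - 1)) else [:1,1:] ^ ee * b (i - 1))" for i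
 obtain L where L: "lam = Suc L" using lam_pos by (cases lam) auto
 have "yy v * g v * (1 + tt v) ^ (ee + m) = (\<Sum>i<lam. poly (b' i) (tt v) * yy v ^ i)" if v: "v \<in> Xo" for v
 proof -
  define t y where "t = tt v" and "y = yy v"
  have m1: "(- (1::'k)) ^ ee * (- 1) ^ ee = 1" by (simp flip: power_mult_distrib)
  have "y ^ lam * (- (1 + t)) ^ ee = t" using Xo_yy[OF v] by (simp add: t_def y_def)
  then have yl: "y ^ lam * (1 + t) ^ ee = (-1) ^ ee * t"
   using m1 by (subst (asm) power_minus) (metis mult.assoc mult.commute mult_1)
  have "yy v * g v * (1 + tt v) ^ (ee + m) = (1 + t) ^ ee * y * (\<Sum>i<lam. poly (b i) t * y ^ i)"
   unfolding t_def y_def b(1)[OF v, symmetric] by (simp only: power_add mult_ac)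
  also have "\<dots> = (\<Sum>i<L. (1 + t) ^ ee * poly (b i) t * y ^ Suc i) + (y ^ lam * (1 + t) ^ ee) * poly (b L) t"
   unfolding L by (simp add: sum_distrib_left distrib_left mult_ac)
  also have "\<dots> = (\<Sum>i<L. poly (b' (Suc i)) t * y ^ Suc i) + poly (b' 0) t"
   unfolding yl by (simp add: b'_def L add.commute)
  also have "\<dots> = (\<Sum>i<lam. poly (b' i) t * y ^ i)" unfolding L by (subst sum.lessThan_Suc_shift) simp
  finally show ?thesis by (simp add: t_def y_def)
 qed
 then show ?thesis unfolding rep0_def by (intro exI[of _ b'] exI[of _ "ee + m"]) (simp add: b'_def)
qed

lemma rep0_yy_pow: assumes "rep0 g c" shows "rep0 (\<lambda>v. yy v ^ k * g v) (if k = 0 then c else 0)"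
proof (induction k)
 case (Suc k)
 then show ?case using rep0_yy[OF Suc.IH] by (simp add: mult.assoc)
qed (use assms in simp)

lemma rep0_mult: assumes "rep0 g c" "rep0 h e" shows "rep0 (\<lambda>v. g v * h v) (c * e)"
proof -
 obtain b m where b: "\<And>v. v \<in> Xo \<Longrightarrow> g v * (1 + tt v) ^ m = (\<Sum>i<lam. poly (b i) (tt v) * yy v ^ i)" "poly (b 0) 0 = c"
  using rep0E[OF assms(1)] by blast
 have "rep0 (\<lambda>v. \<Sum>i<lam. poly (b i) (tt v) * (yy v ^ i * h v)) (\<Sum>i<lam. poly (b i) 0 * (if i = 0 then e else 0))"
  by (intro rep0_sum rep0_poly rep0_yy_pow assms(2)) auto
 moreover have "(\<Sum>i<lam. poly (b i) 0 * (if i = 0 then e else 0)) = c * e"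
  using b(2) by (simp add: if_distrib sum.delta cong: if_cong)
 ultimately have 1: "rep0 (\<lambda>v. (\<Sum>i<lam. poly (b i) (tt v) * (yy v ^ i * h v)) / (1 + tt v) ^ m) (c * e)"
  using rep0_div by auto
 show ?thesis
 proof (rule rep0_cong[OF 1])
  fix v assume v: "v \<in> Xo"
  have "(\<Sum>i<lam. poly (b i) (tt v) * (yy v ^ i * h v)) = g v * (1 + tt v) ^ m * h v"
   unfolding b(1)[OF v] by (simp add: sum_distrib_right mult.assoc)
  then show "g v * h v = (\<Sum>i<lam. poly (b i) (tt v) * (yy v ^ i * h v)) / (1 + tt v) ^ m"
   using Xo_nz(3)[OF v] by simp
 qed
qed

lemma rep0_power: "rep0 g c \<Longrightarrow> rep0 (\<lambda>v. g v ^ k) (c ^ k)"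
proof (induction k)
 case (Suc k)
 then show ?case using rep0_mult[OF Suc.prems Suc.IH[OF Suc.prems]] by simp
qed (use rep0_const[of 1] in simp)

text \<open>Both x / z and y / z vanish at (0:0:1), hence only the pure power of z in a form
  contributes to the value.\<close>

lemma rep0_form: assumes "form n F" shows "rep0 (\<lambda>v. F v / cz v ^ n) (F (0, 0, 1))" using assms
proof (induction rule: form_induct)
 case (add F G)
 then show ?case using rep0_add by (simp add: add_divide_distrib)
next
 case (mono c i j l)
 have "rep0 (\<lambda>v. - (1 + tt v) * yy v ^ ee) 0"
  using rep0_poly[OF rep0_yy_pow[OF rep0_const[of 1], of "ee"], of "-[:1,1:]"] ee_pos by (simp add: algebra_simps)
 then have x: "rep0 (\<lambda>v. fst v / cz v) 0" by (rule rep0_cong) (rule Xo_xz)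
 have y: "rep0 (\<lambda>v. yy v) 0" using rep0_yy[OF rep0_const[of 1]] by simp
 have "rep0 (\<lambda>v. c * ((fst v / cz v) ^ i * yy v ^ j)) (c * (0 ^ i * 0 ^ j))"
  by (intro rep0_mult rep0_power x y rep0_const)
 then have 1: "rep0 (\<lambda>v. c * ((fst v / cz v) ^ i * yy v ^ j)) (c * monom3 i j l (0, 0, 1))"
  by (simp add: monom3_def)
 show ?case by (rule rep0_cong[OF 1])
   (use mono in \<open>auto simp: Xo_def monom3_def yy_def power_divide power_add\<close>)
qed (simp add: rep0_const)

text \<open>Near (0:0:1) the function t is y^\<open>lam\<close> times a unit, so t^o y^i has order
  \<open>lam * o + i\<close>. These orders are distinct for i < \<open>lam\<close>; the least one is
  attained by a single term, and after extraction of y^k the remaining factor has a nonzero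
  value.\<close>

lemma rep0_leading:
 assumes g: "rep0 g c0" and v0: "v0 \<in> Xo" "g v0 \<noteq> 0"
 obtains k m \<Psi> c where "c \<noteq> 0" "rep0 \<Psi> c" "\<And>v. v \<in> Xo \<Longrightarrow> g v * (1 + tt v) ^ m = yy v ^ k * \<Psi> v"
proof -
 obtain b m where b: "\<And>v. v \<in> Xo \<Longrightarrow> g v * (1 + tt v) ^ m = (\<Sum>i<lam. poly (b i) (tt v) * yy v ^ i)"
  using rep0E[OF g] by blast
 define I where "I = {i. i < lam \<and> b i \<noteq> 0}"
 have fin: "finite I" by (simp add: I_def)
 have ne: "I \<noteq> {}"
 proof
  assume "I = {}"
  then have "(\<Sum>i<lam. poly (b i) (tt v0) * yy v0 ^ i) = 0" by (intro sum.neutral) (auto simp: I_def)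
  then show False using b[OF v0(1)] v0(2) Xo_nz(3)[OF v0(1)] by simp
 qed
 define ord where "ord i = pord 0 (b i)" for i
 define b' where "b' i = b i div [:0,1:] ^ ord i" for i
 have b': "b i = [:0,1:] ^ ord i * b' i" "poly (b' i) 0 \<noteq> 0" if "i \<in> I" for i
 proof -
  have bi: "b i \<noteq> 0" using that by (simp add: I_def)
  have dv: "[:0,1:] ^ ord i dvd b i" using order_1[of 0 "b i"] by (simp add: ord_def)
  then show e: "b i = [:0,1:] ^ ord i * b' i" by (simp add: b'_def)
  show "poly (b' i) 0 \<noteq> 0"
  proof
   assume "poly (b' i) 0 = 0"
   then have "[:0,1:] dvd b' i" using poly_eq_0_iff_dvd[of "b' i" 0] by simp
   then have "[:0,1:] ^ ord i * [:0,1:] dvd b i" by (subst e) (rule mult_dvd_mono, auto)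
   then have "[:0,1:] ^ Suc (ord i) dvd b i" by (simp only: power_Suc2)
   then show False using order_2[OF bi, of 0] by (simp add: ord_def)
  qed
 qed
 define w where "w i = lam * ord i + i" for i
 have wmod: "w i mod lam = i" if "i \<in> I" for i
 proof -
  have "i < lam" using that by (simp add: I_def)
  then show ?thesis unfolding w_def by (simp only: mod_mult_self4 mod_less)
 qed
 have winj: "i = j" if "i \<in> I" "j \<in> I" "w i = w j" for i j
  using wmod[OF that(1)] wmod[OF that(2)] that(3) by metis
 define k where "k = Min (w ` I)"
 have k: "k \<le> w i" if "i \<in> I" for i using that fin by (simp add: k_def)
 obtain i0 where i0: "i0 \<in> I" "k = w i0" using Min_in[of "w ` I"] fin ne unfolding k_def by blast
 define \<Psi> where "\<Psi> v = (\<Sum>i\<in>I. poly ((-[:1,1:]) ^ (ee * ord i) * b' i) (tt v) * (yy v ^ (w i - k) * 1))" for v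
 have "rep0 \<Psi> (\<Sum>i\<in>I. poly ((-[:1,1:]) ^ (ee * ord i) * b' i) 0 * (if w i - k = 0 then 1 else 0))"
  unfolding \<Psi>_def by (intro rep0_sum fin rep0_poly rep0_yy_pow rep0_const)
 moreover have "(\<Sum>i\<in>I. poly ((-[:1,1:]) ^ (ee * ord i) * b' i) 0 * (if w i - k = 0 then 1 else 0))
   = (\<Sum>i\<in>I. if i = i0 then poly ((-[:1,1:]) ^ (ee * ord i) * b' i) 0 else 0)"
 proof (rule sum.cong)
  fix i assume i: "i \<in> I"
  have "w i - k = 0 \<longleftrightarrow> i = i0" using k[OF i] i0 winj[OF i i0(1)] by auto
  then show "poly ((-[:1,1:]) ^ (ee * ord i) * b' i) 0 * (if w i - k = 0 then 1 else 0)
   = (if i = i0 then poly ((-[:1,1:]) ^ (ee * ord i) * b' i) 0 else 0)" by simp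
 qed simp
 moreover have "\<dots> = poly ((-[:1,1:]) ^ (ee * ord i0) * b' i0) 0" using fin i0 by (simp add: sum.delta)
 moreover have "\<dots> \<noteq> 0" using b'(2)[OF i0(1)] by simp
 moreover have "g v * (1 + tt v) ^ m = yy v ^ k * \<Psi> v" if v: "v \<in> Xo" for v
 proof -
  have "g v * (1 + tt v) ^ m = (\<Sum>i\<in>I. poly (b i) (tt v) * yy v ^ i)"
   unfolding b[OF v] by (rule sum.mono_neutral_right) (auto simp: I_def)
  also have "\<dots> = (\<Sum>i\<in>I. yy v ^ k * (poly ((-[:1,1:]) ^ (ee * ord i) * b' i) (tt v) * (yy v ^ (w i - k) * 1)))"
  proof (rule sum.cong)
   fix i assume i: "i \<in> I"
   have tp: "tt v ^ n = yy v ^ (lam * n) * (- (1 + tt v)) ^ (ee * n)" for n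
    by (subst Xo_yy[OF v, symmetric]) (simp only: power_mult_distrib power_mult)
   have "poly (b i) (tt v) * yy v ^ i = tt v ^ ord i * poly (b' i) (tt v) * yy v ^ i"
    by (subst b'(1)[OF i]) simp
   also have "\<dots> = (yy v ^ (lam * ord i) * yy v ^ i) * ((- (1 + tt v)) ^ (ee * ord i) * poly (b' i) (tt v))"
    unfolding tp[of "ord i"] by (simp only: mult_ac)
   also have "yy v ^ (lam * ord i) * yy v ^ i = yy v ^ k * yy v ^ (w i - k)"
    using k[OF i] by (simp add: w_def flip: power_add)
   also have "(- (1 + tt v)) ^ (ee * ord i) * poly (b' i) (tt v) = poly ((-[:1,1:]) ^ (ee * ord i) * b' i) (tt v)"
    by simp
   finally show "poly (b i) (tt v) * yy v ^ i
    = yy v ^ k * (poly ((-[:1,1:]) ^ (ee * ord i) * b' i) (tt v) * (yy v ^ (w i - k) * 1))"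
    by (simp only: mult_1_right mult_1_left mult_ac)
  qed simp
  also have "\<dots> = yy v ^ k * \<Psi> v" unfolding \<Psi>_def by (simp only: sum_distrib_left)
  finally show ?thesis .
 qed
 ultimately show ?thesis using that by metis
qed

text \<open>Irreducibility of X: up to powers of y and 1 + t, which do not vanish on
  \<open>Xo\<close>, both functions have nonzero values at (0:0:1), and values multiply.\<close>

lemma form_Xo_domain:
 assumes F: "form n F" "u \<in> Xo" "F u \<noteq> 0" and G: "form m G" "w \<in> Xo" "G w \<noteq> 0" shows "\<exists>v\<in>Xo. F v * G v \<noteq> 0"
proof (rule ccontr)
 assume no: "\<not> (\<exists>v\<in>Xo. F v * G v \<noteq> 0)"
 have nz: "cz v \<noteq> 0" if "v \<in> Xo" for v using that by (simp add: Xo_def)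
 obtain k1 m1 P1 c1 where 1: "c1 \<noteq> 0" "rep0 P1 c1"
  "\<And>v. v \<in> Xo \<Longrightarrow> F v / cz v ^ n * (1 + tt v) ^ m1 = yy v ^ k1 * P1 v"
  by (rule rep0_leading[OF rep0_form[OF F(1)] F(2)]) (use F(3) nz[OF F(2)] in simp, blast)
 obtain k2 m2 P2 c2 where 2: "c2 \<noteq> 0" "rep0 P2 c2"
  "\<And>v. v \<in> Xo \<Longrightarrow> G v / cz v ^ m * (1 + tt v) ^ m2 = yy v ^ k2 * P2 v"
  by (rule rep0_leading[OF rep0_form[OF G(1)] G(2)]) (use G(3) nz[OF G(2)] in simp, blast)
 have "P1 v * P2 v = 0" if v: "v \<in> Xo" for v
 proof -
  have "F v = 0 \<or> G v = 0" using no v by auto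
  then have "yy v ^ k1 * P1 v = 0 \<or> yy v ^ k2 * P2 v = 0" using 1(3)[OF v] 2(3)[OF v] by auto
  then show ?thesis using Xo_nz(4)[OF v] by simp
 qed
 then show False using rep0_unique[OF rep0_mult[OF 1(2) 2(2)]] 1(1) 2(1) by auto
qed

section \<open>Density of the torus part and the filter of generic points\<close>

lemma rotate_X: "(x, y, z) \<in> X \<longleftrightarrow> (y, z, x) \<in> X" unfolding X_iff by (auto simp: algebra_simps)

lemma rotate_Xo: "(x, y, z) \<in> Xo \<longleftrightarrow> (y, z, x) \<in> Xo" unfolding Xo_def using rotate_X[of x y z] by auto

lemma X_vertex: assumes "v \<in> X" "v \<notin> Xo"
 obtains c where "c \<noteq> 0" "v = (c, 0, 0) \<or> v = (0, c, 0) \<or> v = (0, 0, c)"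
proof -
 obtain x y z where v: "v = (x, y, z)" by (metis prod.collapse)
 have "x = 0 \<or> y = 0 \<or> z = 0" using assms by (auto simp: Xo_def v)
 then show ?thesis using that[of x] that[of y] that[of z] assms(1) unfolding v X_iff by auto
qed

text \<open>A form that vanishes on \<open>Xo\<close> has value 0 at (0:0:1) by uniqueness of
  expansions; the cyclic rotation of the coordinates, which preserves the equation, transports this
  to the other two vertices.\<close>

lemma form_nz_Xo:
 assumes F: "form n F" and v: "v \<in> X" "F v \<noteq> 0" shows "\<exists>w\<in>Xo. F w \<noteq> 0"
proof (cases "v \<in> Xo")
 case False
 have *: "\<exists>w\<in>Xo. G w \<noteq> 0" if G: "form n G" and c: "G (0, 0, c) \<noteq> 0" for G c
 proof (rule ccontr)
  assume no: "\<not> (\<exists>w\<in>Xo. G w \<noteq> 0)"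
  have "G (0, 0, 1) = 0" by (rule rep0_unique[OF rep0_form[OF G]]) (use no in auto)
  then show False using c form_pscale[OF G, of c "(0, 0, 1)"] by (simp add: pscale_def)
 qed
 obtain c where c: "c \<noteq> 0" "v = (c, 0, 0) \<or> v = (0, c, 0) \<or> v = (0, 0, c)"
  using X_vertex[OF v(1) False] by blast
 consider "v = (0, 0, c)" | "v = (c, 0, 0)" | "v = (0, c, 0)" using c by blast
 then show ?thesis
 proof cases
  case 1
  then show ?thesis using *[OF F] v(2) by simp
 next
  case 2
  define G where "G w = F (cz w, fst w, cy w)" for w
  have "form n G" unfolding G_def by (rule form_comp_linear[OF F]) simp_all
  then obtain w where w: "w \<in> Xo" "G w \<noteq> 0" using *[of G c] v(2) 2 by (auto simp: G_def)
  obtain x y z where xyz: "w = (x, y, z)" by (metis prod.collapse)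
  show ?thesis using w unfolding xyz G_def using rotate_Xo[of x y z] rotate_Xo[of y z x]
   by (intro bexI[of _ "(z, x, y)"]) auto
 next
  case 3
  define G where "G w = F (cy w, cz w, fst w)" for w
  have "form n G" unfolding G_def by (rule form_comp_linear[OF F]) simp_all
  then obtain w where w: "w \<in> Xo" "G w \<noteq> 0" using *[of G c] v(2) 3 by (auto simp: G_def)
  obtain x y z where xyz: "w = (x, y, z)" by (metis prod.collapse)
  show ?thesis using w unfolding xyz G_def using rotate_Xo[of x y z] by (intro bexI[of _ "(y, z, x)"]) auto
 qed
qed (use v in blast)

text \<open>Rational functions on \<open>X\<close> are represented by total functions, compared along this filter of cofinite
 sets of points of the curve; values at the exceptional points are junk.\<close>

definition gen :: "'k pt filter" where
 "gen = Abs_filter (\<lambda>P. \<exists>n F. form n F \<and> (\<exists>v\<in>X. F v \<noteq> 0) \<and> (\<forall>v\<in>X. F v \<noteq> 0 \<longrightarrow> P v))"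

lemma Xo_nonempty: "\<exists>v. v \<in> Xo"
proof -
 have "finite {0, -1::'k}" by simp
 then obtain t :: 'k where t: "t \<notin> {0, -1}" using infinite_alg_closed ex_new_if_finite by blast
 then have "card {y. y ^ lam * (- (1 + t)) ^ ee = t} = lam" using card_fibre_roots(1)[of t] by simp
 then have "{y. y ^ lam * (- (1 + t)) ^ ee = t} \<noteq> {}" using lam_pos by (metis card.empty less_irrefl)
 then obtain y where "y ^ lam * (- (1 + t)) ^ ee = t" by blast
 then show ?thesis using Xo_param(1)[of t y] t by blast
qed

abbreviation generically :: "('k pt \<Rightarrow> bool) \<Rightarrow> bool" (binder "GEN " 10)
 where "generically P \<equiv> eventually P gen"

text \<open>Closure under conjunction is the irreducibility of X: two nonempty nonvanishing loci of
  forms always meet.\<close>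

lemma eventually_gen:
 "eventually P gen \<longleftrightarrow> (\<exists>n F. form n F \<and> (\<exists>v\<in>X. F v \<noteq> 0) \<and> (\<forall>v\<in>X. F v \<noteq> 0 \<longrightarrow> P v))" unfolding gen_def
proof (rule eventually_Abs_filter, rule is_filter.intro)
 show "\<exists>n F. form n F \<and> (\<exists>v\<in>X. F v \<noteq> 0) \<and> (\<forall>v\<in>X. F v \<noteq> 0 \<longrightarrow> True)"
  using Xo_nonempty Xo_X by (intro exI[of _ 0] exI[of _ "\<lambda>v. 1"]) (simp, blast)
next
 fix P Q :: "'k pt \<Rightarrow> bool"
 assume "\<exists>n F. form n F \<and> (\<exists>v\<in>X. F v \<noteq> 0) \<and> (\<forall>v\<in>X. F v \<noteq> 0 \<longrightarrow> P v)"
  "\<exists>n F. form n F \<and> (\<exists>v\<in>X. F v \<noteq> 0) \<and> (\<forall>v\<in>X. F v \<noteq> 0 \<longrightarrow> Q v)"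
 then obtain n F u m G w where F: "form n F" "u \<in> X" "F u \<noteq> 0" "\<forall>v\<in>X. F v \<noteq> 0 \<longrightarrow> P v"
  and G: "form m G" "w \<in> X" "G w \<noteq> 0" "\<forall>v\<in>X. G v \<noteq> 0 \<longrightarrow> Q v" by blast
 obtain u' w' where "u' \<in> Xo" "F u' \<noteq> 0" "w' \<in> Xo" "G w' \<noteq> 0"
  using form_nz_Xo[OF F(1-3)] form_nz_Xo[OF G(1-3)] by blast
 then obtain v where v: "v \<in> Xo" "F v * G v \<noteq> 0" using form_Xo_domain[of n F u' m G w'] F(1) G(1) by blast
 have "form (n + m) (\<lambda>v. F v * G v)" using F(1) G(1) by (rule form_mult)
 moreover have "\<exists>v\<in>X. F v * G v \<noteq> 0" using v Xo_X by blast
 moreover have "\<forall>v\<in>X. F v * G v \<noteq> 0 \<longrightarrow> P v \<and> Q v" using F(4) G(4) by simp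
 ultimately show "\<exists>n F. form n F \<and> (\<exists>v\<in>X. F v \<noteq> 0) \<and> (\<forall>v\<in>X. F v \<noteq> 0 \<longrightarrow> P v \<and> Q v)" by blast
next
 fix P Q :: "'k pt \<Rightarrow> bool"
 assume "\<forall>v. P v \<longrightarrow> Q v" "\<exists>n F. form n F \<and> (\<exists>v\<in>X. F v \<noteq> 0) \<and> (\<forall>v\<in>X. F v \<noteq> 0 \<longrightarrow> P v)"
 then show "\<exists>n F. form n F \<and> (\<exists>v\<in>X. F v \<noteq> 0) \<and> (\<forall>v\<in>X. F v \<noteq> 0 \<longrightarrow> Q v)" by blast
qed

lemma gen_form: "form n F \<Longrightarrow> v \<in> X \<Longrightarrow> F v \<noteq> 0 \<Longrightarrow> eventually (\<lambda>w. F w \<noteq> 0) gen" unfolding eventually_gen by blast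

lemma gen_not_bot [simp]: "gen \<noteq> bot"
proof
 assume "gen = bot"
 then have "eventually (\<lambda>_. False) gen" by simp
 then show False unfolding eventually_gen by blast
qed

lemma gen_ex: "eventually P gen \<Longrightarrow> \<exists>v\<in>X. P v" unfolding eventually_gen by blast

lemma gen_X: "eventually (\<lambda>v. v \<in> X) gen"
 unfolding eventually_gen using Xo_nonempty Xo_X by (intro exI[of _ 0] exI[of _ "\<lambda>v. 1"]) (simp, blast)

lemma gen_Xo: "eventually (\<lambda>v. v \<in> Xo) gen"
proof -
 obtain v where v: "v \<in> Xo" using Xo_nonempty by blast
 have "form (Suc 0 + (Suc 0 + Suc 0)) (\<lambda>w. fst w * (cy w * cz w))" by (intro form_mult) auto
 then have "eventually (\<lambda>w. fst w * (cy w * cz w) \<noteq> 0) gen"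
  by (rule gen_form[where v = v]) (use v in \<open>auto simp: Xo_def\<close>)
 then show ?thesis using gen_X by eventually_elim (auto simp: Xo_def)
qed

lemma gen_zopen: assumes "zopen X U" "v \<in> U" shows "eventually (\<lambda>w. w \<in> U) gen"
proof -
 obtain n F where "form n F" "F v \<noteq> 0" "{w \<in> X. F w \<noteq> 0} \<subseteq> U" using zopen_basic[OF assms] by blast
 then show ?thesis unfolding eventually_gen using assms zopen_sub by blast
qed

lemma gen_form_dichotomy:
 assumes "form n F" shows "(\<forall>v\<in>X. F v = 0) \<or> eventually (\<lambda>w. F w \<noteq> 0) gen" using gen_form[OF assms] by blast

lemma gen_form_zero: assumes "form n F" "eventually (\<lambda>w. F w = 0) gen" "v \<in> X" shows "F v = 0"
proof (rule ccontr)
 assume "F v \<noteq> 0"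
 then have "eventually (\<lambda>w. F w \<noteq> 0) gen" using gen_form assms by blast
 with assms(2) have "eventually (\<lambda>w. False) gen" by eventually_elim simp
 then show False by (simp add: eventually_False)
qed

section \<open>Local values and congruences\<close>

text \<open>Membership of g in the local ring at v, with residue c. Only the generic behaviour of g
  enters, so the literal value of g at v may be junk.\<close>

definition locv :: "'k pt \<Rightarrow> ('k pt \<Rightarrow> 'k) \<Rightarrow> 'k \<Rightarrow> bool" where
 "locv v g c \<longleftrightarrow> (\<exists>n F G. form n F \<and> form n G \<and> G v \<noteq> 0 \<and> c = F v / G v \<and> (GEN w. g w = F w / G w))"

lemma locv_frac: "form n F \<Longrightarrow> form n G \<Longrightarrow> G v \<noteq> 0 \<Longrightarrow> locv v (\<lambda>w. F w / G w) (F v / G v)"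
 unfolding locv_def by (intro exI[of _ n] exI[of _ F] exI[of _ G]) simp

lemma locvE:
 assumes "locv v g c"
 obtains n F G where "form n F" "form n G" "G v \<noteq> 0" "c = F v / G v" "GEN w. g w = F w / G w"
 using assms unfolding locv_def by blast

lemma locv_cong: assumes "locv v g c" "GEN w. h w = g w" shows "locv v h c"
proof -
 obtain n F G where *: "form n F" "form n G" "G v \<noteq> 0" "c = F v / G v" "GEN w. g w = F w / G w"
  using locvE[OF assms(1)] by blast
 from assms(2) *(5) have "GEN w. h w = F w / G w" by eventually_elim simp
 with * show ?thesis unfolding locv_def by blast
qed

lemma locv_const [simp]: "locv v (\<lambda>w. c) c" using locv_frac[of 0 "\<lambda>w. c" "\<lambda>w. 1"] by simp

lemma locv_add: assumes "v \<in> X" "locv v g c" "locv v h e" shows "locv v (\<lambda>w. g w + h w) (c + e)"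
proof -
 obtain n F G where 1: "form n F" "form n G" "G v \<noteq> 0" "c = F v / G v" "GEN w. g w = F w / G w"
  using locvE[OF assms(2)] by blast
 obtain m F' G' where 2: "form m F'" "form m G'" "G' v \<noteq> 0" "e = F' v / G' v" "GEN w. h w = F' w / G' w"
  using locvE[OF assms(3)] by blast
 have f: "form (n + m) (\<lambda>w. F w * G' w + G w * F' w)" "form (n + m) (\<lambda>w. G w * G' w)"
  by (intro form_add form_mult 1(1,2) 2(1,2))+
 have L: "locv v (\<lambda>w. (F w * G' w + G w * F' w) / (G w * G' w)) ((F v * G' v + G v * F' v) / (G v * G' v))"
  by (rule locv_frac[OF f]) (use 1 2 in simp)
 have "GEN w. g w + h w = (F w * G' w + G w * F' w) / (G w * G' w)"
  using 1(5) 2(5) gen_form[OF 1(2) assms(1) 1(3)] gen_form[OF 2(2) assms(1) 2(3)]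
  by eventually_elim (simp add: field_simps)
 moreover have "(F v * G' v + G v * F' v) / (G v * G' v) = c + e" using 1(3,4) 2(3,4) by (simp add: field_simps)
 ultimately show ?thesis using locv_cong[OF L] by simp
qed

lemma locv_mult: assumes "locv v g c" "locv v h e" shows "locv v (\<lambda>w. g w * h w) (c * e)"
proof -
 obtain n F G where 1: "form n F" "form n G" "G v \<noteq> 0" "c = F v / G v" "GEN w. g w = F w / G w"
  using locvE[OF assms(1)] by blast
 obtain m F' G' where 2: "form m F'" "form m G'" "G' v \<noteq> 0" "e = F' v / G' v" "GEN w. h w = F' w / G' w"
  using locvE[OF assms(2)] by blast
 have f: "form (n + m) (\<lambda>w. F w * F' w)" "form (n + m) (\<lambda>w. G w * G' w)" by (intro form_mult 1(1,2) 2(1,2))+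
 have L: "locv v (\<lambda>w. (F w * F' w) / (G w * G' w)) ((F v * F' v) / (G v * G' v))"
  by (rule locv_frac[OF f]) (use 1 2 in simp)
 have "GEN w. g w * h w = (F w * F' w) / (G w * G' w)" using 1(5) 2(5) by eventually_elim simp
 from locv_cong[OF L this] show ?thesis using 1(4) 2(4) by simp
qed

lemma locv_inverse: assumes "locv v g c" "c \<noteq> 0" shows "locv v (\<lambda>w. inverse (g w)) (inverse c)"
proof -
 obtain n F G where 1: "form n F" "form n G" "G v \<noteq> 0" "c = F v / G v" "GEN w. g w = F w / G w"
  using locvE[OF assms(1)] by blast
 have L: "locv v (\<lambda>w. G w / F w) (G v / F v)" by (rule locv_frac[OF 1(2,1)]) (use 1 assms in auto)
 have "GEN w. inverse (g w) = G w / F w" using 1(5) by eventually_elim simp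
 from locv_cong[OF L this] show ?thesis using 1(4) by simp
qed

lemma locv_uminus: "locv v g c \<Longrightarrow> locv v (\<lambda>w. - g w) (- c)"
 using locv_mult[OF locv_const[of v "-1"]] by fastforce

lemma locv_diff: "v \<in> X \<Longrightarrow> locv v g c \<Longrightarrow> locv v h e \<Longrightarrow> locv v (\<lambda>w. g w - h w) (c - e)"
 using locv_add[OF _ _ locv_uminus] by fastforce

lemma locv_power: "locv v g c \<Longrightarrow> locv v (\<lambda>w. g w ^ n) (c ^ n)"
proof (induction n)
 case (Suc n)
 show ?case using locv_mult[OF Suc.prems Suc.IH[OF Suc.prems]] by simp
qed simp

lemma locv_sum:
 assumes "v \<in> X" "\<And>i. i \<in> A \<Longrightarrow> locv v (g i) (c i)" shows "locv v (\<lambda>w. \<Sum>i\<in>A. g i w) (\<Sum>i\<in>A. c i)" using assms(2)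
proof (induction A rule: infinite_finite_induct)
 case (insert x A)
 then have "locv v (g x) (c x)" "locv v (\<lambda>w. \<Sum>i\<in>A. g i w) (\<Sum>i\<in>A. c i)" by simp_all
 from locv_add[OF assms(1) this] show ?case using insert.hyps by simp
qed simp_all

text \<open>Cross-multiplied, two representations give a form that vanishes generically, hence
  everywhere on X and in particular at v.\<close>

lemma locv_unique: assumes "v \<in> X" "locv v g c" "locv v g e" shows "c = e"
proof -
 obtain n F G where 1: "form n F" "form n G" "G v \<noteq> 0" "c = F v / G v" "GEN w. g w = F w / G w"
  using locvE[OF assms(2)] by blast
 obtain m F' G' where 2: "form m F'" "form m G'" "G' v \<noteq> 0" "e = F' v / G' v" "GEN w. g w = F' w / G' w"
  using locvE[OF assms(3)] by blast
 have f: "form (n + m) (\<lambda>w. F w * G' w - G w * F' w)" by (intro form_diff form_mult 1(1,2) 2(1,2))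
 have "GEN w. F w * G' w - G w * F' w = 0"
  using 1(5) 2(5) gen_form[OF 1(2) assms(1) 1(3)] gen_form[OF 2(2) assms(1) 2(3)]
  by eventually_elim (auto simp: field_simps)
 then have "F v * G' v - G v * F' v = 0" using gen_form_zero[OF f] assms(1) by blast
 then have "F v * G' v = F' v * G v" by (simp add: mult.commute)
 then show ?thesis unfolding 1(4) 2(4) using 1(3) 2(3) by (simp add: frac_eq_eq)
qed

lemma locv_nz: assumes "v \<in> X" "locv v g c" "c \<noteq> 0" shows "GEN w. g w \<noteq> 0"
proof -
 obtain n F G where 1: "form n F" "form n G" "G v \<noteq> 0" "c = F v / G v" "GEN w. g w = F w / G w"
  using locvE[OF assms(2)] by blast
 have "F v \<noteq> 0" using 1 assms by auto
 show ?thesis using 1(5) gen_form[OF 1(1) assms(1) \<open>F v \<noteq> 0\<close>] gen_form[OF 1(2) assms(1) 1(3)]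
  by eventually_elim simp
qed

lemma locv_regular:
 assumes "f \<in> regular X U" "v \<in> U" shows "locv v f (f v)"
proof -
 obtain W a b F G where 1: "zopen X W" "v \<in> W" "W \<subseteq> U" "form a F" "form b G" "int a - int b = 0"
  "\<And>w. w \<in> W \<Longrightarrow> G w \<noteq> 0 \<and> f w = F w / G w" using tf_local[OF assms] by metis
 have L: "locv v (\<lambda>w. F w / G w) (F v / G v)" using locv_frac[of a F G v] 1 by simp
 have "GEN w. f w = F w / G w" using gen_zopen[OF 1(1,2)] by eventually_elim (use 1(7) in blast)
 from locv_cong[OF L this] show ?thesis using 1(7)[OF 1(2)] by simp
qed

text \<open>A uniformizer at \<open>v\<close>: the quotient by \<open>mu\<close> is unramified on \<open>Xo\<close>, so there the
 coordinate \<open>tt\<close> of the quotient can be used.\<close>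

definition tau :: "'k pt \<Rightarrow> 'k pt \<Rightarrow> 'k" where
 "tau v w = (if v \<in> Xo then tt w - tt v else if fst v \<noteq> 0 then cz w / fst w
   else if cy v \<noteq> 0 then fst w / cy w else cy w / cz w)"

lemma form_u: "form (ee + 1) (\<lambda>w. fst w ^ ee * cy w)"
 and form_v: "form (ee + 1) (\<lambda>w. cy w ^ ee * cz w)"
 using form_mult[OF form_power[OF form_fst, of ee] form_snd1] form_mult[OF form_power[OF form_snd1, of ee] form_snd2]
 by simp_all

lemma locv_tt: "v \<in> Xo \<Longrightarrow> locv v tt (tt v)"
 unfolding tt_def[abs_def] by (rule locv_frac[OF form_u form_v]) (simp add: Xo_def)

lemma locv_yy: "v \<in> Xo \<Longrightarrow> locv v yy (yy v)"
 unfolding yy_def[abs_def] by (rule locv_frac[of "Suc 0"]) (simp_all add: Xo_def)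

lemma vertexE:
 assumes "v \<in> X" "v \<notin> Xo"
 obtains (x) c where "c \<noteq> 0" "v = (c, 0, 0)" "tau v = (\<lambda>w. cz w / fst w)"
 | (y) c where "c \<noteq> 0" "v = (0, c, 0)" "tau v = (\<lambda>w. fst w / cy w)"
 | (z) c where "c \<noteq> 0" "v = (0, 0, c)" "tau v = (\<lambda>w. cy w / cz w)"
proof -
 obtain c where c: "c \<noteq> 0" "v = (c, 0, 0) \<or> v = (0, c, 0) \<or> v = (0, 0, c)" using X_vertex[OF assms] by blast
 have t: "tau v = (\<lambda>w. if fst v \<noteq> 0 then cz w / fst w
   else if cy v \<noteq> 0 then fst w / cy w else cy w / cz w)" using assms(2) by (intro ext) (simp add: tau_def)
 from c(2) show ?thesis
 proof (elim disjE)
  assume "v = (c, 0, 0)" then show ?thesis using x[OF c(1)] t c(1) by simp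
 next
  assume "v = (0, c, 0)" then show ?thesis using y[OF c(1)] t c(1) by simp
 next
  assume "v = (0, 0, c)" then show ?thesis using z[OF c(1)] t c(1) by simp
 qed
qed

lemma locv_tau: assumes "v \<in> X" shows "locv v (tau v) 0"
proof (cases "v \<in> Xo")
 case True
 have "tau v = (\<lambda>w. tt w - tt v)" using True by (intro ext) (simp add: tau_def)
 then show ?thesis using locv_diff[OF assms locv_tt[OF True] locv_const[of v "tt v"]] by simp
next
 case False
 from assms False show ?thesis
 proof (cases rule: vertexE)
  case (x c)
  then show ?thesis using locv_frac[of "Suc 0" "\<lambda>w. cz w" "\<lambda>w. fst w" v] by simp
 next
  case (y c)
  then show ?thesis using locv_frac[of "Suc 0" "\<lambda>w. fst w" "\<lambda>w. cy w" v] by simp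
 next
  case (z c)
  then show ?thesis using locv_frac[of "Suc 0" "\<lambda>w. cy w" "\<lambda>w. cz w" v] by simp
 qed
qed

lemma X_pscale: assumes "c \<noteq> 0" "v \<in> X" shows "pscale c v \<in> X"
proof -
 obtain x y z where v: "v = (x, y, z)" by (metis prod.collapse)
 have "(c*x)^ee*(c*y) + (c*y)^ee*(c*z) + (c*z)^ee*(c*x) = c^ee*c*(x^ee*y+y^ee*z+z^ee*x)"
  by (simp add: power_mult_distrib algebra_simps)
 then show ?thesis using assms unfolding X_iff v pscale_def by auto
qed

lemma gen_tau: assumes "v \<in> X" shows "GEN w. tau v w \<noteq> 0"
proof (cases "v \<in> Xo")
 case True
 have "finite {0, -1, tt v}" by simp
 then obtain t :: 'k where t: "t \<notin> {0, -1, tt v}" using infinite_alg_closed ex_new_if_finite by blast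
 then have "card {y. y ^ lam * (- (1 + t)) ^ ee = t} = lam" using card_fibre_roots(1)[of t] by simp
 then have "{y. y ^ lam * (- (1 + t)) ^ ee = t} \<noteq> {}" using lam_pos by (metis card.empty less_irrefl)
 then obtain y where "y ^ lam * (- (1 + t)) ^ ee = t" by blast
 then obtain w where w: "w \<in> Xo" "tt w = t" using Xo_param(1,2)[of t y] t by blast
 have "locv w (\<lambda>w. tt w - tt v) (t - tt v)"
  using locv_diff[OF Xo_X[OF w(1)] locv_tt[OF w(1)] locv_const] w(2) by simp
 then have "GEN w. tt w - tt v \<noteq> 0" by (rule locv_nz[OF Xo_X[OF w(1)]]) (use t in simp)
 then show ?thesis using True by (simp add: tau_def)
next
 case False
 have "tau v w \<noteq> 0" if "fst w \<noteq> 0 \<and> cy w \<noteq> 0 \<and> cz w \<noteq> 0" for w using False that by (simp add: tau_def)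
 then show ?thesis using gen_Xo by (auto simp: Xo_def elim: eventually_mono)
qed

text \<open>Congruence modulo \<open>tau v\<close> in the local ring. It implies
  \<open>locv\<close>; the converse, \<open>locv_tcong\<close>, says that \<open>tau v\<close>
  generates the maximal ideal, and is reached through the coordinate functions.\<close>

definition tcong :: "'k pt \<Rightarrow> ('k pt \<Rightarrow> 'k) \<Rightarrow> 'k \<Rightarrow> bool" where
 "tcong v g c \<longleftrightarrow> (\<exists>h e. locv v h e \<and> (GEN w. g w - c = tau v w * h w))"

lemma tcongI: "locv v h e \<Longrightarrow> (GEN w. g w - c = tau v w * h w) \<Longrightarrow> tcong v g c" unfolding tcong_def by blast

lemma tcong_locv: assumes "v \<in> X" "tcong v g c" shows "locv v g c"
proof -
 obtain h e where h: "locv v h e" "GEN w. g w - c = tau v w * h w"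
  using assms(2) unfolding tcong_def by blast
 have L: "locv v (\<lambda>w. c + tau v w * h w) (c + 0 * e)"
  by (intro locv_add locv_mult locv_tau assms locv_const h)
 have "GEN w. g w = c + tau v w * h w" using h(2) by eventually_elim (simp add: algebra_simps)
 from locv_cong[OF L this] show ?thesis by simp
qed

lemma tcong_cong: assumes "tcong v g c" "GEN w. h w = g w" shows "tcong v h c"
proof -
 obtain f e where h: "locv v f e" "GEN w. g w - c = tau v w * f w"
  using assms(1) unfolding tcong_def by blast
 show ?thesis by (rule tcongI[OF h(1)]) (use assms(2) h(2) in \<open>eventually_elim, simp\<close>)
qed

lemma tcong_const [simp]: "tcong v (\<lambda>w. c) c" by (rule tcongI[OF locv_const[of v 0]]) simp

lemma tcong_add: assumes "v \<in> X" "tcong v g c" "tcong v h e" shows "tcong v (\<lambda>w. g w + h w) (c + e)"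
proof -
 obtain g' c' h' e' where 1: "locv v g' c'" "GEN w. g w - c = tau v w * g' w"
  "locv v h' e'" "GEN w. h w - e = tau v w * h' w" using assms(2,3) unfolding tcong_def by blast
 show ?thesis
  by (rule tcongI[OF locv_add[OF assms(1) 1(1,3)]]) (use 1(2,4) in \<open>eventually_elim, simp add: algebra_simps\<close>)
qed

lemma tcong_mult: assumes "v \<in> X" "tcong v g c" "tcong v h e" shows "tcong v (\<lambda>w. g w * h w) (c * e)"
proof -
 obtain g' c' h' e' where 1: "locv v g' c'" "GEN w. g w - c = tau v w * g' w"
  "locv v h' e'" "GEN w. h w - e = tau v w * h' w" using assms(2,3) unfolding tcong_def by blast
 have L: "locv v (\<lambda>w. g' w * h w + c * h' w) (c' * e + c * e')"
  by (intro locv_add locv_mult locv_const tcong_locv assms 1)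
 show ?thesis
 proof (rule tcongI[OF L])
  show "GEN w. g w * h w - c * e = tau v w * (g' w * h w + c * h' w)" using 1(2,4)
  proof eventually_elim
   case (elim w)
   have "g w * h w - c * e = (g w - c) * h w + c * (h w - e)" by (simp add: algebra_simps)
   then show ?case unfolding elim by (simp add: algebra_simps)
  qed
 qed
qed

lemma tcong_power: "v \<in> X \<Longrightarrow> tcong v g c \<Longrightarrow> tcong v (\<lambda>w. g w ^ n) (c ^ n)"
proof (induction n)
 case (Suc n)
 show ?case using tcong_mult[OF Suc.prems(1) Suc.prems(2) Suc.IH[OF Suc.prems]] by simp
qed simp

lemma tcong_inverse: assumes "v \<in> X" "tcong v g c" "c \<noteq> 0" shows "tcong v (\<lambda>w. inverse (g w)) (inverse c)"
proof -
 obtain g' c' where 1: "locv v g' c'" "GEN w. g w - c = tau v w * g' w"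
  using assms(2) unfolding tcong_def by blast
 have g: "locv v g c" using tcong_locv assms by blast
 have L: "locv v (\<lambda>w. (- inverse c) * (g' w * inverse (g w))) ((- inverse c) * (c' * inverse c))"
  by (intro locv_mult locv_const locv_inverse g 1 assms)
 show ?thesis
 proof (rule tcongI[OF L])
  show "GEN w. inverse (g w) - inverse c = tau v w * ((- inverse c) * (g' w * inverse (g w)))"
   using 1(2) locv_nz[OF assms(1) g assms(3)]
  proof eventually_elim
   case (elim w)
   have "inverse (g w) - inverse c = - (inverse c * inverse (g w) * (g w - c))"
    using elim assms(3) by (simp add: field_simps)
   then show ?case unfolding elim by (simp add: algebra_simps)
  qed
 qed
qed

lemma tcong_divide: "v \<in> X \<Longrightarrow> tcong v g c \<Longrightarrow> tcong v h e \<Longrightarrow> e \<noteq> 0 \<Longrightarrow> tcong v (\<lambda>w. g w / h w) (c / e)"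
 using tcong_mult[OF _ _ tcong_inverse] by (simp add: divide_inverse)

lemma tcong_tt: assumes "v \<in> Xo" shows "tcong v tt (tt v)"
 by (rule tcongI[OF locv_const[of v 1]]) (use assms in \<open>simp add: tau_def\<close>)

text \<open>By the Kummer equation y^\<open>lam\<close> is a function of t, so y^\<open>lam\<close>
  - y0^\<open>lam\<close> is divisible by t - t0. It factors as (y - y0) S, where S takes the value
  \<open>lam\<close> y0^(\<open>lam\<close> - 1) at v; this is nonzero, so S can be cancelled. The
  cover is unramified here.\<close>

lemma tcong_yy: assumes v: "v \<in> Xo" shows "tcong v yy (yy v)"
proof -
 define S where "S w = (\<Sum>i<lam. yy v ^ (lam - Suc i) * yy w ^ i)" for w
 have X: "v \<in> X" using v by (rule Xo_X)
 have LS: "locv v S (\<Sum>i<lam. yy v ^ (lam - Suc i) * yy v ^ i)"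
  unfolding S_def by (intro locv_sum locv_mult locv_const locv_power locv_yy v X)
 have "(\<Sum>i<lam. yy v ^ (lam - Suc i) * yy v ^ i) = (\<Sum>i<lam. yy v ^ (lam - 1))"
  by (rule sum.cong) (auto simp flip: power_add)
 then have S0: "(\<Sum>i<lam. yy v ^ (lam - Suc i) * yy v ^ i) \<noteq> 0" using lam_nz Xo_nz(4)[OF v] by simp
 have yl: "yy w ^ lam = tt w / ((-1) * (1 + tt w)) ^ ee" if "w \<in> Xo" for w
 proof -
  have "(- (1 + tt w)) ^ ee \<noteq> 0" using Xo_nz(3)[OF that] by (intro power_not_zero) (simp only: neg_equal_0_iff_equal not_False_eq_True)
  then have "yy w ^ lam = tt w / (- (1 + tt w)) ^ ee" using Xo_yy[OF that] by (metis nonzero_eq_divide_eq)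
  then show ?thesis by (simp only: mult_minus1)
 qed
 have nz: "((-1) * (1 + tt v)) ^ ee \<noteq> 0" using Xo_nz(3)[OF v] by (intro power_not_zero no_zero_divisors) auto
 have "tcong v (\<lambda>w. tt w / ((-1) * (1 + tt w)) ^ ee) (tt v / ((-1) * (1 + tt v)) ^ ee)"
  by (intro tcong_divide tcong_power tcong_mult tcong_add tcong_const tcong_tt v X nz)
 then have "tcong v (\<lambda>w. yy w ^ lam) (yy v ^ lam)"
  unfolding yl[OF v, symmetric] by (rule tcong_cong) (use gen_Xo yl in \<open>auto elim: eventually_mono\<close>)
 then obtain h e where h: "locv v h e" "GEN w. yy w ^ lam - yy v ^ lam = tau v w * h w"
  unfolding tcong_def by blast
 show ?thesis
 proof (rule tcongI[OF locv_mult[OF h(1) locv_inverse[OF LS S0]]])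
  show "GEN w. yy w - yy v = tau v w * (h w * inverse (S w))" using h(2) locv_nz[OF X LS S0]
  proof eventually_elim
   case (elim w)
   have "yy w ^ lam - yy v ^ lam = (yy w - yy v) * S w" unfolding S_def by (rule power_diff_sumr2)
   then have "(yy w - yy v) * S w = tau v w * h w" using elim by simp
   then show ?case using elim(2) by (simp add: field_simps)
  qed
 qed
qed

text \<open>The equation reads A (1 + A^\<open>al\<close> \<tau>) = -\<tau>^\<open>ee\<close> and
  the bracket is a unit, so A is \<tau>^\<open>ee\<close> times a unit. Dehomogenised at any of the
  three vertices, the curve has this same shape.\<close>

lemma tcong_vertex:
 assumes "v \<in> X" "locv v A 0" "GEN w. A w ^ ee * tau v w + tau v w ^ ee + A w = 0"
 shows "\<exists>h c. locv v h c \<and> c \<noteq> 0 \<and> (GEN w. A w = tau v w ^ ee * h w)"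
proof -
 have L: "locv v (\<lambda>w. 1 + A w ^ al * tau v w) (1 + 0 ^ al * 0)"
  by (intro locv_add locv_mult locv_power locv_const locv_tau assms)
 then have L1: "locv v (\<lambda>w. 1 + A w ^ al * tau v w) 1" by simp
 have L2: "locv v (\<lambda>w. (-1) * inverse (1 + A w ^ al * tau v w)) ((-1) * inverse 1)"
  by (intro locv_mult locv_inverse[OF L1] locv_const) simp
 have "GEN w. A w = tau v w ^ ee * ((-1) * inverse (1 + A w ^ al * tau v w))"
  using assms(3) locv_nz[OF assms(1) L1 one_neq_zero]
 proof eventually_elim
  case (elim w)
  have "A w * (1 + A w ^ al * tau v w) = - (tau v w ^ ee)"
  proof -
   have "A w * (1 + A w ^ al * tau v w) + tau v w ^ ee = 0"
    using elim(1) by (simp add: ee_eq algebra_simps)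
   then show ?thesis by (simp add: eq_neg_iff_add_eq_0)
  qed
  then show ?case using elim(2) by (simp add: field_simps)
 qed
 with L2 show ?thesis by (intro exI[of _ "\<lambda>w. (-1) * inverse (1 + A w ^ al * tau v w)"] exI[of _ "(-1) * inverse 1"]) simp
qed

lemma gen_eq: "GEN w. fst w ^ ee * cy w + cy w ^ ee * cz w + cz w ^ ee * fst w = 0 \<and>
  fst w \<noteq> 0 \<and> cy w \<noteq> 0 \<and> cz w \<noteq> 0" using gen_Xo by eventually_elim (simp add: Xo_def X_iff)

lemma vertex_eq_aux:
 fixes x y z :: 'k assumes "x ^ ee * y + y ^ ee * z + z ^ ee * x = 0" "z \<noteq> 0"
 shows "(x / z) ^ ee * (y / z) + (y / z) ^ ee + x / z = 0"
proof -
 have "(x / z) ^ ee * (y / z) + (y / z) ^ ee + x / z = (x ^ ee * y + y ^ ee * z + z ^ ee * x) / (z ^ ee * z)"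
  using assms(2) by (simp add: power_divide field_simps)
 then show ?thesis using assms(1) by simp
qed

lemma vertex_x:
 assumes "v \<in> X" "v = (c, 0, 0)" "c \<noteq> 0" "tau v = (\<lambda>w. cz w / fst w)"
 shows "\<exists>h e. locv v h e \<and> e \<noteq> 0 \<and> (GEN w. cy w / fst w = tau v w ^ ee * h w)"
proof (rule tcong_vertex[OF assms(1)])
 show "locv v (\<lambda>w. cy w / fst w) 0" using locv_frac[of "Suc 0" "\<lambda>w. cy w" "\<lambda>w. fst w" v] assms by simp
 show "GEN w. (cy w / fst w) ^ ee * tau v w + tau v w ^ ee + cy w / fst w = 0"
  using gen_eq by eventually_elim (unfold assms(4), rule vertex_eq_aux, simp_all add: algebra_simps)
qed

lemma vertex_y:
 assumes "v \<in> X" "v = (0, c, 0)" "c \<noteq> 0" "tau v = (\<lambda>w. fst w / cy w)"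
 shows "\<exists>h e. locv v h e \<and> e \<noteq> 0 \<and> (GEN w. cz w / cy w = tau v w ^ ee * h w)"
proof (rule tcong_vertex[OF assms(1)])
 show "locv v (\<lambda>w. cz w / cy w) 0" using locv_frac[of "Suc 0" "\<lambda>w. cz w" "\<lambda>w. cy w" v] assms by simp
 show "GEN w. (cz w / cy w) ^ ee * tau v w + tau v w ^ ee + cz w / cy w = 0"
  using gen_eq by eventually_elim (unfold assms(4), rule vertex_eq_aux, simp_all add: algebra_simps)
qed

lemma vertex_z:
 assumes "v \<in> X" "v = (0, 0, c)" "c \<noteq> 0" "tau v = (\<lambda>w. cy w / cz w)"
 shows "\<exists>h e. locv v h e \<and> e \<noteq> 0 \<and> (GEN w. fst w / cz w = tau v w ^ ee * h w)"
proof (rule tcong_vertex[OF assms(1)])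
 show "locv v (\<lambda>w. fst w / cz w) 0" using locv_frac[of "Suc 0" "\<lambda>w. fst w" "\<lambda>w. cz w" v] assms by simp
 show "GEN w. (fst w / cz w) ^ ee * tau v w + tau v w ^ ee + fst w / cz w = 0"
  using gen_eq by eventually_elim (unfold assms(4), rule vertex_eq_aux, simp_all add: algebra_simps)
qed

lemma tcong_pow_ee:
 assumes "v \<in> X" "\<exists>h e. locv v h e \<and> e \<noteq> 0 \<and> (GEN w. A w = tau v w ^ ee * h w)" shows "tcong v A 0"
proof -
 obtain h e where h: "locv v h e" "GEN w. A w = tau v w ^ ee * h w" using assms(2) by blast
 have L: "locv v (\<lambda>w. tau v w ^ al * h w) (0 ^ al * e)" by (intro locv_mult locv_power locv_tau assms(1) h)
 show ?thesis by (rule tcongI[OF L]) (use h(2) in \<open>eventually_elim, simp add: ee_eq\<close>)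
qed

lemma tcong_tau: "tcong v (tau v) 0" by (rule tcongI[OF locv_const[of v 1]]) simp

lemma tcong_coords:
 assumes "v \<in> X"
 obtains l where "form (Suc 0) l" "l v \<noteq> 0" "tcong v (\<lambda>w. fst w / l w) (fst v / l v)"
  "tcong v (\<lambda>w. cy w / l w) (cy v / l v)" "tcong v (\<lambda>w. cz w / l w) (cz v / l v)"
proof (cases "v \<in> Xo")
 case True
 have z: "cz v \<noteq> 0" using True by (simp add: Xo_def)
 have y: "tcong v (\<lambda>w. cy w / cz w) (cy v / cz v)" using tcong_yy[OF True] by (simp add: yy_def[abs_def])
 have "tcong v (\<lambda>w. ((-1) * (1 + tt w)) * yy w ^ ee) (((-1) * (1 + tt v)) * yy v ^ ee)"
  by (intro tcong_mult tcong_power tcong_add tcong_const tcong_tt tcong_yy True assms)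
 then have "tcong v (\<lambda>w. ((-1) * (1 + tt w)) * yy w ^ ee) (fst v / cz v)" unfolding Xo_xz[OF True] by simp
 moreover have "GEN w. fst w / cz w = ((-1) * (1 + tt w)) * yy w ^ ee"
  using gen_Xo by eventually_elim (simp only: Xo_xz mult_minus1)
 ultimately have x: "tcong v (\<lambda>w. fst w / cz w) (fst v / cz v)" by (rule tcong_cong)
 have "GEN w. cz w / cz w = 1" using gen_eq by eventually_elim simp
 from tcong_cong[OF tcong_const this] have "tcong v (\<lambda>w. cz w / cz w) (cz v / cz v)" using z by simp
 with x y z show ?thesis by (intro that[of "\<lambda>w. cz w"]) auto
next
 case False
 have 1: "tcong v (\<lambda>w. l w / l w) 1" if "GEN w. l w \<noteq> 0" for l
 proof -
  have "GEN w. l w / l w = 1" using that by eventually_elim simp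
  from tcong_cong[OF tcong_const this] show ?thesis .
 qed
 have nz: "GEN w. fst w \<noteq> 0" "GEN w. cy w \<noteq> 0" "GEN w. cz w \<noteq> 0" using gen_eq by (auto elim: eventually_mono)
 from assms False show ?thesis
 proof (cases rule: vertexE)
  case (x c)
  then show ?thesis using 1[OF nz(1)] tcong_tau[of v] tcong_pow_ee[OF assms vertex_x[OF assms x(2,1,3)]]
   by (intro that[of "\<lambda>w. fst w"]) auto
 next
  case (y c)
  then show ?thesis using 1[OF nz(2)] tcong_tau[of v] tcong_pow_ee[OF assms vertex_y[OF assms y(2,1,3)]]
   by (intro that[of "\<lambda>w. cy w"]) auto
 next
  case (z c)
  then show ?thesis using 1[OF nz(3)] tcong_tau[of v] tcong_pow_ee[OF assms vertex_z[OF assms z(2,1,3)]]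
   by (intro that[of "\<lambda>w. cz w"]) auto
 qed
qed

lemma tcong_form:
 assumes "v \<in> X" "l v \<noteq> 0" "tcong v (\<lambda>w. fst w / l w) (fst v / l v)"
  "tcong v (\<lambda>w. cy w / l w) (cy v / l v)" "tcong v (\<lambda>w. cz w / l w) (cz v / l v)"
  and F: "form n F" shows "tcong v (\<lambda>w. F w / l w ^ n) (F v / l v ^ n)" using F
proof (induction rule: form_induct)
 case (add F G)
 then show ?case using tcong_add[OF assms(1)] by (simp add: add_divide_distrib)
next
 case (mono c i j k)
 have e: "c * monom3 i j k w / l w ^ n
  = c * ((fst w / l w) ^ i * ((cy w / l w) ^ j * (cz w / l w) ^ k))" for w
  unfolding mono[symmetric] by (simp add: monom3_def power_divide power_add mult.assoc)
 show ?case unfolding e by (intro tcong_mult tcong_power tcong_const assms)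
qed simp

text \<open>The congruence holds for the coordinates divided by a linear form nonzero at v, hence
  for quotients of forms, which make up the local ring.\<close>

lemma locv_tcong: assumes v: "v \<in> X" and g: "locv v g c" shows "tcong v g c"
proof -
 obtain l where l: "form (Suc 0) l" "l v \<noteq> 0" "tcong v (\<lambda>w. fst w / l w) (fst v / l v)"
  "tcong v (\<lambda>w. cy w / l w) (cy v / l v)" "tcong v (\<lambda>w. cz w / l w) (cz v / l v)"
  using tcong_coords[OF v] by blast
 obtain n F G where 1: "form n F" "form n G" "G v \<noteq> 0" "c = F v / G v" "GEN w. g w = F w / G w"
  using locvE[OF g] by blast
 have "tcong v (\<lambda>w. (F w / l w ^ n) / (G w / l w ^ n)) ((F v / l v ^ n) / (G v / l v ^ n))"
  by (rule tcong_divide[OF v tcong_form[OF v l(2-5) 1(1)] tcong_form[OF v l(2-5) 1(2)]]) (use 1 l in simp)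
 then have "tcong v (\<lambda>w. (F w / l w ^ n) / (G w / l w ^ n)) c" using 1(4) l(2) by simp
 then show ?thesis
 proof (rule tcong_cong)
  show "GEN w. g w = (F w / l w ^ n) / (G w / l w ^ n)"
   using 1(5) gen_form[OF l(1) v l(2)] by eventually_elim simp
 qed
qed

lemma locv_zero_tau:
 assumes "v \<in> X" "locv v g 0" obtains h e where "locv v h e" "GEN w. g w = tau v w * h w"
 using locv_tcong[OF assms] unfolding tcong_def by auto

section \<open>The cyclic group action and orders of rational functions\<close>

definition mu :: "'k set" where "mu = {c. c ^ lam = 1}"

lemma card_mu: "card mu = lam" and finite_mu [simp]: "finite mu"
 using card_nth_roots[of "1::'k" lam] lam_nz by (simp_all add: mu_def)

lemma one_mu [simp]: "1 \<in> mu" by (simp add: mu_def)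

lemma mu_nz: "c \<in> mu \<Longrightarrow> c \<noteq> 0" by (auto simp: mu_def)

lemma mu_mult: "c \<in> mu \<Longrightarrow> e \<in> mu \<Longrightarrow> c * e \<in> mu" by (simp add: mu_def power_mult_distrib)

lemma mu_inverse: "c \<in> mu \<Longrightarrow> inverse c \<in> mu" by (simp add: mu_def power_inverse)

lemma bij_mu: assumes "c \<in> mu" shows "bij_betw (\<lambda>z. z * c) mu mu"
 by (rule bij_betw_byWitness[where f' = "\<lambda>z. z * inverse c"])
  (use mu_mult[OF _ assms] mu_mult[OF _ mu_inverse[OF assms]] mu_nz[OF assms] in \<open>auto simp: mult.assoc\<close>)

text \<open>Orthogonality of characters: T^i - 1 cannot have \<open>lam\<close> roots if 0 < i <
  \<open>lam\<close>, so some c in \<open>mu\<close> has c^i \<noteq> 1, and translation by c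
  multiplies the sum by c^i.\<close>

lemma sum_mu_power: assumes "i < lam" shows "(\<Sum>z\<in>mu. z ^ i) = (if i = 0 then of_nat lam else 0)"
proof (cases "i = 0")
 case False
 have "\<exists>c\<in>mu. c ^ i \<noteq> 1"
 proof (rule ccontr)
  assume "\<not> (\<exists>c\<in>mu. c ^ i \<noteq> 1)"
  then have "mu \<subseteq> {x. poly (monom 1 i - 1) x = 0}" by (auto simp: poly_monom)
  moreover have ne: "monom 1 i - (1::'k poly) \<noteq> 0"
  proof
   assume "monom 1 i - (1::'k poly) = 0"
   then have "coeff (monom 1 i) i = coeff (1::'k poly) i" by simp
   then show False using False by simp
  qed
  ultimately have "card mu \<le> card {x. poly (monom 1 i - 1) x = (0::'k)}"
   by (intro card_mono poly_roots_finite[OF ne])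
  also have "\<dots> \<le> degree (monom 1 i - (1::'k poly))" by (rule card_poly_roots_bound[OF ne])
  also have "\<dots> \<le> i" by (rule degree_diff_le) (auto simp: degree_monom_le)
  finally show False using assms card_mu by simp
 qed
 then obtain c where c: "c \<in> mu" "c ^ i \<noteq> 1" by blast
 have "(\<Sum>z\<in>mu. z ^ i) = (\<Sum>z\<in>mu. (z * c) ^ i)"
  using sum.reindex_bij_betw[OF bij_mu[OF c(1)], of "\<lambda>z. z ^ i"] by simp
 also have "\<dots> = (\<Sum>z\<in>mu. z ^ i) * c ^ i" by (simp add: power_mult_distrib sum_distrib_right)
 finally have "(\<Sum>z\<in>mu. z ^ i) * (c ^ i - 1) = 0" by (simp add: algebra_simps)
 then show ?thesis using c(2) False by simp
qed (simp add: card_mu)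

text \<open>The weights \<open>ee\<close>, 1, 0 make all three terms of the equation scale by
  c^\<open>ee\<close>; for the first term the exponent is
  \<open>ee * ee + 1 = lam + ee\<close>.\<close>

definition sig :: "'k \<Rightarrow> 'k pt \<Rightarrow> 'k pt" where
 "sig c v = (c ^ ee * fst v, c * cy v, cz v)"

lemma sig_simps [simp]: "fst (sig c v) = c ^ ee * fst v" "cy (sig c v) = c * cy v"
 "cz (sig c v) = cz v" by (simp_all add: sig_def)

lemma sig_sig [simp]: "sig c (sig e v) = sig (c * e) v" by (simp add: sig_def power_mult_distrib mult.assoc)

lemma sig_1 [simp]: "sig 1 v = v" by (simp add: sig_def)

lemma mu_pow: assumes "c \<in> mu" shows "(c ^ ee) ^ ee * c = c ^ ee"
proof -
 have "ee * ee + 1 = lam + ee" by (simp add: lam_def ee_eq)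
 then have "(c ^ ee) ^ ee * c = c ^ (lam + ee)" by (metis power_mult power_Suc2 Suc_eq_plus1)
 then show ?thesis using assms by (simp add: mu_def power_add)
qed

lemma sig_X: assumes "c \<in> mu" "v \<in> X" shows "sig c v \<in> X"
proof -
 obtain x y z where v: "v = (x, y, z)" by (metis prod.collapse)
 have "(c^ee*x)^ee*(c*y) + (c*y)^ee*z + z^ee*(c^ee*x) = ((c^ee)^ee*c)*(x^ee*y) + c^ee*(y^ee*z) + c^ee*(z^ee*x)"
  by (simp add: power_mult_distrib algebra_simps)
 also have "\<dots> = c^ee * (x^ee*y+y^ee*z+z^ee*x)" unfolding mu_pow[OF assms(1)] by (simp add: algebra_simps)
 finally show ?thesis using assms mu_nz[OF assms(1)] unfolding X_iff v sig_def by auto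
qed

lemma sig_Xo: "c \<in> mu \<Longrightarrow> v \<in> Xo \<Longrightarrow> sig c v \<in> Xo" using sig_X mu_nz[of c] by (simp add: Xo_def)

lemma sig_tt: assumes "c \<in> mu" shows "tt (sig c v) = tt v"
proof -
 have "(c ^ ee * fst v) ^ ee * (c * cy v) = ((c ^ ee) ^ ee * c) * (fst v ^ ee * cy v)"
  by (simp add: power_mult_distrib)
 then have 1: "(c ^ ee * fst v) ^ ee * (c * cy v) = c ^ ee * (fst v ^ ee * cy v)"
  unfolding mu_pow[OF assms] .
 have 2: "(c * cy v) ^ ee * cz v = c ^ ee * (cy v ^ ee * cz v)" by (simp add: power_mult_distrib)
 show ?thesis unfolding tt_def sig_simps 1 2 using mu_nz[OF assms] by simp
qed

lemma sig_yy: "yy (sig c v) = c * yy v" by (simp add: yy_def)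

lemma form_sig: "form n F \<Longrightarrow> form n (\<lambda>v. F (sig c v))" by (rule form_comp_linear) (simp_all add: form_cmult)

lemma gen_sig: assumes "c \<in> mu" "eventually P gen" shows "eventually (\<lambda>v. P (sig c v)) gen"
proof -
 obtain n F v where F: "form n F" "v \<in> X" "F v \<noteq> 0" "\<forall>v\<in>X. F v \<noteq> 0 \<longrightarrow> P v"
  using assms(2) unfolding eventually_gen by blast
 have "F (sig c (sig (inverse c) v)) \<noteq> 0" using F(3) mu_nz[OF assms(1)] by simp
 moreover have "sig (inverse c) v \<in> X" using sig_X[OF mu_inverse] assms(1) F(2) by blast
 ultimately show ?thesis unfolding eventually_gen
  using F(4) sig_X[OF assms(1)] form_sig[OF F(1), of c] by blast
qed

lemma locv_sig: assumes "c \<in> mu" "locv (sig c v) g e" shows "locv v (\<lambda>w. g (sig c w)) e"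
proof -
 obtain n F G where 1: "form n F" "form n G" "G (sig c v) \<noteq> 0" "e = F (sig c v) / G (sig c v)" "GEN w. g w = F w / G w"
  using locvE[OF assms(2)] by blast
 show ?thesis
  using locv_cong[OF locv_frac[OF form_sig[OF 1(1)] form_sig[OF 1(2)] 1(3)] gen_sig[OF assms(1) 1(5)]] 1(4) by simp
qed

section \<open>Rational functions on X\<close>

definition rat :: "('k pt \<Rightarrow> 'k) \<Rightarrow> bool" where
 "rat g \<longleftrightarrow> (\<exists>n F G. form n F \<and> form n G \<and> (GEN w. G w \<noteq> 0) \<and> (GEN w. g w = F w / G w))"

lemma ratE:
 assumes "rat g" obtains n F G where "form n F" "form n G" "GEN w. G w \<noteq> 0" "GEN w. g w = F w / G w"
 using assms unfolding rat_def by blast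

lemma rat_frac: "form n F \<Longrightarrow> form n G \<Longrightarrow> GEN w. G w \<noteq> 0 \<Longrightarrow> rat (\<lambda>w. F w / G w)"
 unfolding rat_def by (intro exI[of _ n] exI[of _ F] exI[of _ G]) simp

lemma locv_rat: assumes "v \<in> X" "locv v g c" shows "rat g"
proof -
 obtain n F G where 1: "form n F" "form n G" "G v \<noteq> 0" "c = F v / G v" "GEN w. g w = F w / G w"
  using locvE[OF assms(2)] by blast
 then show ?thesis unfolding rat_def using gen_form[OF 1(2) assms(1) 1(3)] by blast
qed

lemma rat_locv: assumes "rat g" obtains U where "zopen X U" "U \<noteq> {}" "\<And>v. v \<in> U \<Longrightarrow> \<exists>c. locv v g c"
proof -
 obtain n F G where 1: "form n F" "form n G" "GEN w. G w \<noteq> 0" "GEN w. g w = F w / G w"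
  using ratE[OF assms] by blast
 obtain v where "v \<in> X" "G v \<noteq> 0" using gen_ex[OF 1(3)] by blast
 moreover have "\<exists>c. locv w g c" if "w \<in> {w \<in> X. G w \<noteq> 0}" for w using 1 that unfolding locv_def by blast
 ultimately show ?thesis using that[OF zopen_D[OF 1(2)]] by blast
qed

text \<open>Closure properties of rational functions are inherited from those of functions with a
 value at a suitable point.\<close>

lemma rat_common:
 assumes "rat g" "rat h"
 obtains v c e where "v \<in> X" "locv v g c" "locv v h e"
proof -
 obtain U where U: "zopen X U" "U \<noteq> {}" "\<And>v. v \<in> U \<Longrightarrow> \<exists>c. locv v g c" using rat_locv[OF assms(1)] by blast
 obtain W where W: "zopen X W" "W \<noteq> {}" "\<And>v. v \<in> W \<Longrightarrow> \<exists>c. locv v h c" using rat_locv[OF assms(2)] by blast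
 have "GEN w. w \<in> U" "GEN w. w \<in> W" using gen_zopen U W by blast+
 then have "GEN w. w \<in> U \<and> w \<in> W" by eventually_elim simp
 then obtain v where "v \<in> X" "v \<in> U" "v \<in> W" using gen_ex by blast
 then show ?thesis using U W that by blast
qed

lemma rat_add: "rat g \<Longrightarrow> rat h \<Longrightarrow> rat (\<lambda>w. g w + h w)" by (metis rat_common locv_add locv_rat)

lemma rat_mult: "rat g \<Longrightarrow> rat h \<Longrightarrow> rat (\<lambda>w. g w * h w)" by (metis rat_common locv_mult locv_rat)

lemma rat_const [simp]: "rat (\<lambda>w. c)" using locv_rat locv_const Xo_nonempty Xo_X by blast

lemma rat_diff: "rat g \<Longrightarrow> rat h \<Longrightarrow> rat (\<lambda>w. g w - h w)" by (metis rat_common locv_diff locv_rat)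

lemma rat_inverse: assumes "rat g" shows "rat (\<lambda>w. inverse (g w))"
proof -
 obtain n F G where 1: "form n F" "form n G" "GEN w. G w \<noteq> 0" "GEN w. g w = F w / G w"
  using ratE[OF assms] by blast
 show ?thesis
 proof (cases "GEN w. F w \<noteq> 0")
  case True
  have "GEN w. inverse (g w) = G w / F w" using 1(4) by eventually_elim simp
  then show ?thesis using 1 True unfolding rat_def by blast
 next
  case False
  then have "\<forall>v\<in>X. F v = 0" using gen_form_dichotomy[OF 1(1)] by blast
  then have "GEN w. F w = 0" using gen_X by (auto elim: eventually_mono)
  then have "GEN w. inverse (g w) = 0 / 1" using 1(4) by eventually_elim simp
  then show ?thesis unfolding rat_def by (intro exI[of _ 0] exI[of _ "\<lambda>_. 0"] exI[of _ "\<lambda>_. 1"]) simp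
 qed
qed

lemma rat_divide: "rat g \<Longrightarrow> rat h \<Longrightarrow> rat (\<lambda>w. g w / h w)"
 using rat_mult[OF _ rat_inverse] by (simp add: divide_inverse)

lemma rat_power: "rat g \<Longrightarrow> rat (\<lambda>w. g w ^ n)"
proof (induction n)
 case (Suc n)
 show ?case using rat_mult[OF Suc.prems Suc.IH[OF Suc.prems]] by simp
qed simp

lemma rat_prod: "(\<And>i. i \<in> A \<Longrightarrow> rat (g i)) \<Longrightarrow> rat (\<lambda>w. \<Prod>i\<in>A. g i w)"
proof (induction A rule: infinite_finite_induct)
 case (insert x A)
 then have "rat (g x)" "rat (\<lambda>w. \<Prod>i\<in>A. g i w)" by simp_all
 from rat_mult[OF this] show ?case using insert.hyps by simp
qed simp_all

lemma rat_cong: assumes "rat g" "GEN w. h w = g w" shows "rat h"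
proof -
 obtain n F G where 1: "form n F" "form n G" "GEN w. G w \<noteq> 0" "GEN w. g w = F w / G w"
  using ratE[OF assms(1)] by blast
 from assms(2) 1(4) have "GEN w. h w = F w / G w" by eventually_elim simp
 with 1 show ?thesis unfolding rat_def by blast
qed

lemma rat_sig: assumes "c \<in> mu" "rat g" shows "rat (\<lambda>w. g (sig c w))"
proof -
 obtain n F G where 1: "form n F" "form n G" "GEN w. G w \<noteq> 0" "GEN w. g w = F w / G w"
  using ratE[OF assms(2)] by blast
 show ?thesis unfolding rat_def
  using form_sig[OF 1(1)] form_sig[OF 1(2)] gen_sig[OF assms(1) 1(3)] gen_sig[OF assms(1) 1(4)] by blast
qed

lemma rat_dichotomy: assumes "rat g" shows "(GEN w. g w = 0) \<or> (GEN w. g w \<noteq> 0)"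
proof -
 obtain n F G where 1: "form n F" "form n G" "GEN w. G w \<noteq> 0" "GEN w. g w = F w / G w"
  using ratE[OF assms] by blast
 from gen_form_dichotomy[OF 1(1)] show ?thesis
 proof
  assume "\<forall>v\<in>X. F v = 0"
  then have "GEN w. F w = 0" using gen_X by (auto elim: eventually_mono)
  then have "GEN w. g w = 0" using 1(4) by eventually_elim simp
  then show ?thesis ..
 next
  assume "GEN w. F w \<noteq> 0"
  then have "GEN w. g w \<noteq> 0" using 1(3,4) by eventually_elim simp
  then show ?thesis ..
 qed
qed

lemma rat_regular: "f \<in> regular X U \<Longrightarrow> zopen X U \<Longrightarrow> v \<in> U \<Longrightarrow> rat f"
 using locv_rat locv_regular zopen_sub by blast

lemma rat_tt: "rat tt" and rat_yy: "rat yy"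
 using locv_rat[OF Xo_X locv_tt] locv_rat[OF Xo_X locv_yy] Xo_nonempty by blast+

lemma rat_poly: "rat (\<lambda>w. poly q (tt w))" by (induction q) (simp_all add: rat_add rat_mult rat_tt)

lemma locv_poly: "v \<in> X \<Longrightarrow> locv v g c \<Longrightarrow> locv v (\<lambda>w. poly q (g w)) (poly q c)"
 by (induction q) (simp_all add: locv_add locv_mult)

text \<open>A relation rather than a function, since the existence of an order is only available
  once norms are. It refers to the fixed uniformizer \<open>tau v\<close>; independence of that
  choice is part of \<open>ord_at_eq\<close>.\<close>

definition hasord :: "'k pt \<Rightarrow> ('k pt \<Rightarrow> 'k) \<Rightarrow> int \<Rightarrow> bool" where
 "hasord v g k \<longleftrightarrow> (\<exists>h c. locv v h c \<and> c \<noteq> 0 \<and> (GEN w. g w = tau v w powi k * h w))"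

lemma hasordI: "locv v h c \<Longrightarrow> c \<noteq> 0 \<Longrightarrow> GEN w. g w = tau v w powi k * h w \<Longrightarrow> hasord v g k"
 unfolding hasord_def by blast

lemma hasordE:
 assumes "hasord v g k" obtains h c where "locv v h c" "c \<noteq> 0" "GEN w. g w = tau v w powi k * h w"
 using assms unfolding hasord_def by blast

lemma hasord_cong: assumes "hasord v g k" "GEN w. h w = g w" shows "hasord v h k"
proof -
 obtain f c where 1: "locv v f c" "c \<noteq> 0" "GEN w. g w = tau v w powi k * f w" using hasordE[OF assms(1)] by blast
 from assms(2) 1(3) have "GEN w. h w = tau v w powi k * f w" by eventually_elim simp
 then show ?thesis using 1 hasordI by blast
qed

lemma hasord_rat: assumes "v \<in> X" "hasord v g k" shows "rat g"
proof -
 obtain f c where 1: "locv v f c" "c \<noteq> 0" "GEN w. g w = tau v w powi k * f w" using hasordE[OF assms(2)] by blast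
 have t: "rat (tau v)" using locv_rat locv_tau assms by blast
 have "rat (\<lambda>w. tau v w powi k)"
  unfolding power_int_def using rat_power[OF t] rat_power[OF rat_inverse[OF t]] by (cases "k \<ge> 0") simp_all
 then show ?thesis using rat_cong[OF rat_mult 1(3)] locv_rat[OF assms(1) 1(1)] by blast
qed

lemma hasord_nz: assumes "v \<in> X" "hasord v g k" shows "GEN w. g w \<noteq> 0"
proof -
 obtain f c where 1: "locv v f c" "c \<noteq> 0" "GEN w. g w = tau v w powi k * f w" using hasordE[OF assms(2)] by blast
 show ?thesis using 1(3) gen_tau[OF assms(1)] locv_nz[OF assms(1) 1(1,2)]
  by eventually_elim (simp add: power_int_eq_0_iff)
qed

lemma hasord_mult: assumes "v \<in> X" "hasord v g k" "hasord v h l" shows "hasord v (\<lambda>w. g w * h w) (k + l)"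
proof -
 obtain f c where 1: "locv v f c" "c \<noteq> 0" "GEN w. g w = tau v w powi k * f w" using hasordE[OF assms(2)] by blast
 obtain f' c' where 2: "locv v f' c'" "c' \<noteq> 0" "GEN w. h w = tau v w powi l * f' w" using hasordE[OF assms(3)] by blast
 show ?thesis
 proof (rule hasordI[OF locv_mult[OF 1(1) 2(1)]])
  show "GEN w. g w * h w = tau v w powi (k + l) * (f w * f' w)"
   using 1(3) 2(3) gen_tau[OF assms(1)] by eventually_elim (simp add: power_int_add)
 qed (use 1 2 in simp)
qed

lemma hasord_inverse: assumes "v \<in> X" "hasord v g k" shows "hasord v (\<lambda>w. inverse (g w)) (- k)"
proof -
 obtain f c where 1: "locv v f c" "c \<noteq> 0" "GEN w. g w = tau v w powi k * f w" using hasordE[OF assms(2)] by blast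
 show ?thesis
 proof (rule hasordI[OF locv_inverse[OF 1(1,2)]])
  show "GEN w. inverse (g w) = tau v w powi (- k) * inverse (f w)"
   using 1(3) by eventually_elim (simp add: power_int_minus)
 qed (use 1 in simp)
qed

lemma hasord_divide: "v \<in> X \<Longrightarrow> hasord v g k \<Longrightarrow> hasord v h l \<Longrightarrow> hasord v (\<lambda>w. g w / h w) (k - l)"
 using hasord_mult[OF _ _ hasord_inverse] by (simp add: divide_inverse)

lemma hasord_locv: "locv v g c \<Longrightarrow> c \<noteq> 0 \<Longrightarrow> hasord v g 0" by (rule hasordI, assumption+) simp

lemma hasord_const: "c \<noteq> 0 \<Longrightarrow> hasord v (\<lambda>w. c) 0" by (rule hasord_locv) simp_all

lemma hasord_tau: "hasord v (tau v) 1" by (rule hasordI[OF locv_const[of v 1]]) simp_all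

lemma hasord_power: "v \<in> X \<Longrightarrow> hasord v g k \<Longrightarrow> hasord v (\<lambda>w. g w ^ n) (int n * k)"
proof (induction n)
 case (Suc n)
 show ?case using hasord_mult[OF Suc.prems Suc.IH[OF Suc.prems]] by (simp add: algebra_simps)
qed (simp add: hasord_const)

text \<open>Positive powers of \<tau> have residue 0. Comparing \<tau>^k times a unit with \<tau>^l
  times h therefore excludes l > k, and l = k holds exactly when h is a unit. Uniqueness of orders
  and their positivity for regular functions are special cases.\<close>

lemma hasord_locv_ge: assumes v: "v \<in> X" and g: "hasord v g k" and h: "locv v h e"
  "GEN w. g w = tau v w powi l * h w" shows "l \<le> k" "l = k \<longleftrightarrow> e \<noteq> 0"
proof -
 obtain f c where 1: "locv v f c" "c \<noteq> 0" "GEN w. g w = tau v w powi k * f w" using hasordE[OF g] by blast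
 have key: "l - k < 0 \<and> e = 0 \<or> l = k \<and> e \<noteq> 0"
 proof -
  consider (gt) "l > k" | (eq) "l = k" | (lt) "l < k" by linarith
  then show ?thesis
  proof cases
   case gt
   have L: "locv v (\<lambda>w. tau v w ^ nat (l - k) * h w) (0 ^ nat (l - k) * e)"
    by (intro locv_mult locv_power locv_tau v h)
   have "GEN w. f w = tau v w ^ nat (l - k) * h w" using 1(3) h(2) gen_tau[OF v]
   proof eventually_elim
    case (elim w)
    have "tau v w powi l = tau v w powi k * tau v w powi (l - k)" using elim(3) by (simp flip: power_int_add)
    moreover have "tau v w powi (l - k) = tau v w ^ nat (l - k)" using gt by (simp add: power_int_def)
    ultimately have "tau v w powi k * f w = tau v w powi k * (tau v w ^ nat (l - k) * h w)" using elim by simp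
    then show ?case using elim(3) by simp
   qed
   from locv_cong[OF L this] have "locv v f (0 ^ nat (l - k) * e)" .
   moreover have "(0::'k) ^ nat (l - k) = 0" using gt by (intro zero_power) simp
   ultimately have "locv v f 0" by simp
   then show ?thesis using locv_unique[OF v 1(1)] 1(2) by blast
  next
   case eq
   have "GEN w. h w = f w"
    using 1(3) h(2) gen_tau[OF v] by eventually_elim (use eq in \<open>simp add: power_int_eq_0_iff\<close>)
   from locv_cong[OF 1(1) this] have "e = c" using locv_unique[OF v h(1)] by blast
   then show ?thesis using 1(2) eq by simp
  next
   case lt
   have L: "locv v (\<lambda>w. tau v w ^ nat (k - l) * f w) (0 ^ nat (k - l) * c)"
    by (intro locv_mult locv_power locv_tau v 1)
   have "GEN w. h w = tau v w ^ nat (k - l) * f w" using 1(3) h(2) gen_tau[OF v]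
   proof eventually_elim
    case (elim w)
    have "tau v w powi k = tau v w powi l * tau v w powi (k - l)" using elim(3) by (simp flip: power_int_add)
    moreover have "tau v w powi (k - l) = tau v w ^ nat (k - l)" using lt by (simp add: power_int_def)
    ultimately have "tau v w powi l * h w = tau v w powi l * (tau v w ^ nat (k - l) * f w)" using elim by simp
    then show ?case using elim(3) by simp
   qed
   from locv_cong[OF L this] have "locv v h (0 ^ nat (k - l) * c)" .
   moreover have "(0::'k) ^ nat (k - l) = 0" using lt by (intro zero_power) simp
   ultimately have "locv v h 0" by simp
   then have "e = 0" using locv_unique[OF v h(1)] by blast
   then show ?thesis using lt by simp
  qed
 qed
 then show "l \<le> k" "l = k \<longleftrightarrow> e \<noteq> 0" by auto
qed

lemma hasord_unique: assumes "v \<in> X" "hasord v g k" "hasord v g l" shows "k = l"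
proof -
 obtain f c where 1: "locv v f c" "c \<noteq> 0" "GEN w. g w = tau v w powi l * f w" using hasordE[OF assms(3)] by blast
 show ?thesis using hasord_locv_ge(2)[OF assms(1,2) 1(1,3)] 1(2) by simp
qed

lemma hasord_value: assumes "v \<in> X" "hasord v g k" "locv v g c" shows "k \<ge> 0" "k = 0 \<longleftrightarrow> c \<noteq> 0"
 using hasord_locv_ge[OF assms(1,2,3), of 0] by auto

lemma hasord_ge0_locv: assumes "v \<in> X" "hasord v g k" "k \<ge> l" shows "\<exists>h e. locv v h e \<and> (GEN w. g w = tau v w powi l * h w)"
proof -
 obtain f c where 1: "locv v f c" "c \<noteq> 0" "GEN w. g w = tau v w powi k * f w" using hasordE[OF assms(2)] by blast
 have L: "locv v (\<lambda>w. tau v w ^ nat (k - l) * f w) (0 ^ nat (k - l) * c)"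
  by (intro locv_mult locv_power locv_tau assms 1)
 have "GEN w. g w = tau v w powi l * (tau v w ^ nat (k - l) * f w)" using 1(3) gen_tau[OF assms(1)]
 proof eventually_elim
  case (elim w)
  have "tau v w powi k = tau v w powi l * tau v w powi (k - l)" using elim(2) by (simp flip: power_int_add)
  moreover have "tau v w powi (k - l) = tau v w ^ nat (k - l)" using assms(3) by (simp add: power_int_def)
  ultimately show ?case using elim(1) by simp
 qed
 with L show ?thesis by blast
qed

section \<open>Orders at the three vertices\<close>

definition xz :: "'k pt \<Rightarrow> 'k" where "xz w = fst w / cz w"

lemma rat_xz: "rat xz"
proof -
 have "GEN w. cz w \<noteq> 0" using gen_eq by (auto elim: eventually_mono)
 then show ?thesis unfolding xz_def[abs_def] by (intro rat_frac[of "Suc 0"]) simp_all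
qed

lemma gen_tt: "GEN w. tt w = xz w ^ ee * yy w / yy w ^ ee" using gen_Xo
proof eventually_elim
 case (elim w)
 then have "fst w \<noteq> 0" "cy w \<noteq> 0" "cz w \<noteq> 0" by (auto simp: Xo_def)
 then show ?case by (simp add: tt_def xz_def yy_def power_divide)
qed

lemma gen_tt1: "GEN w. 1 + tt w = (-1) * (xz w / yy w ^ ee)" using gen_Xo
proof eventually_elim
 case (elim w)
 have "xz w = ((-1) * (1 + tt w)) * yy w ^ ee" unfolding xz_def using Xo_xz[OF elim] by simp
 then show ?case using Xo_nz(4)[OF elim] by simp
qed

lemma hasord_pow_ee:
 assumes "\<exists>h e. locv v h e \<and> e \<noteq> 0 \<and> (GEN w. A w = tau v w ^ ee * h w)" shows "hasord v A (int ee)"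
proof -
 obtain h e where "locv v h e" "e \<noteq> 0" "GEN w. A w = tau v w ^ ee * h w" using assms by blast
 then show ?thesis by (intro hasordI[of v h e]) simp_all
qed

text \<open>At each vertex one coordinate ratio is the uniformizer and another is its
  \<open>ee\<close>-th power times a unit; all other orders follow. Over the three vertices t has a
  pole, 1 + t a zero and t a zero of order \<open>lam\<close>: total ramification over the branch
  points.\<close>

lemma hasord_vx:
 assumes "v \<in> X" "v \<notin> Xo" "fst v \<noteq> 0"
 shows "hasord v xz (-1)" "hasord v yy (int al)" "hasord v tt (- int lam)" "hasord v (\<lambda>w. cz w / fst w) 1"
proof -
 obtain c where c: "c \<noteq> 0" "v = (c, 0, 0)" "tau v = (\<lambda>w. cz w / fst w)"
  using assms(1,2) by (cases rule: vertexE) (use assms(3) in auto)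
 have 1: "hasord v (\<lambda>w. cz w / fst w) 1" using hasord_tau[of v] c(3) by simp
 have 2: "hasord v (\<lambda>w. cy w / fst w) (int ee)" using hasord_pow_ee[OF vertex_x[OF assms(1) c(2,1,3)]] .
 have "hasord v (\<lambda>w. inverse (cz w / fst w)) (-1)" using hasord_inverse[OF assms(1) 1] .
 then show x: "hasord v xz (-1)" by (simp add: xz_def[abs_def])
 have "hasord v yy (int ee - 1)"
  by (rule hasord_cong[OF hasord_divide[OF assms(1) 2 1]]) (use gen_eq in \<open>eventually_elim, simp add: yy_def\<close>)
 then show y: "hasord v yy (int al)" by (simp add: ee_eq)
 have "hasord v tt (int ee * (-1) + int al - int ee * int al)"
  by (rule hasord_cong[OF hasord_divide[OF assms(1) hasord_mult[OF assms(1) hasord_power[OF assms(1) x] y]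
    hasord_power[OF assms(1) y]] gen_tt])
 moreover have "int ee * (-1) + int al - int ee * int al = - int lam" by (simp add: lam_def ee_eq algebra_simps)
 ultimately show "hasord v tt (- int lam)" by simp
 show "hasord v (\<lambda>w. cz w / fst w) 1" by (rule 1)
qed

lemma hasord_vy:
 assumes "v \<in> X" "v \<notin> Xo" "cy v \<noteq> 0"
 shows "hasord v xz (- int al)" "hasord v yy (- int ee)" "hasord v (\<lambda>w. 1 + tt w) (int lam)" "hasord v (\<lambda>w. cz w / cy w) (int ee)"
proof -
 obtain c where c: "c \<noteq> 0" "v = (0, c, 0)" "tau v = (\<lambda>w. fst w / cy w)"
  using assms(1,2) by (cases rule: vertexE) (use assms(3) in auto)
 have 1: "hasord v (\<lambda>w. fst w / cy w) 1" using hasord_tau[of v] c(3) by simp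
 have 2: "hasord v (\<lambda>w. cz w / cy w) (int ee)" using hasord_pow_ee[OF vertex_y[OF assms(1) c(2,1,3)]] .
 have "hasord v (\<lambda>w. inverse (cz w / cy w)) (- int ee)" using hasord_inverse[OF assms(1) 2] .
 then show y: "hasord v yy (- int ee)" by (simp add: yy_def[abs_def])
 have "hasord v xz (1 - int ee)"
  by (rule hasord_cong[OF hasord_divide[OF assms(1) 1 2]]) (use gen_eq in \<open>eventually_elim, simp add: xz_def\<close>)
 then show x: "hasord v xz (- int al)" by (simp add: ee_eq)
 have "hasord v (\<lambda>w. 1 + tt w) (0 + (- int al - int ee * (- int ee)))"
  by (rule hasord_cong[OF hasord_mult[OF assms(1) hasord_const hasord_divide[OF assms(1) x
    hasord_power[OF assms(1) y]]] gen_tt1]) simp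
 moreover have "0 + (- int al - int ee * (- int ee)) = int lam" by (simp add: lam_def ee_eq algebra_simps)
 ultimately show "hasord v (\<lambda>w. 1 + tt w) (int lam)" by simp
 show "hasord v (\<lambda>w. cz w / cy w) (int ee)" by (rule 2)
qed

lemma hasord_vz:
 assumes "v \<in> X" "v \<notin> Xo" "cz v \<noteq> 0" shows "hasord v xz (int ee)" "hasord v yy 1" "hasord v tt (int lam)"
proof -
 obtain c where c: "c \<noteq> 0" "v = (0, 0, c)" "tau v = (\<lambda>w. cy w / cz w)"
  using assms(1,2) by (cases rule: vertexE) (use assms(3) in auto)
 have "hasord v (\<lambda>w. cy w / cz w) 1" using hasord_tau[of v] c(3) by simp
 then show y: "hasord v yy 1" by (simp add: yy_def[abs_def])
 have "hasord v (\<lambda>w. fst w / cz w) (int ee)" using hasord_pow_ee[OF vertex_z[OF assms(1) c(2,1,3)]] .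
 then show x: "hasord v xz (int ee)" by (simp add: xz_def[abs_def])
 have "hasord v tt (int ee * int ee + 1 - int ee * 1)"
  by (rule hasord_cong[OF hasord_divide[OF assms(1) hasord_mult[OF assms(1) hasord_power[OF assms(1) x] y]
    hasord_power[OF assms(1) y]] gen_tt])
 moreover have "int ee * int ee + 1 - int ee * 1 = int lam" by (simp add: lam_def ee_eq algebra_simps)
 ultimately show "hasord v tt (int lam)" by simp
qed

lemma vertex_cases:
 assumes "v \<in> X" "v \<notin> Xo"
 obtains "fst v \<noteq> 0" "cy v = 0" "cz v = 0" | "fst v = 0" "cy v \<noteq> 0" "cz v = 0"
  | "fst v = 0" "cy v = 0" "cz v \<noteq> 0" using assms by (cases rule: vertexE) auto

text \<open>The order on the line times the ramification index, which is 1 on \<open>Xo\<close> and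
  \<open>lam\<close> at the vertices. The vertex (1:0:0) lies over infinity, where the order on the
  line is minus the degree.\<close>

definition ordt :: "'k pt \<Rightarrow> 'k poly \<Rightarrow> int" where
 "ordt v B = (if v \<in> Xo then int (pord (tt v) B) else if fst v \<noteq> 0 then - (int lam * int (degree B))
   else if cy v \<noteq> 0 then int lam * int (pord (-1) B) else int lam * int (pord 0 B))"

lemma hasord_pos_locv: assumes "v \<in> X" "hasord v (\<lambda>w. g w - a) k" "k > 0" shows "locv v g a"
proof -
 obtain h e where h: "locv v h e" "GEN w. g w - a = tau v w powi 1 * h w"
  using hasord_ge0_locv[OF assms(1,2), of 1] assms(3) by auto
 have L: "locv v (\<lambda>w. a + tau v w * h w) (a + 0 * e)" by (intro locv_add locv_mult locv_const locv_tau assms h)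
 have "GEN w. g w = a + tau v w * h w" using h(2) by eventually_elim (simp add: algebra_simps)
 from locv_cong[OF L this] show ?thesis by simp
qed

lemma hasord_poly_aux:
 assumes v: "v \<in> X" and g: "hasord v (\<lambda>w. g w - a) k" "k > 0" and B: "B \<noteq> 0"
 shows "hasord v (\<lambda>w. poly B (g w)) (int (pord a B) * k)"
proof -
 define n where "n = pord a B"
 obtain B' where B': "B = [:-a, 1:] ^ n * B'" "\<not> [:-a, 1:] dvd B'"
  using order_decomp[OF B, of a] unfolding n_def by blast
 have "poly B' a \<noteq> 0" using B'(2) poly_eq_0_iff_dvd by blast
 then have "hasord v (\<lambda>w. poly B' (g w)) 0"
  using hasord_locv locv_poly[OF v hasord_pos_locv[OF v g]] by blast
 from hasord_mult[OF v hasord_power[OF v g(1), of n] this]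
 show ?thesis unfolding n_def[symmetric] by (subst B'(1)) (simp add: algebra_simps)
qed

lemma hasord_poly: assumes v: "v \<in> X" and B: "B \<noteq> 0" shows "hasord v (\<lambda>w. poly B (tt w)) (ordt v B)"
proof (cases "v \<in> Xo")
 case True
 have "tau v = (\<lambda>w. tt w - tt v)" using True by (intro ext) (simp add: tau_def)
 then have "hasord v (\<lambda>w. tt w - tt v) 1" using hasord_tau[of v] by simp
 from hasord_poly_aux[OF v this _ B] show ?thesis using True by (simp add: ordt_def)
next
 case False
 from v False show ?thesis
 proof (cases rule: vertex_cases)
  case 1
  note t = hasord_vx(3)[OF v False 1(1)]
  have i: "hasord v (\<lambda>w. inverse (tt w) - 0) (int lam)" using hasord_inverse[OF v t] by simp
  \<comment> \<open>At the pole of t, B(t) is t^deg(B) times the reflected polynomial in 1 / t,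
    whose value at 0 is the leading coefficient.\<close>
  have "locv v (\<lambda>w. poly (reflect_poly B) (inverse (tt w))) (poly (reflect_poly B) 0)"
   by (rule locv_poly[OF v hasord_pos_locv[OF v i]]) simp
  then have "hasord v (\<lambda>w. poly (reflect_poly B) (inverse (tt w))) 0" by (rule hasord_locv) (simp add: B)
  from hasord_mult[OF v hasord_power[OF v t, of "degree B"] this]
  have "hasord v (\<lambda>w. tt w ^ degree B * poly (reflect_poly B) (inverse (tt w))) (ordt v B)"
   using 1 False by (simp add: ordt_def mult.commute)
  then show ?thesis
  proof (rule hasord_cong)
   show "GEN w. poly B (tt w) = tt w ^ degree B * poly (reflect_poly B) (inverse (tt w))" using gen_Xo
   proof eventually_elim
    case (elim w)
    have "tt w \<noteq> 0" using Xo_nz[OF elim] by simp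
    then show ?case by (simp add: poly_reflect_poly_nz power_inverse)
   qed
  qed
 next
  case 2
  have "hasord v (\<lambda>w. tt w - (-1)) (int lam)" using hasord_vy(3)[OF v False 2(2)] by (simp add: add.commute)
  from hasord_poly_aux[OF v this _ B] show ?thesis using False 2 by (simp add: ordt_def mult.commute)
 next
  case 3
  have "hasord v (\<lambda>w. tt w - 0) (int lam)" using hasord_vz(3)[OF v False 3(3)] by simp
  from hasord_poly_aux[OF v this _ B] show ?thesis using False 3 by (simp add: ordt_def mult.commute)
 qed
qed

lemma poly_tt_nz: "B \<noteq> 0 \<Longrightarrow> GEN w. poly B (tt w) \<noteq> 0" using hasord_nz hasord_poly Xo_nonempty Xo_X by blast

text \<open>Averaging over \<open>mu\<close> kills all terms y^i with 0 < i < \<open>lam\<close> and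
  multiplies the zeroth one by \<open>lam\<close>, which is invertible.\<close>

lemma invariant_rep:
 assumes "rep0 g c" "\<And>v z. v \<in> Xo \<Longrightarrow> z \<in> mu \<Longrightarrow> g (sig z v) = g v"
 shows "\<exists>b m. \<forall>v\<in>Xo. g v * (1 + tt v) ^ m = poly b (tt v)"
proof -
 obtain b m where b: "\<And>v. v \<in> Xo \<Longrightarrow> g v * (1 + tt v) ^ m = (\<Sum>i<lam. poly (b i) (tt v) * yy v ^ i)"
  using rep0E[OF assms(1)] by blast
 have "g v * (1 + tt v) ^ m = poly (b 0) (tt v)" if v: "v \<in> Xo" for v
 proof -
  have "of_nat lam * (g v * (1 + tt v) ^ m) = (\<Sum>z\<in>mu. g (sig z v) * (1 + tt (sig z v)) ^ m)"
   by (simp add: assms(2)[OF v] sig_tt card_mu)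
  also have "\<dots> = (\<Sum>z\<in>mu. \<Sum>i<lam. poly (b i) (tt v) * (yy v ^ i * z ^ i))"
  proof (rule sum.cong)
   fix z assume z: "z \<in> mu"
   show "g (sig z v) * (1 + tt (sig z v)) ^ m = (\<Sum>i<lam. poly (b i) (tt v) * (yy v ^ i * z ^ i))"
    unfolding b[OF sig_Xo[OF z v]] by (intro sum.cong refl) (simp add: sig_tt[OF z] sig_yy power_mult_distrib mult.commute)
  qed simp
  also have "\<dots> = (\<Sum>i<lam. poly (b i) (tt v) * (yy v ^ i * (\<Sum>z\<in>mu. z ^ i)))"
   by (subst sum.swap) (simp add: sum_distrib_left)
  also have "\<dots> = (\<Sum>i<lam. if i = 0 then poly (b i) (tt v) * of_nat lam else 0)"
   by (intro sum.cong refl) (simp add: sum_mu_power)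
  also have "\<dots> = of_nat lam * poly (b 0) (tt v)" by (simp add: sum.delta mult.commute)
  finally show ?thesis using lam_nz by simp
 qed
 then show ?thesis by blast
qed

section \<open>Norms, invariant functions and existence of orders\<close>

definition Nm :: "('k pt \<Rightarrow> 'k) \<Rightarrow> 'k pt \<Rightarrow> 'k" where "Nm F v = (\<Prod>z\<in>mu. F (sig z v))"

lemma form_Nm: "form n F \<Longrightarrow> form (n * lam) (Nm F)"
 using form_prod[OF finite_mu, of n "\<lambda>z v. F (sig z v)"] form_sig by (simp add: Nm_def[abs_def] card_mu)

lemma Nm_sig: assumes "z \<in> mu" shows "Nm F (sig z v) = Nm F v"
 using prod.reindex_bij_betw[OF bij_mu[OF assms], of "\<lambda>z. F (sig z v)"] by (simp add: Nm_def)

lemma Nm_gen_nz: assumes "GEN w. g w \<noteq> 0" shows "GEN w. Nm g w \<noteq> 0"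
proof -
 have "GEN w. \<forall>z\<in>mu. g (sig z w) \<noteq> 0" using gen_sig[OF _ assms] by (intro eventually_ball_finite) auto
 then show ?thesis by eventually_elim (simp add: Nm_def)
qed

lemma inv_form_rep:
 assumes "form n F" "\<And>v z. v \<in> Xo \<Longrightarrow> z \<in> mu \<Longrightarrow> F (sig z v) = F v"
 shows "\<exists>b m. \<forall>v\<in>Xo. F v / cz v ^ n * (1 + tt v) ^ m = poly b (tt v)"
 by (rule invariant_rep[OF rep0_form[OF assms(1)]]) (simp add: assms(2))

text \<open>The invariant field is k(t): multiplying numerator and denominator by the other
  translates of the denominator G turns G into its norm. Then the numerator is invariant as well,
  and both are polynomials in t up to powers of z and 1 + t.\<close>

lemma rat_invariant:
 assumes g: "rat g" and inv: "\<And>z. z \<in> mu \<Longrightarrow> GEN w. g (sig z w) = g w"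
 obtains B C where "C \<noteq> 0" "GEN w. g w = poly B (tt w) / poly C (tt w)"
proof -
 obtain n F G where 1: "form n F" "form n G" "GEN w. G w \<noteq> 0" "GEN w. g w = F w / G w"
  using ratE[OF g] by blast
 define G' where "G' v = (\<Prod>z\<in>mu - {1}. G (sig z v))" for v
 have NG: "Nm G v = G v * G' v" for v
  unfolding Nm_def G'_def using prod.remove[OF finite_mu one_mu, of "\<lambda>z. G (sig z v)"] by simp
 have "card (mu - {1}) = lam - 1" by (simp add: card_mu)
 then have G': "form (n * (lam - 1)) G'"
  using form_prod[of "mu - {1}" n "\<lambda>z v. G (sig z v)"] form_sig[OF 1(2)] by (simp add: G'_def[abs_def])
 define H where "H v = F v * G' v" for v
 have "n + n * (lam - 1) = n * lam" using lam_pos by (cases lam) auto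
 then have H: "form (n * lam) H" using form_mult[OF 1(1) G'] by (simp add: H_def[abs_def])
 have gN: "GEN w. H w = g w * Nm G w" using 1(3,4) by eventually_elim (simp add: H_def NG)
 have Hinv: "H (sig z v) = H v" if "v \<in> Xo" "z \<in> mu" for v z
 proof -
  have "GEN w. H (sig z w) - H w = 0"
   using gN gen_sig[OF that(2) gN] inv[OF that(2)] by eventually_elim (simp add: Nm_sig[OF that(2)])
  then have "H (sig z v) - H v = 0"
   using gen_form_zero[OF form_diff[OF form_sig[OF H, of z] H]] Xo_X[OF that(1)] by blast
  then show ?thesis by simp
 qed
 obtain b m where b: "\<And>v. v \<in> Xo \<Longrightarrow> H v / cz v ^ (n * lam) * (1 + tt v) ^ m = poly b (tt v)"
  using inv_form_rep[OF H Hinv] by blast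
 obtain b' m' where b': "\<And>v. v \<in> Xo \<Longrightarrow> Nm G v / cz v ^ (n * lam) * (1 + tt v) ^ m' = poly b' (tt v)"
  using inv_form_rep[OF form_Nm[OF 1(2)]] Nm_sig by blast
 define B where "B = b * [:1,1:] ^ m'"
 define C where "C = b' * [:1,1:] ^ m"
 have key: "GEN w. poly C (tt w) \<noteq> 0 \<and> g w = poly B (tt w) / poly C (tt w)"
  using gen_Xo gN Nm_gen_nz[OF 1(3)]
 proof eventually_elim
  case (elim w)
  have z: "cz w \<noteq> 0" using elim(1) by (simp add: Xo_def)
  have t: "1 + tt w \<noteq> 0" using Xo_nz[OF elim(1)] by simp
  have "poly b' (tt w) \<noteq> 0" using b'[OF elim(1), symmetric] elim(3) z t by simp
  moreover have "poly B (tt w) = g w * poly C (tt w)"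
   unfolding B_def C_def using b[OF elim(1), symmetric] b'[OF elim(1), symmetric] elim(2) by simp
  ultimately show ?case using t by (simp add: C_def)
 qed
 have "C \<noteq> 0" using gen_ex[OF key] by auto
 moreover have "GEN w. g w = poly B (tt w) / poly C (tt w)" using key by eventually_elim simp
 ultimately show ?thesis using that by blast
qed

lemma hasord_zl:
 assumes v: "v \<in> X" and l: "form (Suc 0) l" "l v \<noteq> 0" shows "\<exists>k. hasord v (\<lambda>w. cz w / l w) k"
proof (cases "cz v = 0")
 case False
 then show ?thesis using hasord_locv[OF locv_frac[OF form_snd2 l]] l by auto
next
 case True
 then have nXo: "v \<notin> Xo" by (simp add: Xo_def)
 from v nXo show ?thesis
 proof (cases rule: vertex_cases)
  case 1
  have "hasord v (\<lambda>w. fst w / l w) 0" using hasord_locv[OF locv_frac[OF form_fst l]] l 1 by auto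
  from hasord_mult[OF v hasord_vx(4)[OF v nXo 1(1)] this]
  have "hasord v (\<lambda>w. cz w / l w) (1 + 0)" by (rule hasord_cong) (use gen_eq in \<open>eventually_elim, simp\<close>)
  then show ?thesis by blast
 next
  case 2
  have "hasord v (\<lambda>w. cy w / l w) 0" using hasord_locv[OF locv_frac[OF form_snd1 l]] l 2 by auto
  from hasord_mult[OF v hasord_vy(4)[OF v nXo 2(2)] this]
  have "hasord v (\<lambda>w. cz w / l w) (int ee + 0)"
   by (rule hasord_cong) (use gen_eq in \<open>eventually_elim, simp\<close>)
  then show ?thesis by blast
 qed (use True in simp)
qed

text \<open>F divides its norm, whose order at v is known because it is a polynomial in t up to
  known factors. This bounds the powers of \<tau> dividing F; for the largest one the cofactor is a
  unit, since otherwise \<tau> could be extracted once more.\<close>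

lemma form_hasord_ex:
 assumes v: "v \<in> X" and F: "form n F" "GEN w. F w \<noteq> 0" and l: "form (Suc 0) l" "l v \<noteq> 0"
 shows "\<exists>k. hasord v (\<lambda>w. F w / l w ^ n) k"
proof -
 have lg: "GEN w. l w \<noteq> 0" using gen_form[OF l(1) v l(2)] .
 obtain b m where b: "\<And>v. v \<in> Xo \<Longrightarrow> Nm F v / cz v ^ (n * lam) * (1 + tt v) ^ m = poly b (tt v)"
  using inv_form_rep[OF form_Nm[OF F(1)]] Nm_sig by blast
 have Nnz: "GEN w. Nm F w \<noteq> 0" using Nm_gen_nz[OF F(2)] .
 have b0: "b \<noteq> 0"
 proof
  assume "b = 0"
  have "GEN w. False" using gen_Xo Nnz by eventually_elim (use b \<open>b = 0\<close> Xo_nz in \<open>fastforce simp: Xo_def\<close>)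
  then show False by simp
 qed
 obtain k0 where k0: "hasord v (\<lambda>w. cz w / l w) k0" using hasord_zl[OF v l] by blast
 have "[:1,1:] ^ m \<noteq> (0::'k poly)" by simp
 from hasord_mult[OF v hasord_divide[OF v hasord_poly[OF v b0] hasord_poly[OF v this]] hasord_power[OF v k0, of "n * lam"]]
 obtain e where e0: "hasord v (\<lambda>w. poly b (tt w) / poly ([:1,1:] ^ m) (tt w) * (cz w / l w) ^ (n * lam)) e" by blast
 have e: "hasord v (\<lambda>w. Nm F w / l w ^ (n * lam)) e"
 proof (rule hasord_cong[OF e0])
  show "GEN w. Nm F w / l w ^ (n * lam) = poly b (tt w) / poly ([:1,1:] ^ m) (tt w) * (cz w / l w) ^ (n * lam)"
   using gen_Xo
  proof eventually_elim
   case (elim w)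
   then have "cz w \<noteq> 0" "1 + tt w \<noteq> 0" using Xo_nz by (auto simp: Xo_def)
   then show ?case unfolding b[OF elim, symmetric] by (simp add: power_divide)
  qed
 qed
 define F' where "F' v = (\<Prod>z\<in>mu - {1}. F (sig z v))" for v
 have NF: "Nm F v = F v * F' v" for v
  unfolding Nm_def F'_def using prod.remove[OF finite_mu one_mu, of "\<lambda>z. F (sig z v)"] by simp
 have "card (mu - {1}) = lam - 1" by (simp add: card_mu)
 then have F': "form (n * (lam - 1)) F'"
  using form_prod[of "mu - {1}" n "\<lambda>z v. F (sig z v)"] form_sig[OF F(1)] by (simp add: F'_def[abs_def])
 have nl: "n + n * (lam - 1) = n * lam" using lam_pos by (cases lam) auto
 have LF': "locv v (\<lambda>w. F' w / l w ^ (n * (lam - 1))) (F' v / l v ^ (n * (lam - 1)))"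
  using locv_frac[OF F', of "\<lambda>w. l w ^ (n * (lam - 1))" v] form_power[OF l(1), of "n * (lam - 1)"] l(2) by simp
 define K where "K = {k. \<exists>h c. locv v h c \<and> (GEN w. F w / l w ^ n = tau v w ^ k * h w)}"
 have "locv v (\<lambda>w. F w / l w ^ n) (F v / l v ^ n)"
  using locv_frac[OF F(1), of "\<lambda>w. l w ^ n" v] form_power[OF l(1), of n] l(2) by simp
 then have K0: "0 \<in> K" unfolding K_def by auto
 have bnd: "int k \<le> e" if kK: "k \<in> K" for k
 proof -
  obtain h c where h: "locv v h c" "GEN w. F w / l w ^ n = tau v w ^ k * h w" using kK unfolding K_def by blast
  have "GEN w. Nm F w / l w ^ (n * lam) = tau v w powi (int k) * (h w * (F' w / l w ^ (n * (lam - 1))))"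
   using h(2)
  proof eventually_elim
   case (elim w)
   have "Nm F w / l w ^ (n * lam) = (F w / l w ^ n) * (F' w / l w ^ (n * (lam - 1)))"
    unfolding nl[symmetric] power_add NF by simp
   then show ?case unfolding elim by simp
  qed
  from hasord_locv_ge(1)[OF v e locv_mult[OF h(1) LF'] this] show ?thesis .
 qed
 have fin: "finite K" by (rule finite_subset[of _ "{..nat e}"]) (use bnd in fastforce, simp)
 define k where "k = Max K"
 have "k \<in> K" unfolding k_def using fin K0 by (intro Max_in) auto
 then obtain h c where h: "locv v h c" "GEN w. F w / l w ^ n = tau v w ^ k * h w" unfolding K_def by blast
 have "c \<noteq> 0"
 proof
  assume "c = 0"
  then obtain h' c' where h': "locv v h' c'" "GEN w. h w = tau v w * h' w"
   using locv_zero_tau[OF v] h(1) by blast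
  have "GEN w. F w / l w ^ n = tau v w ^ Suc k * h' w" using h(2) h'(2) by eventually_elim simp
  then have "Suc k \<in> K" unfolding K_def using h'(1) by blast
  then have "Suc k \<le> k" unfolding k_def using fin Max_ge by blast
  then show False by simp
 qed
 then have "hasord v (\<lambda>w. F w / l w ^ n) (int k)" using h by (intro hasordI[OF h(1)]) simp_all
 then show ?thesis by blast
qed

lemma hasord_ex:
 assumes v: "v \<in> X" and g: "rat g" "GEN w. g w \<noteq> 0" shows "\<exists>k. hasord v g k"
proof -
 obtain n F G where 1: "form n F" "form n G" "GEN w. G w \<noteq> 0" "GEN w. g w = F w / G w"
  using ratE[OF g(1)] by blast
 obtain l where l: "form (Suc 0) l" "l v \<noteq> 0" using tcong_coords[OF v] by blast
 have Fnz: "GEN w. F w \<noteq> 0" using 1(4) g(2) by eventually_elim auto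
 obtain k k' where "hasord v (\<lambda>w. F w / l w ^ n) k" "hasord v (\<lambda>w. G w / l w ^ n) k'"
  using form_hasord_ex[OF v 1(1) Fnz l] form_hasord_ex[OF v 1(2,3) l] by blast
 from hasord_divide[OF v this]
 have "hasord v g (k - k')"
  by (rule hasord_cong) (use 1(4) gen_form[OF l(1) v l(2)] in \<open>eventually_elim, simp\<close>)
 then show ?thesis by blast
qed

section \<open>Finiteness of zero sets and punctured neighbourhoods\<close>

lemma finite_points_param:
 assumes "finite T" "0 \<notin> T" "-1 \<notin> T" shows "finite {P \<in> points X. \<exists>v\<in>P. v \<in> Xo \<and> tt v \<in> T}"
proof -
 define S where "S = (SIGMA t:T. {y. y ^ lam * (- (1 + t)) ^ ee = t})"
 have "finite S" unfolding S_def by (intro finite_SigmaI assms(1) card_fibre_roots(2)) (use assms in auto)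
 moreover have "{P \<in> points X. \<exists>v\<in>P. v \<in> Xo \<and> tt v \<in> T}
  \<subseteq> (\<lambda>(t, y). proj_point (- (1 + t) * y ^ ee, y, 1)) ` S"
 proof
  fix P assume "P \<in> {P \<in> points X. \<exists>v\<in>P. v \<in> Xo \<and> tt v \<in> T}"
  then obtain u v where u: "P = proj_point u" "v \<in> P" "v \<in> Xo" "tt v \<in> T" by (auto simp: points_def)
  have z: "cz v \<noteq> 0" using u(3) by (simp add: Xo_def)
  have "P = proj_point v" using proj_point_eq u by blast
  also have "\<dots> = proj_point (pscale (cz v) (- (1 + tt v) * yy v ^ ee, yy v, 1))" using Xo_norm[OF u(3)] by simp
  also have "\<dots> = proj_point (- (1 + tt v) * yy v ^ ee, yy v, 1)" using proj_point_pscale[OF z] .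
  finally have "P = (\<lambda>(t, y). proj_point (- (1 + t) * y ^ ee, y, 1)) (tt v, yy v)" by simp
  moreover have "(tt v, yy v) \<in> S" unfolding S_def using u(4) Xo_yy[OF u(3)] by simp
  ultimately show "P \<in> (\<lambda>(t, y). proj_point (- (1 + t) * y ^ ee, y, 1)) ` S" by (rule image_eqI)
 qed
 ultimately show ?thesis by (meson finite_imageI finite_subset)
qed

definition Px :: "'k pt set" where "Px = proj_point (1, 0, 0)"
definition Py :: "'k pt set" where "Py = proj_point (0, 1, 0)"
definition Pz :: "'k pt set" where "Pz = proj_point (0, 0, 1)"

lemma vertex_points:
 assumes "v \<in> X" "v \<notin> Xo" shows "proj_point v \<in> {Px, Py, Pz}"
proof -
 have "(c, 0, 0) = pscale c (1, 0, 0)" "(0, c, 0) = pscale c (0, 1, 0)" "(0, 0, c) = pscale c (0, 0, 1)" for c :: 'k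
  by (simp_all add: pscale_def)
 then show ?thesis using X_vertex[OF assms] proj_point_pscale unfolding Px_def Py_def Pz_def by (metis insertCI)
qed

text \<open>A zero of F is a zero of its norm, hence a vertex or a point over one of finitely many
  values of t, and fibres are finite.\<close>

lemma finite_zeros:
 assumes F: "form n F" "GEN w. F w \<noteq> 0" shows "finite {P \<in> points X. \<exists>v\<in>P. F v = 0}"
proof -
 obtain b m where b: "\<And>v. v \<in> Xo \<Longrightarrow> Nm F v / cz v ^ (n * lam) * (1 + tt v) ^ m = poly b (tt v)"
  using inv_form_rep[OF form_Nm[OF F(1)]] Nm_sig by blast
 have Nnz: "GEN w. Nm F w \<noteq> 0" using Nm_gen_nz[OF F(2)] .
 have b0: "b \<noteq> 0"
 proof
  assume "b = 0"
  have "GEN w. False" using gen_Xo Nnz by eventually_elim (use b \<open>b = 0\<close> Xo_nz in \<open>fastforce simp: Xo_def\<close>)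
  then show False by simp
 qed
 define T where "T = {t. poly b t = 0} - {0, -1}"
 have "finite T" unfolding T_def using poly_roots_finite[OF b0] by simp
 then have "finite ({P \<in> points X. \<exists>v\<in>P. v \<in> Xo \<and> tt v \<in> T} \<union> {Px, Py, Pz})"
  using finite_points_param[of T] by (simp add: T_def)
 moreover have "{P \<in> points X. \<exists>v\<in>P. F v = 0} \<subseteq> {P \<in> points X. \<exists>v\<in>P. v \<in> Xo \<and> tt v \<in> T} \<union> {Px, Py, Pz}"
 proof
  fix P assume "P \<in> {P \<in> points X. \<exists>v\<in>P. F v = 0}"
  then obtain u v where u: "P \<in> points X" "u \<in> X" "P = proj_point u" "v \<in> P" "F v = 0" by (auto simp: points_def)
  have vX: "v \<in> X" using u(2-4) X_pscale unfolding proj_point_alt by blast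
  have Pv: "P = proj_point v" using proj_point_eq u by blast
  show "P \<in> {P \<in> points X. \<exists>v\<in>P. v \<in> Xo \<and> tt v \<in> T} \<union> {Px, Py, Pz}"
  proof (cases "v \<in> Xo")
   case True
   have "Nm F v = 0" unfolding Nm_def using u(5) by (intro prod_zero bexI[of _ 1]) auto
   then have "poly b (tt v) = 0" using b[OF True] by simp
   then have "tt v \<in> T" using Xo_nz[OF True] by (simp add: T_def)
   then show ?thesis using u True by blast
  next
   case False
   then show ?thesis using vertex_points[OF vX False] Pv by blast
  qed
 qed
 ultimately show ?thesis using finite_subset by blast
qed

lemma proj_point_X: "v \<in> X \<Longrightarrow> w \<in> proj_point v \<Longrightarrow> w \<in> X" using X_pscale unfolding proj_point_alt by blast

lemma proj_point_zopen: "zopen X U \<Longrightarrow> v \<in> U \<Longrightarrow> proj_point v \<subseteq> U"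
 using zopen_cone zopen_sub proj_point_X by blast

lemma pointsE: assumes "P \<in> points X" obtains v where "v \<in> X" "P = proj_point v"
 using assms by (auto simp: points_def)

lemma pointsI: "v \<in> X \<Longrightarrow> proj_point v \<in> points X" by (simp add: points_def)

text \<open>The 2 x 2 minors of w against u are linear forms in w that all vanish at the point u,
  while some minor is nonzero at any other point.\<close>

lemma zopen_minus_point: assumes "u \<in> X" shows "zopen X (X - proj_point u)"
proof (rule zopenI)
 fix w assume w: "w \<in> X - proj_point u"
 obtain a b c where u: "u = (a, b, c)" by (metis prod.collapse)
 obtain x y z where v: "w = (x, y, z)" by (metis prod.collapse)
 have un: "a \<noteq> 0 \<or> b \<noteq> 0 \<or> c \<noteq> 0" using assms by (auto simp: u X_iff)
 have wn: "x \<noteq> 0 \<or> y \<noteq> 0 \<or> z \<noteq> 0" using w by (auto simp: v X_iff)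
 have "b * x - a * y \<noteq> 0 \<or> c * x - a * z \<noteq> 0 \<or> c * y - b * z \<noteq> 0"
 proof (rule ccontr)
  assume "\<not> ?thesis"
  then have e: "b * x = a * y" "c * x = a * z" "c * y = b * z" by auto
  have "\<exists>k. w = pscale k u"
  proof -
   consider "a \<noteq> 0" | "b \<noteq> 0" | "c \<noteq> 0" using un by blast
   then show ?thesis
   proof cases
    case 1 then show ?thesis using e by (intro exI[of _ "x / a"]) (simp add: v u pscale_def field_simps)
   next
    case 2 then show ?thesis using e by (intro exI[of _ "y / b"]) (simp add: v u pscale_def field_simps)
   next
    case 3 then show ?thesis using e by (intro exI[of _ "z / c"]) (simp add: v u pscale_def field_simps)
   qed
  qed
  then obtain k where k: "w = pscale k u" by blast
  moreover have "k \<noteq> 0" using wn k by (auto simp: v pscale_def)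
  ultimately show False using w unfolding proj_point_alt by blast
 qed
 moreover have fm: "form (Suc 0) (\<lambda>w. b * fst w - a * cy w)" "form (Suc 0) (\<lambda>w. c * fst w - a * cz w)"
  "form (Suc 0) (\<lambda>w. c * cy w - b * cz w)" by (intro form_diff form_cmult form_fst form_snd1 form_snd2)+
 have sub: "{w \<in> X. b * fst w - a * cy w \<noteq> 0} \<subseteq> X - proj_point u"
  "{w \<in> X. c * fst w - a * cz w \<noteq> 0} \<subseteq> X - proj_point u"
  "{w \<in> X. c * cy w - b * cz w \<noteq> 0} \<subseteq> X - proj_point u"
  by (auto simp: u proj_point_alt pscale_def algebra_simps)
 ultimately consider "b * fst w - a * cy w \<noteq> 0" | "c * fst w - a * cz w \<noteq> 0"
  | "c * cy w - b * cz w \<noteq> 0" by (auto simp: v)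
 then show "\<exists>n F. form n F \<and> F w \<noteq> 0 \<and> {w \<in> X. F w \<noteq> 0} \<subseteq> X - proj_point u"
 proof cases
  case 1 then show ?thesis using fm(1) sub(1) by blast
 next
  case 2 then show ?thesis using fm(2) sub(2) by blast
 next
  case 3 then show ?thesis using fm(3) sub(3) by blast
 qed
qed auto

lemma zopen_minus_points: "finite S \<Longrightarrow> S \<subseteq> points X \<Longrightarrow> zopen X (X - \<Union>S)"
proof (induction S rule: finite_induct)
 case (insert P S)
 obtain u where "u \<in> X" "P = proj_point u" using pointsE insert.prems by blast
 then have "zopen X ((X - P) \<inter> (X - \<Union>S))" using zopen_minus_point insert by blast
 moreover have "(X - P) \<inter> (X - \<Union>S) = X - \<Union>(insert P S)" by blast
 ultimately show ?case by simp
qed simp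

text \<open>A generic property fails at finitely many points; removing those other than v leaves a
  neighbourhood where only v is exceptional. This converts generic identities into the punctured
  neighbourhoods of \<open>ord_at\<close>.\<close>

lemma gen_nbhd:
 assumes "eventually P gen" "v \<in> X"
 obtains W where "zopen X W" "v \<in> W" "\<And>w. w \<in> W - proj_point v \<Longrightarrow> P w"
proof -
 obtain n F u where F: "form n F" "u \<in> X" "F u \<noteq> 0" "\<forall>v\<in>X. F v \<noteq> 0 \<longrightarrow> P v"
  using assms(1) unfolding eventually_gen by blast
 define Z where "Z = {P \<in> points X. \<exists>v\<in>P. F v = 0} - {proj_point v}"
 have fin: "finite Z" using finite_zeros[OF F(1) gen_form[OF F(1-3)]] by (simp add: Z_def)
 have op: "zopen X (X - \<Union>Z)" by (rule zopen_minus_points[OF fin]) (auto simp: Z_def)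
 have vW: "v \<in> X - \<Union>Z"
 proof -
  have "v \<notin> Q" if Q: "Q \<in> Z" for Q
  proof
   assume vQ: "v \<in> Q"
   obtain u' where "Q = proj_point u'" using Q by (auto simp: Z_def points_def)
   then have "Q = proj_point v" using proj_point_eq vQ by blast
   then show False using Q by (simp add: Z_def)
  qed
  then show ?thesis using assms(2) by blast
 qed
 have "P w" if w: "w \<in> (X - \<Union>Z) - proj_point v" for w
 proof -
  have "F w \<noteq> 0"
  proof
   assume "F w = 0"
   then have "proj_point w \<in> {P \<in> points X. \<exists>v\<in>P. F v = 0}" using w pointsI proj_point_self by blast
   moreover have "proj_point w \<noteq> proj_point v" using w proj_point_self by blast
   ultimately have "proj_point w \<in> Z" by (simp add: Z_def)
   then show False using w proj_point_self by blast
  qed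
  then show ?thesis using F(4) w by blast
 qed
 then show ?thesis by (rule that[OF op vW])
qed

lemma regular_proj: assumes "f \<in> regular X U" "v \<in> U" "w \<in> proj_point v" "zopen X U" shows "f w = f v"
proof -
 obtain W a b F G where 1: "zopen X W" "v \<in> W" "W \<subseteq> U" "form a F" "form b G" "int a - int b = 0"
  "\<And>w. w \<in> W \<Longrightarrow> G w \<noteq> 0 \<and> f w = F w / G w" using tf_local[OF assms(1,2)] by metis
 obtain c where c: "c \<noteq> 0" "w = pscale c v" using proj_pointE[OF assms(3)] by blast
 have "w \<in> W" using proj_point_zopen[OF 1(1,2)] assms(3) by blast
 then show ?thesis using 1(7)[of w] 1(7)[OF 1(2)] 1(6) c form_pscale[OF 1(4), of c v] form_pscale[OF 1(5), of c v] by simp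
qed

lemma regular_gen_eq:
 assumes "f \<in> regular X U" "g \<in> regular X W" "GEN w. f w = g w" "v \<in> U" "v \<in> W" "v \<in> X" shows "f v = g v"
 using locv_unique[OF assms(6) locv_regular[OF assms(1,4)] locv_cong[OF locv_regular[OF assms(2,5)] assms(3)]] .

lemma locv_extend:
 assumes v: "v \<in> X" and g: "locv v g c"
 obtains W f where "zopen X W" "v \<in> W" "f \<in> regular X W" "f v = c" "GEN w. f w = g w" "c \<noteq> 0 \<Longrightarrow> \<forall>w\<in>W. f w \<noteq> 0"
proof -
 obtain n F G where 1: "form n F" "form n G" "G v \<noteq> 0" "c = F v / G v" "GEN w. g w = F w / G w"
  using locvE[OF g] by blast
 define W where "W = {w \<in> X. G w \<noteq> 0} \<inter> (if c = 0 then X else {w \<in> X. F w \<noteq> 0})"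
 have W: "zopen X W" unfolding W_def using zopen_D[OF 1(1), of X] zopen_D[OF 1(2), of X] by (auto simp del: Int_Collect)
 define f where "f w = (if w \<in> W then F w / G w else 0)" for w
 have vW: "v \<in> W" using v 1 by (auto simp: W_def)
 have "f \<in> regular X W" by (rule tf_frac[OF W 1(1,2)]) (auto simp: f_def W_def)
 moreover have "GEN w. f w = g w" using 1(5) gen_zopen[OF W vW] by eventually_elim (simp add: f_def)
 moreover have "f v = c" using vW 1(4) by (simp add: f_def)
 moreover have "c \<noteq> 0 \<Longrightarrow> \<forall>w\<in>W. f w \<noteq> 0" by (auto simp: f_def W_def)
 ultimately show ?thesis using that[OF W vW] by blast
qed

lemma restrict_gen:
 assumes "f \<in> regular X U" "zopen X W" "W \<subseteq> U" "v \<in> W"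
 shows "(\<lambda>w. if w \<in> W then f w else 0) \<in> regular X W" "GEN w. (if w \<in> W then f w else 0) = f w"
 using tf_restrict[OF assms(1-3)] gen_zopen[OF assms(2,4)] by (auto elim: eventually_mono)

lemma uniformizer_tau:
 assumes v: "v \<in> X" and W: "zopen X W" "v \<in> W" and t: "t \<in> regular X W" "GEN w. t w = tau v w"
 shows "uniformizer X (proj_point v) W t" unfolding uniformizer_def
proof (intro conjI allI impI ballI)
 show "zopen X W" "proj_point v \<subseteq> W" "t \<in> regular X W" using W t proj_point_zopen by auto
 have "t v = 0" using locv_unique[OF v locv_regular[OF t(1) W(2)] locv_cong[OF locv_tau[OF v] t(2)]] .
 then show "t w = 0" if "w \<in> proj_point v" for w using regular_proj[OF t(1) W(2) that W(1)] by simp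
 fix W' f
 assume A: "zopen X W' \<and> proj_point v \<subseteq> W' \<and> W' \<subseteq> W \<and> f \<in> regular X W' \<and> (\<forall>v\<in>proj_point v. f v = 0)"
 then have vW': "v \<in> W'" using proj_point_self by blast
 have "locv v f 0" using locv_regular[of f W' v] A vW' proj_point_self[of v] by auto
 then obtain h e where h: "locv v h e" "GEN w. f w = tau v w * h w" using locv_zero_tau[OF v] by blast
 obtain U g where U: "zopen X U" "v \<in> U" "g \<in> regular X U" "GEN w. g w = h w"
  using locv_extend[OF v h(1)] by blast
 define W'' where "W'' = W' \<inter> U"
 have W'': "zopen X W''" "v \<in> W''" using A U vW' by (auto simp: W''_def)
 define g' where "g' = (\<lambda>w. if w \<in> W'' then g w else 0)"
 have g': "g' \<in> regular X W''" "GEN w. g' w = g w"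
  unfolding g'_def by (rule restrict_gen[OF U(3) W''(1) _ W''(2)]; simp add: W''_def)+
 define t' where "t' = (\<lambda>w. if w \<in> W'' then t w else 0)"
 have t': "t' \<in> regular X W''" "GEN w. t' w = t w"
  unfolding t'_def by (rule restrict_gen[OF t(1) W''(1) _ W''(2)]; use A in \<open>auto simp: W''_def\<close>)+
 have ge: "GEN w. f w = g' w * t' w" using h(2) U(4) g'(2) t'(2) t(2) by eventually_elim simp
 have "f w = g' w * t w" if w: "w \<in> W''" for w
 proof -
  have "f w = g' w * t' w" by (rule regular_gen_eq[OF _ regular_mult[OF g'(1) t'(1)] ge, where U = W'])
    (use A w W''_def zopen_sub[OF W''(1)] in auto)
  then show ?thesis using w by (simp add: t'_def)
 qed
 then show "\<exists>W'' g. zopen X W'' \<and> proj_point v \<subseteq> W'' \<and> W'' \<subseteq> W' \<and> g \<in> regular X W'' \<and> (\<forall>w\<in>W''. f w = g w * t w)"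
  using W'' g'(1) proj_point_zopen[OF W''] by (intro exI[of _ W''] exI[of _ g']) (auto simp: W''_def)
qed

lemma hasord_powi: assumes "v \<in> X" "hasord v g k" shows "hasord v (\<lambda>w. g w powi n) (n * k)"
proof (cases "n \<ge> 0")
 case True
 then show ?thesis using hasord_power[OF assms, of "nat n"] by (simp add: power_int_def)
next
 case False
 then show ?thesis using hasord_power[OF assms(1) hasord_inverse[OF assms], of "nat (-n)"] by (simp add: power_int_def)
qed

lemma gen_not_point: assumes "v \<in> X" shows "GEN w. w \<notin> proj_point v"
proof -
 have "\<exists>w\<in>X. w \<notin> proj_point v"
 proof (rule ccontr)
  assume no: "\<not> (\<exists>w\<in>X. w \<notin> proj_point v)"
  obtain u where u: "u \<in> Xo" using Xo_nonempty by blast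
  obtain w where w: "w \<in> X" "w \<in> Xo" "tau u w \<noteq> 0"
   using gen_ex[OF eventually_conj[OF gen_Xo gen_tau[OF Xo_X[OF u]]]] by blast
  have "w \<in> proj_point v" "u \<in> proj_point v" using no w Xo_X u by blast+
  then have "w \<in> proj_point u" using proj_point_eq[of u v] by simp
  then obtain c where "c \<noteq> 0" "w = pscale c u" by (rule proj_pointE)
  then have "tt w = tt u" by (simp add: tt_def pscale_def power_mult_distrib)
  then show False using w(3) u by (simp add: tau_def)
 qed
 then obtain w where "w \<in> X - proj_point v" by blast
 from gen_zopen[OF zopen_minus_point[OF assms] this] show ?thesis by (auto elim: eventually_mono)
qed

section \<open>Divisors and the product formula\<close>

lemma locv_extend_unit:
 assumes v: "v \<in> X" and g: "locv v g c" and c: "c \<noteq> 0"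
 obtains W f where "zopen X W" "v \<in> W" "f \<in> regular X W" "GEN w. f w = g w" "\<forall>w\<in>W. f w \<noteq> 0"
proof (rule locv_extend[OF v g])
 fix W f
 assume "zopen X W" "v \<in> W" "f \<in> regular X W" "f v = c" "GEN w. f w = g w" and nz: "c \<noteq> 0 \<Longrightarrow> \<forall>w\<in>W. f w \<noteq> 0"
 then show thesis using that nz[OF c] by simp
qed

text \<open>The link to the definition through arbitrary uniformizers. For uniqueness,
  \<open>tau v\<close> is a multiple g' t of the given uniformizer t; the orders of g' and t add up
  to 1 and that of t is positive, so t has order 1.\<close>

lemma ord_at_eq:
 assumes v: "v \<in> X" and g: "hasord v g k" shows "ord_at X (proj_point v) g = k" unfolding ord_at_def
proof (rule the_equality)
 obtain h c where h: "locv v h c" "c \<noteq> 0" "GEN w. g w = tau v w powi k * h w" using hasordE[OF g] by blast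
 obtain U1 u where U1: "zopen X U1" "v \<in> U1" "u \<in> regular X U1" "GEN w. u w = h w" "\<forall>w\<in>U1. u w \<noteq> 0"
  using locv_extend_unit[OF v h(1,2)] by blast
 obtain U2 t where U2: "zopen X U2" "v \<in> U2" "t \<in> regular X U2" "GEN w. t w = tau v w"
  using locv_extend[OF v locv_tau[OF v]] by blast
 have "GEN w. t w \<noteq> 0 \<and> g w = u w * t w powi k" using h(3) U1(4) U2(4) gen_tau[OF v] by eventually_elim simp
 from gen_nbhd[OF this v]
 obtain U3 where U3: "zopen X U3" "v \<in> U3" "\<And>w. w \<in> U3 - proj_point v \<Longrightarrow> t w \<noteq> 0 \<and> g w = u w * t w powi k"
  by blast
 define W where "W = U1 \<inter> U2 \<inter> U3"
 have W: "zopen X W" "v \<in> W" using U1 U2 U3 by (auto simp: W_def)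
 define t' where "t' = (\<lambda>w. if w \<in> W then t w else 0)"
 define u' where "u' = (\<lambda>w. if w \<in> W then u w else 0)"
 have t': "t' \<in> regular X W" "GEN w. t' w = t w"
  unfolding t'_def by (rule restrict_gen[OF U2(3) W(1) _ W(2)]; auto simp: W_def)+
 have u': "u' \<in> regular X W"
  unfolding u'_def by (rule restrict_gen(1)[OF U1(3) W(1) _ W(2)]) (auto simp: W_def)
 have "GEN w. t' w = tau v w" using t'(2) U2(4) by eventually_elim simp
 then have "uniformizer X (proj_point v) W t'" using uniformizer_tau[OF v W t'(1)] by blast
 then show "\<exists>W t u. uniformizer X (proj_point v) W t \<and> u \<in> regular X W \<and> (\<forall>w\<in>W. u w \<noteq> 0) \<and>
   (\<forall>w\<in>W - proj_point v. t w \<noteq> 0 \<and> g w = u w * t w powi k)"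
  using u' U1(5) U3(3) by (intro exI[of _ W] exI[of _ t'] exI[of _ u']) (auto simp: t'_def u'_def W_def)
next
 fix n
 assume "\<exists>W t u. uniformizer X (proj_point v) W t \<and> u \<in> regular X W \<and> (\<forall>w\<in>W. u w \<noteq> 0) \<and>
   (\<forall>w\<in>W - proj_point v. t w \<noteq> 0 \<and> g w = u w * t w powi n)"
 then obtain W t u where A: "uniformizer X (proj_point v) W t" "u \<in> regular X W" "\<forall>w\<in>W. u w \<noteq> 0"
   "\<forall>w\<in>W - proj_point v. t w \<noteq> 0 \<and> g w = u w * t w powi n" by blast
 have B: "zopen X W" "proj_point v \<subseteq> W" "t \<in> regular X W" "\<forall>v\<in>proj_point v. t v = 0"
  "\<And>W' f. zopen X W' \<Longrightarrow> proj_point v \<subseteq> W' \<Longrightarrow> W' \<subseteq> W \<Longrightarrow> f \<in> regular X W' \<Longrightarrow> (\<forall>v\<in>proj_point v. f v = 0) \<Longrightarrow>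
    (\<exists>W'' g. zopen X W'' \<and> proj_point v \<subseteq> W'' \<and> W'' \<subseteq> W' \<and> g \<in> regular X W'' \<and> (\<forall>w\<in>W''. f w = g w * t w))"
  using A(1) unfolding uniformizer_def by blast+
 have vW: "v \<in> W" using B(2) proj_point_self by blast
 obtain U2 t2 where U2: "zopen X U2" "v \<in> U2" "t2 \<in> regular X U2" "t2 v = 0" "GEN w. t2 w = tau v w"
  using locv_extend[OF v locv_tau[OF v]] by blast
 define W' where "W' = W \<inter> U2"
 have W': "zopen X W'" "v \<in> W'" using B(1) vW U2 by (auto simp: W'_def)
 define t3 where "t3 = (\<lambda>w. if w \<in> W' then t2 w else 0)"
 have t3: "t3 \<in> regular X W'" "GEN w. t3 w = t2 w"
  unfolding t3_def by (rule restrict_gen[OF U2(3) W'(1) _ W'(2)]; auto simp: W'_def)+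
 have t3v: "t3 v = 0" using U2(4) W'(2) by (simp add: t3_def)
 have t3z: "\<forall>w\<in>proj_point v. t3 w = 0"
 proof
  fix w assume "w \<in> proj_point v"
  from regular_proj[OF t3(1) W'(2) this W'(1)] t3v show "t3 w = 0" by simp
 qed
 have subW: "W' \<subseteq> W" by (simp add: W'_def)
 from B(5)[OF W'(1) proj_point_zopen[OF W'] subW t3(1) t3z]
 obtain W'' g' where W'': "zopen X W''" "proj_point v \<subseteq> W''" "W'' \<subseteq> W'" "g' \<in> regular X W''" "\<forall>w\<in>W''. t3 w = g' w * t w"
  by blast
 have vW'': "v \<in> W''" using W''(2) proj_point_self by blast
 have gt: "GEN w. tau v w = g' w * t w"
  using gen_zopen[OF W''(1) vW''] t3(2) U2(5) by eventually_elim (use W''(5) in simp)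
 have gnz: "GEN w. g' w \<noteq> 0" using gt gen_tau[OF v] by eventually_elim auto
 have tnz: "GEN w. t w \<noteq> 0" using gt gen_tau[OF v] by eventually_elim auto
 obtain kt where kt: "hasord v t kt" using hasord_ex[OF v rat_regular[OF B(3,1) vW] tnz] by blast
 obtain kg where kg: "hasord v g' kg" using hasord_ex[OF v rat_regular[OF W''(4,1) vW''] gnz] by blast
 have "kt \<ge> 0" "kt \<noteq> 0" using hasord_value[OF v kt locv_regular[OF B(3) vW]] B(4) by auto
 moreover have "kg \<ge> 0" using hasord_value(1)[OF v kg locv_regular[OF W''(4) vW'']] .
 moreover have "kg + kt = 1"
  using hasord_unique[OF v hasord_tau hasord_cong[OF hasord_mult[OF v kg kt] gt]] by simp
 ultimately have kt1: "kt = 1" by linarith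
 have u0: "hasord v u 0" using hasord_locv[OF locv_regular[OF A(2) vW]] A(3) vW by blast
 have "GEN w. g w = u w * t w powi n"
  using gen_zopen[OF B(1) vW] gen_not_point[OF v] by eventually_elim (use A(4) in blast)
 from hasord_cong[OF hasord_mult[OF v u0 hasord_powi[OF v kt]] this]
 have "hasord v g n" using kt1 by simp
 then show "n = k" using hasord_unique[OF v g] by blast
qed

text \<open>The degree of a divisor. A sum over an infinite set is 0 by convention, so finiteness of
  the support, \<open>fsup\<close>, accompanies every use of additivity.\<close>

definition dsum :: "('k pt set \<Rightarrow> int) \<Rightarrow> int" where "dsum f = (\<Sum>P\<in>{P \<in> points X. f P \<noteq> 0}. f P)"
definition fsup :: "('k pt set \<Rightarrow> int) \<Rightarrow> bool" where "fsup f \<longleftrightarrow> finite {P \<in> points X. f P \<noteq> 0}"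

lemma dsum_eq: assumes "finite A" "A \<subseteq> points X" "\<And>P. P \<in> points X \<Longrightarrow> P \<notin> A \<Longrightarrow> f P = 0"
 shows "dsum f = (\<Sum>P\<in>A. f P)" "fsup f"
proof -
 show "dsum f = (\<Sum>P\<in>A. f P)" unfolding dsum_def by (rule sum.mono_neutral_left) (use assms in auto)
 show "fsup f" unfolding fsup_def by (rule finite_subset[OF _ assms(1)]) (use assms(3) in auto)
qed

lemma dsum_cong: "(\<And>P. P \<in> points X \<Longrightarrow> f P = g P) \<Longrightarrow> dsum f = dsum g"
 unfolding dsum_def by (intro sum.cong) auto

lemma fsup_cong: assumes "fsup f" "\<And>P. P \<in> points X \<Longrightarrow> g P = f P" shows "fsup g"
proof -
 have "{P \<in> points X. g P \<noteq> 0} = {P \<in> points X. f P \<noteq> 0}" using assms(2) by auto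
 then show ?thesis using assms(1) by (simp add: fsup_def)
qed

lemma fsup_add: assumes "fsup f" "fsup g" shows "fsup (\<lambda>P. f P + g P)"
 unfolding fsup_def by (rule finite_subset[OF _ finite_UnI[OF assms[unfolded fsup_def]]]) auto

lemma dsum_add: assumes "fsup f" "fsup g" shows "dsum (\<lambda>P. f P + g P) = dsum f + dsum g"
proof -
 define A where "A = {P \<in> points X. f P \<noteq> 0} \<union> {P \<in> points X. g P \<noteq> 0}"
 have A: "finite A" "A \<subseteq> points X" using assms by (auto simp: A_def fsup_def)
 have "dsum (\<lambda>P. f P + g P) = (\<Sum>P\<in>A. f P + g P)" "dsum f = (\<Sum>P\<in>A. f P)" "dsum g = (\<Sum>P\<in>A. g P)"
  by (rule dsum_eq(1)[OF A]; auto simp: A_def)+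
 then show ?thesis by (simp add: sum.distrib)
qed

lemma dsum_mono: assumes "fsup f" "fsup g" "\<And>P. P \<in> points X \<Longrightarrow> f P \<le> g P" shows "dsum f \<le> dsum g"
proof -
 define A where "A = {P \<in> points X. f P \<noteq> 0} \<union> {P \<in> points X. g P \<noteq> 0}"
 have A: "finite A" "A \<subseteq> points X" using assms by (auto simp: A_def fsup_def)
 have "dsum f = (\<Sum>P\<in>A. f P)" "dsum g = (\<Sum>P\<in>A. g P)" by (rule dsum_eq(1)[OF A]; auto simp: A_def)+
 then show ?thesis using assms(3) A(2) by (auto intro: sum_mono)
qed

lemma fsup_cmult: assumes "fsup f" shows "fsup (\<lambda>P. c * f P)"
 unfolding fsup_def by (rule finite_subset[OF _ assms[unfolded fsup_def]]) auto

lemma dsum_cmult: assumes "fsup f" shows "dsum (\<lambda>P. c * f P) = c * dsum f"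
proof -
 define A where "A = {P \<in> points X. f P \<noteq> 0}"
 have A: "finite A" "A \<subseteq> points X" using assms by (auto simp: A_def fsup_def)
 have "dsum f = (\<Sum>P\<in>A. f P)" "dsum (\<lambda>P. c * f P) = (\<Sum>P\<in>A. c * f P)" by (rule dsum_eq(1)[OF A]; auto simp: A_def)+
 then show ?thesis by (simp add: sum_distrib_left)
qed

definition ordd :: "('k pt \<Rightarrow> 'k) \<Rightarrow> 'k pt set \<Rightarrow> int" where "ordd g P = ord_at X P g"

lemma ordd_eq: "v \<in> X \<Longrightarrow> hasord v g k \<Longrightarrow> ordd g (proj_point v) = k" unfolding ordd_def by (rule ord_at_eq)

lemma fsup_ordd: assumes g: "rat g" "GEN w. g w \<noteq> 0" shows "fsup (ordd g)"
proof -
 obtain n F G where 1: "form n F" "form n G" "GEN w. G w \<noteq> 0" "GEN w. g w = F w / G w"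
  using ratE[OF g(1)] by blast
 have Fnz: "GEN w. F w \<noteq> 0" using 1(4) g(2) by eventually_elim auto
 have "{P \<in> points X. ordd g P \<noteq> 0} \<subseteq> {P \<in> points X. \<exists>v\<in>P. F v = 0} \<union> {P \<in> points X. \<exists>v\<in>P. G v = 0}"
 proof
  fix P assume P: "P \<in> {P \<in> points X. ordd g P \<noteq> 0}"
  then obtain v where v: "v \<in> X" "P = proj_point v" using pointsE by blast
  show "P \<in> {P \<in> points X. \<exists>v\<in>P. F v = 0} \<union> {P \<in> points X. \<exists>v\<in>P. G v = 0}"
  proof (rule ccontr)
   assume "\<not> ?thesis"
   then have nz: "F v \<noteq> 0" "G v \<noteq> 0" using P v proj_point_self by blast+
   have "locv v g (F v / G v)" by (rule locv_cong[OF locv_frac[OF 1(1,2) nz(2)] 1(4)])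
   then have "ordd g P = 0" unfolding v(2) using nz by (intro ordd_eq[OF v(1)] hasord_locv[of v g "F v / G v"]) simp_all
   then show False using P by simp
  qed
 qed
 then show ?thesis unfolding fsup_def using finite_zeros[OF 1(1) Fnz] finite_zeros[OF 1(2,3)] finite_subset by blast
qed

lemma ordd_mult:
 assumes "rat g" "GEN w. g w \<noteq> 0" "rat h" "GEN w. h w \<noteq> 0" "P \<in> points X"
 shows "ordd (\<lambda>w. g w * h w) P = ordd g P + ordd h P"
proof -
 obtain v where v: "v \<in> X" "P = proj_point v" using pointsE assms(5) by blast
 obtain k l where kl: "hasord v g k" "hasord v h l" using hasord_ex[OF v(1)] assms by blast
 show ?thesis unfolding v(2) ordd_eq[OF v(1) kl(1)] ordd_eq[OF v(1) kl(2)] ordd_eq[OF v(1) hasord_mult[OF v(1) kl]] ..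
qed

lemma ordd_cong:
 assumes "rat g" "GEN w. g w \<noteq> 0" "GEN w. h w = g w" "P \<in> points X" shows "ordd h P = ordd g P"
proof -
 obtain v where v: "v \<in> X" "P = proj_point v" using pointsE assms(4) by blast
 obtain k where k: "hasord v g k" using hasord_ex[OF v(1)] assms by blast
 show ?thesis unfolding v(2) ordd_eq[OF v(1) k] ordd_eq[OF v(1) hasord_cong[OF k assms(3)]] ..
qed

lemma dsum_ordd_mult:
 assumes "rat g" "GEN w. g w \<noteq> 0" "rat h" "GEN w. h w \<noteq> 0"
 shows "dsum (ordd (\<lambda>w. g w * h w)) = dsum (ordd g) + dsum (ordd h)"
proof -
 have "dsum (ordd (\<lambda>w. g w * h w)) = dsum (\<lambda>P. ordd g P + ordd h P)"
  by (rule dsum_cong) (rule ordd_mult[OF assms])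
 also have "\<dots> = dsum (ordd g) + dsum (ordd h)" by (rule dsum_add) (intro fsup_ordd assms)+
 finally show ?thesis .
qed

text \<open>The action carries the chosen uniformizers into each other up to constants, so orders
  are transported along it.\<close>

lemma tau_sig: assumes c: "c \<in> mu" shows "\<exists>e. e \<noteq> 0 \<and> (\<forall>w. tau (sig c v) (sig c w) = e * tau v w)"
proof -
 have nz: "c \<noteq> 0" using mu_nz[OF c] .
 have iff: "sig c v \<in> Xo \<longleftrightarrow> v \<in> Xo"
  using sig_Xo[OF c, of v] sig_Xo[OF mu_inverse[OF c], of "sig c v"] nz by auto
 consider "v \<in> Xo" | "v \<notin> Xo" "fst v \<noteq> 0" | "v \<notin> Xo" "fst v = 0" "cy v \<noteq> 0" | "v \<notin> Xo" "fst v = 0" "cy v = 0"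
  by blast
 then show ?thesis
 proof cases
  case 1
  then show ?thesis by (intro exI[of _ 1]) (simp add: tau_def iff sig_tt[OF c])
 next
  case 2
  then show ?thesis using nz by (intro exI[of _ "1 / c ^ ee"]) (simp add: tau_def iff)
 next
  case 3
  then show ?thesis using nz by (intro exI[of _ "c ^ ee / c"]) (simp add: tau_def iff)
 next
  case 4
  then show ?thesis using nz by (intro exI[of _ "c"]) (simp add: tau_def iff)
 qed
qed

lemma hasord_sig: assumes c: "c \<in> mu" and g: "hasord (sig c v) g k" shows "hasord v (\<lambda>w. g (sig c w)) k"
proof -
 obtain h a where h: "locv (sig c v) h a" "a \<noteq> 0" "GEN w. g w = tau (sig c v) w powi k * h w" using hasordE[OF g] by blast
 obtain e where e: "e \<noteq> 0" "\<And>w. tau (sig c v) (sig c w) = e * tau v w" using tau_sig[OF c] by blast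
 show ?thesis
 proof (rule hasordI[OF locv_mult[OF locv_const[of v "e powi k"] locv_sig[OF c h(1)]]])
  show "e powi k * a \<noteq> 0" using h e by simp
  show "GEN w. g (sig c w) = tau v w powi k * (e powi k * h (sig c w))"
   using gen_sig[OF c h(3)] by eventually_elim (simp add: e(2) power_int_mult_distrib)
 qed
qed

lemma sig_proj_point: "sig c ` proj_point v = proj_point (sig c v)"
proof -
 have e: "sig c (pscale a v) = pscale a (sig c v)" for a by (simp add: sig_def pscale_def)
 have "sig c ` {pscale a v | a. a \<noteq> 0} = {sig c (pscale a v) | a. a \<noteq> 0}" by blast
 then show ?thesis unfolding proj_point_alt e .
qed

lemma dsum_sig:
 assumes c: "c \<in> mu" shows "dsum (\<lambda>P. f (sig c ` P)) = dsum f" "fsup f \<Longrightarrow> fsup (\<lambda>P. f (sig c ` P))"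
proof -
 have nz: "c \<noteq> 0" using mu_nz[OF c] .
 have m: "sig e ` P \<in> points X" if "e \<in> mu" "P \<in> points X" for e P
  using pointsE[OF that(2)] sig_proj_point pointsI sig_X[OF that(1)] by metis
 have inv: "sig (inverse c) ` sig c ` P = P" "sig c ` sig (inverse c) ` P = P" for P
  using nz by (simp_all add: image_image)
 have bij: "bij_betw (\<lambda>P. sig c ` P) {P \<in> points X. f (sig c ` P) \<noteq> 0} {P \<in> points X. f P \<noteq> 0}"
  by (rule bij_betw_byWitness[where f' = "\<lambda>P. sig (inverse c) ` P"])
   (use m[OF c] m[OF mu_inverse[OF c]] inv in auto)
 show "dsum (\<lambda>P. f (sig c ` P)) = dsum f" unfolding dsum_def using sum.reindex_bij_betw[OF bij, of f] by simp
 show "fsup (\<lambda>P. f (sig c ` P))" if "fsup f" using bij_betw_finite[OF bij] that unfolding fsup_def by simp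
qed

lemma dsum_ordd_sig:
 assumes "c \<in> mu" "rat g" "GEN w. g w \<noteq> 0" shows "dsum (ordd (\<lambda>w. g (sig c w))) = dsum (ordd g)"
proof -
 have "dsum (ordd (\<lambda>w. g (sig c w))) = dsum (\<lambda>P. ordd g (sig c ` P))"
 proof (rule dsum_cong)
  fix P assume "P \<in> points X"
  then obtain v where v: "v \<in> X" "P = proj_point v" using pointsE by blast
  have sv: "sig c v \<in> X" using sig_X[OF assms(1) v(1)] .
  obtain k where k: "hasord (sig c v) g k" using hasord_ex[OF sv assms(2,3)] by blast
  show "ordd (\<lambda>w. g (sig c w)) P = ordd g (sig c ` P)"
   unfolding v(2) sig_proj_point ordd_eq[OF sv k] ordd_eq[OF v(1) hasord_sig[OF assms(1) k]] ..
 qed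
 then show ?thesis using dsum_sig(1)[OF assms(1)] by simp
qed

lemma points_vertices: "Px \<in> points X" "Py \<in> points X" "Pz \<in> points X"
 "Px \<noteq> Py" "Px \<noteq> Pz" "Py \<noteq> Pz"
proof -
 show "Px \<in> points X" "Py \<in> points X" "Pz \<in> points X"
  unfolding Px_def Py_def Pz_def by (intro pointsI; simp add: X_iff)+
 have "(1, 0, 0) \<in> Px" "(0, 1, 0) \<in> Py" unfolding Px_def Py_def by simp_all
 moreover have "(1, 0, 0) \<notin> Py" "(1, 0, 0) \<notin> Pz" "(0, 1, 0) \<notin> Pz"
  unfolding Px_def Py_def Pz_def proj_point_alt by (auto simp: pscale_def)
 ultimately show "Px \<noteq> Py" "Px \<noteq> Pz" "Py \<noteq> Pz" by blast+
qed

definition fibre :: "'k \<Rightarrow> 'k pt set set" where "fibre a = {proj_point v | v. v \<in> Xo \<and> tt v = a}"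

lemma card_fibre: assumes "a \<noteq> 0" "a \<noteq> -1" shows "card (fibre a) = lam" "finite (fibre a)"
proof -
 define Y where "Y = {y. y ^ lam * (- (1 + a)) ^ ee = a}"
 define q where "q y = proj_point (- (1 + a) * y ^ ee, y, 1)" for y
 have Y: "card Y = lam" "finite Y" using card_fibre_roots[OF assms] by (simp_all add: Y_def)
 have im: "fibre a = q ` Y"
 proof
  show "q ` Y \<subseteq> fibre a" unfolding fibre_def q_def Y_def using Xo_param[OF assms] by blast
  show "fibre a \<subseteq> q ` Y"
  proof
   fix P assume "P \<in> fibre a"
   then obtain v where v: "v \<in> Xo" "tt v = a" "P = proj_point v" by (auto simp: fibre_def)
   have z: "cz v \<noteq> 0" using v(1) by (simp add: Xo_def)
   have "P = proj_point (pscale (cz v) (- (1 + a) * yy v ^ ee, yy v, 1))" using Xo_norm[OF v(1)] v by simp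
   also have "\<dots> = q (yy v)" unfolding q_def using proj_point_pscale[OF z] .
   finally show "P \<in> q ` Y" using Xo_yy[OF v(1)] v(2) by (simp add: Y_def)
  qed
 qed
 have inj: "inj_on q Y"
 proof
  fix y y' assume "y \<in> Y" "y' \<in> Y" "q y = q y'"
  then have "(- (1 + a) * y ^ ee, y, 1) \<in> proj_point (- (1 + a) * y' ^ ee, y', 1)"
   unfolding q_def using proj_point_self by blast
  then show "y = y'" unfolding proj_point_alt by (auto simp: pscale_def)
 qed
 show "card (fibre a) = lam" "finite (fibre a)" unfolding im using Y inj by (simp_all add: card_image)
qed

lemma order_linear_factor: "pord b [:- a, 1:] = (if b = a then 1 else (0::nat))" for a b :: 'k
proof (cases "b = a")
 case True
 then show ?thesis using order_power_n_n[of a 1] by simp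
qed (simp add: order_0I)

lemma hasord_vertices:
 assumes B: "B \<noteq> 0" shows "ordd (\<lambda>w. poly B (tt w)) Px = - (int lam * int (degree B))"
  "ordd (\<lambda>w. poly B (tt w)) Py = int lam * int (pord (-1) B)"
  "ordd (\<lambda>w. poly B (tt w)) Pz = int lam * int (pord 0 B)"
proof -
 have X: "(1, 0, 0) \<in> X" "(0, 1, 0) \<in> X" "(0, 0, 1) \<in> X" by (simp_all add: X_iff)
 show "ordd (\<lambda>w. poly B (tt w)) Px = - (int lam * int (degree B))"
  unfolding Px_def using ordd_eq[OF X(1) hasord_poly[OF X(1) B]] by (simp add: ordt_def Xo_def)
 show "ordd (\<lambda>w. poly B (tt w)) Py = int lam * int (pord (-1) B)"
  unfolding Py_def using ordd_eq[OF X(2) hasord_poly[OF X(2) B]] by (simp add: ordt_def Xo_def)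
 show "ordd (\<lambda>w. poly B (tt w)) Pz = int lam * int (pord 0 B)"
  unfolding Pz_def using ordd_eq[OF X(3) hasord_poly[OF X(3) B]] by (simp add: ordt_def Xo_def)
qed

lemma ordd_poly_Xo: "B \<noteq> 0 \<Longrightarrow> v \<in> Xo \<Longrightarrow> ordd (\<lambda>w. poly B (tt w)) (proj_point v) = int (pord (tt v) B)"
 using ordd_eq[OF Xo_X hasord_poly[OF Xo_X]] by (simp add: ordt_def)

lemma Xo_not_vertex: "v \<in> Xo \<Longrightarrow> proj_point v \<notin> {Px, Py, Pz}"
proof
 assume v: "v \<in> Xo" and "proj_point v \<in> {Px, Py, Pz}"
 then have "v \<in> Px \<or> v \<in> Py \<or> v \<in> Pz" using proj_point_self by blast
 then show False using v unfolding Px_def Py_def Pz_def proj_point_alt by (auto simp: pscale_def Xo_def)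
qed

lemma points_cases: assumes "P \<in> points X" obtains "P \<in> {Px, Py, Pz}" | v where "v \<in> Xo" "P = proj_point v"
proof -
 obtain v where v: "v \<in> X" "P = proj_point v" using assms pointsE by blast
 show thesis
 proof (cases "v \<in> Xo")
  case True
  then show thesis using that(2) v by blast
 next
  case False
  then show thesis using that(1) v vertex_points[OF v(1) False] by blast
 qed
qed

text \<open>The zeros of t - a are the \<open>lam\<close> simple ones over a, or a single one of
  order \<open>lam\<close> at a vertex if a is 0 or -1; they balance the pole of order
  \<open>lam\<close> at (1:0:0).\<close>

lemma dsum_linear: "dsum (ordd (\<lambda>w. poly [:- a, 1:] (tt w))) = 0"
proof -
 let ?f = "ordd (\<lambda>w. poly [:- a, 1:] (tt w))"
 have B: "[:- a, 1:] \<noteq> 0" by simp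
 note V = hasord_vertices[OF B]
 define A where "A = fibre a \<union> {Px, Py, Pz}"
 have fin: "finite A" and sub: "A \<subseteq> points X"
 proof -
  have "finite (fibre a)"
  proof (cases "a = 0 \<or> a = -1")
   case True
   then have "fibre a = {}" using Xo_nz by (auto simp: fibre_def)
   then show ?thesis by simp
  qed (use card_fibre in auto)
  then show "finite A" by (simp add: A_def)
  show "A \<subseteq> points X" using points_vertices pointsI[OF Xo_X] by (auto simp: A_def fibre_def)
 qed
 have out: "?f P = 0" if P: "P \<in> points X" "P \<notin> A" for P using P(1)
 proof (cases rule: points_cases)
  case 1
  then show ?thesis using P(2) by (simp add: A_def)
 next
  case (2 v)
  have "tt v \<noteq> a" using 2 P(2) by (auto simp: A_def fibre_def)
  then show ?thesis unfolding 2(2) ordd_poly_Xo[OF B 2(1)] by (simp only: order_linear_factor) simp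
 qed
 have "dsum ?f = sum ?f A" using dsum_eq(1)[OF fin sub] out by blast
 also have "\<dots> = sum ?f (fibre a) + sum ?f {Px, Py, Pz}"
  unfolding A_def using fin Xo_not_vertex by (subst sum.union_disjoint) (auto simp: A_def fibre_def)
 also have "sum ?f (fibre a) = int (card (fibre a))"
 proof -
  have "?f P = 1" if Pf: "P \<in> fibre a" for P
  proof -
   obtain v where v: "v \<in> Xo" "tt v = a" "P = proj_point v" using Pf unfolding fibre_def by blast
   show ?thesis unfolding v(3) ordd_poly_Xo[OF B v(1)] by (simp only: order_linear_factor v(2)) simp
  qed
  then show ?thesis by simp
 qed
 also have "sum ?f {Px, Py, Pz} = - int lam + int lam * int (if a = -1 then 1 else 0) + int lam * int (if a = 0 then 1 else 0)"
  using points_vertices V by (auto simp: order_linear_factor)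
 also have "int (card (fibre a)) + \<dots> = 0"
 proof (cases "a = 0 \<or> a = -1")
  case True
  then have "fibre a = {}" using Xo_nz by (auto simp: fibre_def)
  then show ?thesis using True by auto
 qed (use card_fibre in auto)
 finally show ?thesis .
qed

lemma dsum_poly: assumes "B \<noteq> 0" shows "dsum (ordd (\<lambda>w. poly B (tt w))) = 0"
proof -
 have zc: "dsum (ordd (\<lambda>w. c)) = 0" if "c \<noteq> 0" for c
 proof -
  have "ordd (\<lambda>w. c) P = 0" if "P \<in> points X" for P
   using pointsE[OF that] ordd_eq[OF _ hasord_const[OF \<open>c \<noteq> 0\<close>]] by metis
  then have "dsum (ordd (\<lambda>w. c)) = dsum (\<lambda>_. 0)" by (rule dsum_cong)
  then show ?thesis by (simp add: dsum_def)
 qed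
 obtain A where A: "B = Polynomial.smult (lead_coeff B) (\<Prod>x\<in>#A. [:-x, 1:])"
  using alg_closed_imp_factorization[OF assms] by blast
 have nz: "(\<Prod>x\<in>#A. [:-x, 1::'k:]) \<noteq> 0" for A by (auto simp: prod_mset_zero_iff)
 have "dsum (ordd (\<lambda>w. poly (\<Prod>x\<in>#A. [:-x, 1:]) (tt w))) = 0"
 proof (induction A)
  case empty
  show ?case using zc[of 1] by simp
 next
  case (add x A)
  have x: "[:-x, 1:] \<noteq> 0" by simp
  have "dsum (ordd (\<lambda>w. poly (\<Prod>x\<in>#add_mset x A. [:-x, 1:]) (tt w)))
   = dsum (ordd (\<lambda>w. poly [:-x, 1:] (tt w) * poly (\<Prod>x\<in>#A. [:-x, 1:]) (tt w)))"
   by (simp only: image_mset_add_mset prod_mset.add_mset poly_mult)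
  also have "\<dots> = 0" using dsum_ordd_mult[OF rat_poly poly_tt_nz[OF x] rat_poly poly_tt_nz[OF nz]] dsum_linear add by simp
  finally show ?case .
 qed
 moreover have "poly B (tt w) = lead_coeff B * poly (\<Prod>x\<in>#A. [:-x, 1:]) (tt w)" for w by (subst A) simp
 ultimately show ?thesis using dsum_ordd_mult[OF rat_const _ rat_poly poly_tt_nz[OF nz], of "lead_coeff B"] zc[of "lead_coeff B"] assms
  by simp
qed

text \<open>The norm of g is a rational function of t, and its divisor has degree 0 by factorisation
  into linear polynomials. Translates of g have divisors of equal degree, so that of the norm is
  \<open>lam\<close> times that of g.\<close>

theorem product_formula:
 assumes g: "rat g" "GEN w. g w \<noteq> 0" shows "dsum (ordd g) = 0"
proof -
 have S: "dsum (ordd (\<lambda>w. \<Prod>z\<in>A. g (sig z w))) = int (card A) * dsum (ordd g) \<and> (GEN w. (\<Prod>z\<in>A. g (sig z w)) \<noteq> 0)"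
  if "A \<subseteq> mu" "finite A" for A using that(2,1)
 proof (induction A rule: finite_induct)
  case empty
  have "dsum (ordd (\<lambda>w. poly 1 (tt w))) = 0" by (rule dsum_poly) simp
  then show ?case by simp
 next
  case (insert z A)
  then have z: "z \<in> mu" and A: "A \<subseteq> mu" by auto
  have r: "rat (\<lambda>w. g (sig z w))" "rat (\<lambda>w. \<Prod>z\<in>A. g (sig z w))" using A z by (auto intro!: rat_sig rat_prod g)
  have nz: "GEN w. g (sig z w) \<noteq> 0" using gen_sig[OF z g(2)] .
  have IH: "dsum (ordd (\<lambda>w. \<Prod>z\<in>A. g (sig z w))) = int (card A) * dsum (ordd g)"
   "GEN w. (\<Prod>z\<in>A. g (sig z w)) \<noteq> 0" using insert.IH[OF A] by auto
  have "GEN w. g (sig z w) * (\<Prod>z\<in>A. g (sig z w)) \<noteq> 0" using nz IH(2) by eventually_elim simp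
  moreover have "dsum (ordd (\<lambda>w. g (sig z w) * (\<Prod>z\<in>A. g (sig z w)))) = int (card (insert z A)) * dsum (ordd g)"
   unfolding dsum_ordd_mult[OF r(1) nz r(2) IH(2)] dsum_ordd_sig[OF z g] IH(1) using insert.hyps by (simp add: algebra_simps)
  ultimately show ?case using insert.hyps by simp
 qed
 have NS: "dsum (ordd (Nm g)) = int lam * dsum (ordd g)" "GEN w. Nm g w \<noteq> 0"
  using S[of mu] by (simp_all add: Nm_def[abs_def] card_mu)
 have Nr: "rat (Nm g)" unfolding Nm_def[abs_def] by (intro rat_prod rat_sig g)
 obtain B C where BC: "C \<noteq> 0" "GEN w. Nm g w = poly B (tt w) / poly C (tt w)"
  by (rule rat_invariant[OF Nr]) (simp_all add: Nm_sig)
 have "GEN w. poly B (tt w) \<noteq> 0" using BC(2) NS(2) by eventually_elim auto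
 then have B: "B \<noteq> 0" using gen_ex by fastforce
 have "GEN w. poly B (tt w) = Nm g w * poly C (tt w)"
  using BC(2) poly_tt_nz[OF BC(1)] by eventually_elim simp
 then have e: "GEN w. Nm g w * poly C (tt w) = poly B (tt w)" by (auto elim: eventually_mono)
 have "dsum (ordd (\<lambda>w. Nm g w * poly C (tt w))) = dsum (ordd (\<lambda>w. poly B (tt w)))"
  by (rule dsum_cong) (rule ordd_cong[OF rat_poly poly_tt_nz[OF B] e])
 then have "dsum (ordd (Nm g)) = 0"
  using dsum_ordd_mult[OF Nr NS(2) rat_poly poly_tt_nz[OF BC(1)]] dsum_poly[OF B] dsum_poly[OF BC(1)] by simp
 then show ?thesis using NS(1) lam_pos by simp
qed

end

section \<open>Global sections of the twisting sheaf\<close>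

text \<open>Common linear factors are removed one at a time. The absence of common roots stands for
  coprimality, with which it agrees over an algebraically closed field.\<close>

lemma divide_common_roots:
 fixes B C :: "'k::field poly"
 assumes "C \<noteq> 0" shows "\<exists>g B' C'. g \<noteq> 0 \<and> B = g * B' \<and> C = g * C' \<and> (\<forall>a. poly B' a \<noteq> 0 \<or> poly C' a \<noteq> 0)"
 using assms
proof (induction "degree C" arbitrary: B C rule: less_induct)
 case less
 show ?case
 proof (cases "\<exists>a. poly B a = 0 \<and> poly C a = 0")
  case False
  then show ?thesis by (intro exI[of _ 1] exI[of _ B] exI[of _ C]) auto
 next
  case True
  then obtain a B1 C1 where e: "B = [:-a, 1:] * B1" "C = [:-a, 1:] * C1"
   unfolding poly_eq_0_iff_dvd by (auto elim!: dvdE)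
  have C1: "C1 \<noteq> 0" using less.prems e(2) by auto
  then have "degree C = degree [:-a, 1:] + degree C1" unfolding e(2) by (intro degree_mult_eq) auto
  then have "degree C1 < degree C" by simp
  from less.hyps[OF this C1, of B1] obtain g B' C' where
   g: "g \<noteq> 0" "B1 = g * B'" "C1 = g * C'" "\<forall>a. poly B' a \<noteq> 0 \<or> poly C' a \<noteq> 0" by blast
  have "[:-a, 1:] * g \<noteq> 0" using g(1) by (simp only: mult_eq_0_iff) simp
  moreover have "B = ([:-a, 1:] * g) * B'" "C = ([:-a, 1:] * g) * C'"
   unfolding e g(2,3) by (simp_all only: mult.assoc)
  ultimately show ?thesis using g(4) by blast
 qed
qed

context trinomial_curve
begin

lemma vX: "(1, 0, 0) \<in> X" "(0, 1, 0) \<in> X" "(0, 0, 1) \<in> X" "(1, 0, 0) \<notin> Xo" "(0, 1, 0) \<notin> Xo" "(0, 0, 1) \<notin> Xo"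
 by (simp_all add: X_iff Xo_def)

lemma coprime_quotient:
 fixes B C :: "'k poly"
 assumes "C \<noteq> 0"
 obtains B' C' where "C' \<noteq> 0" "\<And>a. poly B' a \<noteq> 0 \<or> poly C' a \<noteq> 0"
  "GEN w. poly B (tt w) / poly C (tt w) = poly B' (tt w) / poly C' (tt w)"
proof -
 obtain g B' C' where e: "g \<noteq> 0" "B = g * B'" "C = g * C'" "\<And>a. poly B' a \<noteq> 0 \<or> poly C' a \<noteq> 0"
  using divide_common_roots[of C B] assms by metis
 have "C' \<noteq> 0" using assms e(3) by auto
 moreover have "GEN w. poly B (tt w) / poly C (tt w) = poly B' (tt w) / poly C' (tt w)"
  using poly_tt_nz[OF e(1)] by eventually_elim (simp add: e)
 ultimately show ?thesis using that e(4) by blast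
qed

lemma ordd_quotient:
 assumes "B \<noteq> 0" "C \<noteq> 0" "GEN w. g w = poly B (tt w) / poly C (tt w)" "v \<in> X"
 shows "hasord v g (ordt v B - ordt v C)"
 by (rule hasord_cong[OF hasord_divide[OF assms(4) hasord_poly[OF assms(4,1)] hasord_poly[OF assms(4,2)]] assms(3)])

text \<open>At the vertices over 0 and -1 the order of a function of t is a multiple of
  \<open>lam\<close>, so the weak bound above \<open>- lam\<close> already excludes poles. A reduced
  denominator then has no root at all and is constant.\<close>

lemma invariant_polynomial:
 assumes g: "rat g" "GEN w. g w \<noteq> 0" "\<And>z. z \<in> mu \<Longrightarrow> GEN w. g (sig z w) = g w"
  and pos: "\<And>v k. v \<in> Xo \<Longrightarrow> hasord v g k \<Longrightarrow> k \<ge> 0" "\<And>k. hasord (0, 1, 0) g k \<Longrightarrow> k > - int lam"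
   "\<And>k. hasord (0, 0, 1) g k \<Longrightarrow> k > - int lam"
 obtains B where "B \<noteq> 0" "GEN w. g w = poly B (tt w)"
  "hasord (1, 0, 0) g (- (int lam * int (degree B)))" "hasord (0, 1, 0) g (int lam * int (pord (-1) B))"
proof -
 obtain B0 C0 where BC0: "C0 \<noteq> 0" "GEN w. g w = poly B0 (tt w) / poly C0 (tt w)"
  using rat_invariant[OF g(1,3)] .
 obtain B C where BC: "C \<noteq> 0" "\<And>a. poly B a \<noteq> 0 \<or> poly C a \<noteq> 0" "GEN w. poly B0 (tt w) / poly C0 (tt w) = poly B (tt w) / poly C (tt w)"
  using coprime_quotient[OF BC0(1)] by blast
 have gBC: "GEN w. g w = poly B (tt w) / poly C (tt w)" using BC0(2) BC(3) by eventually_elim simp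
 have B: "B \<noteq> 0"
 proof
  assume B0: "B = 0"
  have "GEN w. False" using gBC g(2) by eventually_elim (simp add: B0)
  then show False by simp
 qed
 note o = ordd_quotient[OF B BC(1) gBC]
 have "poly C a \<noteq> 0" for a
 proof
  assume Ca: "poly C a = 0"
  then have C: "pord a C > 0" "pord a B = 0" using BC(1,2) order_root order_0I by blast+
  then have l: "int lam * int (pord a C) \<ge> int lam" by simp
  consider "a = 0" | "a = -1" | "a \<noteq> 0" "a \<noteq> -1" by blast
  then show False
  proof cases
   case 1
   show False using pos(3)[OF o[OF vX(3)]] l C(2) 1 by (simp add: ordt_def vX)
  next
   case 2
   show False using pos(2)[OF o[OF vX(2)]] l C(2) 2 by (simp add: ordt_def vX)
  next
   case 3
   have "fibre a \<noteq> {}" using card_fibre[OF 3] lam_pos by force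
   then obtain v where v: "v \<in> Xo" "tt v = a" by (auto simp: fibre_def)
   then show False using pos(1)[OF v(1) o[OF Xo_X[OF v(1)]]] C by (simp add: ordt_def)
  qed
 qed
 then have "degree C = 0" using alg_closed_imp_poly_has_root by (metis neq0_conv)
 then obtain c where C: "C = [:c:]" "c \<noteq> 0" using BC(1) by (metis degree_eq_zeroE pCons_0_0)
 have e: "GEN w. g w = poly (Polynomial.smult (inverse c) B) (tt w)" using gBC by (simp add: C divide_inverse mult.commute)
 have B': "Polynomial.smult (inverse c) B \<noteq> 0" using B C by simp
 have o: "hasord v g (ordt v (Polynomial.smult (inverse c) B))" if "v \<in> X" for v
  by (rule hasord_cong[OF hasord_poly[OF that B'] e])
 show ?thesis by (rule that[OF B' e]) (use o[OF vX(1)] o[OF vX(2)] in \<open>simp_all add: ordt_def vX\<close>)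
qed

lemma T1_frac:
 assumes f: "f \<in> twisted_functions X 1 X" and v: "v \<in> X" and l: "form (Suc 0) l" "l v \<noteq> 0"
 shows "locv v (\<lambda>w. f w / l w) (f v / l v)"
proof -
 obtain W a b F G where 1: "zopen X W" "v \<in> W" "W \<subseteq> X" "form a F" "form b G" "int a - int b = 1"
  "\<And>w. w \<in> W \<Longrightarrow> G w \<noteq> 0 \<and> f w = F w / G w" using tf_local[OF f v] by metis
 have "form (b + Suc 0) (\<lambda>w. G w * l w)" by (intro form_mult 1 l)
 moreover have "b + Suc 0 = a" using 1(6) by linarith
 ultimately have "locv v (\<lambda>w. F w / (G w * l w)) (F v / (G v * l v))"
  using locv_frac[OF 1(4), of "\<lambda>w. G w * l w" v] l 1(7)[OF 1(2)] by simp
 moreover have "GEN w. f w / l w = F w / (G w * l w)"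
  using gen_zopen[OF 1(1,2)] by eventually_elim (use 1(7) in simp)
 ultimately show ?thesis using locv_cong 1(7)[OF 1(2)] by fastforce
qed

lemma T1_gen_zero:
 assumes f: "f \<in> twisted_functions X 1 X" and z: "GEN w. f w = 0" and v: "v \<in> X" shows "f v = 0"
proof -
 obtain l where l: "form (Suc 0) l" "l v \<noteq> 0" using tcong_coords[OF v] by blast
 have "GEN w. f w / l w = 0" using z by eventually_elim simp
 from locv_unique[OF v T1_frac[OF f v l] locv_cong[OF locv_const this]] show ?thesis using l(2) by simp
qed

lemma T1_sig:
 assumes f: "f \<in> twisted_functions X 1 X" and c: "c \<in> mu" shows "(\<lambda>w. f (sig c w)) \<in> twisted_functions X 1 X"
proof (rule tfI)
 fix v
 show "f (sig c v) = 0" if "v \<notin> X"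
 proof -
  have "sig c v \<notin> X" using sig_X[OF mu_inverse[OF c], of "sig c v"] that mu_nz[OF c] by auto
  then show ?thesis using tf_out[OF f] by blast
 qed
 assume v: "v \<in> X"
 obtain W a b F G where 1: "zopen X W" "sig c v \<in> W" "W \<subseteq> X" "form a F" "form b G" "int a - int b = 1"
  "\<And>w. w \<in> W \<Longrightarrow> G w \<noteq> 0 \<and> f w = F w / G w" using tf_local[OF f sig_X[OF c v]] by metis
 obtain m H where H: "form m H" "H (sig c v) \<noteq> 0" "{w \<in> X. H w \<noteq> 0} \<subseteq> W" using zopen_basic[OF 1(1,2)] by blast
 let ?U = "{w \<in> X. H (sig c w) \<noteq> 0}"
 have "zopen X ?U" by (rule zopen_D[OF form_sig[OF H(1)]])
 moreover have "v \<in> ?U" using H v by simp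
 moreover have "\<forall>w\<in>?U. G (sig c w) \<noteq> 0 \<and> f (sig c w) = F (sig c w) / G (sig c w)"
 proof
  fix w assume "w \<in> ?U"
  then have "sig c w \<in> W" using H(3) sig_X[OF c] by blast
  then show "G (sig c w) \<noteq> 0 \<and> f (sig c w) = F (sig c w) / G (sig c w)" using 1(7) by blast
 qed
 ultimately show "\<exists>W a b F G. zopen X W \<and> v \<in> W \<and> W \<subseteq> X \<and> form a F \<and> form b G \<and> int a - int b = 1 \<and>
    (\<forall>w\<in>W. G w \<noteq> 0 \<and> f (sig c w) = F w / G w)" using form_sig[OF 1(4), of c] form_sig[OF 1(5), of c] 1(6)
  by (intro exI[of _ ?U] exI[of _ a] exI[of _ b] exI[of _ "\<lambda>w. F (sig c w)"] exI[of _ "\<lambda>w. G (sig c w)"]) blast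
qed

text \<open>In the eigenspace of index \<open>i\<close> of the sections of \<open>\<O>(1)\<close>, the polynomial in \<open>tt\<close> has degree \<open>D\<close>
 and a zero of order \<open>b1\<close> at \<open>-1\<close>; only the indices 0, 1, \<open>ee\<close> of z, y, x survive.\<close>

lemma eigen_index_aux:
 assumes i: "i < lam" "i \<noteq> 0" "i \<noteq> 1" "i \<noteq> ee"
  and D: "int lam * b1 \<ge> int ee * (int i - 1)" "int lam * D \<le> 1 + int i * int al" "D \<ge> b1" shows False
proof -
 define Q where "Q = (1 + i * al) div lam"
 define r where "r = (1 + i * al) mod lam"
 have Qr: "1 + i * al = Q * lam + r" "r < lam" unfolding Q_def r_def using lam_pos by (auto simp: div_mult_mod_eq)
 \<comment> \<open>The bounds become \<open>lam * b1 \<ge> Q * lam + (r + i - ee - 1)\<close> and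
   \<open>lam * D \<le> Q * lam + r\<close>. So \<open>r + i > ee + 1\<close> yields b1 > Q, while D
   \<le> Q, against D \<ge> b1.\<close>
 have key: "r + i > ee + 1"
 proof -
  consider "i > ee + 1" | "i = ee + 1" | "2 \<le> i" "i < ee" using i by linarith
  then show ?thesis
  proof cases
   case 2
   have "1 + i * al = lam + al" unfolding 2 lam_def by simp
   moreover have "al < lam" using lam_gt ee_eq by simp
   ultimately have "r = al" unfolding r_def by simp
   then show ?thesis using 2 al_pos by simp
  next
   case 3
   have "i * al \<le> (ee - 1) * al" using 3 by (intro mult_le_mono1) simp
   also have "\<dots> < ee * al" using al_pos ee_pos by (intro mult_strict_right_mono) auto
   finally have "1 + i * al < lam" by (simp add: lam_def)
   then have "r = 1 + i * al" by (simp add: r_def)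
   then have "r + i = 1 + i * ee" by (simp add: ee_eq)
   moreover have "2 * ee \<le> i * ee" using 3 by (intro mult_le_mono1) simp
   ultimately show ?thesis using ee_pos by linarith
  qed auto
 qed
 have "int ee * (int i - 1) = int Q * int lam + int r + int i - int ee - 1"
 proof -
  have "int ee * (int i - 1) = (1 + int i * int al) - 1 + int i - int ee" by (simp add: ee_eq algebra_simps)
  also have "1 + int i * int al = int (1 + i * al)" by simp
  finally show ?thesis unfolding Qr(1) by simp
 qed
 moreover have "int r + int i > int ee + 1" using key by linarith
 moreover have "int Q * int lam = int lam * int Q" by (rule mult.commute)
 ultimately have "int lam * int Q < int lam * b1" using D(1) by linarith
 then have "int Q < b1" by (rule mult_left_less_imp_less) simp
 moreover have "int lam * D \<le> int Q * int lam + int r" using D(2) Qr(1) by (metis of_nat_1 of_nat_add of_nat_mult)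
 then have "int lam * D < int lam * (int Q + 1)" using Qr(2) by (simp add: algebra_simps)
 then have "D < int Q + 1" by (rule mult_left_less_imp_less) simp
 ultimately show False using D(3) by linarith
qed

text \<open>Dividing by z y^i leaves an invariant function, which is 0 or, by regularity of f, a
  polynomial B in t. The vertex (1:0:0) bounds deg B and (0:1:0) forces zeros at -1. What survives
  is B constant for i = 0 and i = 1, and B a multiple of 1 + t for i = \<open>ee\<close>: multiples
  of z, y and x.\<close>

lemma eigen_section:
 assumes f: "f \<in> twisted_functions X 1 X" and i: "i < lam"
  and eig: "\<And>c w. c \<in> mu \<Longrightarrow> w \<in> X \<Longrightarrow> f (sig c w) = c ^ i * f w"
 shows "\<exists>a b e. GEN w. f w = a * fst w + b * cy w + e * cz w"
proof -
 define g where "g w = f w / cz w / yy w ^ i" for w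
 obtain u where u: "u \<in> Xo" using Xo_nonempty by blast
 have "rat (\<lambda>w. f w / cz w)"
  using locv_rat[OF Xo_X[OF u] T1_frac[OF f Xo_X[OF u] form_snd2]] u by (simp add: Xo_def)
 then have rg: "rat g" unfolding g_def[abs_def] by (rule rat_divide) (intro rat_power rat_yy)
 have fg: "GEN w. f w = g w * yy w ^ i * cz w"
  using gen_Xo by eventually_elim (use Xo_nz(4) in \<open>auto simp: g_def Xo_def\<close>)
 from rat_dichotomy[OF rg] show ?thesis
 proof
  assume "GEN w. g w = 0"
  then have "GEN w. f w = 0 * fst w + 0 * cy w + 0 * cz w" using fg by eventually_elim simp
  then show ?thesis by blast
 next
  assume gnz: "GEN w. g w \<noteq> 0"
  have ge: "k + int i * j + m \<ge> 0" if v: "v \<in> X" and k: "hasord v g k" and j: "hasord v yy j" and l: "form (Suc 0) l" "l v \<noteq> 0"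
   and m: "hasord v (\<lambda>w. cz w / l w) m" for v k j l m
  proof -
   have "hasord v (\<lambda>w. f w / l w) (k + int i * j + m)"
    by (rule hasord_cong[OF hasord_mult[OF v hasord_mult[OF v k hasord_power[OF v j]] m]]) (use fg in \<open>eventually_elim, simp\<close>)
   from hasord_value(1)[OF v this T1_frac[OF f v l]] show ?thesis by simp
  qed
  have one: "hasord v (\<lambda>w. cz w / cz w) 0" if "cz v \<noteq> 0" for v
   using hasord_locv[OF locv_frac[OF form_snd2 form_snd2, of v]] that by simp
  have geX: "k + int i * int al + 1 \<ge> 0" if "hasord (1, 0, 0) g k" for k
   using ge[OF vX(1) that hasord_vx(2)[OF vX(1,4)] form_fst _ hasord_vx(4)[OF vX(1,4)]] by simp
  have geY: "k \<ge> int ee * (int i - 1)" if "hasord (0, 1, 0) g k" for k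
   using ge[OF vX(2) that hasord_vy(2)[OF vX(2,5)] form_snd1 _ hasord_vy(4)[OF vX(2,5)]] by (simp add: algebra_simps)
  have lamge: "int lam > int ee" "int lam > int al + 1" "int lam = int ee * int al + 1" using lam_gt ee_eq by (auto simp: lam_def algebra_simps)
  have "int ee * (int i - 1) \<ge> int ee * (-1)" by (intro mult_left_mono) auto
  then have eei: "int ee * (int i - 1) > - int lam" using lamge(1) by linarith
  obtain B where B: "B \<noteq> 0" "GEN w. g w = poly B (tt w)"
   "hasord (1, 0, 0) g (- (int lam * int (degree B)))" "hasord (0, 1, 0) g (int lam * int (pord (-1) B))"
  proof (rule invariant_polynomial[OF rg gnz])
   show "GEN w. g (sig c w) = g w" if "c \<in> mu" for c
    using gen_X by eventually_elim (use mu_nz[OF that] in \<open>simp add: g_def eig[OF that] sig_yy power_mult_distrib\<close>)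
   show "k \<ge> 0" if "v \<in> Xo" "hasord v g k" for v k
    using ge[OF Xo_X[OF that(1)] that(2) hasord_locv[OF locv_yy[OF that(1)] Xo_nz(4)[OF that(1)]] form_snd2 _ one] that(1)
    by (simp add: Xo_def)
   show "k > - int lam" if "hasord (0, 1, 0) g k" for k using geY[OF that] eei by linarith
   show "k > - int lam" if "hasord (0, 0, 1) g k" for k
    using ge[OF vX(3) that hasord_vz(2)[OF vX(3,6)] form_snd2 _ one] i by simp
  qed
  note dX = geX[OF B(3)] and dY = geY[OF B(4)]
  consider "i = 0 \<or> i = 1" | "i = ee" | "i \<noteq> 0" "i \<noteq> 1" "i \<noteq> ee" by blast
  then show ?thesis
  proof cases
   case 1
   then have "int i * int al \<le> int al" by auto
   then have "int lam * int (degree B) < int lam * 1" using dX lamge(2) by linarith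
   then have "degree B = 0" by (simp only: mult_less_cancel_left) simp
   then obtain c where c: "B = [:c:]" by (metis degree_eq_zeroE)
   have "GEN w. f w = 0 * fst w + (if i = 1 then c else 0) * cy w + (if i = 0 then c else 0) * cz w"
    using fg B(2) gen_eq by eventually_elim (use 1 in \<open>auto simp: c yy_def\<close>)
   then show ?thesis by blast
  next
   case 2
   have "int lam * int (degree B) \<le> int lam * 1" using dX unfolding 2 using lamge(3) by linarith
   then have d: "degree B \<le> 1" using lam_pos by (simp only: mult_le_cancel_left) simp
   have "int ee * (int i - 1) > 0" using 2 ee_eq al_pos by simp
   then have "pord (-1) B \<noteq> 0" using dY by (intro notI) simp
   then have "poly B (-1) = 0" by (metis order_0I)
   then obtain B' where B': "B = [:1, 1:] * B'" unfolding poly_eq_0_iff_dvd by (auto elim: dvdE)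
   then have "degree B = Suc (degree B')" using B(1) by (simp add: degree_mult_eq del: mult_pCons_left)
   then have "degree B' = 0" using d by simp
   then obtain c where c: "B' = [:c:]" by (metis degree_eq_zeroE)
   have "GEN w. f w = - c * fst w + 0 * cy w + 0 * cz w" using fg B(2) gen_Xo
   proof eventually_elim
    case (elim w)
    have x: "fst w = - (1 + tt w) * yy w ^ ee * cz w"
     using Xo_xz[OF elim(3)] elim(3) by (simp add: Xo_def field_simps)
    show ?case unfolding x using elim(1,2) by (simp add: B' c 2 algebra_simps)
   qed
   then show ?thesis by blast
  next
   case 3
   have "int (degree B) \<ge> int (pord (-1) B)" using order_degree[OF B(1)] by simp
   moreover have "int lam * int (degree B) \<le> 1 + int i * int al" using dX by linarith
   ultimately show ?thesis using eigen_index_aux[OF i 3 dY] by blast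
  qed
 qed
qed

text \<open>Since \<open>lam\<close> is invertible, f is the sum of its components in the
  eigenspaces of \<open>mu\<close>, and each of them is a combination of coordinates. This
  identifies H^0(X, O(1)), of which only an arbitrary basis is given.\<close>

theorem sections_O1:
 assumes f: "f \<in> twisted_functions X 1 X" shows "\<exists>a b e. \<forall>w\<in>X. f w = a * fst w + b * cy w + e * cz w"
proof -
 define fi where "fi i w = inverse (of_nat lam) * (\<Sum>c\<in>mu. inverse c ^ i * f (sig c w))" for i w
 have T: "fi i \<in> twisted_functions X 1 X" for i
  unfolding fi_def[abs_def] using one_mu by (intro tf_cmult tf_sum T1_sig f zopen_X finite_mu) blast+
 have eig: "fi i (sig c w) = c ^ i * fi i w" if c: "c \<in> mu" for c w i
 proof -
  have "(\<Sum>e\<in>mu. inverse e ^ i * f (sig e (sig c w))) = (\<Sum>e\<in>mu. c ^ i * (inverse (e * c) ^ i * f (sig (e * c) w)))"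
   by (intro sum.cong refl) (use mu_nz[OF c] in \<open>simp add: power_mult_distrib power_inverse\<close>)
  also have "\<dots> = c ^ i * (\<Sum>e\<in>mu. inverse e ^ i * f (sig e w))"
   using sum.reindex_bij_betw[OF bij_mu[OF c], of "\<lambda>e. inverse e ^ i * f (sig e w)"]
   by (simp only: sum_distrib_left[symmetric])
  finally show ?thesis by (simp add: fi_def)
 qed
 have sm: "(\<Sum>i<lam. fi i w) = f w" for w
 proof -
  have "(\<Sum>i<lam. inverse c ^ i) = (if c = 1 then of_nat lam else 0)" if c: "c \<in> mu" for c
  proof (cases "c = 1")
   case False
   have "inverse c ^ lam = 1" using c by (simp add: mu_def power_inverse)
   then have "(inverse c - 1) * (\<Sum>i<lam. inverse c ^ i) = 0" using power_diff_1_eq[of "inverse c" lam] by simp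
   then show ?thesis using False by (simp add: inverse_eq_1_iff)
  qed simp
  then have "(\<Sum>c\<in>mu. (\<Sum>i<lam. inverse c ^ i) * f (sig c w)) = (\<Sum>c\<in>mu. if c = 1 then of_nat lam * f (sig c w) else 0)"
   by (intro sum.cong refl) simp
  also have "\<dots> = of_nat lam * f w" by (simp add: sum.delta)
  finally have "inverse (of_nat lam) * (\<Sum>c\<in>mu. (\<Sum>i<lam. inverse c ^ i) * f (sig c w)) = f w" using lam_nz by simp
  moreover have "(\<Sum>i<lam. fi i w) = inverse (of_nat lam) * (\<Sum>c\<in>mu. (\<Sum>i<lam. inverse c ^ i) * f (sig c w))"
  proof -
   have "(\<Sum>i<lam. fi i w) = inverse (of_nat lam) * (\<Sum>i<lam. \<Sum>c\<in>mu. inverse c ^ i * f (sig c w))"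
    by (simp only: fi_def sum_distrib_left)
   also have "(\<Sum>i<lam. \<Sum>c\<in>mu. inverse c ^ i * f (sig c w)) = (\<Sum>c\<in>mu. \<Sum>i<lam. inverse c ^ i * f (sig c w))"
    by (rule sum.swap)
   finally show ?thesis by (simp only: sum_distrib_right)
  qed
  ultimately show ?thesis by simp
 qed
 have "\<exists>a b e. GEN w. (\<Sum>i<m. fi i w) = a * fst w + b * cy w + e * cz w" if "m \<le> lam" for m using that
 proof (induction m)
  case 0
  show ?case by (intro exI[of _ 0]) simp
 next
  case (Suc m)
  obtain a b e where 1: "GEN w. (\<Sum>i<m. fi i w) = a * fst w + b * cy w + e * cz w" using Suc by auto
  have "\<exists>a b e. GEN w. fi m w = a * fst w + b * cy w + e * cz w"
   by (rule eigen_section[OF T _ eig]) (use Suc.prems in auto)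
  then obtain a' b' e' where 2: "GEN w. fi m w = a' * fst w + b' * cy w + e' * cz w" by blast
  have "GEN w. (\<Sum>i<Suc m. fi i w) = (a + a') * fst w + (b + b') * cy w + (e + e') * cz w"
   using 1 2 by eventually_elim (simp add: algebra_simps)
  then show ?case by blast
 qed
 from this[OF order_refl] obtain A B E where ge: "GEN w. f w = A * fst w + B * cy w + E * cz w" unfolding sm by blast
 define L where "L w = (if w \<in> X then A * fst w + B * cy w + E * cz w else 0)" for w
 have fL: "form (Suc 0) (\<lambda>w. A * fst w + B * cy w + E * cz w)"
  by (intro form_add form_cmult form_fst form_snd1 form_snd2)
 have L: "L \<in> twisted_functions X 1 X" by (rule tf_frac[OF zopen_X fL, of 0 "\<lambda>_. 1"]) (simp_all add: L_def)
 have "GEN w. f w - L w = 0" using ge gen_X by eventually_elim (simp add: L_def)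
 then have "f w - L w = 0" if "w \<in> X" for w using T1_gen_zero[OF tf_diff[OF f L zopen_X] _ that] by blast
 then show ?thesis by (intro exI[of _ A] exI[of _ B] exI[of _ E]) (simp add: L_def)
qed

end

section \<open>Frames and degrees of bundles\<close>

text \<open>Zero rows complete the system to a square matrix; row r then annihilates every term of
  the Leibniz expansion of its determinant.\<close>

lemma underdetermined:
 fixes a :: "nat \<Rightarrow> nat \<Rightarrow> 'a::field"
 assumes "r < n" shows "\<exists>c. (\<exists>i<n. c i \<noteq> 0) \<and> (\<forall>j<r. (\<Sum>i<n. a j i * c i) = 0)"
proof -
 define A where "A = mat n n (\<lambda>(j, i). if j < r then a j i else 0)"
 have A: "A \<in> carrier_mat n n" by (simp add: A_def)
 have "det A = (\<Sum>p | p permutes {0..<n}. signof p * (\<Prod>i = 0..<n. A $$ (i, p i)))" using det_def'[OF A] .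
 also have "\<dots> = 0"
 proof (rule sum.neutral, rule ballI)
  fix p assume "p \<in> {p. p permutes {0..<n}}"
  then have p: "p r < n" using assms permutes_in_image[of p "{0..<n}" r] by auto
  have "(\<Prod>i = 0..<n. A $$ (i, p i)) = 0"
   by (rule prod_zero) (use assms p in \<open>auto simp: A_def intro!: bexI[of _ r]\<close>)
  then show "signof p * (\<Prod>i = 0..<n. A $$ (i, p i)) = 0" by simp
 qed
 finally obtain v where v: "v \<in> carrier_vec n" "v \<noteq> 0\<^sub>v n" "A *\<^sub>v v = 0\<^sub>v n"
  using det_0_iff_vec_prod_zero_field[OF A] by auto
 have "\<exists>i<n. v $ i \<noteq> 0" using v(1,2) by (metis carrier_vecD eq_vecI index_zero_vec(1,2))
 moreover have "(\<Sum>i<n. a j i * v $ i) = 0" if "j < r" for j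
 proof -
  have "(A *\<^sub>v v) $ j = 0" using v(3) that assms by simp
  moreover have "(A *\<^sub>v v) $ j = (\<Sum>i<n. a j i * v $ i)"
   using that assms v(1) by (simp add: A_def scalar_prod_def atLeast0LessThan)
  ultimately show ?thesis by simp
 qed
 ultimately show ?thesis by blast
qed

section \<open>Independence, transition determinants and frames\<close>

lemma independent_span_le:
 assumes "independent_values r e v" "\<And>i. i < r \<Longrightarrow> \<exists>f. \<forall>l. e i v l = (\<Sum>j<r'. f j * e' j v l)" shows "r \<le> r'"
proof (rule ccontr)
 assume "\<not> r \<le> r'"
 then have lt: "r' < r" by simp
 have "\<forall>i. \<exists>f. i < r \<longrightarrow> (\<forall>l. e i v l = (\<Sum>j<r'. f j * e' j v l))" using assms(2) by blast
 from choice[OF this] obtain f where f: "\<And>i l. i < r \<Longrightarrow> e i v l = (\<Sum>j<r'. f i j * e' j v l)" by blast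
 obtain c where c: "\<exists>i<r. c i \<noteq> 0" "\<forall>j<r'. (\<Sum>i<r. f i j * c i) = 0"
  using underdetermined[OF lt, of "\<lambda>j i. f i j"] by blast
 have "(\<Sum>i<r. c i * e i v l) = 0" for l
 proof -
  have "(\<Sum>i<r. c i * e i v l) = (\<Sum>i<r. \<Sum>j<r'. (f i j * c i) * e' j v l)"
   by (intro sum.cong refl) (simp add: f sum_distrib_left mult_ac)
  also have "\<dots> = (\<Sum>j<r'. \<Sum>i<r. (f i j * c i) * e' j v l)" by (rule sum.swap)
  also have "\<dots> = (\<Sum>j<r'. (\<Sum>i<r. f i j * c i) * e' j v l)" by (simp only: sum_distrib_right)
  also have "\<dots> = 0" using c(2) by simp
  finally show ?thesis .
 qed
 then show False using assms(1) c(1) unfolding independent_values_def by blast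
qed

lemma independent_eqI:
 assumes "independent_values r e v" "\<And>l. (\<Sum>i<r. a i * e i v l) = (\<Sum>i<r. b i * e i v l)" "i < r"
 shows "a i = b i"
proof -
 have "(\<Sum>i<r. (a i - b i) * e i v l) = 0" for l using assms(2)[of l] by (simp add: left_diff_distrib sum_subtractf)
 then have "\<forall>i<r. a i - b i = 0"
  using assms(1)[unfolded independent_values_def, THEN spec, THEN mp, of "\<lambda>i. a i - b i"] by blast
 then have "a i - b i = 0" using assms(3) by blast
 then show ?thesis by simp
qed

text \<open>The determinant whose order defines \<open>det_ord\<close>, isolated so that
  multiplicativity and regularity can be stated for it.\<close>

definition dm :: "nat \<Rightarrow> (nat \<Rightarrow> nat \<Rightarrow> 'k::field pt \<Rightarrow> 'k) \<Rightarrow> 'k pt \<Rightarrow> 'k" where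
 "dm r a v = det (mat r r (\<lambda>(i, j). a i j v))"

lemma dm_mult:
 assumes "\<And>k j. k < r \<Longrightarrow> j < r \<Longrightarrow> a k j v = (\<Sum>i<r. b k i v * c i j v)" shows "dm r a v = dm r b v * dm r c v"
proof -
 have "mat r r (\<lambda>(i, j). a i j v) = mat r r (\<lambda>(i, j). b i j v) * mat r r (\<lambda>(i, j). c i j v)"
  by (rule eq_matI) (auto simp: assms scalar_prod_def atLeast0LessThan)
 then show ?thesis unfolding dm_def by (simp add: det_mult[of _ r])
qed

lemma dm_one: assumes "\<And>i j. i < r \<Longrightarrow> j < r \<Longrightarrow> a i j v = (if i = j then 1 else 0)" shows "dm r a v = 1"
proof -
 have "mat r r (\<lambda>(i, j). a i j v) = 1\<^sub>m r" by (rule eq_matI) (auto simp: assms)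
 then show ?thesis by (simp add: dm_def)
qed

lemma dm_1: "dm (Suc 0) a v = a 0 0 v" unfolding dm_def by (subst det_single) auto

lemma dm_sum: "dm r a v = (\<Sum>p | p permutes {0..<r}. signof p * (\<Prod>i\<in>{0..<r}. a i (p i) v))"
proof -
 have "dm r a v = (\<Sum>p | p permutes {0..<r}. signof p * (\<Prod>i = 0..<r. mat r r (\<lambda>(i, j). a i j v) $$ (i, p i)))"
  unfolding dm_def by (rule det_def') simp
 also have "\<dots> = (\<Sum>p | p permutes {0..<r}. signof p * (\<Prod>i\<in>{0..<r}. a i (p i) v))"
 proof (intro sum.cong refl arg_cong2[where f = "(*)"] prod.cong)
  fix p i assume "p \<in> {p. p permutes {0..<r}}" "i \<in> {0..<r}"
  then show "mat r r (\<lambda>(i, j). a i j v) $$ (i, p i) = a i (p i) v"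
   using permutes_in_image[of p "{0..<r}" i] by auto
 qed
 finally show ?thesis .
qed

lemma dm_2: "dm 2 a v = a 0 0 v * a 1 1 v - a 0 1 v * a 1 0 v"
proof -
 have p: "{p. p permutes {0..<2::nat}} = {id, Transposition.transpose 0 1}"
 proof -
  have "{0..<2::nat} = {0, 1}" by auto
  then show ?thesis by (simp only: permutes_doubleton_iff) auto
 qed
 have "id \<noteq> Transposition.transpose (0::nat) 1" by (metis id_apply transpose_apply_first zero_neq_one)
 moreover have "signof (Transposition.transpose (0::nat) 1) = (-1 :: 'a)" by (simp add: sign_swap_id)
 ultimately show ?thesis unfolding dm_sum p by (simp add: numeral_2_eq_2)
qed

lemma independent_dm:
 assumes "independent_values r s v" "\<And>j l. j < r \<Longrightarrow> s j v l = (\<Sum>i<r. c i j v * t i v l)" shows "dm r c v \<noteq> 0"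
proof
 assume "dm r c v = 0"
 moreover define A where "A = mat r r (\<lambda>(i, j). c i j v)"
 ultimately obtain x where x: "x \<in> carrier_vec r" "x \<noteq> 0\<^sub>v r" "A *\<^sub>v x = 0\<^sub>v r"
  using det_0_iff_vec_prod_zero_field[of A r] by (auto simp: dm_def)
 have nz: "\<exists>j<r. x $ j \<noteq> 0" using x(1,2) by (metis carrier_vecD eq_vecI index_zero_vec(1,2))
 have "(\<Sum>j<r. x $ j * s j v l) = 0" for l
 proof -
  have "(\<Sum>j<r. x $ j * s j v l) = (\<Sum>j<r. \<Sum>i<r. c i j v * x $ j * t i v l)"
   by (intro sum.cong refl) (simp add: assms(2) sum_distrib_left mult_ac)
  also have "\<dots> = (\<Sum>i<r. \<Sum>j<r. c i j v * x $ j * t i v l)" by (rule sum.swap)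
  also have "\<dots> = (\<Sum>i<r. (A *\<^sub>v x) $ i * t i v l)"
   using x(1) by (intro sum.cong refl) (simp add: A_def scalar_prod_def atLeast0LessThan sum_distrib_right)
  finally show ?thesis by (simp add: x(3))
 qed
 then show False using assms(1) nz unfolding independent_values_def by blast
qed

lemma dm_regular:
 assumes "zopen X W" "r > 0" "\<And>i j. i < r \<Longrightarrow> j < r \<Longrightarrow> a i j \<in> regular X W" shows "dm r a \<in> regular X W"
proof -
 have "(\<lambda>v. \<Sum>p | p permutes {0..<r}. signof p * (\<Prod>i\<in>{0..<r}. a i (p i) v)) \<in> regular X W"
 proof (intro regular_sum tf_cmult regular_prod assms(1))
  fix p i assume "p \<in> {p. p permutes {0..<r}}" "i \<in> {0..<r}"
  then show "a i (p i) \<in> regular X W" using permutes_in_image[of p "{0..<r}" i] assms(3) by auto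
 qed (use assms(2) in auto)
 then show ?thesis unfolding dm_sum[abs_def] .
qed

lemma frameD:
 assumes "local_frame X E r U e"
 shows "zopen X U" "\<And>i. i < r \<Longrightarrow> e i \<in> E U" "\<And>v. v \<in> U \<Longrightarrow> independent_values r e v"
  "\<And>W s. zopen X W \<Longrightarrow> W \<subseteq> U \<Longrightarrow> s \<in> E W \<Longrightarrow>
   \<exists>f. (\<forall>i<r. f i \<in> regular X W) \<and> s = (\<lambda>v j. \<Sum>i<r. f i v * e i v j)"
 using assms unfolding local_frame_def by blast+

lemma sheafD:
 assumes "module_sheaf X E" "zopen X U" shows "\<And>s v j. s \<in> E U \<Longrightarrow> v \<notin> U \<Longrightarrow> s v j = 0" "(\<lambda>v j. 0) \<in> E U"
  "\<And>s t. s \<in> E U \<Longrightarrow> t \<in> E U \<Longrightarrow> (\<lambda>v j. s v j + t v j) \<in> E U"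
  "\<And>f s. f \<in> regular X U \<Longrightarrow> s \<in> E U \<Longrightarrow> (\<lambda>v j. f v * s v j) \<in> E U"
  "\<And>W s. zopen X W \<Longrightarrow> W \<subseteq> U \<Longrightarrow> s \<in> E U \<Longrightarrow> restr W s \<in> E W"
  "\<And>s. (\<And>v j. v \<notin> U \<Longrightarrow> s v j = 0) \<Longrightarrow>
   (\<And>v. v \<in> U \<Longrightarrow> \<exists>W. zopen X W \<and> v \<in> W \<and> W \<subseteq> U \<and> restr W s \<in> E W) \<Longrightarrow> s \<in> E U"
proof -
 note c1 = assms(1)[unfolded module_sheaf_def, THEN spec, THEN mp, OF assms(2)]
 note c2 = c1[THEN conjunct2] note c3 = c2[THEN conjunct2] note c4 = c3[THEN conjunct2]
 note c5 = c4[THEN conjunct2] note c6 = c5[THEN conjunct2, THEN spec, THEN mp]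
 show "\<And>s v j. s \<in> E U \<Longrightarrow> v \<notin> U \<Longrightarrow> s v j = 0" using c1[THEN conjunct1] by blast
 show "(\<lambda>v j. 0) \<in> E U" using c2[THEN conjunct1] .
 show "\<And>s t. s \<in> E U \<Longrightarrow> t \<in> E U \<Longrightarrow> (\<lambda>v j. s v j + t v j) \<in> E U" using c3[THEN conjunct1] by blast
 show "\<And>f s. f \<in> regular X U \<Longrightarrow> s \<in> E U \<Longrightarrow> (\<lambda>v j. f v * s v j) \<in> E U" using c4[THEN conjunct1] by blast
 show "\<And>W s. zopen X W \<Longrightarrow> W \<subseteq> U \<Longrightarrow> s \<in> E U \<Longrightarrow> restr W s \<in> E W" using c5[THEN conjunct1] by blast
 show "s \<in> E U" if "\<And>v j. v \<notin> U \<Longrightarrow> s v j = 0"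
   "\<And>v. v \<in> U \<Longrightarrow> \<exists>W. zopen X W \<and> v \<in> W \<and> W \<subseteq> U \<and> restr W s \<in> E W" for s
 proof (rule c6, rule conjI)
  show "\<forall>v. v \<notin> U \<longrightarrow> (\<forall>j. s v j = 0)" using that(1) by blast
  show "\<forall>v\<in>U. \<exists>W. zopen X W \<and> v \<in> W \<and> W \<subseteq> U \<and> restr W s \<in> E W" using that(2) by blast
 qed
qed

lemma frame_coeffs:
 assumes E: "module_sheaf X E" and e: "local_frame X E r U e" and s: "\<And>j. j < r' \<Longrightarrow> s j \<in> E W" "zopen X W"
 shows "\<exists>b. (\<forall>i<r. \<forall>j<r'. b i j \<in> regular X (U \<inter> W)) \<and>
  (\<forall>v\<in>U \<inter> W. \<forall>j<r'. \<forall>l. s j v l = (\<Sum>i<r. b i j v * e i v l))"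
proof -
 have UW: "zopen X (U \<inter> W)" using frameD(1)[OF e] s(2) by blast
 have "\<forall>j. \<exists>f. j < r' \<longrightarrow> (\<forall>i<r. f i \<in> regular X (U \<inter> W)) \<and> restr (U \<inter> W) (s j) = (\<lambda>v l. \<Sum>i<r. f i v * e i v l)"
 proof (intro allI)
  fix j
  show "\<exists>f. j < r' \<longrightarrow> (\<forall>i<r. f i \<in> regular X (U \<inter> W)) \<and> restr (U \<inter> W) (s j) = (\<lambda>v l. \<Sum>i<r. f i v * e i v l)"
  proof (cases "j < r'")
   case True
   have "restr (U \<inter> W) (s j) \<in> E (U \<inter> W)" using sheafD(5)[OF E s(2) UW _ s(1)[OF True]] by simp
   from frameD(4)[OF e UW _ this] show ?thesis by blast
  qed simp
 qed
 from choice[OF this] obtain f where f: "\<And>j. j < r' \<Longrightarrow> (\<forall>i<r. f j i \<in> regular X (U \<inter> W))"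
  "\<And>j. j < r' \<Longrightarrow> restr (U \<inter> W) (s j) = (\<lambda>v l. \<Sum>i<r. f j i v * e i v l)" by blast
 have "s j v l = (\<Sum>i<r. f j i v * e i v l)" if "v \<in> U \<inter> W" "j < r'" for v j l
  using fun_cong[OF fun_cong[OF f(2)[OF that(2)], of v], of l] that(1) by (simp add: restr_def)
 then show ?thesis using f(1) by (intro exI[of _ "\<lambda>i j. f j i"]) blast
qed

lemma frame_restrict:
 assumes E: "module_sheaf X E" and e: "local_frame X E r U e" and W: "zopen X W" "W \<subseteq> U"
 shows "local_frame X E r W (\<lambda>i. restr W (e i))" unfolding local_frame_def
proof (intro conjI allI impI ballI)
 show "zopen X W" by (rule W)
 show "restr W (e i) \<in> E W" if "i < r" for i using sheafD(5)[OF E frameD(1)[OF e] W frameD(2)[OF e that]] .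
 show "independent_values r (\<lambda>i. restr W (e i)) v" if "v \<in> W" for v
  using frameD(3)[OF e, of v] W(2) that by (auto simp: independent_values_def restr_def)
 fix W' s assume A: "zopen X W' \<and> W' \<subseteq> W \<and> s \<in> E W'"
 then obtain f where f: "\<forall>i<r. f i \<in> regular X W'" "s = (\<lambda>v j. \<Sum>i<r. f i v * e i v j)"
  using frameD(4)[OF e, of W' s] W(2) by blast
 have "s = (\<lambda>v j. \<Sum>i<r. f i v * restr W (e i) v j)"
 proof (intro ext)
  fix v j
  show "s v j = (\<Sum>i<r. f i v * restr W (e i) v j)"
  proof (cases "v \<in> W")
   case False
   then have "f i v = 0" if "i < r" for i using f(1) that A tf_out by blast
   then show ?thesis unfolding f(2) by simp
  qed (simp add: f(2) restr_def)
 qed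
 then show "\<exists>f. (\<forall>i<r. f i \<in> regular X W') \<and> s = (\<lambda>v j. \<Sum>i<r. f i v * restr W (e i) v j)" using f(1) by blast
qed

context trinomial_curve
begin

section \<open>Rank and degree are well defined\<close>

lemma subsheaf_rank_le:
 assumes E: "module_sheaf X E" and e: "local_frame X E r U e" "v \<in> U"
  and e': "local_frame X W r' U' e'" "v \<in> U'" "W U' \<subseteq> E U'" shows "r' \<le> r"
proof -
 obtain b where b: "\<forall>v\<in>U \<inter> U'. \<forall>j<r'. \<forall>l. e' j v l = (\<Sum>i<r. b i j v * e i v l)"
  using frame_coeffs[OF E e(1), of r' e' U'] frameD(1,2)[OF e'(1)] e'(3) by blast
 have "\<exists>f. \<forall>l. e' i v l = (\<Sum>j<r. f j * e j v l)" if "i < r'" for i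
  by (rule exI[of _ "\<lambda>j. b j i v"]) (use b e(2) e'(2) that in simp)
 with independent_span_le[OF frameD(3)[OF e'(1,2)], where r' = r and e' = e] show ?thesis by blast
qed

lemma X_nonempty: "\<exists>v. v \<in> X" using vX(1) by blast

lemma vbrD: "vector_bundle_rank X r E \<Longrightarrow> module_sheaf X E"
 "vector_bundle_rank X r E \<Longrightarrow> v \<in> X \<Longrightarrow> \<exists>U e. v \<in> U \<and> local_frame X E r U e"
 unfolding vector_bundle_rank_def by blast+

lemma bundle_rank_eq: assumes E: "vector_bundle_rank X r E" shows "bundle_rank X E = r"
 unfolding bundle_rank_def
proof (rule the_equality)
 show "vector_bundle_rank X r E" by (rule E)
 fix r' assume E': "vector_bundle_rank X r' E"
 obtain v where v: "v \<in> X" using X_nonempty by blast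
 obtain U e U' e' where "v \<in> U" "local_frame X E r U e" "v \<in> U'" "local_frame X E r' U' e'"
  using vbrD(2)[OF E v] vbrD(2)[OF E' v] by blast
 then show "r' = r" using subsheaf_rank_le[OF vbrD(1)[OF E]] subset_refl by (intro le_antisym) blast+
qed

lemma gen_frame: assumes "zopen X U" "U \<noteq> {}" shows "GEN w. w \<in> U" using assms gen_zopen by blast

lemma gen_inter_nonempty: assumes "zopen X U" "U \<noteq> {}" "zopen X W" "W \<noteq> {}" shows "U \<inter> W \<noteq> {}"
proof -
 have "GEN w. w \<in> U \<and> w \<in> W" using gen_frame[OF assms(1,2)] gen_frame[OF assms(3,4)] by eventually_elim simp
 then show ?thesis using gen_ex by blast
qed

lemma frame_change:
 assumes E: "module_sheaf X E" and e: "local_frame X E r U e" and e': "local_frame X E r U' e'" and r: "r > 0"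
 shows "\<exists>b. (\<forall>i<r. \<forall>j<r. b i j \<in> regular X (U \<inter> U')) \<and>
  (\<forall>v\<in>U \<inter> U'. \<forall>j<r. \<forall>l. e' j v l = (\<Sum>i<r. b i j v * e i v l)) \<and>
  dm r b \<in> regular X (U \<inter> U') \<and> (\<forall>v\<in>U \<inter> U'. dm r b v \<noteq> 0)"
proof -
 obtain b where b: "\<forall>i<r. \<forall>j<r. b i j \<in> regular X (U \<inter> U')"
  "\<forall>v\<in>U \<inter> U'. \<forall>j<r. \<forall>l. e' j v l = (\<Sum>i<r. b i j v * e i v l)"
  using frame_coeffs[OF E e, of r e' U'] frameD(1,2)[OF e'] by blast
 have nz: "dm r b v \<noteq> 0" if "v \<in> U \<inter> U'" for v
  by (rule independent_dm[OF frameD(3)[OF e'], where t = e]) (use that b(2) in auto)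
 have "zopen X (U \<inter> U')" using frameD(1)[OF e] frameD(1)[OF e'] by blast
 then have "dm r b \<in> regular X (U \<inter> U')" using r b(1) by (intro dm_regular) auto
 then show ?thesis using b nz by (intro exI[of _ b]) blast
qed

lemma coeffs_compose:
 assumes "independent_values r e v" "\<And>j l. j < r \<Longrightarrow> s j v l = (\<Sum>i<r. a i j v * e i v l)"
  "\<And>j l. j < r \<Longrightarrow> e' j v l = (\<Sum>i<r. b i j v * e i v l)"
  "\<And>j l. j < r \<Longrightarrow> s j v l = (\<Sum>i<r. a' i j v * e' i v l)" shows "dm r a v = dm r b v * dm r a' v"
proof (rule dm_mult)
 fix k j assume kj: "k < r" "j < r"
 have "(\<Sum>k<r. a k j v * e k v l) = (\<Sum>k<r. (\<Sum>i<r. b k i v * a' i j v) * e k v l)" for l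
 proof -
  have "(\<Sum>k<r. a k j v * e k v l) = (\<Sum>i<r. a' i j v * (\<Sum>k<r. b k i v * e k v l))"
   using assms(2)[OF kj(2), of l] assms(4)[OF kj(2), of l] assms(3) by simp
  also have "\<dots> = (\<Sum>i<r. \<Sum>k<r. b k i v * a' i j v * e k v l)" by (simp add: sum_distrib_left mult_ac)
  also have "\<dots> = (\<Sum>k<r. \<Sum>i<r. b k i v * a' i j v * e k v l)" by (rule sum.swap)
  finally show ?thesis by (simp only: sum_distrib_right)
 qed
 from independent_eqI[OF assms(1) this kj(1)] show "a k j v = (\<Sum>i<r. b k i v * a' i j v)" .
qed

lemma hasord_unit: "f \<in> regular X U \<Longrightarrow> v \<in> U \<Longrightarrow> f v \<noteq> 0 \<Longrightarrow> hasord v f 0" using hasord_locv locv_regular by blast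

text \<open>Two frames at v differ by a matrix whose determinant is a unit at v, so the order does
  not depend on the frame. The coefficients need to be right only generically, which permits
  rational ones.\<close>

lemma det_ord_eq:
 assumes E: "module_sheaf X E" and r: "r > 0" and s: "local_frame X E r U s" "U \<noteq> {}"
  and e: "local_frame X E r W e" "v \<in> W"
  and a: "GEN w. \<forall>j<r. \<forall>l. s j w l = (\<Sum>i<r. a i j w * e i w l)" "hasord v (dm r a) k"
 shows "det_ord X E r U s (proj_point v) = k" unfolding det_ord_def
proof (rule the_equality)
 have W: "zopen X W" "W \<noteq> {}" using frameD(1)[OF e(1)] e(2) by auto
 have v: "v \<in> X" using e(2) zopen_sub[OF W(1)] by blast
 have U: "zopen X U" using frameD(1)[OF s(1)] .
 have *: "ord_at X (proj_point v) (\<lambda>v. det (mat r r (\<lambda>(i, j). a' i j v))) = k"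
  if e': "local_frame X E r W' e'" "proj_point v \<subseteq> W'"
   and a': "\<forall>w\<in>U \<inter> W'. \<forall>j<r. \<forall>l. s j w l = (\<Sum>i<r. a' i j w * e' i w l)" for W' e' a'
 proof -
  have vW': "v \<in> W'" using e'(2) proj_point_self by blast
  obtain b where b: "\<forall>v\<in>W \<inter> W'. \<forall>j<r. \<forall>l. e' j v l = (\<Sum>i<r. b i j v * e i v l)"
   "dm r b \<in> regular X (W \<inter> W')" "\<forall>v\<in>W \<inter> W'. dm r b v \<noteq> 0" using frame_change[OF E e(1) e'(1) r] by blast
  have W': "zopen X W'" "W' \<noteq> {}" using frameD(1)[OF e'(1)] vW' by auto
  have g: "GEN w. dm r a w = dm r b w * dm r a' w"
   using a(1) gen_frame[OF W] gen_frame[OF W'] gen_frame[OF U s(2)]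
  proof eventually_elim
   case (elim w)
   show ?case by (rule coeffs_compose[OF frameD(3)[OF e(1) elim(2)], of s a e' b a'])
     (use elim a' b(1) in blast)+
  qed
  have b0: "hasord v (dm r b) 0" using hasord_unit[OF b(2)] b(3) e(2) vW' by blast
  have g': "GEN w. dm r a' w = dm r a w / dm r b w" using g hasord_nz[OF v b0] by eventually_elim simp
  have "hasord v (dm r a') (k - 0)" by (rule hasord_cong[OF hasord_divide[OF v a(2) b0] g'])
  then show ?thesis using ord_at_eq[OF v] unfolding dm_def[abs_def] by simp
 qed
 obtain a' where a': "\<forall>i<r. \<forall>j<r. a' i j \<in> regular X (W \<inter> U)"
  "\<forall>w\<in>W \<inter> U. \<forall>j<r. \<forall>l. s j w l = (\<Sum>i<r. a' i j w * e i w l)"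
  using frame_coeffs[OF E e(1), of r s U] frameD(2)[OF s(1)] U by blast
 have PW: "proj_point v \<subseteq> W" using proj_point_zopen[OF W(1) e(2)] .
 have "k = ord_at X (proj_point v) (\<lambda>v. det (mat r r (\<lambda>(i, j). a' i j v)))"
  using *[OF e(1) PW, of a'] a'(2) by (simp add: Int_commute)
 then show "\<exists>W e a. proj_point v \<subseteq> W \<and> local_frame X E r W e \<and>
   (\<forall>i<r. \<forall>j<r. a i j \<in> regular X (U \<inter> W)) \<and>
   (\<forall>v\<in>U \<inter> W. \<forall>j<r. \<forall>l. s j v l = (\<Sum>i<r. a i j v * e i v l)) \<and>
   k = ord_at X (proj_point v) (\<lambda>v. det (mat r r (\<lambda>(i, j). a i j v)))"
  using PW e(1) a' by (intro exI[of _ W] exI[of _ e] exI[of _ a']) (simp add: Int_commute)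
 fix n
 assume "\<exists>W e a. proj_point v \<subseteq> W \<and> local_frame X E r W e \<and>
   (\<forall>i<r. \<forall>j<r. a i j \<in> regular X (U \<inter> W)) \<and>
   (\<forall>v\<in>U \<inter> W. \<forall>j<r. \<forall>l. s j v l = (\<Sum>i<r. a i j v * e i v l)) \<and>
   n = ord_at X (proj_point v) (\<lambda>v. det (mat r r (\<lambda>(i, j). a i j v)))"
 then obtain W' e' a' where "proj_point v \<subseteq> W'" "local_frame X E r W' e'"
   "\<forall>v\<in>U \<inter> W'. \<forall>j<r. \<forall>l. s j v l = (\<Sum>i<r. a' i j v * e' i v l)"
   "n = ord_at X (proj_point v) (\<lambda>v. det (mat r r (\<lambda>(i, j). a' i j v)))" by blast
 then show "n = k" using * by blast
qed

lemma det_ord_frame: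
 assumes E: "module_sheaf X E" and r: "r > 0" and s: "local_frame X E r U s" "U \<noteq> {}"
  and e: "local_frame X E r W e" "v \<in> W"
 obtains a where "GEN w. \<forall>j<r. \<forall>l. s j w l = (\<Sum>i<r. a i j w * e i w l)"
  "hasord v (dm r a) (det_ord X E r U s (proj_point v))"
proof -
 have v: "v \<in> X" using e(2) zopen_sub frameD(1)[OF e(1)] by blast
 obtain a where a: "\<forall>w\<in>W \<inter> U. \<forall>j<r. \<forall>l. s j w l = (\<Sum>i<r. a i j w * e i w l)"
  "dm r a \<in> regular X (W \<inter> U)" "\<forall>w\<in>W \<inter> U. dm r a w \<noteq> 0" using frame_change[OF E e(1) s(1) r] by blast
 have op: "zopen X (W \<inter> U)" "W \<inter> U \<noteq> {}"
  using frameD(1)[OF e(1)] frameD(1)[OF s(1)] gen_inter_nonempty s(2) e(2) by blast+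
 have "GEN w. dm r a w \<noteq> 0" using gen_frame[OF op] by eventually_elim (use a(3) in blast)
 moreover have "rat (dm r a)" using rat_regular[OF a(2) op(1)] op(2) by blast
 ultimately obtain k where k: "hasord v (dm r a) k" using hasord_ex[OF v] by blast
 have g: "GEN w. \<forall>j<r. \<forall>l. s j w l = (\<Sum>i<r. a i j w * e i w l)"
  using gen_frame[OF op] by eventually_elim (use a(1) in blast)
 show ?thesis using that[OF g] k unfolding det_ord_eq[OF E r s e g k] .
qed

lemma finite_complement: assumes "zopen X U" "U \<noteq> {}" shows "finite {P \<in> points X. \<not> P \<subseteq> U}"
proof -
 obtain v where v: "v \<in> U" using assms(2) by blast
 obtain n F where F: "form n F" "F v \<noteq> 0" "{w \<in> X. F w \<noteq> 0} \<subseteq> U" using zopen_basic[OF assms(1) v] by blast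
 have vX: "v \<in> X" using v zopen_sub[OF assms(1)] by blast
 show ?thesis
 proof (rule finite_subset[OF _ finite_zeros[OF F(1) gen_form[OF F(1) vX F(2)]]])
  show "{P \<in> points X. \<not> P \<subseteq> U} \<subseteq> {P \<in> points X. \<exists>v\<in>P. F v = 0}"
  proof
   fix P assume P: "P \<in> {P \<in> points X. \<not> P \<subseteq> U}"
   then obtain u w where "u \<in> X" "P = proj_point u" "w \<in> P" "w \<notin> U" using pointsE by blast
   moreover then have "w \<in> X" using proj_point_X by blast
   ultimately show "P \<in> {P \<in> points X. \<exists>v\<in>P. F v = 0}" using F(3) P by blast
  qed
 qed
qed

lemma fsup_det_ord:
 assumes E: "module_sheaf X E" and r: "r > 0" and s: "local_frame X E r U s" "U \<noteq> {}"
 shows "fsup (det_ord X E r U s)" unfolding fsup_def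
proof (rule finite_subset[OF _ finite_complement[OF frameD(1)[OF s(1)] s(2)]])
 show "{P \<in> points X. det_ord X E r U s P \<noteq> 0} \<subseteq> {P \<in> points X. \<not> P \<subseteq> U}"
 proof safe
  fix P assume P: "P \<in> points X" "det_ord X E r U s P \<noteq> 0" "P \<subseteq> U"
  obtain v where v: "v \<in> X" "P = proj_point v" using pointsE[OF P(1)] by blast
  have vU: "v \<in> U" using P(3) v(2) proj_point_self by blast
  define one where "one i j v = (if i = j then 1 else 0 :: 'k)" for i j :: nat and v :: "'k pt"
  have "(\<Sum>i<r. one i j w * s i w l) = s j w l" if "j < r" for j w l
  proof -
   have "(\<Sum>i<r. one i j w * s i w l) = (\<Sum>i<r. if i = j then s i w l else 0)" by (intro sum.cong refl) (simp add: one_def)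
   then show ?thesis using that by (simp add: sum.delta)
  qed
  then have g: "GEN w. \<forall>j<r. \<forall>l. s j w l = (\<Sum>i<r. one i j w * s i w l)" by simp
  have "dm r one = (\<lambda>w. 1)" by (intro ext dm_one) (simp add: one_def)
  then have "hasord v (dm r one) 0" using hasord_const[of 1] by simp
  then have "det_ord X E r U s (proj_point v) = 0" using det_ord_eq[OF E r s s(1) vU g] by blast
  then show False using P(2) v(2) by simp
 qed
qed

text \<open>Two rational sections of det E differ by a rational function, whose divisor has degree
  0. The sections s are only assumed independent on U, so that a frame of a sub-bundle of full rank
  can be compared with one of E.\<close>

lemma dsum_det_ord:
 assumes V: "vector_bundle_rank X r E" and r: "r > 0" and t: "local_frame X E r U' t" "U' \<noteq> {}"
  and U: "zopen X U" "U \<noteq> {}" and s: "\<And>j. j < r \<Longrightarrow> s j \<in> E U" "\<And>v. v \<in> U \<Longrightarrow> independent_values r s v"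
  and loc: "\<And>v. v \<in> X \<Longrightarrow> \<exists>W e a. local_frame X E r W e \<and> v \<in> W \<and>
   (GEN w. \<forall>j<r. \<forall>l. s j w l = (\<Sum>i<r. a i j w * e i w l)) \<and> hasord v (dm r a) (n (proj_point v))"
 shows "dsum n = dsum (det_ord X E r U' t)"
proof -
 note E = vbrD(1)[OF V]
 obtain c where c: "\<forall>i<r. \<forall>j<r. c i j \<in> regular X (U' \<inter> U)"
  "\<forall>w\<in>U' \<inter> U. \<forall>j<r. \<forall>l. s j w l = (\<Sum>i<r. c i j w * t i w l)"
  using frame_coeffs[OF E t(1), of r s U] s(1) U(1) by blast
 have op: "zopen X (U' \<inter> U)" "U' \<inter> U \<noteq> {}" using frameD(1)[OF t(1)] U t(2) gen_inter_nonempty by blast+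
 have cnz: "dm r c w \<noteq> 0" if "w \<in> U' \<inter> U" for w
  by (rule independent_dm[OF s(2), where t = t]) (use that c(2) in auto)
 have cn: "GEN w. dm r c w \<noteq> 0" using gen_frame[OF op] by eventually_elim (rule cnz)
 have cr: "rat (dm r c)" using rat_regular[OF dm_regular[OF op(1) r] op(1)] c(1) op(2) by blast
 have "dsum n = dsum (\<lambda>P. det_ord X E r U' t P + ordd (dm r c) P)"
 proof (rule dsum_cong)
  fix P assume "P \<in> points X"
  then obtain v where v: "v \<in> X" "P = proj_point v" using pointsE by blast
  obtain W e a where e: "local_frame X E r W e" "v \<in> W"
   and a: "GEN w. \<forall>j<r. \<forall>l. s j w l = (\<Sum>i<r. a i j w * e i w l)" "hasord v (dm r a) (n (proj_point v))"
   using loc[OF v(1)] by blast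
  have W: "zopen X W" "W \<noteq> {}" using frameD(1)[OF e(1)] e(2) by auto
  obtain b where b: "GEN w. \<forall>j<r. \<forall>l. t j w l = (\<Sum>i<r. b i j w * e i w l)"
   "hasord v (dm r b) (det_ord X E r U' t (proj_point v))" using det_ord_frame[OF E r t e] by blast
  obtain k where k: "hasord v (dm r c) k" using hasord_ex[OF v(1) cr cn] by blast
  have "GEN w. dm r a w = dm r b w * dm r c w" using a(1) b(1) gen_frame[OF op] gen_frame[OF W]
  proof eventually_elim
   case (elim w)
   show ?case
    by (rule coeffs_compose[OF frameD(3)[OF e(1) elim(4)], of s a t b c]) (use elim c(2) in blast)+
  qed
  from hasord_unique[OF v(1) a(2) hasord_cong[OF hasord_mult[OF v(1) b(2) k] this]]
  show "n P = det_ord X E r U' t P + ordd (dm r c) P" unfolding v(2) ordd_eq[OF v(1) k] .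
 qed
 also have "\<dots> = dsum (det_ord X E r U' t) + dsum (ordd (dm r c))"
  by (rule dsum_add[OF fsup_det_ord[OF E r t] fsup_ordd[OF cr cn]])
 finally show ?thesis using product_formula[OF cr cn] by simp
qed

lemma det_ord_compare:
 assumes V: "vector_bundle_rank X r E" and r: "r > 0" and s: "local_frame X E r U s" "U \<noteq> {}"
  and s': "local_frame X E r U' s'" "U' \<noteq> {}" shows "dsum (det_ord X E r U' s') = dsum (det_ord X E r U s)"
proof (rule dsum_det_ord[OF V r s frameD(1)[OF s'(1)] s'(2) frameD(2,3)[OF s'(1)]])
 fix v assume "v \<in> X"
 then obtain W e where e: "local_frame X E r W e" "v \<in> W" using vbrD(2)[OF V] by blast
 then show "\<exists>W e a. local_frame X E r W e \<and> v \<in> W \<and> (GEN w. \<forall>j<r. \<forall>l. s' j w l = (\<Sum>i<r. a i j w * e i w l)) \<and>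
   hasord v (dm r a) (det_ord X E r U' s' (proj_point v))"
  using det_ord_frame[OF vbrD(1)[OF V] r s' e] by blast
qed

end

lemma zopen_regular_nz: assumes "zopen X U" "f \<in> regular X U" shows "zopen X {w \<in> U. f w \<noteq> 0}"
proof (rule zopenI)
 show "{w \<in> U. f w \<noteq> 0} \<subseteq> X" using zopen_sub[OF assms(1)] by blast
 fix v assume "v \<in> {w \<in> U. f w \<noteq> 0}"
 then have v: "v \<in> U" "f v \<noteq> 0" by auto
 obtain W a b F G where 1: "zopen X W" "v \<in> W" "W \<subseteq> U" "form a F" "form b G" "int a - int b = 0"
  "\<And>w. w \<in> W \<Longrightarrow> G w \<noteq> 0 \<and> f w = F w / G w" using tf_local[OF assms(2) v(1)] by metis
 obtain m H where H: "form m H" "H v \<noteq> 0" "{w \<in> X. H w \<noteq> 0} \<subseteq> W" using zopen_basic[OF 1(1,2)] by blast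
 have "form (m + a) (\<lambda>w. H w * F w)" using H(1) 1(4) by (rule form_mult)
 moreover have "H v * F v \<noteq> 0" using H(2) v(2) 1(7)[OF 1(2)] by auto
 moreover have "{w \<in> X. H w * F w \<noteq> 0} \<subseteq> {w \<in> U. f w \<noteq> 0}"
 proof
  fix w assume w: "w \<in> {w \<in> X. H w * F w \<noteq> 0}"
  then have "w \<in> W" using H(3) by auto
  then show "w \<in> {w \<in> U. f w \<noteq> 0}" using 1(3) 1(7)[of w] w by auto
 qed
 ultimately show "\<exists>n F. form n F \<and> F v \<noteq> 0 \<and> {w \<in> X. F w \<noteq> 0} \<subseteq> {w \<in> U. f w \<noteq> 0}" by blast
qed

context trinomial_curve
begin

lemma frame_exists: assumes "vector_bundle_rank X r E" shows "\<exists>U s. local_frame X E r U s \<and> U \<noteq> {}"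
 using X_nonempty vbrD(2)[OF assms] by blast

lemma bundle_degree_eq:
 assumes E: "vector_bundle_rank X r E" and r: "r > 0" and s: "local_frame X E r U s" "U \<noteq> {}"
 shows "bundle_degree X E = dsum (det_ord X E r U s)" unfolding bundle_degree_def bundle_rank_eq[OF E]
proof (rule the_equality)
 show "\<exists>U' s'. U' \<noteq> {} \<and> local_frame X E r U' s' \<and>
   dsum (det_ord X E r U s) = (\<Sum>P\<in>{P \<in> points X. det_ord X E r U' s' P \<noteq> 0}. det_ord X E r U' s' P)"
  by (rule exI[of _ U], rule exI[of _ s]) (simp add: s dsum_def)
next
 fix D
 assume "\<exists>U' s'. U' \<noteq> {} \<and> local_frame X E r U' s' \<and>
   D = (\<Sum>P\<in>{P \<in> points X. det_ord X E r U' s' P \<noteq> 0}. det_ord X E r U' s' P)"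
 then obtain U' s' where *: "U' \<noteq> {}" "local_frame X E r U' s'" "D = dsum (det_ord X E r U' s')"
  unfolding dsum_def by blast
 show "D = dsum (det_ord X E r U s)" unfolding *(3) by (rule det_ord_compare[OF E r s *(2,1)])
qed

text \<open>The working form of the degree: near each point a frame and generic coefficients may be
  chosen freely.\<close>

lemma bundle_degree_local:
 assumes E: "vector_bundle_rank X r E" and r: "r > 0" and s: "local_frame X E r U s" "U \<noteq> {}"
  and loc: "\<And>v. v \<in> X \<Longrightarrow> \<exists>W e a. local_frame X E r W e \<and> v \<in> W \<and>
   (GEN w. \<forall>j<r. \<forall>l. s j w l = (\<Sum>i<r. a i j w * e i w l)) \<and> hasord v (dm r a) (n (proj_point v))"
 shows "bundle_degree X E = dsum n" "fsup n"
proof -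
 have eq: "det_ord X E r U s P = n P" if P: "P \<in> points X" for P
 proof -
  obtain v where v: "v \<in> X" "P = proj_point v" using pointsE[OF P] by blast
  obtain W e a where "local_frame X E r W e" "v \<in> W"
   "GEN w. \<forall>j<r. \<forall>l. s j w l = (\<Sum>i<r. a i j w * e i w l)" "hasord v (dm r a) (n (proj_point v))"
   using loc[OF v(1)] by blast
  from det_ord_eq[OF vbrD(1)[OF E] r s this] show ?thesis unfolding v(2) .
 qed
 show "bundle_degree X E = dsum n" unfolding bundle_degree_eq[OF E r s] by (rule dsum_cong) (rule eq)
 show "fsup n" by (rule fsup_cong[OF fsup_det_ord[OF vbrD(1)[OF E] r s]]) (simp add: eq)
qed

text \<open>Values of a frame of W stay independent in the fibres of E, so the transition
  determinant is a unit at every point; a mere subsheaf of full rank could have smaller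
  degree.\<close>

lemma same_rank_degree:
 assumes E: "vector_bundle_rank X r E" and W: "vector_bundle_rank X r W" and r: "r > 0"
  and sub: "\<And>U. zopen X U \<Longrightarrow> W U \<subseteq> E U" shows "bundle_degree X W = bundle_degree X E"
proof -
 note EM = vbrD(1)[OF E] and WM = vbrD(1)[OF W]
 obtain U s where s: "local_frame X W r U s" "U \<noteq> {}" using frame_exists[OF W] by blast
 obtain U' t where t: "local_frame X E r U' t" "U' \<noteq> {}" using frame_exists[OF E] by blast
 have "dsum (det_ord X W r U s) = dsum (det_ord X E r U' t)"
 proof (rule dsum_det_ord[OF E r t frameD(1)[OF s(1)] s(2) _ frameD(3)[OF s(1)]])
  show "s j \<in> E U" if "j < r" for j using frameD(1,2)[OF s(1)] sub that by blast
  fix v assume v: "v \<in> X"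
  obtain W1 e1 where e1: "local_frame X W r W1 e1" "v \<in> W1" using vbrD(2)[OF W v] by blast
  obtain W2 e2 where e2: "local_frame X E r W2 e2" "v \<in> W2" using vbrD(2)[OF E v] by blast
  have o1: "zopen X W1" "zopen X W2" using frameD(1)[OF e1(1)] frameD(1)[OF e2(1)] .
  obtain b where b: "\<forall>i<r. \<forall>j<r. b i j \<in> regular X (W2 \<inter> W1)"
   "\<forall>v\<in>W2 \<inter> W1. \<forall>j<r. \<forall>l. e1 j v l = (\<Sum>i<r. b i j v * e2 i v l)"
   using frame_coeffs[OF EM e2(1), of r e1 W1] frameD(2)[OF e1(1)] sub[OF o1(1)] o1(1) by blast
  have o: "zopen X (W2 \<inter> W1)" "v \<in> W2 \<inter> W1" using o1 e1(2) e2(2) by blast+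
  have "dm r b v \<noteq> 0" by (rule independent_dm[OF frameD(3)[OF e1], where t = e2]) (use o(2) b(2) in auto)
  then have b0: "hasord v (dm r b) 0" using hasord_unit[OF dm_regular[OF o(1) r]] b(1) o(2) by blast
  obtain a where a: "GEN w. \<forall>j<r. \<forall>l. s j w l = (\<Sum>i<r. a i j w * e1 i w l)"
   "hasord v (dm r a) (det_ord X W r U s (proj_point v))" using det_ord_frame[OF WM r s e1] by blast
  have gn: "GEN w. w \<in> W2 \<inter> W1" using gen_frame[OF o(1)] o(2) by blast
  define m where "m i j w = (\<Sum>k<r. b i k w * a k j w)" for i j w
  have "dm r m = (\<lambda>w. dm r b w * dm r a w)" by (intro ext dm_mult) (simp add: m_def)
  then have "hasord v (dm r m) (det_ord X W r U s (proj_point v))" using hasord_mult[OF v b0 a(2)] by simp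
  moreover have "GEN w. \<forall>j<r. \<forall>l. s j w l = (\<Sum>i<r. m i j w * e2 i w l)" using a(1) gn
  proof eventually_elim
   case (elim w)
   have "s j w l = (\<Sum>i<r. m i j w * e2 i w l)" if "j < r" for j l
   proof -
    have "s j w l = (\<Sum>k<r. a k j w * (\<Sum>i<r. b i k w * e2 i w l))" using elim that b(2) by simp
    also have "\<dots> = (\<Sum>k<r. \<Sum>i<r. b i k w * a k j w * e2 i w l)" by (simp add: sum_distrib_left mult_ac)
    also have "\<dots> = (\<Sum>i<r. \<Sum>k<r. b i k w * a k j w * e2 i w l)" by (rule sum.swap)
    finally show ?thesis unfolding m_def by (simp only: sum_distrib_right)
   qed
   then show ?case by blast
  qed
  ultimately show "\<exists>B e a. local_frame X E r B e \<and> v \<in> B \<and> (GEN w. \<forall>j<r. \<forall>l. s j w l = (\<Sum>i<r. a i j w * e i w l)) \<and>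
   hasord v (dm r a) (det_ord X W r U s (proj_point v))" using e2 by blast
 qed
 then show ?thesis unfolding bundle_degree_eq[OF W r s] bundle_degree_eq[OF E r t] .
qed

lemma subbundle_rank:
 assumes "subbundle X W E" "vector_bundle_rank X r E"
 obtains r' where "vector_bundle_rank X r' W" "r' \<le> r" "bundle_rank X W = r'"
proof -
 obtain r' where W: "vector_bundle_rank X r' W" using assms(1) unfolding subbundle_def vector_bundle_def by blast
 obtain v where v: "v \<in> X" using X_nonempty by blast
 obtain U e U' e' where 1: "v \<in> U" "local_frame X E r U e" "v \<in> U'" "local_frame X W r' U' e'"
  using vbrD(2)[OF assms(2) v] vbrD(2)[OF W v] by blast
 have "W U' \<subseteq> E U'" using assms(1) frameD(1)[OF 1(4)] unfolding subbundle_def by blast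
 then have "r' \<le> r" using subsheaf_rank_le[OF vbrD(1)[OF assms(2)] 1(2,1,4,3)] by blast
 then show ?thesis using that W bundle_rank_eq[OF W] by blast
qed

lemma subbundle_same_rank_slope:
 assumes "subbundle X W E" "vector_bundle_rank X r E" "vector_bundle_rank X r W" "r > 0"
 shows "slope X W = slope X E"
proof -
 have "bundle_degree X W = bundle_degree X E"
  by (rule same_rank_degree[OF assms(2,3,4)]) (use assms(1) in \<open>auto simp: subbundle_def\<close>)
 then show ?thesis by (simp add: slope_def bundle_rank_eq[OF assms(2)] bundle_rank_eq[OF assms(3)])
qed

lemma semistable_line: assumes L: "vector_bundle_rank X 1 L" shows "semistable X L" unfolding semistable_def
proof (intro conjI allI impI)
 show "vector_bundle X L" using L unfolding vector_bundle_def by blast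
 fix W assume W: "subbundle X W L \<and> bundle_rank X W > 0"
 obtain r' where r': "vector_bundle_rank X r' W" "r' \<le> 1" "bundle_rank X W = r'"
  using subbundle_rank[OF conjunct1[OF W] L] by blast
 then have "r' = 1" using W by simp
 then show "slope X W \<le> slope X L" using subbundle_same_rank_slope[OF conjunct1[OF W] L] r'(1) by simp
qed

section \<open>Frames of a rank two bundle adapted to a line sub-bundle\<close>

lemma independent_2: "independent_values 2 e v \<longleftrightarrow>
  (\<forall>a b. (\<forall>l. a * e 0 v l + b * e 1 v l = 0) \<longrightarrow> a = 0 \<and> b = 0)"
proof
 assume I: "independent_values 2 e v"
 show "\<forall>a b. (\<forall>l. a * e 0 v l + b * e 1 v l = 0) \<longrightarrow> a = 0 \<and> b = 0"
 proof (intro allI impI)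
  fix a b assume "\<forall>l. a * e 0 v l + b * e 1 v l = 0"
  then have "\<forall>j. (\<Sum>i<2. (if i = 0 then a else b) * e i v j) = 0" by (simp add: numeral_2_eq_2)
  with I[unfolded independent_values_def, THEN spec, THEN mp, of "\<lambda>i. if i = 0 then a else b"]
  have *: "\<forall>i<(2::nat). (if i = 0 then a else b) = 0" by blast
  from *[THEN spec, of 0] *[THEN spec, of 1] show "a = 0 \<and> b = 0" by simp
 qed
next
 assume *: "\<forall>a b. (\<forall>l. a * e 0 v l + b * e 1 v l = 0) \<longrightarrow> a = 0 \<and> b = 0"
 show "independent_values 2 e v" unfolding independent_values_def
 proof (intro allI impI)
  fix c :: "nat \<Rightarrow> _" and i :: nat
  assume "\<forall>j. (\<Sum>i<2. c i * e i v j) = 0" and i: "i < 2"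
  then have "\<forall>l. c 0 * e 0 v l + c 1 * e 1 v l = 0" by (simp add: numeral_2_eq_2)
  then have "c 0 = 0 \<and> c 1 = 0" using * by blast
  moreover have "i = 0 \<or> i = 1" using i by linarith
  ultimately show "c i = 0" by blast
 qed
qed

lemma independent_1: "independent_values (Suc 0) e v \<longleftrightarrow> (\<exists>l. e 0 v l \<noteq> 0)"
proof
 assume I: "independent_values (Suc 0) e v"
 show "\<exists>l. e 0 v l \<noteq> 0" using I[unfolded independent_values_def, THEN spec, THEN mp, of "\<lambda>_. 1"] by auto
next
 assume "\<exists>l. e 0 v l \<noteq> 0"
 then show "independent_values (Suc 0) e v" unfolding independent_values_def by auto
qed

text \<open>Where the coefficient b0 of the generator of L is invertible, that generator can replace
  the first frame vector. As one of its two coefficients is nonzero at v, \<open>frame_swap\<close>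
  reduces the general situation to this one.\<close>

lemma adapted_frame_aux:
 assumes EM: "module_sheaf X E" and l: "local_frame X L (Suc 0) U1 l" "l 0 \<in> E U1" and LM: "module_sheaf X L"
  and g: "local_frame X E 2 U2 g"
  and b: "b0 \<in> regular X (U1 \<inter> U2)" "b1 \<in> regular X (U1 \<inter> U2)"
   "\<And>w j. w \<in> U1 \<inter> U2 \<Longrightarrow> l 0 w j = b0 w * g 0 w j + b1 w * g 1 w j"
  and v: "v \<in> U1 \<inter> U2" "b0 v \<noteq> 0" shows "\<exists>U e. v \<in> U \<and> local_frame X E 2 U e \<and> local_frame X L (Suc 0) U e"
proof -
 have o: "zopen X (U1 \<inter> U2)" using frameD(1)[OF l(1)] frameD(1)[OF g] by blast
 define U where "U = {w \<in> U1 \<inter> U2. b0 w \<noteq> 0}"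
 have U: "zopen X U" "U \<subseteq> U1" "U \<subseteq> U2" "v \<in> U" using zopen_regular_nz[OF o b(1)] v by (auto simp: U_def)
 define e where "e i = restr U (if i = 0 then l 0 else g 1)" for i :: nat
 have eE: "e i \<in> E U" if "i < 2" for i
 proof -
  have "restr U (l 0) \<in> E U" using sheafD(5)[OF EM frameD(1)[OF l(1)] U(1,2) l(2)] .
  moreover have "restr U (g 1) \<in> E U" using sheafD(5)[OF EM frameD(1)[OF g] U(1,3) frameD(2)[OF g]] by simp
  ultimately show ?thesis by (simp add: e_def)
 qed
 have val: "e 0 w j = b0 w * g 0 w j + b1 w * g 1 w j" "e 1 w j = g 1 w j" if "w \<in> U" for w j
  using that b(3)[of w j] by (auto simp: e_def restr_def U_def)
 have ind: "independent_values 2 e w" if w: "w \<in> U" for w unfolding independent_2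
 proof (intro allI impI)
  fix a c assume A: "\<forall>j. a * e 0 w j + c * e 1 w j = 0"
  have "\<forall>j. (a * b0 w) * g 0 w j + (a * b1 w + c) * g 1 w j = 0"
   using A val[OF w] by (simp add: algebra_simps)
  moreover have "independent_values 2 g w" using frameD(3)[OF g] w U(3) by blast
  ultimately have "a * b0 w = 0 \<and> a * b1 w + c = 0" unfolding independent_2 by blast
  then show "a = 0 \<and> c = 0" using w by (auto simp: U_def)
 qed
 have gen: "\<exists>f. (\<forall>i<2. f i \<in> regular X W) \<and> s = (\<lambda>v j. \<Sum>i<2. f i v * e i v j)"
  if W: "zopen X W" "W \<subseteq> U" "s \<in> E W" for W s
 proof -
  obtain f where f: "\<forall>i<2. f i \<in> regular X W" "s = (\<lambda>v j. \<Sum>i<2. f i v * g i v j)"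
   using frameD(4)[OF g W(1) _ W(3)] W(2) U(3) by blast
  have bW: "(\<lambda>w. if w \<in> W then b0 w else 0) \<in> regular X W" "(\<lambda>w. if w \<in> W then b1 w else 0) \<in> regular X W"
   using tf_restrict[OF b(1) W(1)] tf_restrict[OF b(2) W(1)] W(2) by (auto simp: U_def)
  have ib: "(\<lambda>w. inverse (if w \<in> W then b0 w else 0)) \<in> regular X W"
   using tf_inverse[OF bW(1)] W(2) by (auto simp: U_def)
  define q where "q w = f 0 w * inverse (if w \<in> W then b0 w else 0)" for w
  define p where "p w = f 1 w - q w * (if w \<in> W then b1 w else 0)" for w
  have f01: "f 0 \<in> regular X W" "f 1 \<in> regular X W" using f(1) by auto
  have q: "q \<in> regular X W" unfolding q_def[abs_def] by (rule regular_mult[OF f01(1) ib])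
  have p: "p \<in> regular X W" unfolding p_def[abs_def] by (rule tf_diff[OF f01(2) regular_mult[OF q bW(2)] W(1)])
  have "s = (\<lambda>v j. \<Sum>i<2. (if i = 0 then q else p) v * e i v j)"
  proof (intro ext)
   fix w j
   show "s w j = (\<Sum>i<2. (if i = 0 then q else p) w * e i w j)"
   proof (cases "w \<in> W")
    case True
    then have wU: "w \<in> U" using W(2) by blast
    have nz: "b0 w \<noteq> 0" using wU by (simp add: U_def)
    show ?thesis using True nz val[OF wU] by (simp add: f(2) numeral_2_eq_2 p_def q_def field_simps)
   next
    case False
    have "s w j = 0" using sheafD(1)[OF EM W(1) W(3) False] .
    then show ?thesis using tf_out[OF q False] tf_out[OF p False] by (simp add: numeral_2_eq_2)
   qed
  qed
  then show ?thesis using p q by (intro exI[of _ "\<lambda>i. if i = 0 then q else p"]) auto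
 qed
 have "local_frame X E 2 U e" unfolding local_frame_def using U(1) eE ind gen by blast
 moreover have "local_frame X L (Suc 0) U e"
 proof -
  have "local_frame X L (Suc 0) U (\<lambda>i. restr U (l i))" by (rule frame_restrict[OF LM l(1) U(1,2)])
  moreover have "restr U (l 0) = e 0" by (simp add: e_def)
  ultimately show ?thesis unfolding local_frame_def independent_values_def by simp
 qed
 ultimately show ?thesis using U(4) by blast
qed

lemma frame_swap: assumes "local_frame X E 2 U g" shows "local_frame X E 2 U (\<lambda>i. g (1 - i))"
 unfolding local_frame_def
proof (intro conjI allI impI ballI)
 show "zopen X U" by (rule frameD(1)[OF assms])
 show "g (1 - i) \<in> E U" if "i < 2" for i using frameD(2)[OF assms, of "1 - i"] by simp
 show "independent_values 2 (\<lambda>i. g (1 - i)) v" if "v \<in> U" for v unfolding independent_2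
 proof (intro allI impI)
  fix a b assume "\<forall>l. a * g (1 - 0) v l + b * g (1 - 1) v l = 0"
  then have "\<forall>l. b * g 0 v l + a * g 1 v l = 0" by (simp add: add.commute)
  then have "b = 0 \<and> a = 0" using frameD(3)[OF assms that, unfolded independent_2] by blast
  then show "a = 0 \<and> b = 0" by blast
 qed
 fix W s assume A: "zopen X W \<and> W \<subseteq> U \<and> s \<in> E W"
 then obtain f where f: "\<forall>i<2. f i \<in> regular X W" "s = (\<lambda>v j. \<Sum>i<2. f i v * g i v j)"
  using frameD(4)[OF assms, of W s] by blast
 have "s = (\<lambda>v j. \<Sum>i<2. f (1 - i) v * g (1 - i) v j)"
  unfolding f(2) by (intro ext) (simp add: numeral_2_eq_2)
 moreover have "\<forall>i<2. f (1 - i) \<in> regular X W" using f(1) by simp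
 ultimately show "\<exists>f. (\<forall>i<2. f i \<in> regular X W) \<and> s = (\<lambda>v j. \<Sum>i<2. f i v * g (1 - i) v j)"
  by (intro exI[of _ "\<lambda>i. f (1 - i)"]) blast
qed

lemma adapted_frame:
 assumes E: "vector_bundle_rank X 2 E" and L: "vector_bundle_rank X (Suc 0) L"
  and sub: "\<And>U. zopen X U \<Longrightarrow> L U \<subseteq> E U" and v: "v \<in> X"
 shows "\<exists>U e. v \<in> U \<and> local_frame X E 2 U e \<and> local_frame X L (Suc 0) U e"
proof -
 note EM = vbrD(1)[OF E] and LM = vbrD(1)[OF L]
 obtain U1 l where l: "v \<in> U1" "local_frame X L (Suc 0) U1 l" using vbrD(2)[OF L v] by blast
 obtain U2 g where g: "v \<in> U2" "local_frame X E 2 U2 g" using vbrD(2)[OF E v] by blast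
 have o: "zopen X U1" "zopen X U2" using frameD(1)[OF l(2)] frameD(1)[OF g(2)] .
 have lE: "l 0 \<in> E U1" using frameD(2)[OF l(2), of 0] sub[OF o(1)] by blast
 obtain b where b: "\<forall>i<2. \<forall>j<Suc 0. b i j \<in> regular X (U2 \<inter> U1)"
  "\<forall>w\<in>U2 \<inter> U1. \<forall>j<Suc 0. \<forall>k. l j w k = (\<Sum>i<2. b i j w * g i w k)"
  using frame_coeffs[OF EM g(2), of "Suc 0" l U1] lE o(1) by auto
 have br: "b 0 0 \<in> regular X (U1 \<inter> U2)" "b 1 0 \<in> regular X (U1 \<inter> U2)" using b(1) by (simp_all add: Int_commute)
 have bl: "l 0 w k = b 0 0 w * g 0 w k + b 1 0 w * g 1 w k" if "w \<in> U1 \<inter> U2" for w k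
  using b(2) that by (simp add: numeral_2_eq_2)
 have vv: "v \<in> U1 \<inter> U2" using l(1) g(1) by blast
 have "\<exists>k. l 0 v k \<noteq> 0" using frameD(3)[OF l(2,1)] by (simp add: independent_1)
 then have "b 0 0 v \<noteq> 0 \<or> b 1 0 v \<noteq> 0" using bl[OF vv] by auto
 then show ?thesis
 proof
  assume "b 0 0 v \<noteq> 0"
  from adapted_frame_aux[OF EM l(2) lE LM g(2) br bl vv this] show ?thesis by blast
 next
  assume nz: "b 1 0 v \<noteq> 0"
  show ?thesis
   by (rule adapted_frame_aux[OF EM l(2) lE LM frame_swap[OF g(2)] br(2,1) _ vv nz]) (simp add: bl add.commute)
 qed
qed

section \<open>Quotient line bundles\<close>

text \<open>At each point w a linear form \<open>\<beta> w\<close> on the fibre of E with kernel the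
  fibre of L is chosen, with no compatibility between points. Sections of Q are the functions
  arising locally when it is applied to sections of E. Ratios of such functions do not depend on the
  choices, so Q is locally free, and degrees add up by a triangular determinant.\<close>

theorem quotient_exists:
 assumes E: "vector_bundle_rank X 2 E" and L: "vector_bundle_rank X (Suc 0) L"
  and sub: "\<And>U. zopen X U \<Longrightarrow> L U \<subseteq> E U" shows "\<exists>Q. quotient_bundle X E L Q \<and> vector_bundle_rank X (Suc 0) Q \<and>
  bundle_degree X Q = bundle_degree X E - bundle_degree X L"
proof -
 note EM = vbrD(1)[OF E] and LM = vbrD(1)[OF L]
 have "\<forall>v. \<exists>U. \<exists>e. v \<in> X \<longrightarrow> v \<in> U \<and> local_frame X E 2 U e \<and> local_frame X L (Suc 0) U e"
  using adapted_frame[OF E L sub] by blast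
 from choice[OF this] obtain N where "\<forall>v. \<exists>e. v \<in> X \<longrightarrow> v \<in> N v \<and> local_frame X E 2 (N v) e \<and> local_frame X L (Suc 0) (N v) e" ..
 from choice[OF this] obtain e where
  "\<forall>v. v \<in> X \<longrightarrow> v \<in> N v \<and> local_frame X E 2 (N v) (e v) \<and> local_frame X L (Suc 0) (N v) (e v)" ..
 then have N: "v \<in> N v" "local_frame X E 2 (N v) (e v)" "local_frame X L (Suc 0) (N v) (e v)" "zopen X (N v)"
  "e v 1 \<in> E (N v)" "e v 0 \<in> L (N v)" if "v \<in> X" for v using that frameD(1,2) by fastforce+
 have ind: "a = 0 \<and> b = 0" if "v \<in> X" "w \<in> N v" "\<And>l. a * e v 0 w l + b * e v 1 w l = 0" for v w a b
  using frameD(3)[OF N(2)[OF that(1)] that(2), unfolded independent_2] that(3) by blast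
 \<comment> \<open>The second coordinate in the adapted frame attached to w, used only at its own
   centre w.\<close>
 define \<beta> where "\<beta> w x = (THE b. \<exists>a. \<forall>l. x l = a * e w 0 w l + b * e w 1 w l)" for w and x :: "nat \<Rightarrow> 'k"
 have \<beta>: "\<beta> w x = b" if w: "w \<in> X" and x: "\<And>l. x l = a * e w 0 w l + b * e w 1 w l" for w x a b
  unfolding \<beta>_def
 proof (rule the_equality)
  show "\<exists>a. \<forall>l. x l = a * e w 0 w l + b * e w 1 w l" using x by blast
  fix b' assume "\<exists>a. \<forall>l. x l = a * e w 0 w l + b' * e w 1 w l"
  then obtain a' where "\<And>l. x l = a' * e w 0 w l + b' * e w 1 w l" by blast
  then have "(a' - a) * e w 0 w l + (b' - b) * e w 1 w l = 0" for l using x[of l] by (simp add: algebra_simps)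
  from ind[OF w N(1)[OF w] this] show "b' = b" by simp
 qed
 have frm: "\<exists>f g. f \<in> regular X (N v \<inter> W) \<and> g \<in> regular X (N v \<inter> W) \<and>
   (\<forall>w\<in>N v \<inter> W. \<forall>l. s w l = f w * e v 0 w l + g w * e v 1 w l)"
  if v: "v \<in> X" and W: "zopen X W" "s \<in> E W" for v W s
 proof -
  obtain b where b: "\<forall>i<2. \<forall>j<Suc 0. b i j \<in> regular X (N v \<inter> W)"
   "\<forall>w\<in>N v \<inter> W. \<forall>j<Suc 0. \<forall>l. s w l = (\<Sum>i<2. b i j w * e v i w l)"
   using frame_coeffs[OF EM N(2)[OF v], of "Suc 0" "\<lambda>_. s" W] W by blast
  then show ?thesis by (intro exI[of _ "b 0 0"] exI[of _ "b 1 0"]) (simp add: numeral_2_eq_2)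
 qed
 have lin: "\<exists>a. \<forall>l. s w l = a * e w 0 w l + \<beta> w (s w) * e w 1 w l" and wX: "w \<in> X"
  if U: "zopen X U" "s \<in> E U" "w \<in> U" for U s w
 proof -
  show w: "w \<in> X" using U zopen_sub by blast
  then obtain a b where "\<And>l. s w l = a * e w 0 w l + b * e w 1 w l" using frm[OF w U(1,2)] N(1) U(3) by blast
  then show "\<exists>a. \<forall>l. s w l = a * e w 0 w l + \<beta> w (s w) * e w 1 w l" using \<beta>[OF w] by metis
 qed
 have \<beta>comb: "\<beta> w (\<lambda>l. c * s w l + d * t w l) = c * \<beta> w (s w) + d * \<beta> w (t w)"
  if s: "zopen X U" "s \<in> E U" "w \<in> U" and t: "zopen X U'" "t \<in> E U'" "w \<in> U'" for U U' s t w c d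
 proof -
  obtain a b where "\<forall>l. s w l = a * e w 0 w l + \<beta> w (s w) * e w 1 w l" "\<forall>l. t w l = b * e w 0 w l + \<beta> w (t w) * e w 1 w l"
   using lin[OF s] lin[OF t] by blast
  then have "c * s w l + d * t w l = (c * a + d * b) * e w 0 w l + (c * \<beta> w (s w) + d * \<beta> w (t w)) * e w 1 w l" for l
   by (simp only:) (simp add: algebra_simps)
  from \<beta>[OF wX[OF s] this] show ?thesis .
 qed
 have \<beta>0: "\<beta> w (\<lambda>l. 0) = 0" if "w \<in> X" for w by (rule \<beta>[OF that, of _ 0]) simp
 have Lfib: "\<exists>a. \<forall>l. s w l = a * e w 0 w l" if U: "zopen X U" "w \<in> U" and s: "s \<in> L U" for U w s
 proof -
  have wX: "w \<in> X" using U zopen_sub by blast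
  obtain b where "\<forall>u\<in>N w \<inter> U. \<forall>j<Suc 0. \<forall>l. s u l = (\<Sum>i<Suc 0. b i j u * e w i u l)"
   using frame_coeffs[OF LM N(3)[OF wX], of "Suc 0" "\<lambda>_. s" U] s U by blast
  then show ?thesis using U(2) N(1)[OF wX] by auto
 qed
 have \<beta>L: "\<beta> w (s w) = 0" if U: "zopen X U" "w \<in> U" and s: "s \<in> L U" for U w s
  using Lfib[OF that] \<beta>[of w "s w" _ 0] U zopen_sub by fastforce
 have co: "\<exists>f g. f \<in> regular X (N v \<inter> W) \<and> g \<in> regular X (N v \<inter> W) \<and>
   (\<forall>w\<in>N v \<inter> W. (\<forall>l. s w l = f w * e v 0 w l + g w * e v 1 w l) \<and> \<beta> w (s w) = g w * \<beta> w (e v 1 w))"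
  if v: "v \<in> X" and W: "zopen X W" "s \<in> E W" for v W s
 proof -
  obtain f g where 1: "f \<in> regular X (N v \<inter> W)" "g \<in> regular X (N v \<inter> W)"
   "\<forall>w\<in>N v \<inter> W. \<forall>l. s w l = f w * e v 0 w l + g w * e v 1 w l" using frm[OF v W] by blast
  have "\<beta> w (s w) = g w * \<beta> w (e v 1 w)" if w: "w \<in> N v" "w \<in> W" for w
  proof -
   have "s w = (\<lambda>l. f w * e v 0 w l + g w * e v 1 w l)" using 1(3) w by blast
   moreover have "e v 0 \<in> E (N v)" using N(4,6)[OF v] sub by blast
   ultimately show ?thesis
    using \<beta>comb[OF N(4)[OF v] _ w(1) N(4,5)[OF v] w(1), of "e v 0"] \<beta>L[OF N(4)[OF v] w(1) N(6)[OF v]] by simp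
  qed
  with 1 show ?thesis by blast
 qed
 have nz: "\<beta> w (e v 1 w) \<noteq> 0" if v: "v \<in> X" and w: "w \<in> N v" for v w
 proof
  assume z: "\<beta> w (e v 1 w) = 0"
  obtain a where a: "\<forall>l. e v 1 w l = a * e w 0 w l" using lin[OF N(4,5)[OF v] w] unfolding z by auto
  obtain c where c: "\<forall>l. e v 0 w l = c * e w 0 w l" using Lfib[OF N(4)[OF v] w N(6)[OF v]] by blast
  have "(- a) * e v 0 w l + c * e v 1 w l = 0" for l using a c by (simp add: mult_ac)
  from ind[OF v w this] have "e v 0 w l = 0" for l using c by simp
  then show False using ind[OF v w, of 1 0] by simp
 qed
 define Q where "Q U = {t :: 'k sheaf_section. (\<forall>w j. (w \<notin> U \<or> j \<noteq> 0) \<longrightarrow> t w j = 0) \<and>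
  (\<forall>v\<in>U. \<exists>W s. zopen X W \<and> v \<in> W \<and> W \<subseteq> U \<and> s \<in> E W \<and> (\<forall>w\<in>W. t w 0 = \<beta> w (s w)))}" for U
 have Q1: "t w j = 0" if "t \<in> Q U" "w \<notin> U \<or> j \<noteq> 0" for t U w j using that unfolding Q_def by blast
 have Q2: "\<exists>W s. zopen X W \<and> v \<in> W \<and> W \<subseteq> U \<and> s \<in> E W \<and> (\<forall>w\<in>W. t w 0 = \<beta> w (s w))"
  if "t \<in> Q U" "v \<in> U" for t U v using that unfolding Q_def by blast
 have QI: "t \<in> Q U" if "\<And>w j. w \<notin> U \<or> j \<noteq> 0 \<Longrightarrow> t w j = 0"
   "\<And>v. v \<in> U \<Longrightarrow> \<exists>W s. zopen X W \<and> v \<in> W \<and> W \<subseteq> U \<and> s \<in> E W \<and> (\<forall>w\<in>W. t w 0 = \<beta> w (s w))" for t U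
  using that unfolding Q_def by blast
 have QM: "module_sheaf X Q" unfolding module_sheaf_def
 proof (intro allI impI conjI ballI)
  fix U assume U: "zopen X U"
  show "s v j = 0" if "s \<in> Q U" "v \<notin> U" for s v j using Q1 that by blast
  show "(\<lambda>v j. 0) \<in> Q U"
  proof (rule QI)
   show "\<exists>W s. zopen X W \<and> v \<in> W \<and> W \<subseteq> U \<and> s \<in> E W \<and> (\<forall>w\<in>W. 0 = \<beta> w (s w))" if "v \<in> U" for v
    using U that sheafD(2)[OF EM U] \<beta>0 zopen_sub[OF U] by (intro exI[of _ U] exI[of _ "\<lambda>v j. 0"]) auto
  qed simp
  show "(\<lambda>v j. s v j + t v j) \<in> Q U" if s: "s \<in> Q U" and t: "t \<in> Q U" for s t
  proof (rule QI)
   show "s w j + t w j = 0" if "w \<notin> U \<or> j \<noteq> 0" for w j using Q1[OF s that] Q1[OF t that] by simp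
   fix v assume v: "v \<in> U"
   obtain A x where x: "zopen X A" "v \<in> A" "A \<subseteq> U" "x \<in> E A" "\<forall>w\<in>A. s w 0 = \<beta> w (x w)" using Q2[OF s v] by blast
   obtain B y where y: "zopen X B" "v \<in> B" "B \<subseteq> U" "y \<in> E B" "\<forall>w\<in>B. t w 0 = \<beta> w (y w)" using Q2[OF t v] by blast
   have o: "zopen X (A \<inter> B)" using x(1) y(1) by blast
   let ?z = "\<lambda>w j. restr (A \<inter> B) x w j + restr (A \<inter> B) y w j"
   have "?z \<in> E (A \<inter> B)"
    using sheafD(3)[OF EM o sheafD(5)[OF EM x(1) o Int_lower1 x(4)] sheafD(5)[OF EM y(1) o Int_lower2 y(4)]] .
   moreover have "s w 0 + t w 0 = \<beta> w (?z w)" if "w \<in> A \<inter> B" for w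
    using \<beta>comb[OF x(1,4) _ y(1,4), of w 1 1] x(5) y(5) that by (simp add: restr_def)
   ultimately show "\<exists>W r. zopen X W \<and> v \<in> W \<and> W \<subseteq> U \<and> r \<in> E W \<and> (\<forall>w\<in>W. s w 0 + t w 0 = \<beta> w (r w))"
    using o x(2,3) y(2) by blast
  qed
  show "(\<lambda>v j. f v * s v j) \<in> Q U" if f: "f \<in> regular X U" and s: "s \<in> Q U" for f s
  proof (rule QI)
   show "f w * s w j = 0" if "w \<notin> U \<or> j \<noteq> 0" for w j using Q1[OF s that] by simp
   fix v assume v: "v \<in> U"
   obtain A x where x: "zopen X A" "v \<in> A" "A \<subseteq> U" "x \<in> E A" "\<forall>w\<in>A. s w 0 = \<beta> w (x w)" using Q2[OF s v] by blast
   have "f w * s w 0 = \<beta> w (\<lambda>j. (if w \<in> A then f w else 0) * x w j)" if "w \<in> A" for w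
    using \<beta>comb[OF x(1,4) that x(1,4) that, of "f w" 0] x(5) that by simp
   then show "\<exists>W r. zopen X W \<and> v \<in> W \<and> W \<subseteq> U \<and> r \<in> E W \<and> (\<forall>w\<in>W. f w * s w 0 = \<beta> w (r w))"
    using x(1-3) sheafD(4)[OF EM x(1) tf_restrict[OF f x(1,3)] x(4)] by blast
  qed
  show "restr W s \<in> Q W" if A: "zopen X W \<and> W \<subseteq> U \<and> s \<in> Q U" for W s
  proof (rule QI)
   show "restr W s w j = 0" if "w \<notin> W \<or> j \<noteq> 0" for w j using Q1[of s U w j] A that by (auto simp: restr_def)
   fix v assume v: "v \<in> W"
   obtain B x where x: "zopen X B" "v \<in> B" "x \<in> E B" "\<forall>w\<in>B. s w 0 = \<beta> w (x w)" using Q2[of s U v] A v by blast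
   have o: "zopen X (B \<inter> W)" using A x(1) by blast
   show "\<exists>V r. zopen X V \<and> v \<in> V \<and> V \<subseteq> W \<and> r \<in> E V \<and> (\<forall>w\<in>V. restr W s w 0 = \<beta> w (r w))"
    using o v x(2,4) sheafD(5)[OF EM x(1) o Int_lower1 x(3)]
    by (intro exI[of _ "B \<inter> W"] exI[of _ "restr (B \<inter> W) x"]) (simp add: restr_def)
  qed
  fix s :: "'k sheaf_section"
  assume A: "(\<forall>v. v \<notin> U \<longrightarrow> (\<forall>j. s v j = 0)) \<and>
     (\<forall>v\<in>U. \<exists>W. zopen X W \<and> v \<in> W \<and> W \<subseteq> U \<and> restr W s \<in> Q W)"
  show "s \<in> Q U"
  proof (rule QI)
   fix v assume v: "v \<in> U"
   obtain W where W: "v \<in> W" "W \<subseteq> U" "restr W s \<in> Q W" using A v by blast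
   obtain B x where x: "zopen X B" "v \<in> B" "B \<subseteq> W" "x \<in> E B" "\<forall>w\<in>B. restr W s w 0 = \<beta> w (x w)" using Q2[OF W(3,1)] by blast
   then show "\<exists>W r. zopen X W \<and> v \<in> W \<and> W \<subseteq> U \<and> r \<in> E W \<and> (\<forall>w\<in>W. s w 0 = \<beta> w (r w))"
    using W(2) by (intro exI[of _ B] exI[of _ x]) (auto simp: restr_def subset_iff)
  next
   show "s w j = 0" if "w \<notin> U \<or> j \<noteq> 0" for w j
   proof (cases "w \<in> U")
    case True
    then obtain W where W: "w \<in> W" "restr W s \<in> Q W" using A by blast
    then show ?thesis using Q1[OF W(2), of w j] that True by (simp add: restr_def)
   qed (use A in blast)
  qed
 qed
 define \<phi> where "\<phi> U s = (\<lambda>v j. if v \<in> U \<and> j = (0::nat) then \<beta> v (s v) else 0)" for U :: "'k pt set" and s :: "'k sheaf_section"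
 have \<phi>Q: "\<phi> U s \<in> Q U" if "zopen X U" "s \<in> E U" for U s
  by (rule QI) (use that in \<open>auto simp: \<phi>_def intro!: exI[of _ U] exI[of _ s]\<close>)
 \<comment> \<open>The image of the second frame vector. Its values jump with the choice of forms,
   but those of every section of Q jump by the same factor.\<close>
 define q where "q v = \<phi> (N v) (e v 1)" for v
 have q: "q v w j = (if w \<in> N v \<and> j = 0 then \<beta> w (e v 1 w) else 0)" for v w j by (simp add: q_def \<phi>_def)
 have Qf: "local_frame X Q (Suc 0) (N v) (\<lambda>_. q v)" if v: "v \<in> X" for v unfolding local_frame_def
 proof (intro conjI allI impI ballI)
  show "zopen X (N v)" by (rule N(4)[OF v])
  show "q v \<in> Q (N v)" unfolding q_def by (rule \<phi>Q[OF N(4,5)[OF v]])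
  show "independent_values (Suc 0) (\<lambda>_. q v) w" if w: "w \<in> N v" for w
   unfolding independent_1 using nz[OF v w] w by (intro exI[of _ 0]) (simp add: q)
  fix W t assume A: "zopen X W \<and> W \<subseteq> N v \<and> t \<in> Q W"
  define g where "g w = t w 0 / q v w 0" for w
  have "g \<in> regular X W"
  proof (rule tf_glue)
   show "g w = 0" if "w \<notin> W" for w using Q1[of t W w 0] A that by (simp add: g_def)
   fix u assume u: "u \<in> W"
   obtain B s where s: "zopen X B" "u \<in> B" "B \<subseteq> W" "s \<in> E B" "\<forall>w\<in>B. t w 0 = \<beta> w (s w)" using Q2[of t W u] A u by blast
   obtain h where h: "h \<in> regular X (N v \<inter> B)" "\<forall>w\<in>N v \<inter> B. \<beta> w (s w) = h w * \<beta> w (e v 1 w)" using co[OF v s(1,4)] by blast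
   have "\<forall>w\<in>N v \<inter> B. g w = h w" using h(2) s(5) nz[OF v] by (simp add: g_def q)
   then show "\<exists>B h. zopen X B \<and> u \<in> B \<and> B \<subseteq> W \<and> h \<in> regular X B \<and> (\<forall>w\<in>B. g w = h w)"
    using h(1) s(1-3) u A N(4)[OF v] by (intro exI[of _ "N v \<inter> B"] exI[of _ h]) blast
  qed
  moreover have "t w j = g w * q v w j" for w j
  proof (cases "w \<in> W \<and> j = 0")
   case True
   then show ?thesis using A nz[OF v, of w] by (auto simp: g_def q)
  next
   case False
   then have "t w j = 0" using Q1[of t W w j] A by blast
   then show ?thesis using False Q1[of t W w 0] A by (auto simp: g_def q)
  qed
  ultimately show "\<exists>f. (\<forall>i<Suc 0. f i \<in> regular X W) \<and> t = (\<lambda>w j. \<Sum>i<Suc 0. f i w * q v w j)"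
   by (intro exI[of _ "\<lambda>_. g"]) (simp add: fun_eq_iff)
 qed
 have QV: "vector_bundle_rank X (Suc 0) Q" unfolding vector_bundle_rank_def using QM Qf N(1) by blast
 have hom: "sheaf_hom X E Q \<phi>" unfolding sheaf_hom_def
 proof (intro allI impI conjI ballI)
  fix U assume U: "zopen X U"
  show "\<phi> U s \<in> Q U" if s: "s \<in> E U" for s by (rule \<phi>Q[OF U s])
  show "\<phi> U (\<lambda>v j. s v j + t v j) = (\<lambda>v j. \<phi> U s v j + \<phi> U t v j)" if s: "s \<in> E U" and t: "t \<in> E U" for s t
   using \<beta>comb[OF U s _ U t, of _ 1 1] by (simp add: \<phi>_def fun_eq_iff)
  show "\<phi> U (\<lambda>v j. f v * s v j) = (\<lambda>v j. f v * \<phi> U s v j)" if "f \<in> regular X U" and s: "s \<in> E U" for f s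
   using \<beta>comb[OF U s _ U s, of _ _ 0] by (simp add: \<phi>_def fun_eq_iff)
  show "\<phi> W (restr W s) = restr W (\<phi> U s)" if A: "zopen X W \<and> W \<subseteq> U \<and> s \<in> E U" for W s
  proof (intro ext)
   fix w j
   have "restr W s w = s w" if "w \<in> W" using that by (simp add: restr_def)
   then show "\<phi> W (restr W s) w j = restr W (\<phi> U s) w j" using A by (auto simp: \<phi>_def restr_def)
  qed
 qed
 have ker: "{s \<in> E U. \<phi> U s = (\<lambda>v j. 0)} = L U" if U: "zopen X U" for U
 proof (intro equalityI subsetI CollectI)
  fix s assume s: "s \<in> L U"
  then show "s \<in> E U \<and> \<phi> U s = (\<lambda>v j. 0)" using \<beta>L[OF U _ s] sub[OF U] by (auto simp: \<phi>_def intro!: ext)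
 next
  fix s assume "s \<in> {s \<in> E U. \<phi> U s = (\<lambda>v j. 0)}"
  then have s: "s \<in> E U" "\<phi> U s = (\<lambda>v j. 0)" by auto
  have z: "\<beta> w (s w) = 0" if "w \<in> U" for w using fun_cong[OF fun_cong[OF s(2), of w], of 0] that by (simp add: \<phi>_def)
  show "s \<in> L U"
  proof (rule sheafD(6)[OF LM U])
   show "s v j = 0" if "v \<notin> U" for v j using sheafD(1)[OF EM U s(1) that] .
   fix v assume vU: "v \<in> U"
   have v: "v \<in> X" using vU zopen_sub[OF U] by blast
   have o: "zopen X (N v \<inter> U)" using U N(4)[OF v] by blast
   obtain f g where f: "f \<in> regular X (N v \<inter> U)" "\<forall>w\<in>N v \<inter> U. (\<forall>l. s w l = f w * e v 0 w l + g w * e v 1 w l) \<and>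
    \<beta> w (s w) = g w * \<beta> w (e v 1 w)" using co[OF v U s(1)] by blast
   have "s w l = f w * e v 0 w l" if w: "w \<in> N v \<inter> U" for w l using f(2) w z[of w] nz[OF v, of w] by simp
   then have "restr (N v \<inter> U) s = (\<lambda>w l. f w * restr (N v \<inter> U) (e v 0) w l)" by (auto simp: restr_def fun_eq_iff)
   then have "restr (N v \<inter> U) s \<in> L (N v \<inter> U)"
    using sheafD(4)[OF LM o f(1) sheafD(5)[OF LM N(4)[OF v] o Int_lower1 N(6)[OF v]]] by simp
   then show "\<exists>W. zopen X W \<and> v \<in> W \<and> W \<subseteq> U \<and> restr W s \<in> L W" using o vU N(1)[OF v] by blast
  qed
 qed
 have surj: "\<exists>U' s. zopen X U' \<and> v \<in> U' \<and> U' \<subseteq> U \<and> s \<in> E U' \<and> \<phi> U' s = restr U' t"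
  if A: "zopen X U \<and> t \<in> Q U \<and> v \<in> U" for U t v
 proof -
  obtain W s where s: "zopen X W" "v \<in> W" "W \<subseteq> U" "s \<in> E W" "\<forall>w\<in>W. t w 0 = \<beta> w (s w)" using Q2[of t U v] A by blast
  then have "\<phi> W s = restr W t" using Q1[of t U] A by (auto simp: \<phi>_def restr_def fun_eq_iff)
  then show ?thesis using s by blast
 qed
 have "quotient_bundle X E L Q"
  unfolding quotient_bundle_def subbundle_def vector_bundle_def using E L sub QV hom ker surj by blast
 moreover have "bundle_degree X Q = bundle_degree X E - bundle_degree X L"
 proof -
  obtain v0 where v0: "v0 \<in> X" using X_nonempty by blast
  have ne: "N v0 \<noteq> {}" using N(1)[OF v0] by blast
  let ?dE = "det_ord X E 2 (N v0) (e v0)" and ?dL = "det_ord X L (Suc 0) (N v0) (e v0)" and ?dQ = "det_ord X Q (Suc 0) (N v0) (\<lambda>_. q v0)"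
  have key: "?dE P = ?dL P + ?dQ P" if P: "P \<in> points X" for P
  proof -
   obtain v where v: "v \<in> X" "P = proj_point v" using pointsE[OF P] by blast
   have o: "zopen X (N v \<inter> N v0)" "N v \<inter> N v0 \<noteq> {}"
    using N(4)[OF v0] N(4)[OF v(1)] gen_inter_nonempty ne N(1)[OF v(1)] by blast+
   obtain a where a: "GEN w. \<forall>j<Suc 0. \<forall>l. e v0 j w l = (\<Sum>i<Suc 0. a i j w * e v i w l)"
    "hasord v (dm (Suc 0) a) (?dL (proj_point v))"
    using det_ord_frame[OF LM _ N(3)[OF v0] ne N(3,1)[OF v(1)]] by blast
   obtain c where c: "GEN w. \<forall>j<Suc 0. \<forall>l. q v0 w l = (\<Sum>i<Suc 0. c i j w * q v w l)"
    "hasord v (dm (Suc 0) c) (?dQ (proj_point v))"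
    using det_ord_frame[OF QM _ Qf[OF v0] ne Qf[OF v(1)] N(1)[OF v(1)]] by blast
   obtain f g where fg: "\<forall>w\<in>N v \<inter> N v0. (\<forall>l. e v0 1 w l = f w * e v 0 w l + g w * e v 1 w l) \<and>
    \<beta> w (e v0 1 w) = g w * \<beta> w (e v 1 w)" using co[OF v(1) N(4,5)[OF v0]] by blast
   \<comment> \<open>Triangular transition matrix: the first vector involves only the generator of
     L, and the last diagonal entry is the transition of Q.\<close>
   define m where "m i j w = (if j = (0::nat) then (if i = (0::nat) then a 0 0 w else 0) else (if i = 0 then f w else c 0 0 w))" for i j w
   have "dm 2 m = (\<lambda>w. dm (Suc 0) a w * dm (Suc 0) c w)" by (intro ext) (simp add: dm_1 dm_2 m_def)
   then have d: "hasord v (dm 2 m) (?dL (proj_point v) + ?dQ (proj_point v))" using hasord_mult[OF v(1) a(2) c(2)] by simp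
   have "GEN w. \<forall>j<2. \<forall>l. e v0 j w l = (\<Sum>i<2. m i j w * e v i w l)" using a(1) c(1) gen_frame[OF o]
   proof eventually_elim
    case (elim w)
    have "q v0 w 0 = c 0 0 w * q v w 0" using elim(2) by simp
    then have "c 0 0 w = g w" using fg elim(3) nz[OF v(1), of w] by (simp add: q)
    then show ?case using elim(1,3) fg by (simp add: m_def numeral_2_eq_2 less_Suc_eq)
   qed
   from det_ord_eq[OF EM _ N(2)[OF v0] ne N(2,1)[OF v(1)] this d] show ?thesis by (simp add: v(2))
  qed
  have s: "fsup ?dL" "fsup ?dQ"
   using fsup_det_ord[OF LM _ N(3)[OF v0] ne] fsup_det_ord[OF QM _ Qf[OF v0] ne] by simp_all
  show ?thesis
   using bundle_degree_eq[OF E _ N(2)[OF v0] ne] bundle_degree_eq[OF L _ N(3)[OF v0] ne] bundle_degree_eq[OF QV _ Qf[OF v0] ne]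
    dsum_cong[OF key] dsum_add[OF s] by simp
 qed
 ultimately show ?thesis using QV by blast
qed

end

section \<open>Syzygy bundles\<close>

definition co :: "nat \<Rightarrow> 'k::field pt \<Rightarrow> 'k" where
 "co j v = (if j = 0 then fst v else if j = 1 then cy v else cz v)"

lemma form_co: "form (Suc 0) (co j)" unfolding co_def[abs_def] by (cases "j = 0"; cases "j = 1") simp_all

lemma sum_lt3: "(\<Sum>j<3. f j) = f 0 + f 1 + f (2::nat)" for f :: "nat \<Rightarrow> 'a::comm_monoid_add"
 by (simp add: numeral_3_eq_3 numeral_2_eq_2)

lemma perm3_D: assumes "{k, a, b} = {0, 1, 2::nat}"
 shows "k < 3" "a < 3" "b < 3" "k \<noteq> a" "k \<noteq> b" "a \<noteq> b" "\<And>j. j < 3 \<Longrightarrow> j = k \<or> j = a \<or> j = b"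
proof -
 have "k \<in> {0,1,2}" "a \<in> {0,1,2}" "b \<in> {0,1,2}" using assms by blast+
 then show "k < 3" "a < 3" "b < 3" by auto
 have "card {k, a, b} = 3" unfolding assms by simp
 then show "k \<noteq> a" "k \<noteq> b" "a \<noteq> b" by (auto simp: card_insert_if split: if_splits)
 show "j = k \<or> j = a \<or> j = b" if "j < 3" for j
 proof -
  have "j \<in> {0, 1, 2}" using that by auto
  then show ?thesis unfolding assms[symmetric] by blast
 qed
qed

lemma sum_perm3:
 assumes "{k, a, b} = {0, 1, 2::nat}" shows "(\<Sum>j<3. f j) = f k + f a + (f b :: 'a::comm_monoid_add)"
proof -
 have "{..<3::nat} = {k, a, b}" unfolding assms by auto
 then show ?thesis using perm3_D[OF assms] by (simp add: add.assoc)
qed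

context trinomial_curve
begin

lemma proj_point_vertex:
 assumes v: "v \<in> X" "v \<notin> Xo"
 shows "fst v \<noteq> 0 \<Longrightarrow> proj_point v = Px" "cy v \<noteq> 0 \<Longrightarrow> proj_point v = Py" "cz v \<noteq> 0 \<Longrightarrow> proj_point v = Pz"
proof -
 have e: "proj_point v = proj_point u" if "v = pscale a u" "a \<noteq> 0" for a u using that by simp
 show "proj_point v = Px" if f: "fst v \<noteq> 0"
  unfolding Px_def by (rule e[OF _ f]) (use v f in \<open>cases rule: vertex_cases; simp add: pscale_def prod_eq_iff\<close>)
 show "proj_point v = Py" if f: "cy v \<noteq> 0"
  unfolding Py_def by (rule e[OF _ f]) (use v f in \<open>cases rule: vertex_cases; simp add: pscale_def prod_eq_iff\<close>)
 show "proj_point v = Pz" if f: "cz v \<noteq> 0"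
  unfolding Pz_def by (rule e[OF _ f]) (use v f in \<open>cases rule: vertex_cases; simp add: pscale_def prod_eq_iff\<close>)
qed

lemma hasord_Xo: assumes v: "v \<in> Xo" shows "hasord v xz 0" "hasord v yy 0"
proof -
 have "xz v \<noteq> 0" "yy v \<noteq> 0" using v by (auto simp: xz_def yy_def Xo_def)
 moreover have "locv v xz (xz v)" unfolding xz_def[abs_def]
  by (rule locv_frac[of "Suc 0"]) (use v in \<open>simp_all add: Xo_def\<close>)
 ultimately show "hasord v xz 0" "hasord v yy 0" using hasord_locv locv_yy[OF v] by blast+
qed

text \<open>The divisor of x / z, of degree -1 - \<open>al\<close> + \<open>ee\<close> = 0; the
  table, with that of \<open>ordy\<close>, replaces case distinctions at the vertices by
  arithmetic.\<close>

definition ordx :: "'k pt set \<Rightarrow> int" where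
 "ordx P = (if P = Px then - 1 else if P = Py then - int al else if P = Pz then int ee else 0)"
definition ordy :: "'k pt set \<Rightarrow> int" where
 "ordy P = (if P = Px then int al else if P = Py then - int ee else if P = Pz then 1 else 0)"

lemma hasord_xz_yy: assumes v: "v \<in> X" shows "hasord v xz (ordx (proj_point v))" "hasord v yy (ordy (proj_point v))"
proof -
 have "hasord v xz (ordx (proj_point v)) \<and> hasord v yy (ordy (proj_point v))"
 proof (cases "v \<in> Xo")
  case True
  then show ?thesis using Xo_not_vertex[OF True] hasord_Xo[OF True] by (simp add: ordx_def ordy_def)
 next
  case False
  note pv = proj_point_vertex[OF v False]
  from v False show ?thesis
  proof (cases rule: vertex_cases)
   case 1
   then show ?thesis using pv(1)[OF 1(1)] hasord_vx[OF v False 1(1)] by (simp add: ordx_def ordy_def)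
  next
   case 2
   then show ?thesis using pv(2)[OF 2(2)] hasord_vy[OF v False 2(2)] points_vertices(4) by (simp add: ordx_def ordy_def)
  next
   case 3
   then show ?thesis using pv(3)[OF 3(3)] hasord_vz[OF v False 3(3)] points_vertices(5,6) by (simp add: ordx_def ordy_def)
  qed
 qed
 then show "hasord v xz (ordx (proj_point v))" "hasord v yy (ordy (proj_point v))" by auto
qed

end

text \<open>The section space has an arbitrary basis, so the \<open>q\<close>-th syzygy bundle of the coordinates is embedded in
 a trivial bundle of rank \<open>n\<close> through the mutually inverse matrices \<open>C\<close> and \<open>M\<close>.\<close>

locale syz_bundle = trinomial_curve +
 fixes n q :: nat and C M :: "nat \<Rightarrow> nat \<Rightarrow> 'a" and E :: "'a sheaf"
 assumes q_pos: "q > 0"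
  and CM: "\<And>j l. j < 3 \<Longrightarrow> l < 3 \<Longrightarrow> (\<Sum>i<n. C i j * M l i) = (if j = l then 1 else 0)"
  and MC: "\<And>i i'. i < n \<Longrightarrow> i' < n \<Longrightarrow> (\<Sum>j<3. M j i * C i' j) = (if i = i' then 1 else 0)"
  and E_eq: "\<And>U. zopen X U \<Longrightarrow> E U = {g \<in> trivial_bundle X n U.
   \<forall>v\<in>U. (\<Sum>j<3. (\<Sum>i<n. C i j * g v i) * co j v ^ q) = 0}"
begin

text \<open>\<open>dn\<close> passes from the components in the given basis to the three components
  in the coordinates and \<open>up\<close> passes back; the two matrix identities make them inverse,
  so syzygies are handled as triples.\<close>

definition dn :: "(nat \<Rightarrow> 'a) \<Rightarrow> nat \<Rightarrow> 'a" where "dn g j = (\<Sum>i<n. C i j * g i)"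
definition up :: "(nat \<Rightarrow> 'a) \<Rightarrow> nat \<Rightarrow> 'a" where "up f i = (if i < n then \<Sum>j<3. M j i * f j else 0)"

lemma dn_up: assumes "j < 3" shows "dn (up f) j = f j"
proof -
 have "dn (up f) j = (\<Sum>i<n. \<Sum>l<3. C i j * M l i * f l)" by (simp add: dn_def up_def sum_distrib_left mult.assoc)
 also have "\<dots> = (\<Sum>l<3. \<Sum>i<n. C i j * M l i * f l)" by (rule sum.swap)
 also have "\<dots> = (\<Sum>l<3. (\<Sum>i<n. C i j * M l i) * f l)" by (simp only: sum_distrib_right)
 also have "\<dots> = (\<Sum>l<3. if l = j then f l else 0)" by (intro sum.cong refl) (use CM assms in auto)
 finally show ?thesis using assms by (simp add: sum.delta)
qed

lemma up_dn: assumes "\<And>i. i \<ge> n \<Longrightarrow> g i = 0" shows "up (dn g) = g"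
proof
 fix i
 show "up (dn g) i = g i"
 proof (cases "i < n")
  case True
  have "up (dn g) i = (\<Sum>j<3. \<Sum>i'<n. M j i * C i' j * g i')" using True by (simp add: dn_def up_def sum_distrib_left mult.assoc)
  also have "\<dots> = (\<Sum>i'<n. \<Sum>j<3. M j i * C i' j * g i')" by (rule sum.swap)
  also have "\<dots> = (\<Sum>i'<n. (\<Sum>j<3. M j i * C i' j) * g i')" by (simp only: sum_distrib_right)
  also have "\<dots> = (\<Sum>i'<n. if i' = i then g i' else 0)" by (intro sum.cong refl) (use MC True in auto)
  finally show ?thesis using True by (simp add: sum.delta)
 qed (simp add: up_def assms)
qed

lemma dn_add: "dn (\<lambda>l. g l + h l) j = dn g j + dn h j"
 and dn_cmult: "dn (\<lambda>l. c * g l) j = c * dn g j"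
 and dn_zero [simp]: "dn (\<lambda>l. 0) j = 0"
 by (simp_all add: dn_def distrib_left sum.distrib sum_distrib_left mult.left_commute)

lemma up_cong: "(\<And>j. j < 3 \<Longrightarrow> f j = g j) \<Longrightarrow> up f = up g" by (intro ext) (simp add: up_def)

lemma up_comb: "up (\<lambda>j. a * f j + b * g j) l = a * up f l + b * up g l"
 by (simp add: up_def distrib_left sum.distrib sum_distrib_left mult.left_commute)

lemma up_cmult: "up (\<lambda>j. a * f j) l = a * up f l" by (simp add: up_def sum_distrib_left mult.left_commute)

lemma E_D:
 assumes "g \<in> E U" "zopen X U" shows "\<And>j. (\<lambda>v. dn (g v) j) \<in> regular X U" "\<And>v i. i \<ge> n \<Longrightarrow> g v i = 0"
  "\<And>v. v \<in> U \<Longrightarrow> (\<Sum>j<3. dn (g v) j * co j v ^ q) = 0" "\<And>v i. v \<notin> U \<Longrightarrow> g v i = 0"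
  "\<And>v. up (dn (g v)) = g v"
proof -
 have g: "\<forall>i<n. (\<lambda>v. g v i) \<in> regular X U" "\<forall>v. \<forall>i\<ge>n. g v i = 0"
  "\<forall>v\<in>U. (\<Sum>j<3. (\<Sum>i<n. C i j * g v i) * co j v ^ q) = 0"
  using assms unfolding E_eq[OF assms(2)] trivial_bundle_def by blast+
 show "(\<lambda>v. dn (g v) j) \<in> regular X U" for j
  unfolding dn_def by (intro regular_sum tf_cmult assms(2)) (use g(1) in auto)
 show i: "g v i = 0" if "i \<ge> n" for v i using g(2) that by blast
 show "(\<Sum>j<3. dn (g v) j * co j v ^ q) = 0" if "v \<in> U" for v using g(3) that by (simp add: dn_def)
 show "g v i = 0" if "v \<notin> U" for v i
  using g(1) i[of i v] tf_out[of "\<lambda>v. g v i" X 0 U v] that by (cases "i < n") auto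
 show "up (dn (g v)) = g v" for v by (rule up_dn) (rule i)
qed

lemma E_up:
 assumes U: "zopen X U" and f: "\<And>j. j < 3 \<Longrightarrow> f j \<in> regular X U"
  and rel: "\<And>v. v \<in> U \<Longrightarrow> (\<Sum>j<3. f j v * co j v ^ q) = 0" shows "(\<lambda>v. up (\<lambda>j. f j v)) \<in> E U"
proof -
 have "(\<lambda>v. up (\<lambda>j. f j v) i) \<in> regular X U" if "i < n" for i
  using that unfolding up_def by (simp add: U) (intro regular_sum tf_cmult U f; simp)
 moreover have "(\<Sum>j<3. (\<Sum>i<n. C i j * up (\<lambda>j. f j v) i) * co j v ^ q) = 0" if "v \<in> U" for v
 proof -
  have "(\<Sum>j<3. dn (up (\<lambda>j. f j v)) j * co j v ^ q) = (\<Sum>j<3. f j v * co j v ^ q)"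
   by (intro sum.cong refl) (simp add: dn_up)
  then show ?thesis using rel[OF that] by (simp add: dn_def)
 qed
 ultimately show ?thesis unfolding E_eq[OF U] trivial_bundle_def by (auto simp: up_def)
qed

lemma E_intro:
 assumes U: "zopen X U" and g: "\<And>i. i < n \<Longrightarrow> (\<lambda>v. g v i) \<in> regular X U" "\<And>v i. i \<ge> n \<Longrightarrow> g v i = 0"
  "\<And>v. v \<in> U \<Longrightarrow> (\<Sum>j<3. dn (g v) j * co j v ^ q) = 0" shows "g \<in> E U"
 using g unfolding E_eq[OF U] trivial_bundle_def dn_def by blast

lemma E_comp: "g \<in> E U \<Longrightarrow> zopen X U \<Longrightarrow> i < n \<Longrightarrow> (\<lambda>v. g v i) \<in> regular X U"
 using E_eq unfolding trivial_bundle_def by blast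

lemma E_module: "module_sheaf X E" unfolding module_sheaf_def
proof (intro allI impI conjI ballI)
 fix U assume U: "zopen X U"
 show "s v j = 0" if "s \<in> E U" "v \<notin> U" for s v j using E_D(4)[OF that(1) U that(2)] .
 show "(\<lambda>v j. 0) \<in> E U" by (rule E_intro[OF U]) (simp_all add: U)
 show "(\<lambda>v j. s v j + t v j) \<in> E U" if s: "s \<in> E U" and t: "t \<in> E U" for s t
 proof (rule E_intro[OF U])
  show "(\<lambda>v. s v i + t v i) \<in> regular X U" if "i < n" for i
   by (rule tf_add[OF E_comp[OF s U that] E_comp[OF t U that]])
  show "s v i + t v i = 0" if "i \<ge> n" for v i using E_D(2)[OF s U that] E_D(2)[OF t U that] by simp
  show "(\<Sum>j<3. dn (\<lambda>i. s v i + t v i) j * co j v ^ q) = 0" if "v \<in> U" for v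
   using E_D(3)[OF s U that] E_D(3)[OF t U that] by (simp add: dn_add distrib_right sum.distrib)
 qed
 show "(\<lambda>v j. f v * s v j) \<in> E U" if f: "f \<in> regular X U" and s: "s \<in> E U" for f s
 proof (rule E_intro[OF U])
  show "(\<lambda>v. f v * s v i) \<in> regular X U" if "i < n" for i by (rule regular_mult[OF f E_comp[OF s U that]])
  show "f v * s v i = 0" if "i \<ge> n" for v i using E_D(2)[OF s U that] by simp
  show "(\<Sum>j<3. dn (\<lambda>i. f v * s v i) j * co j v ^ q) = 0" if "v \<in> U" for v
   using E_D(3)[OF s U that] by (simp add: dn_cmult mult.assoc flip: sum_distrib_left)
 qed
 show "restr W s \<in> E W" if A: "zopen X W \<and> W \<subseteq> U \<and> s \<in> E U" for W s
 proof (rule E_intro)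
  have W: "zopen X W" "W \<subseteq> U" and s: "s \<in> E U" using A by auto
  show "zopen X W" by (rule W)
  show "(\<lambda>v. restr W s v i) \<in> regular X W" if "i < n" for i
   using tf_restrict[OF E_comp[OF s U that] W] by (simp add: restr_def)
  show "restr W s v i = 0" if "i \<ge> n" for v i using E_D(2)[OF s U that] by (simp add: restr_def)
  show "(\<Sum>j<3. dn (restr W s v) j * co j v ^ q) = 0" if v: "v \<in> W" for v
  proof -
   have "restr W s v = s v" using v by (simp add: restr_def)
   then show ?thesis using E_D(3)[OF s U, of v] v W(2) by auto
  qed
 qed
 fix s :: "'a sheaf_section"
 assume A: "(\<forall>v. v \<notin> U \<longrightarrow> (\<forall>j. s v j = 0)) \<and>
     (\<forall>v\<in>U. \<exists>W. zopen X W \<and> v \<in> W \<and> W \<subseteq> U \<and> restr W s \<in> E W)"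
 show "s \<in> E U"
 proof (rule E_intro[OF U])
  show "(\<lambda>v. s v i) \<in> regular X U" if i: "i < n" for i
  proof (rule tf_glue)
   show "s v i = 0" if "v \<notin> U" for v using A that by blast
   fix v assume "v \<in> U"
   then obtain W where W: "zopen X W" "v \<in> W" "W \<subseteq> U" "restr W s \<in> E W" using A by blast
   have "(\<lambda>v. restr W s v i) \<in> regular X W" by (rule E_comp[OF W(4,1) i])
   moreover have "\<forall>w\<in>W. s w i = restr W s w i" by (simp add: restr_def)
   ultimately show "\<exists>W g. zopen X W \<and> v \<in> W \<and> W \<subseteq> U \<and> g \<in> regular X W \<and> (\<forall>w\<in>W. s w i = g w)" using W by blast
  qed
  show "s v i = 0" if i: "i \<ge> n" for v i
  proof (cases "v \<in> U")
   case True
   then obtain W where W: "zopen X W" "v \<in> W" "restr W s \<in> E W" using A by blast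
   then show ?thesis using E_D(2)[OF W(3,1) i, of v] by (simp add: restr_def)
  qed (use A in blast)
  show "(\<Sum>j<3. dn (s v) j * co j v ^ q) = 0" if v: "v \<in> U" for v
  proof -
   obtain W where W: "zopen X W" "v \<in> W" "restr W s \<in> E W" using A v by blast
   have "restr W s v = s v" using W(2) by (simp add: restr_def)
   then show ?thesis using E_D(3)[OF W(3,1,2)] by simp
  qed
 qed
qed

definition Uc :: "nat \<Rightarrow> 'a pt set" where "Uc k = {v \<in> X. co k v \<noteq> 0}"

lemma Uc_zopen: "zopen X (Uc k)" unfolding Uc_def by (rule zopen_D[OF form_co])

text \<open>Where coordinate k is nonzero this is the relation e_c - (x_c / x_k)^q e_k; those for
  the two indices c \<noteq> k span the syzygies of the q-th powers.\<close>

definition rl :: "nat \<Rightarrow> nat \<Rightarrow> 'a pt \<Rightarrow> nat \<Rightarrow> 'a" where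
 "rl k c v j = (if v \<notin> Uc k then 0 else if j = c then 1 else if j = k then - ((co c v / co k v) ^ q) else 0)"

definition fr :: "nat \<Rightarrow> nat \<Rightarrow> nat \<Rightarrow> nat \<Rightarrow> 'a sheaf_section" where
 "fr k a b i v = up (rl k (if i = 0 then a else b) v)"

lemma E_frame_coeffs:
 assumes p: "{k, a, b} = {0, 1, 2::nat}" and s: "s \<in> E W" "zopen X W" and v: "v \<in> W" "v \<in> Uc k"
 shows "s v l = dn (s v) a * fr k a b 0 v l + dn (s v) b * fr k a b 1 v l"
proof -
 note D = perm3_D[OF p]
 have nz: "co k v \<noteq> 0" using v by (simp add: Uc_def)
 have "dn (s v) k * co k v ^ q + dn (s v) a * co a v ^ q + dn (s v) b * co b v ^ q = 0"
  using E_D(3)[OF s v(1)] unfolding sum_perm3[OF p] .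
 then have "dn (s v) k * co k v ^ q = - (dn (s v) a * co a v ^ q + dn (s v) b * co b v ^ q)"
  by (simp only: eq_neg_iff_add_eq_0 add.assoc)
 then have dk: "dn (s v) k = - dn (s v) a * (co a v / co k v) ^ q - dn (s v) b * (co b v / co k v) ^ q"
  using nz by (simp add: power_divide field_simps)
 have "s v = up (dn (s v))" using E_D(5)[OF s] by simp
 also have "\<dots> = up (\<lambda>j. dn (s v) a * rl k a v j + dn (s v) b * rl k b v j)"
 proof (rule up_cong)
  fix j :: nat assume "j < 3"
  then consider "j = k" | "j = a" | "j = b" using D(7) by blast
  then show "dn (s v) j = dn (s v) a * rl k a v j + dn (s v) b * rl k b v j"
   by cases (use D(4-6) dk v in \<open>simp_all add: rl_def\<close>)
 qed
 finally have "s v l = up (\<lambda>j. dn (s v) a * rl k a v j + dn (s v) b * rl k b v j) l" by (rule fun_cong)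
 then show ?thesis by (simp add: up_comb fr_def)
qed

lemma fr_frame: assumes p: "{k, a, b} = {0, 1, 2::nat}" shows "local_frame X E 2 (Uc k) (fr k a b)"
 unfolding local_frame_def
proof (intro conjI allI impI ballI)
 note D = perm3_D[OF p]
 show U: "zopen X (Uc k)" by (rule Uc_zopen)
 have reg: "(\<lambda>v. rl k c v j) \<in> regular X (Uc k)" for c j
 proof -
  have "(\<lambda>v. if v \<in> Uc k then co c v / co k v else 0) \<in> regular X (Uc k)"
   by (rule tf_frac[OF U form_co[of c] form_co[of k]]) (auto simp: Uc_def)
  from tf_cmult[OF regular_power[OF this q_pos] U, of "-1"] tf_const[OF U, of 1] tf_const[OF U, of 0]
  have "(if j = c then (\<lambda>v. if v \<in> Uc k then 1 else 0) else if j = k then (\<lambda>v. - 1 * (if v \<in> Uc k then co c v / co k v else 0) ^ q)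
    else (\<lambda>v. if v \<in> Uc k then 0 else 0)) \<in> regular X (Uc k)" by presburger
  moreover have "(if j = c then (\<lambda>v. if v \<in> Uc k then 1 else 0) else if j = k then (\<lambda>v. - 1 * (if v \<in> Uc k then co c v / co k v else 0) ^ q)
    else (\<lambda>v. if v \<in> Uc k then 0 else 0)) = (\<lambda>v. rl k c v j)"
   using q_pos by (auto simp: rl_def fun_eq_iff)
  ultimately show ?thesis by simp
 qed
 show "fr k a b i \<in> E (Uc k)" if "i < 2" for i unfolding fr_def
 proof (rule E_up[OF U])
  show "(\<lambda>v. rl k (if i = 0 then a else b) v j) \<in> regular X (Uc k)" for j by (rule reg)
  show "(\<Sum>j<3. rl k (if i = 0 then a else b) v j * co j v ^ q) = 0" if "v \<in> Uc k" for v
   unfolding sum_perm3[OF p] using D that by (simp add: Uc_def rl_def power_divide)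
 qed
 show "independent_values 2 (fr k a b) v" if v: "v \<in> Uc k" for v unfolding independent_2
 proof (intro allI impI)
  fix \<alpha> \<beta> assume z: "\<forall>l. \<alpha> * fr k a b 0 v l + \<beta> * fr k a b 1 v l = 0"
  have "dn (\<lambda>l. \<alpha> * fr k a b 0 v l + \<beta> * fr k a b 1 v l) j = 0" for j using z by simp
  then have "\<alpha> * dn (fr k a b 0 v) j + \<beta> * dn (fr k a b 1 v) j = 0" for j by (simp add: dn_add dn_cmult)
  from this[of a] this[of b] show "\<alpha> = 0 \<and> \<beta> = 0" using D v by (simp add: fr_def rl_def dn_up)
 qed
 fix W s assume A: "zopen X W \<and> W \<subseteq> Uc k \<and> s \<in> E W"
 then have W: "zopen X W" "W \<subseteq> Uc k" and s: "s \<in> E W" by auto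
 define f where "f i v = dn (s v) (if i = 0 then a else b)" for i :: nat and v
 have "s v l = (\<Sum>i<2. f i v * fr k a b i v l)" for v l
 proof (cases "v \<in> W")
  case True
  then show ?thesis using E_frame_coeffs[OF p s W(1), of v l] W(2) by (auto simp: f_def numeral_2_eq_2)
 next
  case False
  then have "s v = (\<lambda>l. 0)" using E_D(4)[OF s W(1)] by blast
  then show ?thesis by (simp add: f_def)
 qed
 then show "\<exists>f. (\<forall>i<2. f i \<in> regular X W) \<and> s = (\<lambda>v l. \<Sum>i<2. f i v * fr k a b i v l)"
  using E_D(1)[OF s W(1)] by (intro exI[of _ f]) (simp add: f_def[abs_def] fun_eq_iff)
qed

lemma Uc_cover: assumes "v \<in> X" obtains "v \<in> Uc 0" | "v \<in> Uc 1" | "v \<in> Uc 2"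
proof -
 have "fst v \<noteq> 0 \<or> cy v \<noteq> 0 \<or> cz v \<noteq> 0" using assms by (auto simp: X_iff prod_eq_iff)
 then show ?thesis using that assms by (auto simp: Uc_def co_def)
qed

lemma E_bundle: "vector_bundle_rank X 2 E" unfolding vector_bundle_rank_def
proof (intro conjI ballI E_module)
 fix v assume "v \<in> X"
 then show "\<exists>U e. v \<in> U \<and> local_frame X E 2 U e"
 proof (cases rule: Uc_cover)
  case 1
  then show ?thesis using fr_frame[of 0 1 2] by blast
 next
  case 2
  then show ?thesis using fr_frame[of 1 0 2] by blast
 next
  case 3
  then show ?thesis using fr_frame[of 2 0 1] by blast
 qed
qed

text \<open>The frame over z \<noteq> 0 serves as a rational section of det E. In the frame over x
  \<noteq> 0 its determinant is (x / z)^q and in the one over y \<noteq> 0 it is -(y / z)^q, so it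
  contributes -q at (1:0:0) and -q \<open>ee\<close> at (0:1:0).\<close>

lemma E_degree: "bundle_degree X E = - int q * int d"
proof -
 have p2: "{2, 0, 1} = {0, 1, 2::nat}" by auto
 have ne: "Uc 2 \<noteq> {}" using vX(3) by (auto simp: Uc_def co_def)
 have s: "fr 2 0 1 i \<in> E (Uc 2)" if "i < 2" for i using frameD(2)[OF fr_frame[OF p2] that] .
 have gz: "GEN w. w \<in> Uc 2" by (rule gen_frame[OF Uc_zopen ne])
 define nn where "nn P = (if P = Px then - int q else if P = Py then - (int q * int ee) else 0)" for P
 define M where "M a b i j w = dn (fr 2 0 1 j w) (if i = 0 then a else b)" for a b i j :: nat and w
 have loc: "\<exists>W e a. local_frame X E 2 W e \<and> v \<in> W \<and>
   (GEN w. \<forall>j<2. \<forall>l. fr 2 0 1 j w l = (\<Sum>i<2. a i j w * e i w l)) \<and> hasord v (dm 2 a) (nn (proj_point v))"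
  if v: "v \<in> X" for v
 proof -
  have main: ?thesis if p: "{k, a, b} = {0, 1, 2::nat}" and vk: "v \<in> Uc k"
   and h: "hasord v h (nn (proj_point v))" and dm: "\<And>w. w \<in> Uc 2 \<Longrightarrow> dm 2 (M a b) w = h w" for k a b h
  proof -
   have "GEN w. w \<in> Uc k" using gen_frame[OF Uc_zopen] vk by blast
   with gz have "GEN w. \<forall>j<2. \<forall>l. fr 2 0 1 j w l = (\<Sum>i<2. M a b i j w * fr k a b i w l)"
    by eventually_elim (use E_frame_coeffs[OF p s Uc_zopen] in \<open>simp add: M_def numeral_2_eq_2\<close>)
   moreover have "hasord v (dm 2 (M a b)) (nn (proj_point v))"
    by (rule hasord_cong[OF h]) (use gz in \<open>eventually_elim, simp add: dm\<close>)
   ultimately show ?thesis using fr_frame[OF p] vk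
    by (intro exI[of _ "Uc k"] exI[of _ "fr k a b"] exI[of _ "M a b"]) blast
  qed
  note M = M_def dm_2 fr_def rl_def dn_up co_def
  show ?thesis
  proof (cases "v \<in> Uc 2")
   case True
   then have "nn (proj_point v) = 0"
    using Xo_not_vertex proj_point_vertex(3)[OF v] points_vertices(5,6) by (cases "v \<in> Xo") (auto simp: nn_def Uc_def co_def)
   then show ?thesis using hasord_const[of 1] by (intro main[OF p2 True]) (simp_all add: M)
  next
   case False
   then have z: "cz v = 0" using v by (auto simp: Uc_def co_def)
   then have nXo: "v \<notin> Xo" by (simp add: Xo_def)
   note pv = proj_point_vertex[OF v nXo]
   from v nXo show ?thesis
   proof (cases rule: vertex_cases)
    case 1
    then have "hasord v (\<lambda>w. xz w ^ q) (nn (proj_point v))"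
     using hasord_power[OF v hasord_vx(1)[OF v nXo 1(1)], of q] pv(1) by (simp add: nn_def)
    then show ?thesis using 1 v by (intro main[of 0 1 2]) (auto simp: M Uc_def xz_def)
   next
    case 2
    then have "hasord v (\<lambda>w. (-1) * yy w ^ q) (nn (proj_point v))"
     using hasord_mult[OF v hasord_const[of "-1"] hasord_power[OF v hasord_vy(2)[OF v nXo 2(2)], of q]] pv(2) points_vertices(4)
     by (simp add: nn_def)
    then show ?thesis using 2 v by (intro main[of 1 0 2]) (auto simp: M Uc_def yy_def)
   qed (use z in simp)
  qed
 qed
 have "bundle_degree X E = dsum nn"
  by (rule bundle_degree_local(1)[OF E_bundle _ fr_frame[OF p2] ne loc]) simp
 also have "\<dots> = (\<Sum>P\<in>{Px, Py}. nn P)" by (rule dsum_eq(1)) (use points_vertices in \<open>auto simp: nn_def\<close>)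
 also have "\<dots> = - int q * (int ee + 1)" using points_vertices(4) by (simp add: nn_def algebra_simps)
 also have "int ee + 1 = int d" using d_eq by simp
 finally show ?thesis .
qed

end

context trinomial_curve
begin

section \<open>Invariant line sub-bundles\<close>

text \<open>Order at least k. Unlike \<open>hasord\<close> it admits the zero function and is
  preserved by differences.\<close>

definition ordge :: "'k pt \<Rightarrow> ('k pt \<Rightarrow> 'k) \<Rightarrow> int \<Rightarrow> bool" where
 "ordge v g k \<longleftrightarrow> (\<exists>h e. locv v h e \<and> (GEN w. g w = tau v w powi k * h w))"

lemma ordgeE: assumes "ordge v g k" obtains h e where "locv v h e" "GEN w. g w = tau v w powi k * h w"
 using assms unfolding ordge_def by blast

lemma ordgeI: "locv v h e \<Longrightarrow> GEN w. g w = tau v w powi k * h w \<Longrightarrow> ordge v g k" unfolding ordge_def by blast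

lemma hasord_ordge: "v \<in> X \<Longrightarrow> hasord v g k \<Longrightarrow> l \<le> k \<Longrightarrow> ordge v g l" unfolding ordge_def by (rule hasord_ge0_locv)

lemma ordge_le: assumes "v \<in> X" "ordge v g k" "hasord v g m" shows "k \<le> m"
 using ordgeE[OF assms(2)] hasord_locv_ge(1)[OF assms(1,3)] by blast

lemma ordge_locv: "locv v g e \<Longrightarrow> ordge v g 0" by (erule ordgeI) simp

lemma ordge_cong: assumes "ordge v g k" "GEN w. h w = g w" shows "ordge v h k"
proof -
 obtain f e where f: "locv v f e" "GEN w. g w = tau v w powi k * f w" using ordgeE[OF assms(1)] by blast
 show ?thesis by (rule ordgeI[OF f(1)]) (use f(2) assms(2) in \<open>eventually_elim, simp\<close>)
qed

lemma ordge_mult: assumes "v \<in> X" "ordge v g k" "ordge v h l" shows "ordge v (\<lambda>w. g w * h w) (k + l)"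
proof -
 obtain f e where f: "locv v f e" "GEN w. g w = tau v w powi k * f w" using ordgeE[OF assms(2)] by blast
 obtain f' e' where f': "locv v f' e'" "GEN w. h w = tau v w powi l * f' w" using ordgeE[OF assms(3)] by blast
 show ?thesis by (rule ordgeI[OF locv_mult[OF f(1) f'(1)]])
   (use f(2) f'(2) gen_tau[OF assms(1)] in \<open>eventually_elim, simp add: power_int_add\<close>)
qed

lemma ordge_diff: assumes "v \<in> X" "ordge v g k" "ordge v h k" shows "ordge v (\<lambda>w. g w - h w) k"
proof -
 obtain f e where f: "locv v f e" "GEN w. g w = tau v w powi k * f w" using ordgeE[OF assms(2)] by blast
 obtain f' e' where f': "locv v f' e'" "GEN w. h w = tau v w powi k * f' w" using ordgeE[OF assms(3)] by blast
 show ?thesis by (rule ordgeI[OF locv_diff[OF assms(1) f(1) f'(1)]])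
   (use f(2) f'(2) in \<open>eventually_elim, simp add: right_diff_distrib\<close>)
qed

lemma ordge_sig: assumes c: "c \<in> mu" and g: "ordge (sig c v) g k" shows "ordge v (\<lambda>w. g (sig c w)) k"
proof -
 obtain h a where h: "locv (sig c v) h a" "GEN w. g w = tau (sig c v) w powi k * h w" using ordgeE[OF g] by blast
 obtain e where e: "e \<noteq> 0" "\<And>w. tau (sig c v) (sig c w) = e * tau v w" using tau_sig[OF c] by blast
 show ?thesis
 proof (rule ordgeI)
  show "locv v (\<lambda>w. e powi k * h (sig c w)) (e powi k * a)" by (intro locv_mult locv_const locv_sig c h(1))
  show "GEN w. g (sig c w) = tau v w powi k * (e powi k * h (sig c w))"
   using gen_sig[OF c h(2)] by eventually_elim (simp add: e(2) power_int_mult_distrib)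
 qed
qed

definition ncr :: "'k poly \<Rightarrow> 'k poly \<Rightarrow> bool" where "ncr A B \<longleftrightarrow> (\<forall>a. poly A a \<noteq> 0 \<or> poly B a \<noteq> 0)"

text \<open>At a vertex the entry with coefficient B competes with another one, relative to which it
  has order \<open>lam * n - q * al\<close>; the smaller order counts. A zero coefficient cannot
  compete and contributes nothing.\<close>

definition trn :: "nat \<Rightarrow> 'k poly \<Rightarrow> int \<Rightarrow> int" where
 "trn q B n = (if B = 0 then 0 else min (int lam * n - int q * int al) 0)"

definition mdeg :: "'k poly \<Rightarrow> 'k poly \<Rightarrow> int" where "mdeg A B = max (int (degree A)) (int (degree B))"

text \<open>\<open>gap q A B\<close> is \<open>2 deg L - deg E\<close> for the line sub-bundle \<open>L\<close> of the syzygy bundle \<open>E\<close> spanned by the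
 triple \<open>fam q A B\<close>; \<open>trn\<close> collects the contributions of the three vertices.\<close>

definition gap :: "nat \<Rightarrow> 'k poly \<Rightarrow> 'k poly \<Rightarrow> int" where
 "gap q A B = 3 * int q * int al - 2 * int lam * mdeg A B + 2 * (trn q A (int (pord 0 A))
   + trn q (- A - B) (int (pord (-1) (- A - B))) + trn q B (mdeg A B - int (degree B)))"

definition cf :: "'k poly \<Rightarrow> 'k poly \<Rightarrow> nat \<Rightarrow> 'k poly" where
 "cf A B j = (if j = 0 then A else if j = 1 then B else - A - B)"

text \<open>Multiplied by x^q, y^q, z^q and divided by z^q, the entries become A, B and -A - B at t,
  which add up to 0: a rational syzygy of the q-th powers.\<close>

definition fam :: "nat \<Rightarrow> 'k poly \<Rightarrow> 'k poly \<Rightarrow> nat \<Rightarrow> 'k pt \<Rightarrow> 'k" where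
 "fam q A B j w = (if j = 0 then poly A (tt w) / xz w ^ q else if j = 1 then poly B (tt w) / yy w ^ q
   else poly (- A - B) (tt w))"

text \<open>The least order among the three entries of \<open>fam\<close> at each point (see
  \<open>fam_orders\<close>); off the vertices it is 0 if A and B have no common root. Its total is
  the degree of the line bundle spanned by \<open>fam\<close>.\<close>

definition bd :: "nat \<Rightarrow> 'k poly \<Rightarrow> 'k poly \<Rightarrow> 'k pt set \<Rightarrow> int" where
 "bd q A B P = (if P = Px then - (int lam * mdeg A B) + trn q B (mdeg A B - int (degree B))
   else if P = Py then int q * int al + trn q (- A - B) (int (pord (-1) (- A - B)))
   else if P = Pz then - int q + trn q A (int (pord 0 A)) else 0)"

lemma dsum_bd: "2 * dsum (bd q A B) = gap q A B - int q * int d" "fsup (bd q A B)"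
proof -
 have "dsum (bd q A B) = (\<Sum>P\<in>{Px, Py, Pz}. bd q A B P)" "fsup (bd q A B)"
  by (rule dsum_eq[of "{Px, Py, Pz}"]; use points_vertices(1-3) in \<open>simp add: bd_def\<close>)+
 moreover have "int d = int al + 2" using d_eq ee_eq by simp
 ultimately show "2 * dsum (bd q A B) = gap q A B - int q * int d" "fsup (bd q A B)"
  using points_vertices(4-6) by (simp_all add: bd_def gap_def algebra_simps)
qed

lemma hasord_fam:
 assumes v: "v \<in> X" and x: "hasord v xz ox" and y: "hasord v yy oy" and nz: "cf A B j \<noteq> 0"
 shows "hasord v (fam q A B j) (ordt v (cf A B j) - int q * (if j = 0 then ox else if j = 1 then oy else 0))"
proof -
 note h = hasord_poly[OF v nz]
 show ?thesis using hasord_divide[OF v h hasord_power[OF v x, of q]] hasord_divide[OF v h hasord_power[OF v y, of q]] h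
  by (cases "j = 0"; cases "j = 1") (simp_all add: fam_def[abs_def] cf_def del: poly_diff poly_minus)
qed

lemma fam_zero: "cf A B j = 0 \<Longrightarrow> fam q A B j = (\<lambda>w. 0)"
 by (simp add: fam_def[abs_def] cf_def split: if_splits del: poly_diff poly_minus)

lemma ordge_zero: "ordge v (\<lambda>w. 0) k" by (rule ordgeI[OF locv_const[of v 0]]) simp

text \<open>At a vertex the minimal order is attained by the member \<open>D\<close>, whose offset is smaller by \<open>q \<alpha>\<close>, or else,
 when the coefficient of \<open>D\<close> vanishes to high order, by the member \<open>K\<close>.\<close>

lemma fam_orders_aux:
 assumes v: "v \<in> X" and x: "hasord v xz ox" and y: "hasord v yy oy" and DKT: "{D, K, T} = {0, 1, 2::nat}"
  and sh: "sh = (\<lambda>j::nat. - (int q * (if j = 0 then ox else if j = 1 then oy else 0)))"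
   "sh D = sh K - int q * int al" "sh T \<ge> sh K"
  and o: "\<And>j. j < 3 \<Longrightarrow> ordt v (cf A B j) = c + int lam * w j" "\<And>j. j < 3 \<Longrightarrow> w j \<ge> 0"
  and alt: "cf A B D = 0 \<or> w D > 0 \<Longrightarrow> cf A B K \<noteq> 0 \<and> w K = 0"
  and n: "n = c + sh K + trn q (cf A B D) (w D)"
 shows "(\<forall>j<3. ordge v (fam q A B j) n) \<and> (\<exists>j<3. hasord v (fam q A B j) n)"
proof -
 note DK = perm3_D[OF DKT]
 have h: "hasord v (fam q A B j) (c + int lam * w j + sh j)" if "j < 3" "cf A B j \<noteq> 0" for j
  using hasord_fam[OF v x y that(2), of q] o(1)[OF that(1)] by (simp add: sh(1))
 have w: "int lam * w j \<ge> 0" if "j < 3" for j using o(2)[OF that] by simp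
 have "ordge v (fam q A B j) n" if j: "j < 3" for j
 proof (cases "cf A B j = 0")
  case False
  have "trn q (cf A B D) (w D) \<le> 0" "cf A B D \<noteq> 0 \<Longrightarrow> trn q (cf A B D) (w D) \<le> int lam * w D - int q * int al"
   by (simp_all add: trn_def)
  then have "n \<le> c + int lam * w j + sh j" using DK(7)[OF j] n sh(2,3) w[OF j] False by auto
  then show ?thesis by (rule hasord_ordge[OF v h[OF j False]])
 qed (simp add: fam_zero ordge_zero)
 moreover have "\<exists>j<3. hasord v (fam q A B j) n"
 proof (cases "cf A B D \<noteq> 0 \<and> int lam * w D \<le> int q * int al")
  case True
  then have "n = c + int lam * w D + sh D" by (simp add: n sh(2) trn_def)
  then show ?thesis using h[OF DK(1)] True DK(1) by auto
 next
  case False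
  have "int q * int al \<ge> 0" by simp
  then have "cf A B D = 0 \<or> w D > 0" using False by (metis less_eq_int_code(1) mult_zero_right not_less o(2)[OF DK(1)] order_antisym_conv)
  then have K: "cf A B K \<noteq> 0" "w K = 0" using alt by blast+
  have "n = c + int lam * w K + sh K" using False by (auto simp: n K trn_def)
  then show ?thesis using h[OF DK(2) K(1)] DK(2) by auto
 qed
 ultimately show ?thesis by blast
qed

lemma fam_orders:
 assumes v: "v \<in> X" and nc: "ncr A B"
 shows "(\<forall>j<3. ordge v (fam q A B j) (bd q A B (proj_point v))) \<and> (\<exists>j<3. hasord v (fam q A B j) (bd q A B (proj_point v)))"
proof (cases "v \<in> Xo")
 case True
 have b: "bd q A B (proj_point v) = 0" using Xo_not_vertex[OF True] by (simp add: bd_def)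
 have h: "hasord v (fam q A B j) (int (pord (tt v) (cf A B j)))" if "cf A B j \<noteq> 0" for j
  using hasord_fam[OF v hasord_Xo[OF True] that, of q] True by (simp add: ordt_def split: if_splits)
 have "ordge v (fam q A B j) 0" for j
  by (cases "cf A B j = 0") (use hasord_ordge[OF v h] in \<open>simp_all add: fam_zero ordge_zero\<close>)
 moreover have "poly (cf A B 0) (tt v) \<noteq> 0 \<or> poly (cf A B 1) (tt v) \<noteq> 0" using nc by (simp add: ncr_def cf_def)
 then have "hasord v (fam q A B 0) 0 \<or> hasord v (fam q A B 1) 0" using h[of 0] h[of 1] order_root by fastforce
 then have "\<exists>j<3. hasord v (fam q A B j) 0" by (metis less_numeral_extra(1) numeral_less_iff one_less_numeral_iff order.strict_trans semiring_norm(77) zero_less_numeral)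
 ultimately show ?thesis unfolding b by blast
next
 case False
 note pv = proj_point_vertex[OF v False]
 have ncC: "poly A a \<noteq> 0 \<or> poly (- A - B) a \<noteq> 0" "poly A a \<noteq> 0 \<or> poly B a \<noteq> 0" for a using nc[unfolded ncr_def, THEN spec, of a] by auto
 have ord: "p \<noteq> 0 \<and> int (pord a p) = 0" if "r = 0 \<or> int (pord a r) > 0" "poly r a \<noteq> 0 \<or> poly p a \<noteq> 0" for p r :: "'k poly" and a
  using that order_root[of r a] order_root[of p a] by auto
 from v False show ?thesis
 proof (cases rule: vertex_cases)
  case 1
  \<comment> \<open>Over infinity the vanishing order of a coefficient is its deficit from the
    common degree m. The entry divided by \<open>yy\<close>^q has the smaller offset here, because y
    / z vanishes to order \<open>al\<close>.\<close>
  define m where "m = mdeg A B"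
  have m: "int (degree (cf A B j)) \<le> m" for j
   using degree_diff_le_max[of "- A" B] by (auto simp: m_def mdeg_def cf_def)
  show ?thesis
  proof (rule fam_orders_aux[OF v hasord_vx(1,2)[OF v False 1(1)] _ refl, where D = 1 and K = 2 and T = 0 and c = "- (int lam * m)" and w = "\<lambda>j. m - int (degree (cf A B j))"])
   assume *: "cf A B 1 = 0 \<or> m - int (degree (cf A B 1)) > 0"
   have "A \<noteq> 0" if "B = 0" using that nc by (auto simp: ncr_def)
   then have "degree (- A - B) = degree A \<and> m = int (degree A) \<and> - A - B \<noteq> 0"
    using * degree_add_eq_left[of "- B" "- A"] by (auto simp: cf_def m_def mdeg_def max_def split: if_splits)
   then show "cf A B 2 \<noteq> 0 \<and> m - int (degree (cf A B 2)) = 0" by (simp add: cf_def)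
  qed (use m 1 False pv(1) in \<open>auto simp: ordt_def right_diff_distrib bd_def m_def cf_def\<close>)
 next
  case 2
  show ?thesis
  proof (rule fam_orders_aux[OF v hasord_vy(1,2)[OF v False 2(2)] _ refl, where D = 2 and K = 0 and T = 1 and c = 0 and w = "\<lambda>j. int (pord (-1) (cf A B j))"])
   show "cf A B 0 \<noteq> 0 \<and> int (pord (-1) (cf A B 0)) = 0" if "cf A B 2 = 0 \<or> int (pord (-1) (cf A B 2)) > 0"
    by (rule ord[OF that]) (use ncC in \<open>auto simp: cf_def\<close>)
  qed (use 2 False pv(2) points_vertices(4) in \<open>auto simp: ordt_def bd_def cf_def ee_eq algebra_simps\<close>)
 next
  case 3
  show ?thesis
  proof (rule fam_orders_aux[OF v hasord_vz(1,2)[OF v False 3(3)] _ refl, where D = 0 and K = 1 and T = 2 and c = 0 and w = "\<lambda>j. int (pord 0 (cf A B j))"])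
   show "cf A B 1 \<noteq> 0 \<and> int (pord 0 (cf A B 1)) = 0" if "cf A B 0 = 0 \<or> int (pord 0 (cf A B 0)) > 0"
    by (rule ord[OF that]) (use ncC in \<open>auto simp: cf_def\<close>)
  qed (use 3 False pv(3) points_vertices(5,6) in \<open>auto simp: ordt_def bd_def cf_def ee_eq algebra_simps\<close>)
 qed
qed

lemma proj_point_sig: assumes c: "c \<in> mu" and v: "v \<in> X"
 shows "ordx (proj_point (sig c v)) = ordx (proj_point v)" "ordy (proj_point (sig c v)) = ordy (proj_point v)"
proof -
 have nz: "c \<noteq> 0" by (rule mu_nz[OF c])
 have "ordx (proj_point (sig c v)) = ordx (proj_point v) \<and> ordy (proj_point (sig c v)) = ordy (proj_point v)"
 proof (cases "v \<in> Xo")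
  case True
  then show ?thesis using Xo_not_vertex[OF True] Xo_not_vertex[OF sig_Xo[OF c True]] by (simp add: ordx_def ordy_def)
 next
  case False
  have s: "sig c v \<in> X" "sig c v \<notin> Xo" using sig_X[OF c v] False v nz by (auto simp: Xo_def)
  note pv = proj_point_vertex[OF v False] and ps = proj_point_vertex[OF s]
  from v False show ?thesis by (cases rule: vertex_cases) (use pv ps nz in simp_all)
 qed
 then show "ordx (proj_point (sig c v)) = ordx (proj_point v)" "ordy (proj_point (sig c v)) = ordy (proj_point v)" by auto
qed

lemma ordge_wronskian:
 assumes v: "v \<in> X" and c: "c \<in> mu" and F: "ordge v F a" "ordge (sig c v) F a'" and G: "ordge v G b" "ordge (sig c v) G b'"
  and k: "a' + b = k" "a + b' = k"
  and eq: "GEN w. K w = F (sig c w) * G w - F w * G (sig c w)" shows "ordge v K k"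
proof (rule ordge_cong[OF ordge_diff[OF v] eq])
 show "ordge v (\<lambda>w. F (sig c w) * G w) k" using ordge_mult[OF v ordge_sig[OF c F(2)] G(1)] k(1) by simp
 show "ordge v (\<lambda>w. F w * G (sig c w)) k" using ordge_mult[OF v F(1) ordge_sig[OF c G(2)]] k(2) by simp
qed

lemma hasord_ordd: assumes "v \<in> X" "rat g" "GEN w. g w \<noteq> 0" shows "hasord v g (ordd g (proj_point v))"
 using hasord_ex[OF assms] ordd_eq[OF assms(1)] by metis

text \<open>Since A, B and -A - B add up to 0, the three 2 x 2 minors of the triple against its
  translate coincide up to sign in one nonzero function K. At each point the best of the three lower
  bounds for its order is used, and the product formula sums them.\<close>

lemma twisted_bound:
 assumes c: "c \<in> mu" and A: "rat A" and B: "rat B" and N: "fsup N"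
  and o: "\<And>v. v \<in> X \<Longrightarrow> ordge v (\<lambda>w. A w / xz w ^ q) (N (proj_point v))"
   "\<And>v. v \<in> X \<Longrightarrow> ordge v (\<lambda>w. B w / yy w ^ q) (N (proj_point v))"
   "\<And>v. v \<in> X \<Longrightarrow> ordge v (\<lambda>w. - A w - B w) (N (proj_point v))"
  and nz: "GEN w. A (sig c w) * B w - A w * B (sig c w) \<noteq> 0" shows "2 * dsum N \<le> - (int q * int d)"
proof -
 define K where "K w = A (sig c w) * B w - A w * B (sig c w)" for w
 have K: "rat K" "GEN w. K w \<noteq> 0"
  unfolding K_def[abs_def] by (intro rat_diff rat_mult rat_sig A B c) (rule nz)
 have oA: "ordge v A (N (proj_point v) + int q * ordx (proj_point v))" if v: "v \<in> X" for v
 proof (rule ordge_cong[OF ordge_mult[OF v o(1)[OF v] hasord_ordge[OF v hasord_power[OF v hasord_xz_yy(1)[OF v]] order_refl]]])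
  show "GEN w. A w = A w / xz w ^ q * xz w ^ q" using gen_eq by eventually_elim (simp add: xz_def)
 qed
 have oB: "ordge v B (N (proj_point v) + int q * ordy (proj_point v))" if v: "v \<in> X" for v
 proof (rule ordge_cong[OF ordge_mult[OF v o(2)[OF v] hasord_ordge[OF v hasord_power[OF v hasord_xz_yy(2)[OF v]] order_refl]]])
  show "GEN w. B w = B w / yy w ^ q * yy w ^ q" using gen_eq by eventually_elim (simp add: yy_def)
 qed
 \<comment> \<open>The largest of the orders of y / z, x / z and x y / z^2, one for each minor; the
   total is \<open>al\<close> - \<open>al\<close> + d = d.\<close>
 define dl where "dl P = (if P = Px then int al else if P = Py then - int al else if P = Pz then int d else 0)" for P
 have dl: "dl P = ordy P \<or> dl P = ordx P \<or> dl P = ordx P + ordy P" for P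
  using d_eq by (auto simp: dl_def ordx_def ordy_def)
 have le: "N P + N (sig c ` P) + int q * dl P \<le> ordd K P" if P: "P \<in> points X" for P
 proof -
  obtain v where v: "v \<in> X" "P = proj_point v" using pointsE[OF P] by blast
  note sv = sig_X[OF c v(1)]
  have P': "proj_point (sig c v) = sig c ` P" unfolding v(2) by (rule sig_proj_point[symmetric])
  note ox = proj_point_sig[OF c v(1), unfolded P', folded v(2)]
  note oA = oA[OF v(1), folded v(2)] oA[OF sv, unfolded P' ox] and oB = oB[OF v(1), folded v(2)] oB[OF sv, unfolded P' ox]
   and oC = o(3)[OF v(1), folded v(2)] o(3)[OF sv, unfolded P']
  have "ordge v K (N P + N (sig c ` P) + int q * dl P)" using dl[of P]
  proof (elim disjE)
   assume d: "dl P = ordy P"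
   show ?thesis by (rule ordge_wronskian[OF v(1) c oB oC]) (simp_all add: d K_def algebra_simps)
  next
   assume d: "dl P = ordx P"
   show ?thesis by (rule ordge_wronskian[OF v(1) c oC oA]) (simp_all add: d K_def algebra_simps)
  next
   assume d: "dl P = ordx P + ordy P"
   show ?thesis by (rule ordge_wronskian[OF v(1) c oA oB]) (simp_all add: d K_def algebra_simps)
  qed
  from ordge_le[OF v(1) this hasord_ordd[OF v(1) K]] show ?thesis unfolding v(2) .
 qed
 have dls: "fsup dl" "dsum dl = int d"
 proof -
  have "dsum dl = (\<Sum>P\<in>{Px, Py, Pz}. dl P)" "fsup dl"
   by (rule dsum_eq[of "{Px, Py, Pz}"]; use points_vertices(1-3) in \<open>simp add: dl_def\<close>)+
  then show "fsup dl" "dsum dl = int d" using points_vertices(4-6) by (simp_all add: dl_def)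
 qed
 have f1: "fsup (\<lambda>P. N P + N (sig c ` P))" by (intro fsup_add dsum_sig(2) c N)
 have f2: "fsup (\<lambda>P. int q * dl P)" by (intro fsup_cmult dls)
 have "dsum (\<lambda>P. N P + N (sig c ` P) + int q * dl P) = dsum N + dsum N + int q * int d"
  using dsum_add[OF f1 f2] dsum_add[OF N dsum_sig(2)[OF c N]] dsum_sig(1)[OF c, of N] dsum_cmult[OF dls(1)] dls(2) by simp
 moreover have "dsum (\<lambda>P. N P + N (sig c ` P) + int q * dl P) \<le> dsum (ordd K)"
  by (rule dsum_mono[OF fsup_add[OF f1 f2] fsup_ordd[OF K] le])
 ultimately show ?thesis using product_formula[OF K] by simp
qed

text \<open>The common factor \<phi> has a divisor of degree 0, and at every point some entry of
  \<open>fam\<close> attains the order \<open>bd\<close>.\<close>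

lemma invariant_bound:
 assumes \<phi>: "rat \<phi>" "GEN w. \<phi> w \<noteq> 0" and nc: "ncr A B" and N: "fsup N"
  and o: "\<And>v j. v \<in> X \<Longrightarrow> j < 3 \<Longrightarrow> ordge v (\<lambda>w. \<phi> w * fam q A B j w) (N (proj_point v))"
 shows "2 * dsum N \<le> gap q A B - int q * int d"
proof -
 have "N P \<le> ordd \<phi> P + bd q A B P" if P: "P \<in> points X" for P
 proof -
  obtain v where v: "v \<in> X" "P = proj_point v" using pointsE[OF P] by blast
  obtain j where j: "j < 3" "hasord v (fam q A B j) (bd q A B (proj_point v))" using fam_orders[OF v(1) nc] by blast
  from ordge_le[OF v(1) o[OF v(1) j(1)] hasord_mult[OF v(1) hasord_ordd[OF v(1) \<phi>] j(2)]]
  show ?thesis unfolding v(2) .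
 qed
 from dsum_mono[OF N fsup_add[OF fsup_ordd[OF \<phi>] dsum_bd(2)] this]
 have "dsum N \<le> dsum (bd q A B)"
  unfolding dsum_add[OF fsup_ordd[OF \<phi>] dsum_bd(2)] product_formula[OF \<phi>] by simp
 then show ?thesis using dsum_bd(1)[of q A B] by linarith
qed

text \<open>If the triple is not proportional to one of its translates under \<open>mu\<close>, the cross product of the two is a
 nonzero rational function whose divisor bounds the degree; otherwise the triple descends to the quotient line.\<close>

lemma triple_bound:
 assumes A: "rat A" and B: "rat B" and N: "fsup N"
  and o: "\<And>v. v \<in> X \<Longrightarrow> ordge v (\<lambda>w. A w / xz w ^ q) (N (proj_point v))"
   "\<And>v. v \<in> X \<Longrightarrow> ordge v (\<lambda>w. B w / yy w ^ q) (N (proj_point v))"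
   "\<And>v. v \<in> X \<Longrightarrow> ordge v (\<lambda>w. - A w - B w) (N (proj_point v))"
  and nz: "(GEN w. A w \<noteq> 0) \<or> (GEN w. B w \<noteq> 0)"
 shows "2 * dsum N \<le> - (int q * int d) \<or> (\<exists>A B. ncr A B \<and> 2 * dsum N \<le> gap q A B - int q * int d)"
proof (cases "\<exists>c\<in>mu. GEN w. A (sig c w) * B w - A w * B (sig c w) \<noteq> 0")
 case True
 then obtain c where "c \<in> mu" "GEN w. A (sig c w) * B w - A w * B (sig c w) \<noteq> 0" by blast
 from twisted_bound[OF this(1) A B N o this(2)] show ?thesis by blast
next
 case False
 have inv: "GEN w. A (sig c w) * B w - A w * B (sig c w) = 0" if c: "c \<in> mu" for c
 proof -
  have "rat (\<lambda>w. A (sig c w) * B w - A w * B (sig c w))" by (intro rat_diff rat_mult rat_sig A B c)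
  from rat_dichotomy[OF this] show ?thesis using False c by blast
 qed
 have "\<exists>\<phi> A' B'. rat \<phi> \<and> (GEN w. \<phi> w \<noteq> 0) \<and> ncr A' B' \<and>
  (GEN w. A w = \<phi> w * poly A' (tt w) \<and> B w = \<phi> w * poly B' (tt w))"
 proof (cases "GEN w. B w \<noteq> 0")
  case True
  \<comment> \<open>Proportional translates make the ratio A / B invariant, hence a rational
    function of t; its reduced numerator and denominator are the coprime pair.\<close>
  have "GEN w. A (sig c w) / B (sig c w) = A w / B w" if c: "c \<in> mu" for c
   using inv[OF c] True gen_sig[OF c True] by eventually_elim (simp add: field_simps)
  from rat_invariant[OF rat_divide[OF A B] this]
  obtain P Q where PQ: "Q \<noteq> 0" "GEN w. A w / B w = poly P (tt w) / poly Q (tt w)" by blast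
  obtain P' Q' where PQ': "Q' \<noteq> 0" "\<And>a. poly P' a \<noteq> 0 \<or> poly Q' a \<noteq> 0"
   "GEN w. poly P (tt w) / poly Q (tt w) = poly P' (tt w) / poly Q' (tt w)"
   using coprime_quotient[OF PQ(1)] by blast
  note Qnz = poly_tt_nz[OF PQ'(1)]
  have e: "GEN w. A w = B w / poly Q' (tt w) * poly P' (tt w) \<and> B w = B w / poly Q' (tt w) * poly Q' (tt w)"
   using PQ(2) PQ'(3) Qnz True by eventually_elim (simp add: field_simps)
  have n: "GEN w. B w / poly Q' (tt w) \<noteq> 0" using Qnz True by eventually_elim simp
  have "ncr P' Q'" unfolding ncr_def using PQ'(2) by blast
  moreover have "rat (\<lambda>w. B w / poly Q' (tt w))" by (intro rat_divide B rat_poly)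
  ultimately show ?thesis using n e by blast
 next
  case B0: False
  then have "GEN w. B w = 0" using rat_dichotomy[OF B] by blast
  then have e: "GEN w. A w = A w * poly 1 (tt w) \<and> B w = A w * poly 0 (tt w)" by eventually_elim simp
  show ?thesis
   by (rule exI[of _ A], rule exI[of _ 1], rule exI[of _ 0]) (use A B0 nz e in \<open>simp add: ncr_def\<close>)
 qed
 then obtain \<phi> A' B' where \<phi>: "rat \<phi>" "GEN w. \<phi> w \<noteq> 0" "ncr A' B'"
  "GEN w. A w = \<phi> w * poly A' (tt w) \<and> B w = \<phi> w * poly B' (tt w)" by blast
 have "2 * dsum N \<le> gap q A' B' - int q * int d"
 proof (rule invariant_bound[OF \<phi>(1-3) N])
  fix v and j :: nat assume v: "v \<in> X" and "j < 3"
  then consider "j = 0" | "j = 1" | "j = 2" by linarith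
  then show "ordge v (\<lambda>w. \<phi> w * fam q A' B' j w) (N (proj_point v))"
  proof cases
   case 1
   show ?thesis by (rule ordge_cong[OF o(1)[OF v]]) (use \<phi>(4) in \<open>eventually_elim, simp add: fam_def 1\<close>)
  next
   case 2
   show ?thesis by (rule ordge_cong[OF o(2)[OF v]]) (use \<phi>(4) in \<open>eventually_elim, simp add: fam_def 2\<close>)
  next
   case 3
   show ?thesis by (rule ordge_cong[OF o(3)[OF v]])
     (use \<phi>(4) in \<open>eventually_elim, simp add: fam_def 3 right_diff_distrib\<close>)
  qed
 qed
 then show ?thesis using \<phi>(3) by blast
qed

end

context syz_bundle
begin

section \<open>Slopes of line sub-bundles of the syzygy bundle\<close>

lemma gen_relation:
 assumes "g \<in> E U" "zopen X U" "U \<noteq> {}"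
 shows "GEN w. dn (g w) 2 = - (dn (g w) 0 * xz w ^ q) - dn (g w) 1 * yy w ^ q"
 using gen_frame[OF assms(2,3)] gen_eq
proof eventually_elim
 case (elim w)
 have "dn (g w) 0 * fst w ^ q + dn (g w) 1 * cy w ^ q + dn (g w) 2 * cz w ^ q = 0"
  using E_D(3)[OF assms(1,2) elim(1)] by (simp add: sum_lt3 co_def)
 then have "dn (g w) 2 * cz w ^ q = - (dn (g w) 0 * fst w ^ q) - dn (g w) 1 * cy w ^ q"
  by (simp only: eq_diff_eq eq_neg_iff_add_eq_0 add_ac)
 then show ?case using elim(2) by (simp add: xz_def yy_def power_divide field_simps)
qed

text \<open>A frame of W is a syzygy. Once the first two entries are multiplied by (x / z)^q and (y
  / z)^q, they and the third add up to 0, which is the shape treated by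
  \<open>triple_bound\<close>.\<close>

lemma line_bound:
 assumes W: "vector_bundle_rank X (Suc 0) W" and sub: "\<And>U. zopen X U \<Longrightarrow> W U \<subseteq> E U"
 shows "2 * bundle_degree X W \<le> - (int q * int d) \<or>
  (\<exists>A B. ncr A B \<and> 2 * bundle_degree X W \<le> gap q A B - int q * int d)"
proof -
 obtain U e where e: "local_frame X W (Suc 0) U e" "U \<noteq> {}" using frame_exists[OF W] by blast
 have U: "zopen X U" by (rule frameD(1)[OF e(1)])
 have eE: "e 0 \<in> E U" using frameD(2)[OF e(1), of 0] sub[OF U] by auto
 define f where "f j w = dn (e 0 w) j" for j w
 define N where "N = det_ord X W (Suc 0) U e"
 have deg: "bundle_degree X W = dsum N" unfolding N_def by (rule bundle_degree_eq[OF W _ e]) simp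
 have fN: "fsup N" unfolding N_def by (rule fsup_det_ord[OF vbrD(1)[OF W] _ e]) simp
 have of: "ordge v (f j) (N (proj_point v))" if v: "v \<in> X" for v j
 proof -
  obtain U' e' where e': "v \<in> U'" "local_frame X W (Suc 0) U' e'" using vbrD(2)[OF W v] by blast
  obtain a k where a: "GEN w. \<forall>j<Suc 0. \<forall>l. e j w l = (\<Sum>i<Suc 0. a i j w * e' i w l)" "hasord v (dm (Suc 0) a) k"
   "N (proj_point v) = k" unfolding N_def using det_ord_frame[OF vbrD(1)[OF W] _ e e'(2,1)] by blast
  have e'E: "e' 0 \<in> E U'" using frameD(1,2)[OF e'(2)] sub by auto
  have o: "hasord v (a 0 0) k" using a(2) by (simp add: dm_1[abs_def])
  have r: "ordge v (\<lambda>w. dn (e' 0 w) j) 0"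
   by (rule ordge_locv[OF locv_regular[OF E_D(1)[OF e'E frameD(1)[OF e'(2)]] e'(1)]])
  have eq: "GEN w. f j w = a 0 0 w * dn (e' 0 w) j" using a(1)
  proof eventually_elim
   case (elim w)
   then have "e 0 w = (\<lambda>l. a 0 0 w * e' 0 w l)" by auto
   then show ?case by (simp add: f_def dn_cmult)
  qed
  show ?thesis using ordge_cong[OF ordge_mult[OF v hasord_ordge[OF v o order_refl] r] eq] a(3) by simp
 qed
 have rf: "rat (f j)" for j
 proof -
  obtain v where v: "v \<in> U" using e(2) by blast
  show ?thesis unfolding f_def by (rule rat_regular[OF E_D(1)[OF eE U] U v])
 qed
 have rxy: "rat xz" "rat yy" by (rule rat_xz rat_yy)+
 have g: "GEN w. f 2 w = - (f 0 w * xz w ^ q) - f 1 w * yy w ^ q"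
  unfolding f_def by (rule gen_relation[OF eE U e(2)])
 show ?thesis unfolding deg
 proof (rule triple_bound[OF _ _ fN])
  show "rat (\<lambda>w. f 0 w * xz w ^ q)" "rat (\<lambda>w. f 1 w * yy w ^ q)" by (intro rat_mult rat_power rf rxy)+
  show "ordge v (\<lambda>w. f 0 w * xz w ^ q / xz w ^ q) (N (proj_point v))" if v: "v \<in> X" for v
   by (rule ordge_cong[OF of[OF v, of 0]]) (use gen_eq in \<open>eventually_elim, simp add: xz_def\<close>)
  show "ordge v (\<lambda>w. f 1 w * yy w ^ q / yy w ^ q) (N (proj_point v))" if v: "v \<in> X" for v
   by (rule ordge_cong[OF of[OF v, of 1]]) (use gen_eq in \<open>eventually_elim, simp add: yy_def\<close>)
  show "ordge v (\<lambda>w. - (f 0 w * xz w ^ q) - f 1 w * yy w ^ q) (N (proj_point v))" if v: "v \<in> X" for v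
   by (rule ordge_cong[OF of[OF v, of 2]]) (use g in \<open>eventually_elim, simp\<close>)
  show "(GEN w. f 0 w * xz w ^ q \<noteq> 0) \<or> (GEN w. f 1 w * yy w ^ q \<noteq> 0)"
  proof (rule ccontr)
   assume n: "\<not> ?thesis"
   have z: "GEN w. f 0 w * xz w ^ q = 0" "GEN w. f 1 w * yy w ^ q = 0"
    using n rat_dichotomy[OF rat_mult[OF rf[of 0] rat_power[OF rxy(1), of q]]]
     rat_dichotomy[OF rat_mult[OF rf[of 1] rat_power[OF rxy(2), of q]]] by blast+
   have "GEN w. False" using z g gen_eq gen_frame[OF U e(2)]
   proof eventually_elim
    case (elim w)
    have "f 0 w = 0" "f 1 w = 0" "f 2 w = 0" using elim by (simp_all add: xz_def yy_def)
    then have "dn (e 0 w) j = 0" if "j < 3" for j using that by (auto simp: f_def less_Suc_eq numeral_3_eq_3 numeral_2_eq_2)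
    then have "up (dn (e 0 w)) = up (\<lambda>j. 0)" by (intro up_cong)
    then have "e 0 w = (\<lambda>l. 0)" unfolding E_D(5)[OF eE U] by (auto simp: up_def fun_eq_iff)
    moreover have "\<exists>l. e 0 w l \<noteq> 0" using frameD(3)[OF e(1) elim(5)] unfolding independent_1 .
    ultimately show ?case by simp
   qed
   then show False by simp
  qed
 qed
qed

lemma E_slope: "slope X E = - (of_nat q * of_nat d) / 2"
 by (simp add: slope_def E_degree bundle_rank_eq[OF E_bundle])

text \<open>Only line sub-bundles can destabilise, since one of rank 2 has the slope of E; for them
  \<open>line_bound\<close> applies, and its first alternative is harmless.\<close>

lemma E_semistable:
 assumes "\<And>A B. ncr A B \<Longrightarrow> gap q A B \<le> 0" shows "semistable X E" unfolding semistable_def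
proof (intro conjI allI impI)
 show "vector_bundle X E" using E_bundle unfolding vector_bundle_def by blast
 fix W assume W: "subbundle X W E \<and> bundle_rank X W > 0"
 obtain r where r: "vector_bundle_rank X r W" "r \<le> 2" "bundle_rank X W = r"
  using subbundle_rank[OF conjunct1[OF W] E_bundle] by blast
 then consider "r = Suc 0" | "r = 2" using W by linarith
 then show "slope X W \<le> slope X E"
 proof cases
  case 1
  have sub: "\<And>U. zopen X U \<Longrightarrow> W U \<subseteq> E U" using W by (simp add: subbundle_def)
  have "2 * bundle_degree X W \<le> - (int q * int d) \<or>
    (\<exists>A B. ncr A B \<and> 2 * bundle_degree X W \<le> gap q A B - int q * int d)"
   by (rule line_bound[OF r(1)[unfolded 1]]) (rule sub)
  then have "2 * bundle_degree X W \<le> - (int q * int d)"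
  proof (elim disjE exE conjE)
   fix A B assume "ncr A B" "2 * bundle_degree X W \<le> gap q A B - int q * int d"
   then show ?thesis using assms[of A B] by linarith
  qed simp
  then have "of_int (2 * bundle_degree X W) \<le> (of_int (- (int q * int d)) :: rat)" by (simp only: of_int_le_iff)
  then show ?thesis unfolding E_slope slope_def[of X W] r(3) 1 by simp
 next
  case 2
  then show ?thesis using subbundle_same_rank_slope[OF conjunct1[OF W] E_bundle] r(1) by simp
 qed
qed

end

context trinomial_curve
begin

section \<open>Two-step filtrations\<close>

lemma zero_bundle_rank: "vector_bundle_rank X 0 zero_bundle" unfolding vector_bundle_rank_def
proof (intro conjI ballI)
 show "module_sheaf X zero_bundle" unfolding module_sheaf_def
 proof (intro allI impI conjI ballI)
  fix U :: "'k pt set" and s :: "'k sheaf_section" assume U: "zopen X U"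
  assume A: "(\<forall>v. v \<notin> U \<longrightarrow> (\<forall>j. s v j = 0)) \<and>
     (\<forall>v\<in>U. \<exists>W. zopen X W \<and> v \<in> W \<and> W \<subseteq> U \<and> restr W s \<in> zero_bundle W)"
  have "s v j = 0" for v j
  proof (cases "v \<in> U")
   case True
   then obtain W where W: "v \<in> W" "restr W s \<in> zero_bundle W" using A by blast
   have "restr W s v j = 0" using W(2) by (simp add: zero_bundle_def)
   then show ?thesis using W(1) by (simp add: restr_def)
  qed (use A in blast)
  then show "s \<in> zero_bundle U" by (simp add: zero_bundle_def fun_eq_iff)
 qed (auto simp: zero_bundle_def restr_def)
 show "\<exists>U e. v \<in> U \<and> local_frame X zero_bundle 0 U e" if v: "v \<in> X" for v
  by (rule exI[of _ X], rule exI[of _ "\<lambda>_ _ _. 0"])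
   (use v in \<open>auto simp: local_frame_def zero_bundle_def independent_values_def\<close>)
qed

lemma quotient_by_zero:
 assumes L: "vector_bundle_rank X r L" shows "quotient_bundle X L zero_bundle L"
 unfolding quotient_bundle_def
proof (intro conjI)
 note LM = vbrD(1)[OF L]
 show "vector_bundle X L" using L unfolding vector_bundle_def by blast
 show "subbundle X zero_bundle L" unfolding subbundle_def vector_bundle_def
  using L zero_bundle_rank sheafD(2)[OF LM] by (auto simp: zero_bundle_def)
 show "\<exists>\<phi>. sheaf_hom X L L \<phi> \<and> (\<forall>U. zopen X U \<longrightarrow> {s \<in> L U. \<phi> U s = (\<lambda>v j. 0)} = zero_bundle U) \<and>
  (\<forall>U t v. zopen X U \<and> t \<in> L U \<and> v \<in> U \<longrightarrow>
   (\<exists>U' s. zopen X U' \<and> v \<in> U' \<and> U' \<subseteq> U \<and> s \<in> L U' \<and> \<phi> U' s = restr U' t))"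
 proof (rule exI[of _ "\<lambda>U s. s"], intro conjI allI impI)
  show "sheaf_hom X L L (\<lambda>U s. s)" by (simp add: sheaf_hom_def)
  show "{s \<in> L U. s = (\<lambda>v j. 0)} = zero_bundle U" if "zopen X U" for U
   using sheafD(2)[OF LM that] by (auto simp: zero_bundle_def)
  fix U t v assume A: "zopen X U \<and> t \<in> L U \<and> v \<in> U"
  have "restr U t = t" using sheafD(1)[OF LM, of U t] A by (auto simp: restr_def fun_eq_iff)
  then show "\<exists>U' s. zopen X U' \<and> v \<in> U' \<and> U' \<subseteq> U \<and> s \<in> L U' \<and> s = restr U' t" using A by (intro exI[of _ U] exI[of _ t]) auto
 qed
qed

text \<open>A line sub-bundle of more than half the degree leaves a quotient line bundle of smaller
  slope, and line bundles are semistable.\<close>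

lemma HN_two_step:
 assumes E: "vector_bundle_rank X 2 E" and L: "vector_bundle_rank X (Suc 0) L"
  and sub: "\<And>U. zopen X U \<Longrightarrow> L U \<subseteq> E U" and deg: "2 * bundle_degree X L > bundle_degree X E"
 shows "HN_filtration X E [zero_bundle, L, E]"
proof -
 obtain Q where Q: "quotient_bundle X E L Q" "vector_bundle_rank X (Suc 0) Q" "bundle_degree X Q = bundle_degree X E - bundle_degree X L"
  using quotient_exists[OF E L] sub by blast
 have sQ: "slope X Q < slope X L"
  using deg by (simp add: slope_def bundle_rank_eq[OF Q(2)] bundle_rank_eq[OF L] Q(3))
 have ss: "semistable X L" "semistable X Q" using semistable_line L Q(2) by simp_all
 show ?thesis unfolding HN_filtration_def by (intro conjI exI[of _ "[L, Q]"])
   (use quotient_by_zero[OF L] Q(1) ss sQ bundle_rank_eq[OF Q(2)] bundle_rank_eq[OF L] in \<open>auto simp: less_Suc_eq\<close>)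
qed

section \<open>The line sub-bundle attached to a coprime pair\<close>

lemma locv_extend3:
 fixes k :: nat
 assumes v: "v \<in> X" and h: "\<And>j. j < 3 \<Longrightarrow> locv v (h j) (c j)" and k: "k < 3" "c k \<noteq> 0"
 obtains U g where "zopen X U" "v \<in> U" "\<And>j. j < 3 \<Longrightarrow> g j \<in> regular X U"
  "\<And>j. j < 3 \<Longrightarrow> GEN w. g j w = h j w" "\<And>w. w \<in> U \<Longrightarrow> g k w \<noteq> 0"
proof -
 have "\<forall>j. \<exists>W f. j < (3::nat) \<longrightarrow> zopen X W \<and> v \<in> W \<and> f \<in> regular X W \<and> (GEN w. f w = h j w) \<and>
   (c j \<noteq> 0 \<longrightarrow> (\<forall>w\<in>W. f w \<noteq> 0))"
 proof
  fix j :: nat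
  show "\<exists>W f. j < 3 \<longrightarrow> zopen X W \<and> v \<in> W \<and> f \<in> regular X W \<and> (GEN w. f w = h j w) \<and>
   (c j \<noteq> 0 \<longrightarrow> (\<forall>w\<in>W. f w \<noteq> 0))"
  proof (cases "j < 3")
   case True
   show ?thesis
   proof (rule locv_extend[OF v h[OF True]])
    fix W f assume 1: "zopen X W" "v \<in> W" "f \<in> regular X W" "f v = c j" "GEN w. f w = h j w"
     "c j \<noteq> 0 \<Longrightarrow> \<forall>w\<in>W. f w \<noteq> 0"
    show ?thesis by (rule exI[of _ W], rule exI[of _ f]) (use 1 in simp)
   qed
  qed simp
 qed
 from choice[OF this] obtain W where W0: "\<forall>j. \<exists>f. j < (3::nat) \<longrightarrow> zopen X (W j) \<and> v \<in> W j \<and> f \<in> regular X (W j) \<and>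
   (GEN w. f w = h j w) \<and> (c j \<noteq> 0 \<longrightarrow> (\<forall>w\<in>W j. f w \<noteq> 0))" by (rule exE)
 from choice[OF this] obtain f where W1: "\<forall>j. j < (3::nat) \<longrightarrow> zopen X (W j) \<and> v \<in> W j \<and> f j \<in> regular X (W j) \<and>
   (GEN w. f j w = h j w) \<and> (c j \<noteq> 0 \<longrightarrow> (\<forall>w\<in>W j. f j w \<noteq> 0))" by (rule exE)
 note W = W1[THEN spec, THEN mp]
 define U where "U = W 0 \<inter> W 1 \<inter> W 2"
 have U: "zopen X U" "v \<in> U" unfolding U_def using W[of 0] W[of 1] W[of 2] by auto
 have UW: "U \<subseteq> W j" if "j < 3" for j
 proof -
  have "j = 0 \<or> j = 1 \<or> j = 2" using that by linarith
  then show ?thesis unfolding U_def by blast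
 qed
 define g where "g j w = (if w \<in> U then f j w else 0)" for j w
 show ?thesis
 proof (rule that[OF U])
  fix j :: nat assume j: "j < 3"
  show "g j \<in> regular X U" unfolding g_def using tf_restrict[OF _ U(1) UW[OF j]] W[OF j] by blast
  show "GEN w. g j w = h j w"
   using conjunct1[OF conjunct2[OF conjunct2[OF conjunct2[OF W[OF j]]]]] gen_zopen[OF U]
   by eventually_elim (simp add: g_def)
 next
  show "g k w \<noteq> 0" if w: "w \<in> U" for w using W[OF k(1)] k(2) UW[OF k(1)] w by (auto simp: g_def)
 qed
qed

end

context syz_bundle
begin

text \<open>All sections of E generically proportional to \<open>fam\<close>, proportionality being
  expressed by cross products. This is a saturated subsheaf, which is what makes it a
  sub-bundle.\<close>

definition lnb :: "'a poly \<Rightarrow> 'a poly \<Rightarrow> 'a sheaf" where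
 "lnb A B U = {g \<in> E U. GEN w. \<forall>i<3. \<forall>j<3. dn (g w) i * fam q A B j w = dn (g w) j * fam q A B i w}"

lemma lnb_restr:
 assumes "g \<in> lnb A B U" "zopen X U" "zopen X W" "W \<subseteq> U" shows "restr W g \<in> lnb A B W"
proof -
 have g: "g \<in> E U" "GEN w. \<forall>i<3. \<forall>j<3. dn (g w) i * fam q A B j w = dn (g w) j * fam q A B i w"
  using assms(1) by (simp_all add: lnb_def)
 have "GEN w. \<forall>i<3. \<forall>j<3. dn (restr W g w) i * fam q A B j w = dn (restr W g w) j * fam q A B i w" using g(2)
 proof eventually_elim
  case (elim w)
  then show ?case by (cases "w \<in> W") (simp_all add: restr_def)
 qed
 then show ?thesis using sheafD(5)[OF E_module assms(2-4) g(1)] by (simp add: lnb_def)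
qed

lemma lnb_module: "module_sheaf X (lnb A B)" unfolding module_sheaf_def
proof (intro allI impI conjI ballI)
 fix U assume U: "zopen X U"
 note M = sheafD[OF E_module U]
 show "s v j = 0" if "s \<in> lnb A B U" "v \<notin> U" for s v j using M(1)[of s v j] that by (simp add: lnb_def)
 show "(\<lambda>v j. 0) \<in> lnb A B U" using M(2) by (simp add: lnb_def)
 show "(\<lambda>v j. s v j + t v j) \<in> lnb A B U" if s: "s \<in> lnb A B U" and t: "t \<in> lnb A B U" for s t
 proof -
  have "GEN w. \<forall>i<3. \<forall>j<3. dn (s w) i * fam q A B j w = dn (s w) j * fam q A B i w"
   "GEN w. \<forall>i<3. \<forall>j<3. dn (t w) i * fam q A B j w = dn (t w) j * fam q A B i w"
   using s t by (simp_all add: lnb_def)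
  then have "GEN w. \<forall>i<3. \<forall>j<3. dn (\<lambda>j. s w j + t w j) i * fam q A B j w = dn (\<lambda>j. s w j + t w j) j * fam q A B i w"
   by eventually_elim (simp add: dn_add distrib_right)
  then show ?thesis using M(3) s t by (simp add: lnb_def)
 qed
 show "(\<lambda>v j. f v * s v j) \<in> lnb A B U" if f: "f \<in> regular X U" and s: "s \<in> lnb A B U" for f s
 proof -
  have "GEN w. \<forall>i<3. \<forall>j<3. dn (s w) i * fam q A B j w = dn (s w) j * fam q A B i w"
   using s by (simp add: lnb_def)
  then have "GEN w. \<forall>i<3. \<forall>j<3. dn (\<lambda>j. f w * s w j) i * fam q A B j w = dn (\<lambda>j. f w * s w j) j * fam q A B i w"
   by eventually_elim (simp add: dn_cmult mult.assoc)
  then show ?thesis using M(4) f s by (simp add: lnb_def)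
 qed
 show "restr W s \<in> lnb A B W" if "zopen X W \<and> W \<subseteq> U \<and> s \<in> lnb A B U" for W s using lnb_restr U that by blast
 fix s :: "'a sheaf_section"
 assume H: "(\<forall>v. v \<notin> U \<longrightarrow> (\<forall>j. s v j = 0)) \<and>
     (\<forall>v\<in>U. \<exists>W. zopen X W \<and> v \<in> W \<and> W \<subseteq> U \<and> restr W s \<in> lnb A B W)"
 have sE: "s \<in> E U"
 proof (rule M(6))
  show "s v j = 0" if "v \<notin> U" for v j using H that by blast
  show "\<exists>W. zopen X W \<and> v \<in> W \<and> W \<subseteq> U \<and> restr W s \<in> E W" if "v \<in> U" for v
   using H that unfolding lnb_def by blast
 qed
 have "GEN w. \<forall>i<3. \<forall>j<3. dn (s w) i * fam q A B j w = dn (s w) j * fam q A B i w"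
 proof (cases "U = {}")
  case True
  then have "s = (\<lambda>v j. 0)" using H by auto
  then show ?thesis by simp
 next
  case False
  then obtain v where "v \<in> U" by blast
  then obtain W where W: "zopen X W" "v \<in> W" "restr W s \<in> lnb A B W" using H by blast
  have "GEN w. \<forall>i<3. \<forall>j<3. dn (restr W s w) i * fam q A B j w = dn (restr W s w) j * fam q A B i w"
   using W(3) by (simp add: lnb_def)
  then show ?thesis using gen_zopen[OF W(1,2)]
  proof eventually_elim
   case (elim w)
   have "restr W s w = s w" using elim(2) by (simp add: restr_def)
   then show ?case using elim(1) by simp
  qed
 qed
 then show "s \<in> lnb A B U" using sE by (simp add: lnb_def)
qed

lemma fam_relation: "GEN w. (\<Sum>j<3. fam q A B j w * co j w ^ q) = 0" using gen_eq
proof eventually_elim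
 case (elim w)
 have "poly A (tt w) / xz w ^ q * fst w ^ q = poly A (tt w) * cz w ^ q"
  "poly B (tt w) / yy w ^ q * cy w ^ q = poly B (tt w) * cz w ^ q"
  using elim by (simp_all add: xz_def yy_def power_divide)
 then show ?case unfolding sum_lt3 by (simp add: fam_def co_def algebra_simps)
qed

lemma locv_relation:
 assumes U: "zopen X U" and g: "\<And>j. j < 3 \<Longrightarrow> g j \<in> regular X U"
  and rel: "GEN w. (\<Sum>j<3. g j w * co j w ^ q) = 0" and w: "w \<in> U" shows "(\<Sum>j<3. g j w * co j w ^ q) = 0"
proof -
 have wX: "w \<in> X" using zopen_sub[OF U] w by blast
 obtain l where l: "form (Suc 0) l" "l w \<noteq> 0" using tcong_coords[OF wX] by blast
 have L: "locv w (\<lambda>u. \<Sum>j<3. g j u * (co j u / l u) ^ q) (\<Sum>j<3. g j w * (co j w / l w) ^ q)"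
  by (intro locv_sum[OF wX] locv_mult locv_power locv_frac[OF form_co l(1)] locv_regular[OF g w]) (use l in simp_all)
 have e: "(\<Sum>j<3. g j u * (co j u / l u) ^ q) = (\<Sum>j<3. g j u * co j u ^ q) / l u ^ q" for u
  by (simp add: power_divide sum_divide_distrib)
 have "GEN u. (\<Sum>j<3. g j u * (co j u / l u) ^ q) = 0" unfolding e using rel by eventually_elim simp
 from locv_unique[OF wX L locv_cong[OF locv_const this]] have "(\<Sum>j<3. g j w * co j w ^ q) / l w ^ q = 0" unfolding e .
 then show ?thesis using l(2) by simp
qed

text \<open>Divided by \<tau> to the power \<open>bd\<close>, the entries of \<open>fam\<close>
  become regular, and one of them, the k-th, is a unit since the least order is attained. That entry
  shows that the generator does not vanish and yields the coefficient of any other section.\<close>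

lemma lnb_frame:
 assumes nc: "ncr A B" and v: "v \<in> X"
 shows "\<exists>U g. v \<in> U \<and> local_frame X (lnb A B) (Suc 0) U (\<lambda>i w. up (\<lambda>j. g j w)) \<and>
  (GEN w. \<forall>j<3. fam q A B j w = tau v w powi (bd q A B (proj_point v)) * g j w)"
proof -
 define n where "n = bd q A B (proj_point v)"
 have "\<forall>j. \<exists>h e. j < 3 \<longrightarrow> locv v h e \<and> (GEN w. fam q A B j w = tau v w powi n * h w)"
  using fam_orders[OF v nc, of q] unfolding ordge_def n_def by blast
 then obtain h c where h: "\<And>j. j < 3 \<Longrightarrow> locv v (h j) (c j) \<and> (GEN w. fam q A B j w = tau v w powi n * h j w)"
  by metis
 obtain k where k: "k < 3" "hasord v (fam q A B k) n" using fam_orders[OF v nc, of q] unfolding n_def by blast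
 have ck: "c k \<noteq> 0" using hasord_locv_ge(2)[OF v k(2) conjunct1[OF h[OF k(1)]] conjunct2[OF h[OF k(1)]]] by simp
 obtain U g where U: "zopen X U" "v \<in> U" and g: "\<And>j. j < 3 \<Longrightarrow> g j \<in> regular X U"
  and gh: "\<And>j. j < 3 \<Longrightarrow> GEN w. g j w = h j w" and gk: "\<And>w. w \<in> U \<Longrightarrow> g k w \<noteq> 0"
 proof (rule locv_extend3[where v = v and h = h and c = c and k = k])
  show "v \<in> X" by (rule v)
  show "\<And>j. j < 3 \<Longrightarrow> locv v (h j) (c j)" using h by blast
  show "k < 3" "c k \<noteq> 0" by (rule k(1) ck)+
 qed blast
 have fg0: "GEN w. fam q A B j w = tau v w powi n * g j w" if j: "j < 3" for j
  using conjunct2[OF h[OF j]] gh[OF j] by eventually_elim simp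
 have fg: "GEN w. \<forall>j<3. fam q A B j w = tau v w powi n * g j w" using fg0[of 0] fg0[of 1] fg0[of 2]
  by (simp add: numeral_3_eq_3 less_Suc_eq numeral_2_eq_2 all_conj_distrib eventually_conj_iff)
 have rel: "GEN w. (\<Sum>j<3. g j w * co j w ^ q) = 0" using fam_relation[of A B] fg gen_tau[OF v]
 proof eventually_elim
  case (elim w)
  have "(\<Sum>j<3. fam q A B j w * co j w ^ q) = tau v w powi n * (\<Sum>j<3. g j w * co j w ^ q)"
   unfolding sum_distrib_left by (intro sum.cong refl) (use elim(2) in simp)
  then show ?case using elim(1,3) by simp
 qed
 have uE: "(\<lambda>w. up (\<lambda>j. g j w)) \<in> E U" by (rule E_up[OF U(1) g locv_relation[OF U(1) g rel]])
 have uL: "(\<lambda>w. up (\<lambda>j. g j w)) \<in> lnb A B U"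
 proof -
  have "GEN w. \<forall>i<3. \<forall>j<3. dn (up (\<lambda>j. g j w)) i * fam q A B j w = dn (up (\<lambda>j. g j w)) j * fam q A B i w"
   using fg by eventually_elim (simp add: dn_up)
  then show ?thesis using uE by (simp add: lnb_def)
 qed
 have "local_frame X (lnb A B) (Suc 0) U (\<lambda>i w. up (\<lambda>j. g j w))" unfolding local_frame_def
 proof (intro conjI allI impI ballI)
  show "zopen X U" by (rule U)
  show "(\<lambda>w. up (\<lambda>j. g j w)) \<in> lnb A B U" by (rule uL)
  show "independent_values (Suc 0) (\<lambda>i w. up (\<lambda>j. g j w)) w" if w: "w \<in> U" for w unfolding independent_1
  proof (rule ccontr)
   assume "\<not> (\<exists>l. up (\<lambda>j. g j w) l \<noteq> 0)"
   then have "up (\<lambda>j. g j w) = (\<lambda>l. 0)" by auto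
   then have "dn (up (\<lambda>j. g j w)) k = 0" by simp
   then show False using dn_up[OF k(1)] gk[OF w] by simp
  qed
  fix W s assume H: "zopen X W \<and> W \<subseteq> U \<and> s \<in> lnb A B W"
  then have W: "zopen X W" "W \<subseteq> U" and sE: "s \<in> E W"
   and sf: "GEN w. \<forall>i<3. \<forall>j<3. dn (s w) i * fam q A B j w = dn (s w) j * fam q A B i w" by (auto simp: lnb_def)
  define gW where "gW j w = (if w \<in> W then g j w else 0)" for j w
  have gW: "gW j \<in> regular X W" if "j < 3" for j unfolding gW_def using tf_restrict[OF g[OF that] W] .
  have gWk: "gW k w \<noteq> 0" if "w \<in> W" for w using gk[OF subsetD[OF W(2) that]] that by (simp add: gW_def)
  define b where "b w = dn (s w) k * inverse (gW k w)" for w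
  have iv: "(\<lambda>w. inverse (gW k w)) \<in> regular X W" using tf_inverse[OF gW[OF k(1)] gWk] by simp
  have b: "b \<in> regular X W" unfolding b_def using regular_mult[OF E_D(1)[OF sE W(1)] iv] .
  have eq: "dn (s w) j = b w * g j w" if j: "j < 3" and w: "w \<in> W" for j w
  proof -
   have "GEN u. dn (s u) j = b u * gW j u" using sf fg gen_tau[OF v] gen_zopen[OF W(1) w]
   proof eventually_elim
    case (elim u)
    have "dn (s u) j * (tau v u powi n * g k u) = dn (s u) k * (tau v u powi n * g j u)"
     using elim(1,2) j k(1) by metis
    then have "tau v u powi n * (dn (s u) j * g k u) = tau v u powi n * (dn (s u) k * g j u)"
     by (simp only: mult_ac)
    then have "dn (s u) j * g k u = dn (s u) k * g j u" using elim(3) by simp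
    then show ?case using elim(4) gk[OF subsetD[OF W(2) elim(4)]] by (simp add: b_def gW_def field_simps)
   qed
   from regular_gen_eq[OF E_D(1)[OF sE W(1)] regular_mult[OF b gW[OF j]] this w w] zopen_sub[OF W(1)] w
   show ?thesis by (auto simp: gW_def)
  qed
  have "s = (\<lambda>w l. \<Sum>i<Suc 0. b w * up (\<lambda>j. g j w) l)"
  proof (intro ext)
   fix w l
   show "s w l = (\<Sum>i<Suc 0. b w * up (\<lambda>j. g j w) l)"
   proof (cases "w \<in> W")
    case True
    have "s w = up (dn (s w))" using E_D(5)[OF sE W(1)] by simp
    also have "\<dots> = up (\<lambda>j. b w * g j w)" by (rule up_cong) (rule eq[OF _ True])
    finally have "s w l = up (\<lambda>j. b w * g j w) l" by (rule fun_cong)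
    then show ?thesis by (simp add: up_cmult)
   next
    case False
    then have "b w = 0" "s w l = 0" using tf_out[OF b] E_D(4)[OF sE W(1)] by auto
    then show ?thesis by simp
   qed
  qed
  then show "\<exists>f. (\<forall>i<Suc 0. f i \<in> regular X W) \<and> s = (\<lambda>v j. \<Sum>i<Suc 0. f i v * up (\<lambda>j. g j v) j)"
   using b by (intro exI[of _ "\<lambda>i. b"]) simp
 qed
 then show ?thesis using U(2) fg unfolding n_def by blast
qed

lemma lnb_bundle: assumes "ncr A B" shows "vector_bundle_rank X (Suc 0) (lnb A B)"
 unfolding vector_bundle_rank_def using lnb_module lnb_frame[OF assms] by blast

text \<open>The frame at v0 is \<open>fam\<close> divided by a power of \<open>tau v0\<close>. That
  power is a rational function with divisor of degree 0, so the degree is the total of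
  \<open>bd\<close>.\<close>

lemma lnb_degree: assumes nc: "ncr A B" shows "2 * bundle_degree X (lnb A B) = gap q A B - int q * int d"
proof -
 define n where "n = bd q A B"
 obtain v0 where v0: "v0 \<in> X" using X_nonempty by blast
 define n0 where "n0 = n (proj_point v0)"
 obtain U g where g: "v0 \<in> U" "local_frame X (lnb A B) (Suc 0) U (\<lambda>i w. up (\<lambda>j. g j w))"
  "GEN w. \<forall>j<3. fam q A B j w = tau v0 w powi n0 * g j w" using lnb_frame[OF nc v0] unfolding n_def n0_def by blast
 have t0: "rat (\<lambda>w. tau v0 w powi (- n0))" "GEN w. tau v0 w powi (- n0) \<noteq> 0"
  using hasord_rat[OF v0] hasord_nz[OF v0] hasord_powi[OF v0 hasord_tau] by blast+
 define m where "m P = n P + ordd (\<lambda>w. tau v0 w powi (- n0)) P" for P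
 have "bundle_degree X (lnb A B) = dsum m"
 proof (rule bundle_degree_local(1)[OF lnb_bundle[OF nc] _ g(2)])
  show "0 < Suc 0" by simp
  show "U \<noteq> {}" using g(1) by blast
  fix v assume v: "v \<in> X"
  obtain W h where h: "v \<in> W" "local_frame X (lnb A B) (Suc 0) W (\<lambda>i w. up (\<lambda>j. h j w))"
   "GEN w. \<forall>j<3. fam q A B j w = tau v w powi (n (proj_point v)) * h j w"
   using lnb_frame[OF nc v] unfolding n_def by blast
  define a where "a i j w = tau v w powi (n (proj_point v)) * tau v0 w powi (- n0)" for i j :: nat and w
  have eq: "GEN w. \<forall>j<Suc 0. \<forall>l. up (\<lambda>j. g j w) l = (\<Sum>i<Suc 0. a i j w * up (\<lambda>j. h j w) l)"
   using g(3) h(3) gen_tau[OF v0]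
  proof eventually_elim
   case (elim w)
   have "g j w = a 0 0 w * h j w" if "j < 3" for j
   proof -
    have "tau v0 w powi n0 * g j w = tau v w powi (n (proj_point v)) * h j w" using elim(1,2) that by metis
    then show ?thesis using elim(3) by (simp add: a_def power_int_minus field_simps)
   qed
   then have "up (\<lambda>j. g j w) = up (\<lambda>j. a 0 0 w * h j w)" by (rule up_cong)
   then have "up (\<lambda>j. g j w) l = a 0 0 w * up (\<lambda>j. h j w) l" for l by (simp add: up_cmult)
   then show ?case by simp
  qed
  have "hasord v (\<lambda>w. tau v w powi (n (proj_point v)) * tau v0 w powi (- n0)) (m (proj_point v))"
   using hasord_mult[OF v hasord_powi[OF v hasord_tau, of "n (proj_point v)"] hasord_ordd[OF v t0]] by (simp add: m_def)
  then have o: "hasord v (dm (Suc 0) a) (m (proj_point v))" by (simp add: dm_1[abs_def] a_def[abs_def])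
  show "\<exists>W e a. local_frame X (lnb A B) (Suc 0) W e \<and> v \<in> W \<and>
   (GEN w. \<forall>j<Suc 0. \<forall>l. up (\<lambda>j. g j w) l = (\<Sum>i<Suc 0. a i j w * e i w l)) \<and> hasord v (dm (Suc 0) a) (m (proj_point v))"
   using h(1,2) eq o by blast
 qed
 also have "\<dots> = dsum (bd q A B)"
  unfolding m_def dsum_add[OF dsum_bd(2)[of q A B, folded n_def] fsup_ordd[OF t0]] product_formula[OF t0] by (simp add: n_def)
 finally show ?thesis using dsum_bd(1) by simp
qed

lemma HN_exists:
 assumes nc: "ncr A B" and gap: "gap q A B > 0"
 shows "\<exists>L. line_bundle X L \<and> HN_filtration X E [zero_bundle, L, E] \<and> slope X L = slope X E + of_int (gap q A B) / 2"
proof -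
 note L = lnb_bundle[OF nc]
 have "HN_filtration X E [zero_bundle, lnb A B, E]"
  by (rule HN_two_step[OF E_bundle L]) (use lnb_degree[OF nc] gap in \<open>auto simp: lnb_def E_degree\<close>)
 moreover have "slope X (lnb A B) = slope X E + of_int (gap q A B) / 2"
 proof -
  have "of_int (2 * bundle_degree X (lnb A B)) = (of_int (gap q A B - int q * int d) :: rat)"
   unfolding lnb_degree[OF nc] ..
  then show ?thesis unfolding E_slope slope_def[of X "lnb A B"] bundle_rank_eq[OF L] by (simp add: field_simps)
 qed
 ultimately show ?thesis using L by (intro exI[of _ "lnb A B"]) simp
qed

end

section \<open>The Wronskian bound in positive characteristic\<close>

lemma degree_pderiv_lt:
 fixes A :: "'k::idom poly"
 assumes "pderiv A \<noteq> 0" shows "degree (pderiv A) < degree A"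
proof (rule ccontr)
 assume "\<not> ?thesis"
 then have "coeff A (Suc (degree (pderiv A))) = 0" by (simp add: coeff_eq_0)
 then have "coeff (pderiv A) (degree (pderiv A)) = 0" by (simp add: coeff_pderiv)
 then show False using assms by simp
qed

text \<open>Euclid's lemma with coprimality expressed by roots: a root of A is not one of B, hence
  is one of C, and the linear factor cancels on both sides.\<close>

lemma dvd_of_no_common_root:
 fixes A B C D :: "'k::alg_closed_field poly"
 assumes "A \<noteq> 0" "A * D = C * B" "\<And>a. poly A a \<noteq> 0 \<or> poly B a \<noteq> 0" shows "A dvd C" using assms
proof (induction "degree A" arbitrary: A C rule: less_induct)
 case less
 show ?case
 proof (cases "\<exists>a. poly A a = 0")
  case True
  then obtain a where a: "poly A a = 0" by blast
  obtain A1 where A1: "A = [:-a, 1:] * A1" using a unfolding poly_eq_0_iff_dvd by (auto elim: dvdE)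
  have "poly C a * poly B a = 0" using arg_cong[OF less.prems(2), of "\<lambda>P. poly P a"] a by simp
  then have "poly C a = 0" using less.prems(3)[of a] a by auto
  then obtain C1 where C1: "C = [:-a, 1:] * C1" unfolding poly_eq_0_iff_dvd by (auto elim: dvdE)
  have nz: "A1 \<noteq> 0" using less.prems(1) A1 by auto
  then have "degree A = degree [:-a, 1:] + degree A1" unfolding A1 by (intro degree_mult_eq) auto
  then have d: "degree A1 < degree A" by simp
  have "[:-a, 1:] * (A1 * D) = [:-a, 1:] * (C1 * B)"
   using less.prems(2) unfolding A1 C1 by (simp only: mult.assoc)
  then have "A1 * D = C1 * B" by (subst (asm) mult_left_cancel) simp_all
  moreover have "poly A1 b \<noteq> 0 \<or> poly B b \<noteq> 0" for b using less.prems(3)[of b] A1 by auto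
  ultimately have "A1 dvd C1" using less.hyps[OF d nz] by blast
  then show ?thesis unfolding A1 C1 by (rule mult_dvd_mono[OF dvd_refl])
 next
  case False
  then have "degree A = 0" using alg_closed_imp_poly_has_root[of A] less.prems(1) by auto
  then obtain a where "A = [:a:]" by (auto elim: degree_eq_zeroE)
  then have "is_unit A" using less.prems(1) by (simp add: is_unit_const_poly_iff dvd_field_iff)
  then show ?thesis by (rule unit_imp_dvd)
 qed
qed

text \<open>Only exponents divisible by p survive a vanishing derivative; the coefficients have p-th
  roots in k, and the p-th power is additive.\<close>

lemma pderiv_zero_power:
 fixes A :: "'k::alg_closed_field poly"
 assumes p: "CHAR('k) > 0" and A: "pderiv A = 0" shows "\<exists>B. A = B ^ CHAR('k)"
proof -
 define p where "p = CHAR('k)"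
 have pp: "prime p" "p > 0" unfolding p_def using prime_CHAR_semidom[OF p] p by auto
 have "\<forall>c. \<exists>r :: 'k. r ^ p = c" using nth_root_exists[OF pp(2)] by blast
 then obtain r :: "'k \<Rightarrow> 'k" where r: "\<And>c. r c ^ p = c" by metis
 define B where "B = (\<Sum>i\<le>degree A. monom (r (coeff A (p * i))) i)"
 have "B ^ p = (\<Sum>i\<le>degree A. monom (r (coeff A (p * i))) i ^ p)"
  unfolding B_def by (rule freshmans_dream_sum) (simp_all add: p_def pp(1)[unfolded p_def])
 also have "\<dots> = (\<Sum>i\<le>degree A. monom (coeff A (p * i)) (p * i))" by (simp add: monom_power r mult.commute)
 also have "\<dots> = A"
 proof (rule poly_eqI)
  fix n
  have c: "coeff (\<Sum>i\<le>degree A. monom (coeff A (p * i)) (p * i)) n = (\<Sum>i\<le>degree A. if p * i = n then coeff A (p * i) else 0)"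
   by (simp add: coeff_sum)
  show "coeff (\<Sum>i\<le>degree A. monom (coeff A (p * i)) (p * i)) n = coeff A n"
  proof (cases "p dvd n")
   case True
   then obtain k where k: "n = p * k" by blast
   have "(\<Sum>i\<le>degree A. if p * i = n then coeff A (p * i) else 0) = (\<Sum>i\<le>degree A. if i = k then coeff A n else 0)"
    by (intro sum.cong refl) (use k pp(2) in auto)
   also have "\<dots> = (if k \<le> degree A then coeff A n else 0)" by (simp add: sum.delta)
   also have "\<dots> = coeff A n"
   proof (cases "k \<le> degree A")
    case False
    moreover have "k \<le> n" using k pp(2) by simp
    ultimately show ?thesis by (simp add: coeff_eq_0)
   qed simp
   finally show ?thesis unfolding c .
  next
   case False
   have "n \<noteq> 0"
   proof
    assume "n = 0"
    then show False using False by simp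
   qed
   then obtain k where k: "n = Suc k" by (cases n) auto
   have "of_nat n * coeff A n = 0" using arg_cong[OF A, of "\<lambda>P. coeff P k"] unfolding coeff_pderiv k by simp
   moreover have "of_nat n \<noteq> (0::'k)" using False unfolding p_def by (simp add: of_nat_eq_0_iff_char_dvd)
   ultimately have "coeff A n = 0" by simp
   moreover have "(\<Sum>i\<le>degree A. if p * i = n then coeff A (p * i) else 0) = 0"
    by (rule sum.neutral) (use False in auto)
   ultimately show ?thesis unfolding c by simp
  qed
 qed
 finally show ?thesis unfolding p_def by (intro exI[of _ B]) simp
qed

lemma order_power_eq: "A \<noteq> 0 \<Longrightarrow> pord a (A ^ n) = n * pord a A" for A :: "'k::idom poly"
 by (induction n) (simp_all add: order_mult)

lemma order_pderiv_ge:
 fixes A :: "'k::idom poly"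
 assumes "[:-a, 1:] ^ n dvd A" shows "[:-a, 1:] ^ (n - 1) dvd A" "[:-a, 1:] ^ (n - 1) dvd pderiv A"
proof -
 obtain Q where Q: "A = [:-a, 1:] ^ n * Q" using assms by blast
 have l: "[:-a, 1:] ^ (n - 1) dvd [:-a, 1:] ^ n" by (rule le_imp_power_dvd) simp
 show "[:-a, 1:] ^ (n - 1) dvd A" by (rule dvd_trans[OF l assms])
 show "[:-a, 1:] ^ (n - 1) dvd pderiv A"
  unfolding Q pderiv_mult by (intro dvd_add dvd_mult2[OF l] dvd_mult) (cases n, simp_all add: pderiv_power_Suc dvd_smult dvd_mult2 del: power_Suc)
qed

text \<open>The Wronskian is divisible by t^(n-1) and (1 + t)^(m-1) and has degree below deg A + deg
  B. The truncated subtraction is harmless, since n \<le> (n - 1) + 1 also for n = 0.\<close>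

lemma wronskian_bound:
 fixes A B :: "'k::alg_closed_field poly"
 assumes w: "pderiv A * B - A * pderiv B \<noteq> 0"
  and a: "[:0, 1:] ^ n dvd A" and c: "[:1, 1:] ^ m dvd - A - B" shows "n + m \<le> degree A + degree B + 1"
proof -
 define w where "w = pderiv A * B - A * pderiv B"
 have z: "[:-(0::'k), 1:] = [:0, 1:]" "[:-(-1::'k), 1:] = [:1, 1:]" by simp_all
 have d1: "[:0, 1:] ^ (n - 1) dvd w"
  using order_pderiv_ge[of 0 n A, unfolded z, OF a] unfolding w_def by (intro dvd_diff dvd_mult2)
 \<comment> \<open>The Wronskian of A and B is also that of B and -A - B, so zeros of the third
   polynomial count as well.\<close>
 have e: "w = B * pderiv (- A - B) * (- 1) + (- A - B) * pderiv B"
  unfolding w_def by (simp add: pderiv_diff pderiv_minus algebra_simps)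
 have d2: "[:1, 1:] ^ (m - 1) dvd w"
  using order_pderiv_ge[of "-1" m "- A - B", unfolded z, OF c] unfolding e by (intro dvd_add dvd_mult2 dvd_mult)
 have w0: "w \<noteq> 0" using w by (simp add: w_def)
 obtain Q where Q: "w = [:0, 1:] ^ (n - 1) * Q" using d1 by blast
 obtain R where R: "w = [:1, 1:] ^ (m - 1) * R" using d2 by blast
 have "[:1, 1:] ^ (m - 1) dvd Q"
 proof (rule dvd_of_no_common_root)
  from R show "[:1, 1:] ^ (m - 1) * R = Q * [:0, 1:] ^ (n - 1)" using Q by (simp add: mult.commute)
  show "[:1, 1:] ^ (m - 1) \<noteq> (0 :: 'k poly)" by simp
  show "poly ([:1, 1:] ^ (m - 1)) b \<noteq> 0 \<or> poly ([:0, 1:] ^ (n - 1)) b \<noteq> 0" for b :: 'k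
   by (cases "b = 0") auto
 qed
 then obtain R where R: "Q = [:1, 1:] ^ (m - 1) * R" by blast
 have R0: "R \<noteq> 0" using w0 Q R by auto
 have "degree w = (n - 1) + ((m - 1) + degree R)"
  unfolding Q R using R0 by (simp add: degree_mult_eq degree_power_eq)
 moreover have "degree w < degree A + degree B"
 proof -
  have s: "pderiv A * B = 0 \<or> degree (pderiv A * B) < degree A + degree B"
   "A * pderiv B = 0 \<or> degree (A * pderiv B) < degree A + degree B"
   using degree_pderiv_lt[of A] degree_pderiv_lt[of B] degree_mult_le[of "pderiv A" B] degree_mult_le[of A "pderiv B"]
   by fastforce+
  then have "0 < degree A + degree B" using w0 unfolding w_def by auto
  then show ?thesis unfolding w_def by (intro degree_diff_less) (use s in auto)
 qed
 ultimately show ?thesis by linarith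
qed

context trinomial_curve
begin

section \<open>Descent along Frobenius and the numerical criterion\<close>

lemma CHAR_pos: "CHAR('k) > 0" and CHAR_prime: "prime CHAR('k)"
proof -
 have "0 < d\<^sup>2" using d3 by simp
 then show p: "CHAR('k) > 0" using char_big by linarith
 show "prime CHAR('k)" by (rule prime_CHAR_semidom[OF p])
qed

text \<open>By coprimality A divides its derivative, which has smaller degree and so vanishes;
  likewise for B. Both are then p-th powers, and so is the third polynomial by additivity.\<close>

lemma wronskian_zero:
 assumes nc: "ncr A B" and w: "pderiv A * B - A * pderiv B = 0"
 obtains A0 B0 where "A = A0 ^ CHAR('k)" "B = B0 ^ CHAR('k)" "- A - B = (- A0 - B0) ^ CHAR('k)" "ncr A0 B0"
proof -
 have c: "pderiv P = 0" if "P \<noteq> 0" "P dvd pderiv P" for P :: "'k poly"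
 proof (rule ccontr)
  assume n: "pderiv P \<noteq> 0"
  show False using dvd_imp_degree_le[OF that(2) n] degree_pderiv_lt[OF n] by simp
 qed
 have A: "pderiv A = 0"
 proof (cases "A = 0")
  case False
  show ?thesis by (rule c[OF False dvd_of_no_common_root[OF False, of "pderiv B" _ B]]) (use w nc in \<open>auto simp: ncr_def\<close>)
 qed simp
 have B: "pderiv B = 0"
 proof (cases "B = 0")
  case False
  show ?thesis by (rule c[OF False dvd_of_no_common_root[OF False, of "pderiv A" _ A]])
    (use w nc in \<open>auto simp: ncr_def mult.commute\<close>)
 qed simp
 obtain A0 B0 where 0: "A = A0 ^ CHAR('k)" "B = B0 ^ CHAR('k)"
  using pderiv_zero_power[OF CHAR_pos A] pderiv_zero_power[OF CHAR_pos B] by blast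
 have "((- A0 - B0) + (A0 + B0)) ^ CHAR('k) = (- A0 - B0) ^ CHAR('k) + (A0 ^ CHAR('k) + B0 ^ CHAR('k))"
  by (subst freshmans_dream, simp_all add: CHAR_prime)+
 then have "A + (B + (- A0 - B0) ^ CHAR('k)) = 0" using CHAR_pos unfolding 0 by (simp add: power_0_left add_ac)
 from minus_unique[OF this] have "- A - B = (- A0 - B0) ^ CHAR('k)" by simp
 moreover have "ncr A0 B0" unfolding ncr_def
 proof
  fix a
  have "poly A a \<noteq> 0 \<or> poly B a \<noteq> 0" using nc by (simp add: ncr_def)
  then show "poly A0 a \<noteq> 0 \<or> poly B0 a \<noteq> 0" using CHAR_pos by (auto simp: 0)
 qed
 ultimately show ?thesis using that 0 by blast
qed

lemma trn_scale: "trn (p * q) (C ^ p) (int p * n) = int p * trn q C n" if "p > 0"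
proof -
 have "int lam * (int p * n) - int (p * q) * int al = int p * (int lam * n - int q * int al)" by (simp add: algebra_simps)
 moreover have "min (int p * x) 0 = int p * min x 0" for x
  using that by (cases "x \<le> 0") (simp_all add: min_def mult_le_0_iff)
 ultimately show ?thesis using that by (simp add: trn_def)
qed

text \<open>Frobenius pull-back multiplies degrees by p: vanishing orders, degrees and the offset q
  \<alpha> all scale by the same factor.\<close>

lemma gap_scale:
 assumes "p > 0" "- (A ^ p) - B ^ p = (- A - B) ^ p" shows "gap (p * q) (A ^ p) (B ^ p) = int p * gap q A B"
proof -
 have o: "int (pord a (C ^ p)) = int p * int (pord a C)" if "C \<noteq> 0" for a and C :: "'k poly"
  using order_power_eq[OF that, of a p] by simp
 have t: "trn (p * q) (C ^ p) (int (pord a (C ^ p))) = int p * trn q C (int (pord a C))" for a C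
  using trn_scale[OF assms(1), of q C "int (pord a C)"] o[of C a] assms(1) by (cases "C = 0") (simp_all add: trn_def)
 have dg: "int (degree (C ^ p)) = int p * int (degree C)" for C :: "'k poly"
  using degree_power_eq[of C p] assms(1) by (cases "C = 0") (simp_all add: power_0_left)
 have m: "mdeg (A ^ p) (B ^ p) = int p * mdeg A B"
  unfolding mdeg_def dg using assms(1) by (simp add: max_def)
 have tB: "trn (p * q) (B ^ p) (int p * mdeg A B - int p * int (degree B)) = int p * trn q B (mdeg A B - int (degree B))"
  using trn_scale[OF assms(1), of q B "mdeg A B - int (degree B)"] by (simp add: right_diff_distrib)
 show ?thesis unfolding gap_def m dg assms(2) t tB by (simp add: algebra_simps)
qed

text \<open>The criterion of Han and Monsky: the point \<open>(q \<alpha> / \<lambda>, q \<alpha> / \<lambda>, q \<alpha> / \<lambda>)\<close> has taxicab distance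
 less than 1 from an integral point with odd coordinate sum.\<close>

definition near :: "nat \<Rightarrow> bool" where
 "near q \<longleftrightarrow> (\<exists>n1 n2 n3 :: nat. odd (n1 + n2 + n3) \<and> \<bar>int lam * int n1 - int q * int al\<bar> +
   \<bar>int lam * int n2 - int q * int al\<bar> + \<bar>int lam * int n3 - int q * int al\<bar> < int lam)"

text \<open>Here n3 is the vanishing order of B at infinity. Since 2 min(x, 0) = x - |x|, the gap is
  \<open>lam\<close> (n1 + n2 + n3 - 2 m) minus the distances; the Wronskian bounds the bracket by 1
  and positivity makes it 1.\<close>

lemma gap_wronskian:
 assumes w: "pderiv A * B - A * pderiv B \<noteq> 0" and g: "gap q A B > 0"
 shows "\<exists>n1 n2 n3. odd (n1 + n2 + n3) \<and> gap q A B = int lam - (\<bar>int lam * int n1 - int q * int al\<bar> +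
   \<bar>int lam * int n2 - int q * int al\<bar> + \<bar>int lam * int n3 - int q * int al\<bar>)"
proof -
 have nz: "A \<noteq> 0" "B \<noteq> 0" "- A - B \<noteq> 0"
 proof -
  show "A \<noteq> 0" "B \<noteq> 0" using w by auto
  show "- A - B \<noteq> 0"
  proof
   assume "- A - B = 0"
   then have "A = - B" by (simp add: eq_neg_iff_add_eq_0 neg_eq_iff_add_eq_0 algebra_simps)
   then show False using w by (simp add: pderiv_minus)
  qed
 qed
 define n1 n2 where "n1 = pord 0 A" and "n2 = pord (-1) (- A - B)"
 define m where "m = max (degree A) (degree B)"
 define n3 where "n3 = m - degree B"
 have m: "mdeg A B = int m" "mdeg A B - int (degree B) = int n3" by (simp_all add: mdeg_def m_def n3_def)
 have s: "n1 + n2 + n3 \<le> 2 * m + 1"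
 proof -
  have "n1 + n2 \<le> degree A + degree B + 1"
  proof (rule wronskian_bound[OF w])
   show "[:0, 1:] ^ n1 dvd A" using order_1[of 0 A] by (simp add: n1_def)
   show "[:1, 1:] ^ n2 dvd - A - B" using order_1[of "-1" "- A - B"] by (simp add: n2_def)
  qed
  then show ?thesis by (simp add: n3_def m_def)
 qed
 define D where "D = \<bar>int lam * int n1 - int q * int al\<bar> + \<bar>int lam * int n2 - int q * int al\<bar> + \<bar>int lam * int n3 - int q * int al\<bar>"
 have mn: "2 * min x 0 = x - \<bar>x\<bar>" for x :: int by simp
 have t: "2 * trn q C (int k) = int lam * int k - int q * int al - \<bar>int lam * int k - int q * int al\<bar>" if "C \<noteq> 0" for C k
  using mn[of "int lam * int k - int q * int al"] that by (simp add: trn_def)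
 have "gap q A B = 3 * (int q * int al) - 2 * (int lam * int m) + (2 * trn q A (int n1) + 2 * trn q (- A - B) (int n2) + 2 * trn q B (int n3))"
  unfolding gap_def m(2) unfolding m(1) by (simp add: n1_def n2_def)
 also have "\<dots> = int lam * int n1 + int lam * int n2 + int lam * int n3 - 2 * (int lam * int m) - D"
  unfolding t[OF nz(1)] t[OF nz(2)] t[OF nz(3)] D_def by linarith
 finally have gap: "gap q A B = int lam * (int (n1 + n2 + n3) - 2 * int m) - D" by (simp add: algebra_simps)
 have D0: "D \<ge> 0" by (simp add: D_def)
 have "int lam * (int (n1 + n2 + n3) - 2 * int m) > 0" using g gap D0 by linarith
 then have "int (n1 + n2 + n3) - 2 * int m > 0" by (simp add: zero_less_mult_iff)
 then have eq: "n1 + n2 + n3 = 2 * m + 1" using s by linarith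
 then have e1: "int (n1 + n2 + n3) - 2 * int m = 1" by linarith
 have "gap q A B = int lam - D" using gap unfolding e1 by simp
 moreover have "odd (n1 + n2 + n3)" using eq by simp
 ultimately show ?thesis unfolding D_def by blast
qed

text \<open>At least two of the three constants are nonzero, and each of them costs 2 q \<alpha>,
  which outweighs the leading 3 q \<alpha>.\<close>

lemma gap_constant:
 assumes nc: "ncr A B" and m: "degree A = 0" "degree B = 0" shows "gap q A B \<le> 0"
proof -
 obtain a b where ab: "A = [:a:]" "B = [:b:]" using m by (auto elim!: degree_eq_zeroE)
 have "a \<noteq> 0 \<or> b \<noteq> 0" using nc by (auto simp: ncr_def ab)
 then have two: "A \<noteq> 0 \<and> B \<noteq> 0 \<or> A \<noteq> 0 \<and> - A - B \<noteq> 0 \<or> B \<noteq> 0 \<and> - A - B \<noteq> 0" by (auto simp: ab)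
 have t: "trn q C 0 = (if C = 0 then 0 else - (int q * int al))" for C by (simp add: trn_def)
 have t2: "trn q C n \<le> 0" for C n by (simp add: trn_def)
 have z: "int (pord 0 A) = 0" if "A \<noteq> 0" using that by (simp add: ab order_0I)
 have z': "int (pord (-1) (- A - B)) = 0" if "- A - B \<noteq> 0" using that by (simp add: ab order_0I)
 have q: "int q * int al \<ge> 0" by simp
 have T: "trn q A (int (pord 0 A)) + trn q (- A - B) (int (pord (-1) (- A - B))) + trn q B 0 \<le> - 2 * (int q * int al)"
  using two z z' t[of A] t[of B] t[of "- A - B"] t2[of A "int (pord 0 A)"] t2[of B 0]
   t2[of "- A - B" "int (pord (-1) (- A - B))"] by auto
 have m0: "mdeg A B = 0" by (simp add: mdeg_def m)
 have "gap q A B = 3 * (int q * int al) + 2 * (trn q A (int (pord 0 A))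
   + trn q (- A - B) (int (pord (-1) (- A - B))) + trn q B 0)" unfolding gap_def m0 by (simp add: m)
 moreover have "3 * x + 2 * t \<le> 0" if "t \<le> - 2 * x" "x \<ge> 0" for x t :: int using that by linarith
 note this[OF T q]
 ultimately show ?thesis by (simp only:)
qed

text \<open>The bottom of the descent, where q = 1 has no factor p left to remove. Nonconstant p-th
  powers have degree at least p \<ge> 9, so -2 \<open>lam\<close> m outweighs 3 \<alpha>.\<close>

lemma gap_base:
 assumes nc: "ncr A B" and w: "pderiv A * B - A * pderiv B = 0" shows "gap 1 A B \<le> 0"
proof -
 obtain A0 B0 where 0: "A = A0 ^ CHAR('k)" "B = B0 ^ CHAR('k)" using wronskian_zero[OF nc w] by blast
 have dg: "degree (C ^ CHAR('k)) = CHAR('k) * degree C" for C :: "'k poly"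
  using degree_power_eq[of C "CHAR('k)"] CHAR_pos by (cases "C = 0") (simp_all add: power_0_left)
 show ?thesis
 proof (cases "degree A = 0 \<and> degree B = 0")
  case True
  then show ?thesis using gap_constant[OF nc] by blast
 next
  case False
  then have "CHAR('k) \<le> degree A \<or> CHAR('k) \<le> degree B" unfolding 0 dg by auto
  then have m: "mdeg A B \<ge> int CHAR('k)" by (auto simp: mdeg_def)
  have "CHAR('k) \<ge> 3\<^sup>2" using char_big d3 by (meson le_trans power2_nat_le_eq_le)
  then have "mdeg A B \<ge> 2" using m by simp
  then have "2 * int lam * 2 \<le> 2 * int lam * mdeg A B" by (intro mult_left_mono) simp_all
  moreover have "int al < int lam" using lam_gt ee_eq by linarith
  ultimately have m: "3 * int al \<le> 2 * int lam * mdeg A B" by linarith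
  have t: "trn 1 C n \<le> 0" for C n by (simp add: trn_def)
  have "3 * x - y + 2 * (a + b + c) \<le> 0" if "3 * x \<le> y" "a \<le> 0" "b \<le> 0" "c \<le> 0" for x y a b c :: int
   using that by presburger
  from this[OF m t t t] show ?thesis unfolding gap_def of_nat_1 mult_1_right .
 qed
qed

lemma near_gap:
 assumes "\<not> near q" "pderiv A * B - A * pderiv B \<noteq> 0" shows "gap q A B \<le> 0"
proof (rule ccontr)
 assume "\<not> gap q A B \<le> 0"
 then have g: "gap q A B > 0" by simp
 from gap_wronskian[OF assms(2) this] obtain n1 n2 n3 where n: "odd (n1 + n2 + n3)"
  "gap q A B = int lam - (\<bar>int lam * int n1 - int q * int al\<bar> +
   \<bar>int lam * int n2 - int q * int al\<bar> + \<bar>int lam * int n3 - int q * int al\<bar>)" by blast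
 have "near q" unfolding near_def by (intro exI[of _ n1] exI[of _ n2] exI[of _ n3]) (use n g in simp)
 then show False using assms(1) by simp
qed

text \<open>A vanishing Wronskian replaces A and B by their p-th roots and s by s - 1, and the sign
  of the gap is kept. The hypothesis concerns levels strictly below s only, so the lemma remains
  available at the first level that is near.\<close>

lemma gap_inseparable:
 assumes "\<And>s'. s' < s \<Longrightarrow> \<not> near (CHAR('k) ^ s')" "ncr A B" "pderiv A * B - A * pderiv B = 0"
 shows "gap (CHAR('k) ^ s) A B \<le> 0" using assms
proof (induction s arbitrary: A B)
 case 0
 then show ?case using gap_base by simp
next
 case (Suc s)
 obtain A0 B0 where 0: "A = A0 ^ CHAR('k)" "B = B0 ^ CHAR('k)" "- A - B = (- A0 - B0) ^ CHAR('k)" "ncr A0 B0"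
  using wronskian_zero[OF Suc.prems(2,3)] by blast
 have "gap (CHAR('k) ^ s) A0 B0 \<le> 0"
 proof (cases "pderiv A0 * B0 - A0 * pderiv B0 = 0")
  case True
  show ?thesis by (rule Suc.IH[OF _ 0(4) True]) (use Suc.prems(1) in simp)
 next
  case False
  then show ?thesis using near_gap[of "CHAR('k) ^ s"] Suc.prems(1)[of s] by simp
 qed
 moreover have "gap (CHAR('k) ^ Suc s) A B = int CHAR('k) * gap (CHAR('k) ^ s) A0 B0"
  using gap_scale[OF CHAR_pos, of A0 B0 "CHAR('k) ^ s"] 0 by simp
 ultimately show ?case by (simp add: mult_le_0_iff)
qed

lemma gap_nonpos:
 assumes "\<And>s'. s' \<le> s \<Longrightarrow> \<not> near (CHAR('k) ^ s')" "ncr A B" shows "gap (CHAR('k) ^ s) A B \<le> 0"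
proof (cases "pderiv A * B - A * pderiv B = 0")
 case True
 show ?thesis by (rule gap_inseparable[OF _ assms(2) True]) (rule assms(1), simp)
next
 case False
 show ?thesis by (rule near_gap[OF assms(1)[OF order_refl] False])
qed

end

section \<open>Existence of destabilising sub-bundles\<close>

lemma polys_dependent:
 fixes e :: "nat \<Rightarrow> 'k::field poly"
 assumes "\<And>i. i < n \<Longrightarrow> degree (e i) < r" "r < n"
 shows "\<exists>c. (\<exists>i<n. c i \<noteq> 0) \<and> (\<Sum>i<n. Polynomial.smult (c i) (e i)) = 0"
proof -
 obtain c where c: "\<exists>i<n. c i \<noteq> 0" "\<forall>j<r. (\<Sum>i<n. coeff (e i) j * c i) = 0"
  using underdetermined[OF assms(2), of "\<lambda>j i. coeff (e i) j"] by blast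
 have "(\<Sum>i<n. Polynomial.smult (c i) (e i)) = 0"
 proof (rule poly_eqI)
  fix j
  have "coeff (\<Sum>i<n. Polynomial.smult (c i) (e i)) j = (\<Sum>i<n. coeff (e i) j * c i)"
   by (simp add: coeff_sum mult.commute)
  also have "\<dots> = 0"
  proof (cases "j < r")
   case False
   then have "coeff (e i) j = 0" if "i < n" for i using assms(1)[OF that] by (simp add: coeff_eq_0)
   then show ?thesis by simp
  qed (use c(2) in blast)
  finally show "coeff (\<Sum>i<n. Polynomial.smult (c i) (e i)) j = coeff 0 j" by simp
 qed
 then show ?thesis using c(1) by blast
qed

text \<open>Three polynomials of degree at most r have 3 r + 3 coefficients, whereas a relation of
  degree at most M + r = 3 r + 1 imposes 3 r + 2 conditions.\<close>

lemma three_term_relation: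
 fixes U V :: "'k::field poly"
 assumes "degree U \<le> M" "degree V \<le> M" and M: "M = 2 * r + 1"
 shows "\<exists>a b c. (a \<noteq> 0 \<or> b \<noteq> 0 \<or> c \<noteq> 0) \<and> U * a + V * b + c = 0 \<and> degree a \<le> r \<and> degree b \<le> r \<and> degree c \<le> r"
proof -
 define R where "R = Suc r"
 \<comment> \<open>The products of U, V and 1 with powers of t, in three blocks of length
   \<open>R\<close>; a linear dependency among them is the wanted relation.\<close>
 define e :: "nat \<Rightarrow> 'k poly" where "e i = (if i < R then U * monom 1 i else if i < 2 * R then V * monom 1 (i - R) else monom 1 (i - 2 * R))" for i
 have dm: "degree (monom (1::'k) i) = i" for i by (simp add: degree_monom_eq)
 have "degree (e i) < M + R" if "i < 3 * R" for i
  using degree_mult_le[of U "monom 1 i"] degree_mult_le[of V "monom 1 (i - R)"] assms(1,2) that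
  by (auto simp: e_def dm)
 moreover have "M + R < 3 * R" unfolding M R_def by simp
 ultimately obtain c where c: "\<exists>i<3 * R. c i \<noteq> 0" "(\<Sum>i<3 * R. Polynomial.smult (c i) (e i)) = 0"
  using polys_dependent[of "3 * R" e "M + R"] by blast
 define a where "a k = (\<Sum>i<R. monom (c (k + i)) i)" for k
 have ca: "coeff (a k) i = c (k + i)" if "i < R" for k i using that by (simp add: a_def coeff_sum sum.delta)
 have da: "degree (a k) \<le> r" for k unfolding a_def
 proof (rule degree_sum_le)
  fix i assume "i \<in> {..<R}"
  then show "degree (monom (c (k + i)) i) \<le> r" using degree_monom_le[of "c (k + i)" i] by (simp add: R_def)
 qed simp
 have s: "(\<Sum>i\<in>{k..<k + R}. f i) = (\<Sum>i<R. f (k + i))" for k and f :: "nat \<Rightarrow> 'k poly"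
  using sum.shift_bounds_nat_ivl[of f 0 k R] by (simp add: add.commute atLeast0LessThan)
 have sm: "Polynomial.smult x (P * monom 1 i) = P * monom x i" for x :: 'k and P and i :: nat
  by (simp only: mult_smult_right[symmetric] smult_monom mult_1_right)
 have "(\<Sum>i<3 * R. Polynomial.smult (c i) (e i)) = (\<Sum>i\<in>{0..<0 + R}. Polynomial.smult (c i) (e i)) +
  (\<Sum>i\<in>{R..<R + R}. Polynomial.smult (c i) (e i)) + (\<Sum>i\<in>{2 * R..<2 * R + R}. Polynomial.smult (c i) (e i))"
  using sum.atLeastLessThan_concat[of 0 R "R + R" "\<lambda>i. Polynomial.smult (c i) (e i)"]
   sum.atLeastLessThan_concat[of 0 "R + R" "3 * R" "\<lambda>i. Polynomial.smult (c i) (e i)"]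
  by (simp add: atLeast0LessThan mult_2 numeral_3_eq_3 add.assoc)
 also have "\<dots> = U * a 0 + V * a R + a (2 * R)"
  unfolding s by (simp add: e_def a_def sm sum_distrib_left smult_monom mult_2)
 finally have rel: "U * a 0 + V * a R + a (2 * R) = 0" using c(2) by simp
 have "a 0 \<noteq> 0 \<or> a R \<noteq> 0 \<or> a (2 * R) \<noteq> 0"
 proof (rule ccontr)
  assume z: "\<not> ?thesis"
  obtain i where i: "i < 3 * R" "c i \<noteq> 0" using c(1) by blast
  consider "i < R" | "R \<le> i" "i < R + R" | "2 * R \<le> i" by linarith
  then show False
  proof cases
   case 1
   then show ?thesis using ca[of i 0] z i by simp
  next
   case 2
   then have "i - R < R" by linarith
   then show ?thesis using ca[of "i - R" R] z i 2 by simp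
  next
   case 3
   then have "i - 2 * R < R" using i by linarith
   then show ?thesis using ca[of "i - 2 * R" "2 * R"] z i 3 by simp
  qed
 qed
 then show ?thesis using rel da by blast
qed

lemma orders_le_degree:
 fixes g :: "'k::alg_closed_field poly"
 assumes "g \<noteq> 0" "a \<noteq> b" shows "pord a g + pord b g \<le> degree g"
proof -
 obtain h where h: "g = [:-a, 1:] ^ pord a g * h" using order_1[of a g] by blast
 obtain f where f: "g = [:-b, 1:] ^ pord b g * f" using order_1[of b g] by blast
 have "[:-b, 1:] ^ pord b g dvd h"
 proof (rule dvd_of_no_common_root)
  show "[:-b, 1:] ^ pord b g * f = h * [:-a, 1:] ^ pord a g" using h f by (simp add: mult.commute)
  show "poly ([:-b, 1:] ^ pord b g) x \<noteq> 0 \<or> poly ([:-a, 1:] ^ pord a g) x \<noteq> 0" for x using assms(2) by auto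
 qed simp
 then obtain k where k: "h = [:-b, 1:] ^ pord b g * k" by blast
 have "k \<noteq> 0" using assms(1) h k by auto
 have "degree g = degree ([:-a, 1:] ^ pord a g * ([:-b, 1:] ^ pord b g * k))" using h k by simp
 also have "\<dots> = pord a g + (pord b g + degree k)" using \<open>k \<noteq> 0\<close> by (simp add: degree_mult_eq degree_power_eq)
 finally show ?thesis by linarith
qed

context trinomial_curve
begin

lemma divide_common:
 assumes "A \<noteq> 0 \<or> B \<noteq> 0"
 obtains g A' B' where "g \<noteq> 0" "A = g * A'" "B = g * B'" "ncr A' B'"
proof (cases "B = 0")
 case True
 then obtain g B' A' where 1: "g \<noteq> 0" "B = g * B'" "A = g * A'" "\<forall>a. poly B' a \<noteq> 0 \<or> poly A' a \<noteq> 0"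
  using divide_common_roots[of A B] assms by blast
 show ?thesis by (rule that[OF 1(1,3,2)]) (use 1(4) in \<open>auto simp: ncr_def\<close>)
next
 case False
 then obtain g A' B' where 1: "g \<noteq> 0" "A = g * A'" "B = g * B'" "\<forall>a. poly A' a \<noteq> 0 \<or> poly B' a \<noteq> 0"
  using divide_common_roots[of B A] by blast
 show ?thesis by (rule that[OF 1(1-3)]) (use 1(4) in \<open>simp add: ncr_def\<close>)
qed

text \<open>Bounds the loss when a common factor lowers a vanishing order from M by at most
  k.\<close>

lemma trn_ge:
 assumes "C \<noteq> 0 \<Longrightarrow> M \<le> n + k" "k \<ge> 0" shows "trn q C n \<ge> min (int lam * M - int q * int al) 0 - int lam * k"
proof (cases "C = 0")
 case True
 have "int lam * k \<ge> 0" using assms(2) by simp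
 then show ?thesis using True by (simp add: trn_def)
next
 case False
 have "int lam * M \<le> int lam * (n + k)" using assms(1)[OF False] by (intro mult_left_mono) simp_all
 moreover have "int lam * k \<ge> 0" using assms(2) by simp
 ultimately show ?thesis using False by (simp add: trn_def distrib_left min_def)
qed

text \<open>In t^M a + (1 + t)^M b + c = 0 the terms vanish to order M at 0, at -1 and, relative to
  degree M + r, at infinity. A common factor g lowers the orders at 0 and -1 by at most deg g in
  total, and the drop in degree repays this.\<close>

lemma gap_large:
 assumes M: "odd M" shows "\<exists>A B. ncr A B \<and> gap q A B \<ge> int lam - 3 * \<bar>int lam * int M - int q * int al\<bar>"
proof -
 obtain r where r: "M = 2 * r + 1" using M oddE by blast
 define T U :: "'k poly" where "T = [:0, 1:] ^ M" and "U = [:1, 1:] ^ M"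
 have dT: "degree T = M" "degree U = M" unfolding T_def U_def by (simp_all add: degree_power_eq)
 have nz: "T \<noteq> 0" "U \<noteq> 0" unfolding T_def U_def by simp_all
 obtain a b c where abc: "a \<noteq> 0 \<or> b \<noteq> 0 \<or> c \<noteq> 0" "T * a + U * b + c = 0" "degree a \<le> r" "degree b \<le> r" "degree c \<le> r"
  using three_term_relation[of T M U r] dT r by auto
 have Z: "- (T * a) - c = U * b" using minus_unique[of "T * a" "U * b + c"] abc(2) by (simp add: add.assoc)
 have "T * a \<noteq> 0 \<or> c \<noteq> 0" using abc(1) Z nz by auto
 then obtain g A B where g: "g \<noteq> 0" "T * a = g * A" "c = g * B" "ncr A B" using divide_common by blast
 have gZ: "g * (- A - B) = U * b" using Z unfolding g(2,3) by (simp add: algebra_simps)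
 define k k0 k1 where "k = int (degree g)" and "k0 = int (pord 0 g)" and "k1 = int (pord (-1) g)"
 have k: "k0 + k1 \<le> k" using orders_le_degree[OF g(1), of 0 "-1"] unfolding k_def k0_def k1_def by simp
 have k0: "k0 \<ge> 0" "k1 \<ge> 0" by (simp_all add: k0_def k1_def)
 have o: "int M \<le> int (pord x P) + int (pord x g)"
  if e: "g * P = [:-x, 1:] ^ M * Q" and P: "P \<noteq> 0" for x and P Q :: "'k poly"
 proof -
  have "[:-x, 1:] ^ M dvd g * P" unfolding e by simp
  then have "M \<le> pord x (g * P)" using g(1) P unfolding order_divides by simp
  then show ?thesis using g(1) P by (simp add: order_mult)
 qed
 have tA: "trn q A (int (pord 0 A)) \<ge> min (int lam * int M - int q * int al) 0 - int lam * k0"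
  by (rule trn_ge[OF _ k0(1)]) (unfold k0_def, rule o[where Q = a], use g(2) in \<open>simp_all add: T_def\<close>)
 have tZ: "trn q (- A - B) (int (pord (-1) (- A - B))) \<ge> min (int lam * int M - int q * int al) 0 - int lam * k1"
  by (rule trn_ge[OF _ k0(2)]) (unfold k1_def, rule o[where Q = b], use gZ in \<open>simp_all add: U_def\<close>)
 have dA: "int (degree A) + k \<le> int M + int r" if "A \<noteq> 0"
 proof -
  have "degree g + degree A = degree (T * a)" unfolding g(2) using degree_mult_eq[OF g(1) that] by simp
  then show ?thesis using degree_mult_le[of T a] dT abc(3) unfolding k_def by linarith
 qed
 have dB: "int (degree B) + k \<le> int r" if "B \<noteq> 0"
  using degree_mult_eq[OF g(1) that] abc(5) unfolding g(3) k_def by linarith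
 define m where "m = mdeg A B"
 have AB: "A \<noteq> 0 \<or> B \<noteq> 0" using g(4) by (auto simp: ncr_def)
 \<comment> \<open>The amount by which the actual degree m falls short of M + r - deg g. The order
   at infinity may lose as much, which the smaller m offsets exactly.\<close>
 define dl where "dl = int M + int r - k - m"
 have dl0: "dl \<ge> 0" using dA dB AB unfolding dl_def m_def mdeg_def by (cases "A = 0"; cases "B = 0") auto
 have tB: "trn q B (m - int (degree B)) \<ge> min (int lam * int M - int q * int al) 0 - int lam * dl"
  by (rule trn_ge[OF _ dl0]) (use dB in \<open>simp add: dl_def\<close>)
 define t where "t = int q * int al"
 define x where "x = int lam * int M - t"
 have kk: "int lam * k0 + int lam * k1 \<le> int lam * k" using mult_left_mono[OF k, of "int lam"] by (simp add: distrib_left)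
 have ldl: "int lam * dl = int lam * int M + int lam * int r - int lam * k - int lam * m" by (simp add: dl_def algebra_simps)
 have lM: "int lam * int M = 2 * (int lam * int r) + int lam" by (simp add: r algebra_simps)
 have gp: "gap q A B = 3 * t - 2 * (int lam * m) + 2 * (trn q A (int (pord 0 A))
   + trn q (- A - B) (int (pord (-1) (- A - B))) + trn q B (m - int (degree B)))"
  unfolding gap_def m_def t_def by simp
 have ar: "3 * t - 2 * lm + 2 * (u + v + w) \<ge> l - 3 * \<bar>x\<bar>"
  if "u \<ge> min x 0 - lk0" "v \<ge> min x 0 - lk1" "w \<ge> min x 0 - ld" "lk0 + lk1 \<le> lk" "ld = lM + lr - lk - lm" "lM = 2 * lr + l" "x = lM - t"
  for u v w l lm lk0 lk1 lk ld lM lr x t :: int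
 proof -
  have "2 * min x 0 = x - \<bar>x\<bar>" by simp
  then show ?thesis unfolding distrib_left using that by linarith
 qed
 have "gap q A B \<ge> int lam - 3 * \<bar>x\<bar>"
  unfolding gp by (rule ar[OF tA[folded t_def, folded x_def] tZ[folded t_def, folded x_def] tB[folded t_def, folded x_def] kk ldl lM]) (simp add: x_def)
 then show ?thesis using g(4) unfolding x_def t_def by blast
qed

text \<open>The bound of \<open>gap_large\<close> is positive, so the Wronskian is nonzero and the
  gap is \<open>lam\<close> minus three distances. With e < \<open>lam\<close> / 3, two n_i
  different from M give at least 2 (\<open>lam\<close> - e); a single one is odd by parity and gives
  at least 2 \<open>lam\<close> - e. Both are too large, so all n_i equal M.\<close>

lemma gap_exact:
 assumes near: "\<And>s'. s' < s \<Longrightarrow> \<not> near (CHAR('k) ^ s')"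
  and M: "odd M" "3 * \<bar>int lam * M - int (CHAR('k) ^ s) * int al\<bar> < int lam"
 shows "\<exists>A B. ncr A B \<and> gap (CHAR('k) ^ s) A B = int lam - 3 * \<bar>int lam * M - int (CHAR('k) ^ s) * int al\<bar>"
proof -
 define t where "t = int (CHAR('k) ^ s) * int al"
 define e where "e = \<bar>int lam * M - t\<bar>"
 have e: "3 * e < int lam" "e \<ge> 0" using M(2) unfolding e_def t_def by simp_all
 have "M \<ge> 0"
 proof (rule ccontr)
  assume "\<not> M \<ge> 0"
  then have "int lam * M \<le> - int lam" using mult_left_mono[of M "-1" "int lam"] by simp
  moreover have "t \<ge> 0" by (simp add: t_def)
  ultimately have "e \<ge> int lam" unfolding e_def by linarith
  then show False using e by linarith
 qed
 then obtain m where m: "M = int m" using nonneg_int_cases by blast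
 obtain A B where AB: "ncr A B" "gap (CHAR('k) ^ s) A B \<ge> int lam - 3 * e"
  using gap_large[of m "CHAR('k) ^ s"] M(1) unfolding e_def t_def m by auto
 have g0: "gap (CHAR('k) ^ s) A B > 0" using AB(2) e by linarith
 have w: "pderiv A * B - A * pderiv B \<noteq> 0"
 proof
  assume "pderiv A * B - A * pderiv B = 0"
  have "gap (CHAR('k) ^ s) A B \<le> 0"
   by (rule gap_inseparable[OF _ AB(1) \<open>pderiv A * B - A * pderiv B = 0\<close>]) (rule near)
  then show False using g0 by simp
 qed
 obtain n1 n2 n3 where n: "odd (n1 + n2 + n3)" "gap (CHAR('k) ^ s) A B = int lam - (\<bar>int lam * int n1 - t\<bar> +
   \<bar>int lam * int n2 - t\<bar> + \<bar>int lam * int n3 - t\<bar>)" using gap_wronskian[OF w g0] unfolding t_def by blast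
 have far: "\<bar>int lam * int x - t\<bar> \<ge> int lam - e" if "int x \<noteq> M" for x
 proof -
  have "\<bar>int lam * (int x - M)\<bar> \<ge> int lam" using that by (simp add: abs_mult)
  then show ?thesis unfolding e_def by (simp add: right_diff_distrib)
 qed
 have far2: "\<bar>int lam * int x - t\<bar> \<ge> 2 * int lam - e" if "int x \<noteq> M" "odd x" for x
 proof -
  have "even (int x - M)" using that(2) M(1) by simp
  then obtain y where y: "int x - M = 2 * y" by blast
  then have "y \<noteq> 0" using that(1) by auto
  then have "\<bar>int lam * (int x - M)\<bar> \<ge> 2 * int lam" unfolding y by (simp add: abs_mult)
  then show ?thesis unfolding e_def by (simp add: right_diff_distrib)
 qed
 have S: "\<bar>int lam * int n1 - t\<bar> + \<bar>int lam * int n2 - t\<bar> + \<bar>int lam * int n3 - t\<bar> < int lam" using n(2) g0 by linarith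
 have Mm: "int n1 = M \<Longrightarrow> odd n1" "int n2 = M \<Longrightarrow> odd n2" "int n3 = M \<Longrightarrow> odd n3" using M(1) unfolding m by simp_all
 have all: "int n1 = M \<and> int n2 = M \<and> int n3 = M"
 proof (rule ccontr)
  assume ne: "\<not> ?thesis"
  consider "int n1 \<noteq> M" "int n2 = M" "int n3 = M" | "int n1 = M" "int n2 \<noteq> M" "int n3 = M"
   | "int n1 = M" "int n2 = M" "int n3 \<noteq> M" | "int n1 \<noteq> M" "int n2 \<noteq> M" | "int n1 \<noteq> M" "int n3 \<noteq> M" | "int n2 \<noteq> M" "int n3 \<noteq> M"
   using ne by blast
  then show False
  proof cases
   case 1
   then have "odd n1" using Mm n(1) by auto
   then show ?thesis using far2[OF 1(1)] S e by linarith
  next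
   case 2
   then have "odd n2" using Mm n(1) by auto
   then show ?thesis using far2[OF 2(2)] S e by linarith
  next
   case 3
   then have "odd n3" using Mm n(1) by auto
   then show ?thesis using far2[OF 3(3)] S e by linarith
  next
   case 4
   then show ?thesis using far[OF 4(1)] far[OF 4(2)] S e by linarith
  next
   case 5
   then show ?thesis using far[OF 5(1)] far[OF 5(2)] S e by linarith
  next
   case 6
   then show ?thesis using far[OF 6(1)] far[OF 6(2)] S e by linarith
  qed
 qed
 have "gap (CHAR('k) ^ s) A B = int lam - 3 * e" using n(2) all unfolding e_def by simp
 then show ?thesis using AB(1) unfolding e_def t_def by blast
qed

text \<open>With e the distance to \<open>lam\<close> N, odd n are at distance at least
  \<open>lam\<close> - e and even n at least e. An odd sum contains one odd term, giving at least
  \<open>lam\<close> + e, or three, giving at least 3 (\<open>lam\<close> - e); the ratio 2/3 is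
  exactly what keeps the latter at \<open>lam\<close> or above.\<close>

lemma not_near:
 assumes N: "even N" "3 * \<bar>int q * int al - int lam * N\<bar> \<le> 2 * int lam" shows "\<not> near q"
proof
 assume "near q"
 define e where "e = \<bar>int q * int al - int lam * N\<bar>"
 have e: "3 * e \<le> 2 * int lam" "e \<ge> 0" using N(2) by (simp_all add: e_def)
 have o: "\<bar>int lam * int x - int q * int al\<bar> \<ge> int lam - e" if "odd x" for x
 proof -
  have "int x - N \<noteq> 0" using that N(1) by auto
  then have "\<bar>int lam * (int x - N)\<bar> \<ge> int lam" by (simp add: abs_mult)
  then show ?thesis unfolding e_def by (simp add: right_diff_distrib)
 qed
 have ev: "\<bar>int lam * int x - int q * int al\<bar> \<ge> e" if "even x" for x
 proof (cases "int x = N")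
  case True
  then show ?thesis unfolding e_def by simp
 next
  case False
  have "even (int x - N)" using that N(1) by simp
  then obtain y where y: "int x - N = 2 * y" by blast
  then have "y \<noteq> 0" using False by auto
  then have "\<bar>int lam * (int x - N)\<bar> \<ge> 2 * int lam" unfolding y by (simp add: abs_mult)
  moreover have "b \<le> x" if "2 * l \<le> a" "3 * b \<le> 2 * l" "0 \<le> b" "a - b \<le> x" for a b l x :: int using that by linarith
  ultimately have "e \<le> \<bar>int lam * (int x - N) - (int q * int al - int lam * N)\<bar>"
   using e abs_triangle_ineq2 unfolding e_def by blast
  then show ?thesis by (simp add: right_diff_distrib)
 qed
 obtain n1 n2 n3 where n: "odd (n1 + n2 + n3)" "\<bar>int lam * int n1 - int q * int al\<bar> +
   \<bar>int lam * int n2 - int q * int al\<bar> + \<bar>int lam * int n3 - int q * int al\<bar> < int lam"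
  using \<open>near q\<close> unfolding near_def by blast
 show False by (cases "odd n1"; cases "odd n2"; cases "odd n3")
   (use n e o[of n1] o[of n2] o[of n3] ev[of n1] ev[of n2] ev[of n3] in simp_all)
qed

section \<open>Frobenius pull-backs\<close>

text \<open>A concrete description of all iterated pull-backs: the exponent 1 gives
  \<open>V\<close>, and each Frobenius multiplies it by p.\<close>

definition ker_pow :: "nat \<Rightarrow> (nat \<Rightarrow> 'k pt \<Rightarrow> 'k) \<Rightarrow> nat \<Rightarrow> 'k sheaf" where
 "ker_pow n S q U = {g \<in> trivial_bundle X n U. \<forall>v\<in>U. (\<Sum>i<n. g v i * S i v ^ q) = 0}"

lemma ker_pow_D:
 assumes "g \<in> ker_pow n S q U" shows "\<And>i. i < n \<Longrightarrow> (\<lambda>v. g v i) \<in> regular X U" "\<And>v i. i \<ge> n \<Longrightarrow> g v i = 0"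
  "\<And>v. v \<in> U \<Longrightarrow> (\<Sum>i<n. g v i * S i v ^ q) = 0" "\<And>v i. v \<notin> U \<Longrightarrow> g v i = 0"
proof -
 show a: "\<And>i. i < n \<Longrightarrow> (\<lambda>v. g v i) \<in> regular X U" and b: "\<And>v i. i \<ge> n \<Longrightarrow> g v i = 0"
  and "\<And>v. v \<in> U \<Longrightarrow> (\<Sum>i<n. g v i * S i v ^ q) = 0"
  using assms unfolding ker_pow_def trivial_bundle_def by blast+
 show "g v i = 0" if "v \<notin> U" for v i using tf_out[OF a[of i] that] b[of i v] by (cases "i < n") auto
qed

lemma ker_pow_I:
 assumes "\<And>i. i < n \<Longrightarrow> (\<lambda>v. g v i) \<in> regular X U" "\<And>v i. i \<ge> n \<Longrightarrow> g v i = 0"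
  "\<And>v. v \<in> U \<Longrightarrow> (\<Sum>i<n. g v i * S i v ^ q) = 0" shows "g \<in> ker_pow n S q U"
 using assms unfolding ker_pow_def trivial_bundle_def by blast

text \<open>By additivity, p-th powers of syzygies of S_i^q are syzygies of S_i^(q p). Conversely,
  where S_k does not vanish, the relations e_i - (S_i / S_k)^q e_k generate, and their p-th powers
  generate at level q p.\<close>

lemma frobenius_ker_pow:
 assumes S: "\<And>i. i < n \<Longrightarrow> \<exists>F. form (Suc 0) F \<and> (\<forall>v\<in>X. S i v = F v)"
  and nz: "\<And>v. v \<in> X \<Longrightarrow> \<exists>k<n. S k v \<noteq> 0"
  and E: "\<And>U. zopen X U \<Longrightarrow> E U = ker_pow n S q U" and q: "q > 0" and U: "zopen X U"
 shows "frobenius_pullback X E U = ker_pow n S (q * CHAR('k)) U"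
proof
 define p where "p = CHAR('k)"
 have p: "prime p" "p > 0" "prime CHAR('k)" unfolding p_def using CHAR_prime CHAR_pos by auto
 show "frobenius_pullback X E U \<subseteq> ker_pow n S (q * CHAR('k)) U" unfolding p_def[symmetric]
 proof
  fix s assume "s \<in> frobenius_pullback X E U"
  then have s: "\<And>v j. v \<notin> U \<Longrightarrow> s v j = 0" "\<And>v. v \<in> U \<Longrightarrow> \<exists>W m f e. zopen X W \<and> v \<in> W \<and> W \<subseteq> U \<and>
    (\<forall>i<m. f i \<in> regular X W \<and> e i \<in> E W) \<and> (\<forall>w\<in>W. \<forall>j. s w j = (\<Sum>i<(m::nat). f i w * e i w j ^ p))"
   unfolding frobenius_pullback_def p_def by blast+
  show "s \<in> ker_pow n S (q * p) U"
  proof (rule ker_pow_I)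
   fix j assume j: "j < n"
   show "(\<lambda>v. s v j) \<in> regular X U"
   proof (rule tf_glue)
    fix v assume "v \<in> U"
    then obtain W m f e where W: "zopen X W" "v \<in> W" "W \<subseteq> U" "\<forall>i<m. f i \<in> regular X W \<and> e i \<in> E W"
     "\<forall>w\<in>W. \<forall>j. s w j = (\<Sum>i<(m::nat). f i w * e i w j ^ p)" using s(2) by blast
    have "(\<lambda>w. \<Sum>i<m. f i w * e i w j ^ p) \<in> regular X W"
    proof (rule regular_sum[OF W(1)])
     fix i assume "i \<in> {..<m}"
     then have i: "f i \<in> regular X W" "e i \<in> ker_pow n S q W" using W(4) E[OF W(1)] by auto
     show "(\<lambda>w. f i w * e i w j ^ p) \<in> regular X W"
      by (intro regular_mult i(1) regular_power ker_pow_D(1)[OF i(2) j] p(2))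
    qed
    then show "\<exists>W g. zopen X W \<and> v \<in> W \<and> W \<subseteq> U \<and> g \<in> regular X W \<and> (\<forall>w\<in>W. s w j = g w)"
     using W(1-3,5) by blast
   qed (rule s(1))
  next
   fix v j assume j: "n \<le> j"
   show "s v j = 0"
   proof (cases "v \<in> U")
    case True
    then obtain W m f e where W: "zopen X W" "v \<in> W" "W \<subseteq> U" "\<forall>i<m. f i \<in> regular X W \<and> e i \<in> E W"
     "\<forall>w\<in>W. \<forall>j. s w j = (\<Sum>i<(m::nat). f i w * e i w j ^ p)" using s(2) by blast
    have "e i v j = 0" if "i < m" for i using W(4) E[OF W(1)] ker_pow_D(2)[OF _ j] that by blast
    then show ?thesis using W(2,5) p(2) by (simp add: power_0_left)
   qed (rule s(1))
  next
   fix v assume v: "v \<in> U"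
   then obtain W m f e where W: "zopen X W" "v \<in> W" "W \<subseteq> U" "\<forall>i<m. f i \<in> regular X W \<and> e i \<in> E W"
     "\<forall>w\<in>W. \<forall>j. s w j = (\<Sum>i<(m::nat). f i w * e i w j ^ p)" using s(2) by blast
   have z: "(\<Sum>j<n. e i v j * S j v ^ q) ^ p = 0" if "i < m" for i
    using ker_pow_D(3)[of "e i" n S q W v] W(2,4) E[OF W(1)] that p(2) by (simp add: power_0_left)
   have "(\<Sum>j<n. s v j * S j v ^ (q * p)) = (\<Sum>j<n. \<Sum>i<m. f i v * (e i v j * S j v ^ q) ^ p)"
    using W(2,5) by (simp add: sum_distrib_right power_mult_distrib power_mult mult.assoc)
   also have "\<dots> = (\<Sum>i<m. \<Sum>j<n. f i v * (e i v j * S j v ^ q) ^ p)" by (rule sum.swap)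
   also have "\<dots> = (\<Sum>i<m. f i v * (\<Sum>j<n. e i v j * S j v ^ q) ^ p)"
    by (subst freshmans_dream_sum[OF p(3) p_def]) (simp add: sum_distrib_left)
   also have "\<dots> = 0" by (rule sum.neutral) (use z in \<open>simp del: power_eq_0_iff\<close>)
   finally show "(\<Sum>j<n. s v j * S j v ^ (q * p)) = 0" .
  qed
 qed
 show "ker_pow n S (q * CHAR('k)) U \<subseteq> frobenius_pullback X E U" unfolding p_def[symmetric]
 proof
  fix g assume g: "g \<in> ker_pow n S (q * p) U"
  note gD = ker_pow_D[OF g]
  have "\<exists>W m f e. zopen X W \<and> v \<in> W \<and> W \<subseteq> U \<and> (\<forall>i<m. f i \<in> regular X W \<and> e i \<in> E W) \<and>
    (\<forall>w\<in>W. \<forall>j. g w j = (\<Sum>i<(m::nat). f i w * e i w j ^ p))" if v: "v \<in> U" for v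
  proof -
   have UX: "U \<subseteq> X" using zopen_sub[OF U] .
   obtain k where k: "k < n" "S k v \<noteq> 0" using nz v UX by blast
   obtain F where F: "\<And>i. i < n \<Longrightarrow> form (Suc 0) (F i) \<and> (\<forall>v\<in>X. S i v = F i v)" using S by metis
   define W where "W = U \<inter> {w \<in> X. F k w \<noteq> 0}"
   have W: "zopen X W" unfolding W_def using F[OF k(1)] by (intro zopen_Int U zopen_D) blast
   have vW: "v \<in> W" "W \<subseteq> U" using v k F[OF k(1)] UX by (auto simp: W_def)
   have SF: "S i w = F i w" if "i < n" "w \<in> W" for i w using F[OF that(1)] that(2) UX vW(2) by blast
   have Sk: "S k w \<noteq> 0" if "w \<in> W" for w using SF[OF k(1) that] that by (simp add: W_def)
   define e where "e i w l = (if w \<notin> W \<or> i = k then 0 else if l = i then 1 else if l = k then - 1 * (S i w / S k w) ^ q else 0)" for i w l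
   have eE: "e i \<in> ker_pow n S q W" if i: "i < n" for i
   proof (rule ker_pow_I)
    fix l assume l: "l < n"
    have r0: "(\<lambda>w. if w \<in> W then S i w / S k w else 0) \<in> regular X W"
     by (rule tf_frac[OF W, of "Suc 0" "F i" "Suc 0" "F k"]) (use F[OF i] F[OF k(1)] SF[OF i] SF[OF k(1)] Sk in auto)
    have r: "(\<lambda>w. - 1 * (if w \<in> W then S i w / S k w else 0) ^ q) \<in> regular X W"
     by (rule tf_cmult[OF regular_power[OF r0 q] W])
    have c: "(\<lambda>w. if w \<in> W then c else 0) \<in> regular X W" for c by (rule tf_const[OF W])
    consider "i = k" | "i \<noteq> k" "l = i" | "i \<noteq> k" "l \<noteq> i" "l = k" | "i \<noteq> k" "l \<noteq> i" "l \<noteq> k" by blast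
    then show "(\<lambda>w. e i w l) \<in> regular X W"
    proof cases
     case 1
     then have "(\<lambda>w. e i w l) = (\<lambda>w. if w \<in> W then 0 else 0)" by (auto simp: e_def)
     then show ?thesis using c[of 0] by simp
    next
     case 2
     then have "(\<lambda>w. e i w l) = (\<lambda>w. if w \<in> W then 1 else 0)" by (auto simp: e_def)
     then show ?thesis using c[of 1] by simp
    next
     case 3
     then have "(\<lambda>w. e i w l) = (\<lambda>w. - 1 * (if w \<in> W then S i w / S k w else 0) ^ q)"
      using q by (auto simp: e_def)
     then show ?thesis using r by simp
    next
     case 4
     then have "(\<lambda>w. e i w l) = (\<lambda>w. if w \<in> W then 0 else 0)" by (auto simp: e_def)
     then show ?thesis using c[of 0] by simp
    qed
   next
    show "e i w l = 0" if "l \<ge> n" for w l using that i k(1) by (simp add: e_def)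
    fix w assume w: "w \<in> W"
    show "(\<Sum>l<n. e i w l * S l w ^ q) = 0"
    proof (cases "i = k")
     case False
     have "(\<Sum>l<n. e i w l * S l w ^ q) = (\<Sum>l\<in>{i, k}. e i w l * S l w ^ q)"
      by (rule sum.mono_neutral_right) (use i k(1) in \<open>auto simp: e_def\<close>)
     also have "\<dots> = 0" using False w Sk[OF w] by (simp add: e_def power_divide)
     finally show ?thesis .
    qed (simp add: e_def)
   qed
   define f where "f i w = (if w \<in> W then g w i else 0)" for i w
   have fr: "f i \<in> regular X W" if "i < n" for i unfolding f_def using tf_restrict[OF gD(1)[OF that] W vW(2)] .
   have eq: "g w l = (\<Sum>i<n. f i w * e i w l ^ p)" if w: "w \<in> W" for w l
   proof -
    \<comment> \<open>The sign survives because (-x)^p = -(x^p) in characteristic p.\<close>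
    have k': "(- 1 * (S i w / S k w) ^ q) ^ p = - (S i w ^ (q * p) / S k w ^ (q * p))" for i
     using minus_power_prime_CHAR[OF p_def p(1), of "(S i w / S k w) ^ q"] by (simp add: power_divide power_mult)
    have "(\<Sum>i<n. g w i * S i w ^ (q * p)) = 0" using gD(3) w vW(2) by blast
    then have rel: "g w k * S k w ^ (q * p) = - (\<Sum>i\<in>{..<n} - {k}. g w i * S i w ^ (q * p))"
     using sum.remove[of "{..<n}" k "\<lambda>i. g w i * S i w ^ (q * p)"] k(1) by (simp add: eq_neg_iff_add_eq_0)
    show ?thesis
    proof (cases "l = k")
     case True
     have "(\<Sum>i<n. f i w * e i w l ^ p) = (\<Sum>i\<in>{..<n} - {k}. - (g w i * S i w ^ (q * p)) / S k w ^ (q * p))"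
      using sum.remove[of "{..<n}" k "\<lambda>i. f i w * e i w l ^ p"] k(1) p(2) w True
      by (auto simp: e_def f_def k'[simplified] power_0_left intro!: sum.cong)
     also have "\<dots> = g w k * S k w ^ (q * p) / S k w ^ (q * p)"
      unfolding rel by (simp add: sum_negf flip: sum_divide_distrib)
     also have "\<dots> = g w l" using Sk[OF w] True by simp
     finally show ?thesis by simp
    next
     case False
     have "(\<Sum>i<n. f i w * e i w l ^ p) = (\<Sum>i<n. if i = l then g w l else 0)"
      by (intro sum.cong refl) (use False w p(2) in \<open>auto simp: e_def f_def power_0_left\<close>)
     also have "\<dots> = g w l" using gD(2)[of l w] by (simp add: sum.delta)
     finally show ?thesis by simp
    qed
   qed
   show ?thesis by (intro exI[of _ W] exI[of _ n] exI[of _ f] exI[of _ e] conjI W vW allI impI ballI fr)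
     (simp_all add: E[OF W] eE eq)
  qed
  then show "g \<in> frobenius_pullback X E U" unfolding frobenius_pullback_def p_def using gD(4) by blast
 qed
qed

section \<open>The pull-backs as syzygy bundles\<close>

lemma coordinate_section: "(\<lambda>v. if v \<in> X then co j v else 0) \<in> twisted_functions X 1 X"
 by (rule tf_frac[OF zopen_X form_co[of j], of 0 "\<lambda>v. 1"]) simp_all

lemma section_linear:
 assumes "f \<in> twisted_functions X 1 X"
 shows "v \<in> X \<Longrightarrow> f v = (\<Sum>j<3. f ([(1, 0, 0), (0, 1, 0), (0, 0, 1)] ! j) * co j v)"
  "\<exists>F. form (Suc 0) F \<and> (\<forall>v\<in>X. f v = F v)"
proof -
 obtain a b e where f: "\<And>v. v \<in> X \<Longrightarrow> f v = a * fst v + b * cy v + e * cz v"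
  using sections_O1[OF assms] by blast
 show "f v = (\<Sum>j<3. f ([(1, 0, 0), (0, 1, 0), (0, 0, 1)] ! j) * co j v)" if v: "v \<in> X"
  using f[OF v] f[OF vX(1)] f[OF vX(2)] f[OF vX(3)] by (simp add: sum_lt3 co_def)
 have "form (Suc 0) (\<lambda>v. a * fst v + b * cy v + e * cz v)"
  by (intro form_add form_cmult form_fst form_snd1 form_snd2)
 then show "\<exists>F. form (Suc 0) F \<and> (\<forall>v\<in>X. f v = F v)" using f by blast
qed

end

text \<open>The shape common to all the filtrations of the theorem; c will be half of
  \<open>gap\<close>.\<close>

definition destabilised :: "'k::field pt set \<Rightarrow> 'k sheaf \<Rightarrow> rat \<Rightarrow> bool" where
 "destabilised X E c \<longleftrightarrow> (\<exists>L. line_bundle X L \<and> HN_filtration X E [zero_bundle, L, E] \<and> slope X L = slope X E + c)"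

locale syzygy_pullbacks = trinomial_curve d X for d :: nat and X :: "'k::alg_closed_field pt set" +
 fixes n :: nat and S :: "nat \<Rightarrow> 'k pt \<Rightarrow> 'k" and V :: "'k sheaf"
 assumes S: "global_sections_basis X 1 n S" and V: "V = evaluation_kernel X n S"
begin

abbreviation Fr :: "nat \<Rightarrow> 'k sheaf" where "Fr s \<equiv> frobenius_pullback_iter X s V"

lemma frobenius_iter:
 assumes U: "zopen X U" shows "Fr s U = ker_pow n S (CHAR('k) ^ s) U" using U
proof (induction s arbitrary: U)
 case 0
 show ?case by (simp add: frobenius_pullback_iter_def V evaluation_kernel_def ker_pow_def)
next
 case (Suc s)
 have "frobenius_pullback X (Fr s) U = ker_pow n S (CHAR('k) ^ s * CHAR('k)) U"
 proof (rule frobenius_ker_pow[OF _ _ Suc.IH _ Suc.prems])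
  show "\<exists>F. form (Suc 0) F \<and> (\<forall>v\<in>X. S i v = F v)" if "i < n" for i
   using section_linear(2) S that unfolding global_sections_basis_def by blast
  show "CHAR('k) ^ s > 0" using CHAR_pos by simp
  fix v assume v: "v \<in> X"
  show "\<exists>k<n. S k v \<noteq> 0"
  proof (rule ccontr)
   assume z: "\<not> (\<exists>k<n. S k v \<noteq> 0)"
   have "co j v = 0" for j
   proof -
    obtain c where "(\<lambda>v. if v \<in> X then co j v else 0) = (\<lambda>v. \<Sum>i<n. c i * S i v)"
     using S coordinate_section[of j] unfolding global_sections_basis_def by blast
    from fun_cong[OF this, of v] show ?thesis using v z by simp
   qed
   from this[of 0] this[of 1] this[of 2] show False using v by (simp add: co_def X_iff prod_eq_iff)
  qed
 qed
 then show ?case by (simp add: frobenius_pullback_iter_def mult.commute)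
qed

text \<open>The values of the basis at the vertices and the coefficients of the coordinates in the
  basis form mutually inverse matrices. They stay inverse when all entries are raised to the power
  q, which is a ring homomorphism.\<close>

lemma frobenius_syz_bundle: "\<exists>C M. syz_bundle d X n (CHAR('k) ^ s) C M (Fr s)"
proof -
 define q where "q = CHAR('k) ^ s"
 define u :: "nat \<Rightarrow> 'k pt" where "u j = [(1, 0, 0), (0, 1, 0), (0, 0, 1)] ! j" for j
 have uX: "u j \<in> X" if "j < 3" for j using that vX(1-3) by (auto simp: u_def less_Suc_eq numeral_3_eq_3)
 have cu: "co l (u j) = (if j = l then 1 else 0)" if "j < 3" "l < 3" for j l
  using that by (auto simp: u_def co_def less_Suc_eq numeral_3_eq_3)
 define c where "c i j = S i (u j)" for i j
 have "\<forall>j. \<exists>m. (\<lambda>v. if v \<in> X then co j v else 0) = (\<lambda>v. \<Sum>i<n. m i * S i v)"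
  using S coordinate_section unfolding global_sections_basis_def by blast
 from choice[OF this] obtain m where m: "\<And>j. (\<lambda>v. if v \<in> X then co j v else 0) = (\<lambda>v. \<Sum>i<n. m j i * S i v)" by blast
 have Sc: "S i v = (\<Sum>j<3. c i j * co j v)" if "i < n" "v \<in> X" for i v
  using section_linear(1)[of "S i" v] S that unfolding global_sections_basis_def c_def u_def by blast
 have S0: "S i v = 0" if "i < n" "v \<notin> X" for i v
  using S that tf_out[of "S i" X 1 X v] unfolding global_sections_basis_def by blast
 have cm: "(\<Sum>i<n. c i j * m l i) = (if j = l then 1 else 0)" if "j < 3" "l < 3" for j l
  using fun_cong[OF m[of l], of "u j"] uX[OF that(1)] cu[OF that] by (simp add: c_def mult.commute)
 have mc: "(\<Sum>j<3. m j i * c i' j) = (if i = i' then 1 else 0)" if i: "i < n" "i' < n" for i i'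
 proof -
  have z: "(\<Sum>k<n. ((\<Sum>j<3. m j k * c i' j) - (if k = i' then 1 else 0)) * S k v) = 0" for v
  proof (cases "v \<in> X")
   case True
   have "(\<Sum>k<n. (\<Sum>j<3. m j k * c i' j) * S k v) = (\<Sum>k<n. \<Sum>j<3. c i' j * (m j k * S k v))"
    by (simp add: sum_distrib_left sum_distrib_right mult_ac)
   also have "\<dots> = (\<Sum>j<3. \<Sum>k<n. c i' j * (m j k * S k v))" by (rule sum.swap)
   also have "\<dots> = (\<Sum>j<3. c i' j * co j v)" using fun_cong[OF m, of v] True by (simp flip: sum_distrib_left)
   also have "\<dots> = S i' v" using Sc[OF i(2) True] by simp
   also have "\<dots> = (\<Sum>k<n. (if k = i' then 1 else 0) * S k v)" using i(2) by (simp add: if_distrib[of "\<lambda>x. x * _"] sum.delta cong: if_cong)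
   finally show ?thesis by (simp add: left_diff_distrib sum_subtractf)
  qed (simp add: S0)
  have "\<forall>k<n. (\<Sum>j<3. m j k * c i' j) - (if k = i' then 1 else 0) = 0"
   using S[unfolded global_sections_basis_def, THEN conjunct2, THEN conjunct1, THEN spec, THEN mp,
    of "\<lambda>k. (\<Sum>j<3. m j k * c i' j) - (if k = i' then 1 else 0)"] z by blast
  then show ?thesis using i(1) by auto
 qed
 have fr: "sum f A ^ q = (\<Sum>i\<in>A. f i ^ q)" for f :: "nat \<Rightarrow> 'k" and A
  unfolding q_def by (rule freshmans_dream_sum'[OF CHAR_prime refl])
 have q: "q > 0" unfolding q_def using CHAR_pos by simp
 have "syz_bundle d X n q (\<lambda>i j. c i j ^ q) (\<lambda>j i. m j i ^ q) (Fr s)"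
 proof unfold_locales
  show "q > 0" by (rule q)
  show "(\<Sum>i<n. c i j ^ q * m l i ^ q) = (if j = l then 1 else 0)" if "j < 3" "l < 3" for j l
   using arg_cong[OF cm[OF that], of "\<lambda>x. x ^ q"] q by (simp add: fr power_mult_distrib power_0_left)
  show "(\<Sum>j<3. m j i ^ q * c i' j ^ q) = (if i = i' then 1 else 0)" if "i < n" "i' < n" for i i'
   using arg_cong[OF mc[OF that], of "\<lambda>x. x ^ q"] q by (simp add: fr power_mult_distrib power_0_left)
  fix U assume U: "zopen X U"
  have "(\<Sum>i<n. g v i * S i v ^ q) = (\<Sum>j<3. (\<Sum>i<n. c i j ^ q * g v i) * co j v ^ q)" if "v \<in> U" for g v
  proof -
   have v: "v \<in> X" using that zopen_sub[OF U] by blast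
   have "(\<Sum>i<n. g v i * S i v ^ q) = (\<Sum>i<n. \<Sum>j<3. c i j ^ q * g v i * co j v ^ q)"
    by (intro sum.cong refl) (simp add: Sc[OF _ v] fr power_mult_distrib sum_distrib_left mult_ac)
   also have "\<dots> = (\<Sum>j<3. \<Sum>i<n. c i j ^ q * g v i * co j v ^ q)" by (rule sum.swap)
   finally show ?thesis by (simp add: sum_distrib_right)
  qed
  then show "Fr s U = {g \<in> trivial_bundle X n U. \<forall>v\<in>U. (\<Sum>j<3. (\<Sum>i<n. c i j ^ q * g v i) * co j v ^ q) = 0}"
   unfolding frobenius_iter[OF U] q_def[symmetric] ker_pow_def by auto
 qed
 then show ?thesis unfolding q_def by blast
qed

lemma frobenius_semistable:
 assumes "\<And>s'. s' \<le> s \<Longrightarrow> \<not> near (CHAR('k) ^ s')" shows "semistable X (Fr s)"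
proof -
 obtain C M where "syz_bundle d X n (CHAR('k) ^ s) C M (Fr s)" using frobenius_syz_bundle by blast
 then interpret B: syz_bundle d X n "CHAR('k) ^ s" C M "Fr s" .
 show ?thesis by (rule B.E_semistable) (rule gap_nonpos[OF assms])
qed

lemma frobenius_HN:
 assumes "\<And>s'. s' < s \<Longrightarrow> \<not> near (CHAR('k) ^ s')"
  and M: "odd M" "3 * \<bar>int lam * M - int (CHAR('k) ^ s) * int al\<bar> < int lam"
 shows "destabilised X (Fr s) (of_int (int lam - 3 * \<bar>int lam * M - int (CHAR('k) ^ s) * int al\<bar>) / 2)"
proof -
 obtain C N where "syz_bundle d X n (CHAR('k) ^ s) C N (Fr s)" using frobenius_syz_bundle by blast
 then interpret B: syz_bundle d X n "CHAR('k) ^ s" C N "Fr s" .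
 obtain A B where AB: "ncr A B" "gap (CHAR('k) ^ s) A B = int lam - 3 * \<bar>int lam * M - int (CHAR('k) ^ s) * int al\<bar>"
  using gap_exact[of s M] assms(1) M by blast
 show ?thesis using B.HN_exists[OF AB(1)] M(2) unfolding AB(2) destabilised_def by simp
qed

end

context trinomial_curve
begin

section \<open>The congruence classes of the characteristic\<close>

lemma int_al: "int al = int d - 2" using d3 by (simp add: al_def)

lemma int_d: "int d = int al + 2" using int_al by simp

lemma int_lam: "int lam = int al * int al + int al + 1" by (simp add: lam_def ee_eq distrib_right)

lemma lam_odd: "odd lam" by (simp add: lam_def ee_eq)

lemma odd_CHAR: "odd CHAR('k)"
proof -
 have "3\<^sup>2 \<le> d\<^sup>2" using d3 by (intro power_mono) simp_all
 then have "CHAR('k) > 2" using char_big by simp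
 then show ?thesis using prime_odd_nat[OF CHAR_prime] by simp
qed

lemma three_al_le: "3 * int al \<le> 2 * int lam"
proof -
 have "int al * 1 \<le> int al * int al" using al_pos by (intro mult_left_mono) simp_all
 then have "int al \<le> int al * int al" by simp
 then show ?thesis unfolding int_lam distrib_left by linarith
qed

lemma even_al: "even al \<longleftrightarrow> even d"
proof -
 have "d = al + 2" using d3 by (simp add: al_def)
 from arg_cong[OF this, of even] show ?thesis by simp
qed

text \<open>Both p and \<open>lam\<close> are odd, which fixes the parity of j + u^s. In this way q
  \<alpha> becomes known modulo 2 \<open>lam\<close> although p is given only modulo
  \<open>lam\<close>.\<close>

lemma power_residue:
 assumes "[int CHAR('k) = u] (mod int lam)"
 obtains j where "int (CHAR('k) ^ s) = int lam * j + u ^ s" "odd (j + u ^ s)"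
proof -
 have "[int CHAR('k) ^ s = u ^ s] (mod int lam)" using assms by (rule cong_pow)
 then obtain j where j: "int CHAR('k) ^ s - u ^ s = int lam * j" unfolding cong_iff_dvd_diff by blast
 then have e: "int (CHAR('k) ^ s) = int lam * j + u ^ s" by simp
 have "odd (int (CHAR('k) ^ s))" using odd_CHAR by simp
 then have "odd (j + u ^ s)" unfolding e using lam_odd by auto
 then show ?thesis using that e by blast
qed

text \<open>Here j is even, so for every s the number q \<alpha> is at distance \<alpha> \<le> 2
  \<open>lam\<close> / 3 from an even multiple of \<open>lam\<close>.\<close>

lemma not_near_unit:
 assumes "[int CHAR('k) = u] (mod int lam)" "\<bar>u\<bar> = 1" shows "\<not> near (CHAR('k) ^ s)"
proof -
 obtain j where j: "int (CHAR('k) ^ s) = int lam * j + u ^ s" "odd (j + u ^ s)" using power_residue[OF assms(1)] by blast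
 have u: "\<bar>u ^ s\<bar> = 1" using assms(2) by (simp add: power_abs)
 then have "odd (u ^ s)" by (metis dvd_abs_iff odd_one)
 then have "even (j * int al)" using j(2) by simp
 moreover have "int (CHAR('k) ^ s) * int al - int lam * (j * int al) = u ^ s * int al" unfolding j(1) by (simp add: algebra_simps)
 ultimately show ?thesis using not_near[of "j * int al" "CHAR('k) ^ s"] three_al_le u by (simp add: abs_mult)
qed

text \<open>For even \<alpha> the multiple j \<alpha> is even whatever j is; the distance doubles
  with each pull-back and is still in range.\<close>

lemma not_near_two:
 assumes "[int CHAR('k) = u] (mod int lam)" "\<bar>u\<bar> = 2" "even al" "3 * 2 ^ s * int al \<le> 2 * int lam"
 shows "\<not> near (CHAR('k) ^ s)"
proof -
 obtain j where j: "int (CHAR('k) ^ s) = int lam * j + u ^ s" using power_residue[OF assms(1)] by blast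
 have "even (j * int al)" using assms(3) by simp
 moreover have "int (CHAR('k) ^ s) * int al - int lam * (j * int al) = u ^ s * int al" unfolding j by (simp add: algebra_simps)
 ultimately show ?thesis using not_near[of "j * int al" "CHAR('k) ^ s"] assms(2,4) by (simp add: abs_mult power_abs mult.assoc)
qed

text \<open>The odd neighbours of the even multiple j \<alpha> are j \<alpha> + 1 and j \<alpha> -
  1; the sign of u^s decides between them.\<close>

lemma odd_multiple_two:
 assumes "[int CHAR('k) = u] (mod int lam)" "\<bar>u\<bar> = 2" "even al"
 shows "\<exists>M. odd M \<and> \<bar>int lam * M - int (CHAR('k) ^ s) * int al\<bar> = \<bar>int lam - 2 ^ s * int al\<bar>"
proof -
 obtain j where j: "int (CHAR('k) ^ s) = int lam * j + u ^ s" using power_residue[OF assms(1)] by blast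
 have "\<bar>u ^ s\<bar> = 2 ^ s" using assms(2) by (simp add: power_abs)
 then consider "u ^ s = 2 ^ s" | "u ^ s = - (2 ^ s)" by linarith
 then show ?thesis
 proof cases
  case 1
  have "int lam * (j * int al + 1) - int (CHAR('k) ^ s) * int al = int lam - 2 ^ s * int al" unfolding j 1 by (simp add: algebra_simps)
  then show ?thesis using assms(3) by (intro exI[of _ "j * int al + 1"]) simp
 next
  case 2
  have "int lam * (j * int al - 1) - int (CHAR('k) ^ s) * int al = - (int lam - 2 ^ s * int al)" unfolding j 2 by (simp add: algebra_simps)
  then show ?thesis using assms(3) by (intro exI[of _ "j * int al - 1"]) (simp only: abs_minus_cancel, simp)
 qed
qed

lemma not_near_one: "\<not> near 1" using not_near[of 0 1] three_al_le by simp

lemma not_near_two_below: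
 assumes u: "[int CHAR('k) = u] (mod int lam)" "\<bar>u\<bar> = 2" "even al" and m: "3 * 2 ^ m * int al \<le> 4 * int lam" and s: "s < m"
 shows "\<not> near (CHAR('k) ^ s)"
proof (rule not_near_two[OF u])
 have "(2::int) ^ Suc s \<le> 2 ^ m" using s by (intro power_increasing) simp_all
 then have "6 * 2 ^ s * int al \<le> 3 * 2 ^ m * int al" by (intro mult_right_mono) simp_all
 then show "3 * 2 ^ s * int al \<le> 2 * int lam" using m by linarith
qed

end

context syzygy_pullbacks
begin

section \<open>The filtrations in each congruence class\<close>

lemma frobenius_HN_two:
 assumes u: "[int CHAR('k) = u] (mod int lam)" "\<bar>u\<bar> = 2" "even al"
  and m: "3 * 2 ^ m * int al \<le> 4 * int lam" "m > 0" "g = int lam - 3 * \<bar>int lam - 2 ^ m * int al\<bar>" "g > 0"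
 shows "semistable X (Fr (m - 1))"
  "destabilised X (Fr m) (of_int g / 2)"
proof -
 show "semistable X (Fr (m - 1))"
  by (rule frobenius_semistable) (rule not_near_two_below[OF u m(1)], use m(2) in linarith)
 obtain M where M: "odd M" "\<bar>int lam * M - int (CHAR('k) ^ m) * int al\<bar> = \<bar>int lam - 2 ^ m * int al\<bar>"
  using odd_multiple_two[OF u] by blast
 show "destabilised X (Fr m) (of_int g / 2)"
  by (rule frobenius_HN[OF _ M(1), where s = m, unfolded M(2), folded m(3)])
   (rule not_near_two_below[OF u m(1)], assumption, use m(3,4) in linarith)
qed

text \<open>The range of d - 1 puts 2^m \<alpha> between \<open>lam\<close> and 4 \<open>lam\<close>
  / 3, so the gap is 4 \<open>lam\<close> - 3 2^m \<alpha>.\<close>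

lemma frobenius_HN_even_high:
 assumes u: "[int CHAR('k) = u] (mod int lam)" "\<bar>u\<bar> = 2" "even d" and m: "m \<ge> 2" "3 * 2 ^ (m - 2) \<le> d - 1" "d - 1 < 2 ^ m"
 shows "semistable X (Fr (m - 1))"
  "destabilised X (Fr m) (of_int (2 * int al * (int d - 1 - 3 * 2 ^ (m - 2)) + 2))"
proof -
 define t where "t = (2::int) ^ (m - 2)"
 obtain k where k: "m = k + 2" using m(1) le_Suc_ex by (metis add.commute)
 have tm: "(2::int) ^ m = 4 * t" by (simp add: t_def k)
 have "int (3 * 2 ^ (m - 2)) \<le> int (d - 1)" "int (d - 1) < int (2 ^ m)" using m by (simp_all only: of_nat_le_iff of_nat_less_iff)
 then have t: "3 * t \<le> int al + 1" "int al + 2 \<le> 4 * t" using d3 int_al tm by (simp_all add: t_def)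
 have al0: "int al \<ge> 0" by simp
 have 1: "(3 * t) * int al \<le> (int al + 1) * int al" "(int al + 2) * int al \<le> 4 * t * int al"
  by (intro mult_right_mono t al0)+
 have ea: "even al" using u(3) even_al by simp
 define g where "g = 2 * (2 * int al * (int d - 1 - 3 * t) + 2)"
 have "g = int lam - 3 * \<bar>int lam - 2 ^ m * int al\<bar>"
 proof -
  have "int lam \<le> 2 ^ m * int al" using 1(2) al_pos unfolding int_lam tm by (simp add: algebra_simps)
  then have "int lam - 3 * \<bar>int lam - 2 ^ m * int al\<bar> = 4 * int lam - 3 * (2 ^ m * int al)" by (simp add: abs_of_nonpos)
  also have "\<dots> = g" unfolding g_def int_lam tm int_d by (simp add: algebra_simps)
  finally show ?thesis ..
 qed
 moreover have "g > 0"
 proof -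
  have "int al * (int d - 1 - 3 * t) \<ge> 0" using t(1) int_al by (intro mult_nonneg_nonneg) simp_all
  then show ?thesis unfolding g_def by (simp add: mult.assoc)
 qed
 moreover have "3 * 2 ^ m * int al \<le> 4 * int lam" using 1(1) unfolding int_lam tm by (simp add: algebra_simps)
 moreover have "m > 0" using m(1) by simp
 ultimately have G: "3 * 2 ^ m * int al \<le> 4 * int lam" "m > 0" "g = int lam - 3 * \<bar>int lam - 2 ^ m * int al\<bar>" "g > 0" by blast+
 show "semistable X (Fr (m - 1))" by (rule frobenius_HN_two(1)[OF u(1,2) ea G])
 have "of_int g / 2 = (of_int (2 * int al * (int d - 1 - 3 * 2 ^ (m - 2)) + 2) :: rat)" by (simp add: g_def t_def)
 then show "destabilised X (Fr m) (of_int (2 * int al * (int d - 1 - 3 * 2 ^ (m - 2)) + 2))"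
  using frobenius_HN_two(2)[OF u(1,2) ea G] by (simp only:)
qed

text \<open>Now 2^m \<alpha> lies between 2 \<open>lam\<close> / 3 and \<open>lam\<close>, so the
  gap is 3 2^m \<alpha> - 2 \<open>lam\<close>.\<close>

lemma frobenius_HN_even_low:
 assumes u: "[int CHAR('k) = u] (mod int lam)" "\<bar>u\<bar> = 2" "even d" and m: "m \<ge> 2" "2 ^ m \<le> d - 1" "d - 1 < 3 * 2 ^ (m - 1)"
 shows "semistable X (Fr (m - 1))"
  "destabilised X (Fr m) (of_int (int al * (3 * 2 ^ (m - 1) - (int d - 1)) - 1))"
proof -
 define t where "t = (2::int) ^ (m - 1)"
 obtain k where k: "m = Suc k" using m(1) by (cases m) auto
 have tm: "(2::int) ^ m = 2 * t" by (simp add: t_def k)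
 have "int (2 ^ m) \<le> int (d - 1)" "int (d - 1) < int (3 * 2 ^ (m - 1))" using m by (simp_all only: of_nat_le_iff of_nat_less_iff)
 then have t: "2 * t \<le> int al + 1" "int al + 2 \<le> 3 * t" using d3 int_al tm by (simp_all add: t_def)
 \<comment> \<open>m \<ge> 2 forces d - 1 \<ge> 4, so \<alpha> outweighs the constant -1 in the
   slope.\<close>
 have "(2::nat) ^ 2 \<le> 2 ^ m" using m(1) by (intro power_increasing) simp_all
 then have "d \<ge> 5" using m(2) by simp
 then have al2: "int al \<ge> 2" using int_al by simp
 have 1: "2 * t * int al \<le> (int al + 1) * int al" "(int al + 2) * int al \<le> 3 * t * int al"
  using al2 by (intro mult_right_mono t, simp)+
 have ea: "even al" using u(3) even_al by simp
 define g where "g = 2 * (int al * (3 * t - (int d - 1)) - 1)"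
 have "g = int lam - 3 * \<bar>int lam - 2 ^ m * int al\<bar>"
 proof -
  have "2 ^ m * int al \<le> int lam" using 1(1) unfolding int_lam tm by (simp add: algebra_simps)
  then have "int lam - 3 * \<bar>int lam - 2 ^ m * int al\<bar> = 3 * (2 ^ m * int al) - 2 * int lam" by (simp add: abs_of_nonneg)
  also have "\<dots> = g" unfolding g_def int_lam tm int_d by (simp add: algebra_simps)
  finally show ?thesis ..
 qed
 moreover have "g > 0"
 proof -
  have "int al * 1 \<le> int al * (3 * t - (int d - 1))" using t(2) int_al by (intro mult_left_mono) simp_all
  then have "0 < int al * (3 * t - (int d - 1)) - 1" using al2 by linarith
  then show ?thesis unfolding g_def by (simp only: zero_less_mult_iff) simp
 qed
 moreover have "3 * 2 ^ m * int al \<le> 4 * int lam"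
 proof -
  have "2 * (t * int al) \<le> int al * int al + int al" using 1(1) by (simp add: algebra_simps)
  moreover have "int al * int al \<ge> 0" by simp
  moreover have "3 * 2 ^ m * int al = 6 * (t * int al)" unfolding tm by simp
  ultimately show ?thesis using al2 unfolding int_lam distrib_left by linarith
 qed
 moreover have "m > 0" using m(1) by simp
 ultimately have G: "3 * 2 ^ m * int al \<le> 4 * int lam" "m > 0" "g = int lam - 3 * \<bar>int lam - 2 ^ m * int al\<bar>" "g > 0" by blast+
 show "semistable X (Fr (m - 1))" by (rule frobenius_HN_two(1)[OF u(1,2) ea G])
 have "of_int g / 2 = (of_int (int al * (3 * 2 ^ (m - 1) - (int d - 1)) - 1) :: rat)" by (simp add: g_def t_def)
 then show "destabilised X (Fr m) (of_int (int al * (3 * 2 ^ (m - 1) - (int d - 1)) - 1))"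
  using frobenius_HN_two(2)[OF u(1,2) ea G] by (simp only:)
qed

text \<open>For odd d both j and \<alpha> are odd, so already p \<alpha> is within 2 \<alpha> of an
  odd multiple of \<open>lam\<close>; d \<ge> 7 is what makes 6 \<alpha> <
  \<open>lam\<close>.\<close>

lemma frobenius_HN_odd:
 assumes u: "[int CHAR('k) = u] (mod int lam)" "\<bar>u\<bar> = 2" "odd d" and d: "d \<ge> 7" shows "semistable X V"
  "destabilised X (Fr 1) (of_int (int lam - 6 * int al) / 2)"
proof -
 have "semistable X (Fr 0)" by (rule frobenius_semistable) (use not_near_one in simp)
 then show "semistable X V" by (simp add: frobenius_pullback_iter_def)
 obtain j where j: "int (CHAR('k) ^ 1) = int lam * j + u ^ 1" "odd (j + u ^ 1)" using power_residue[OF u(1)] by blast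
 have "even u" using u(2) by presburger
 then have M: "odd (j * int al)" using j(2) u(3) even_al by simp
 have e: "\<bar>int lam * (j * int al) - int (CHAR('k) ^ 1) * int al\<bar> = 2 * int al"
 proof -
  have "int lam * (j * int al) - int (CHAR('k) ^ 1) * int al = - (u * int al)" unfolding j(1) by (simp add: algebra_simps)
  then show ?thesis using u(2) by (simp add: abs_mult)
 qed
 have "5 * int al \<le> int al * int al" using d int_al by (intro mult_right_mono) simp_all
 then have "3 * (2 * int al) < int lam" unfolding int_lam by linarith
 then show "destabilised X (Fr 1) (of_int (int lam - 6 * int al) / 2)"
  using frobenius_HN[OF _ M, of 1] not_near_one unfolding e by simp
qed

text \<open>Here \<alpha> = 3 and \<open>lam\<close> = 13. For s = 1 and s = 2 the distances to even
  multiples are 7 and 1, both at most 26 / 3; for s = 3 the distance to an odd multiple is 2, which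
  gives the gap 13 - 6 = 7.\<close>

lemma frobenius_HN_five:
 assumes u: "[int CHAR('k) = u] (mod int lam)" "\<bar>u\<bar> = 2" and d: "d = 5" shows "semistable X (Fr 2)"
  "destabilised X (Fr 3) (7 / 2)"
proof -
 have al: "int al = 3" using int_al d by simp
 have lam: "int lam = 13" unfolding int_lam al by simp
 obtain w :: int where w: "u = 2 * w" "w = 1 \<or> w = -1"
 proof -
  have "u = 2 * 1 \<or> u = 2 * (-1)" using u(2) by linarith
  then show ?thesis using that by blast
 qed
 obtain j1 where j1: "int (CHAR('k) ^ 1) = int lam * j1 + u ^ 1" "odd (j1 + u ^ 1)" using power_residue[OF u(1)] by blast
 obtain j2 where j2: "int (CHAR('k) ^ 2) = int lam * j2 + u ^ 2" "odd (j2 + u ^ 2)" using power_residue[OF u(1)] by blast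
 obtain j3 where j3: "int (CHAR('k) ^ 3) = int lam * j3 + u ^ 3" "odd (j3 + u ^ 3)" using power_residue[OF u(1)] by blast
 have odd: "odd j1" "odd j2" "odd j3" "odd w" using j1(2) j2(2) j3(2) w by auto
 have n1: "\<not> near (CHAR('k) ^ 1)"
 proof (rule not_near[of "3 * j1 + w"])
  show "3 * \<bar>int (CHAR('k) ^ 1) * int al - int lam * (3 * j1 + w)\<bar> \<le> 2 * int lam"
   unfolding j1(1) lam al w(1) using w(2) by auto
 qed (use odd in simp)
 have n2: "\<not> near (CHAR('k) ^ 2)"
 proof (rule not_near[of "3 * j2 + 1"])
  show "3 * \<bar>int (CHAR('k) ^ 2) * int al - int lam * (3 * j2 + 1)\<bar> \<le> 2 * int lam"
   unfolding j2(1) lam al w(1) using w(2) by auto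
 qed (use odd in simp)
 have nn: "\<not> near (CHAR('k) ^ s)" if "s < 3" for s
 proof -
  consider "s = 0" | "s = 1" | "s = 2" using \<open>s < 3\<close> by linarith
  then show ?thesis using n1 n2 not_near_one by cases simp_all
 qed
 show "semistable X (Fr 2)" by (rule frobenius_semistable[OF nn]) simp
 have M: "odd (3 * j3 + 2 * w)" using odd by simp
 have e: "\<bar>int lam * (3 * j3 + 2 * w) - int (CHAR('k) ^ 3) * int al\<bar> = 2"
  unfolding j3(1) lam al w(1) using w(2) by auto
 show "destabilised X (Fr 3) (7 / 2)"
  using frobenius_HN[OF _ M, where s = 3, unfolded e, unfolded lam] nn by simp
qed

end

theorem corollary5p11:
 fixes d p n :: nat
  and X :: "'k::alg_closed_field pt set"
  and S :: "nat \<Rightarrow> 'k pt \<Rightarrow> 'k"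
  and V :: "'k sheaf"
  and \<alpha> lam :: int
 assumes "d \<ge> 3"
  and "p = CHAR('k)" and "p \<ge> d\<^sup>2"
  and "X = plane_curve (\<lambda>(x, y, z). x ^ (d - 1) * y + y ^ (d - 1) * z + z ^ (d - 1) * x)"
  and "global_sections_basis X 1 n S"
  and "V = evaluation_kernel X n S"
  and "\<alpha> = int d - 2"
  and "lam = (int d)\<^sup>2 - 3 * int d + 3" shows
  "([int p = 1] (mod lam) \<or> [int p = -1] (mod lam) \<longrightarrow> strongly_semistable X V) \<and>
   (([int p = 2] (mod lam) \<or> [int p = -2] (mod lam)) \<and> even d \<longrightarrow>
    (d = 4 \<longrightarrow>
      semistable X (frobenius_pullback_iter X 1 V) \<and>
      (\<exists>L. line_bundle X L \<and>
       HN_filtration X (frobenius_pullback_iter X 2 V)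
        [zero_bundle, L, frobenius_pullback_iter X 2 V] \<and>
       slope X L = slope X (frobenius_pullback_iter X 2 V) + 2)) \<and>
    (d \<ge> 6 \<longrightarrow> (\<forall>m::nat. m \<ge> 2 \<longrightarrow>
      (3 * 2 ^ (m - 2) \<le> d - 1 \<and> d - 1 < 2 ^ m \<longrightarrow>
       semistable X (frobenius_pullback_iter X (m - 1) V) \<and>
       (\<exists>L. line_bundle X L \<and>
         HN_filtration X (frobenius_pullback_iter X m V)
          [zero_bundle, L, frobenius_pullback_iter X m V] \<and>
         slope X L = slope X (frobenius_pullback_iter X m V) +
          of_int (2 * \<alpha> * (int d - 1 - 3 * 2 ^ (m - 2)) + 2))) \<and>
      (2 ^ m \<le> d - 1 \<and> d - 1 < 3 * 2 ^ (m - 1) \<longrightarrow>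
       semistable X (frobenius_pullback_iter X (m - 1) V) \<and>
       (\<exists>L. line_bundle X L \<and>
         HN_filtration X (frobenius_pullback_iter X m V)
          [zero_bundle, L, frobenius_pullback_iter X m V] \<and>
         slope X L = slope X (frobenius_pullback_iter X m V) +
          of_int (\<alpha> * (3 * 2 ^ (m - 1) - (int d - 1)) - 1)))))) \<and>
   (([int p = 2] (mod lam) \<or> [int p = -2] (mod lam)) \<and> odd d \<longrightarrow>
    (d \<ge> 7 \<longrightarrow>
      semistable X V \<and>
      (\<exists>L. line_bundle X L \<and>
       HN_filtration X (frobenius_pullback_iter X 1 V)
        [zero_bundle, L, frobenius_pullback_iter X 1 V] \<and>
       slope X L = slope X (frobenius_pullback_iter X 1 V) + of_int (lam - 6 * \<alpha>) / 2)) \<and>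
    (d = 5 \<longrightarrow>
      semistable X (frobenius_pullback_iter X 2 V) \<and>
      (\<exists>L. line_bundle X L \<and>
       HN_filtration X (frobenius_pullback_iter X 3 V)
        [zero_bundle, L, frobenius_pullback_iter X 3 V] \<and>
       slope X L = slope X (frobenius_pullback_iter X 3 V) + 7 / 2)))"
proof -
 interpret C: syzygy_pullbacks d X n S V using assms(1-6) by unfold_locales simp_all
 have al: "\<alpha> = int C.al" unfolding assms(7) C.int_al ..
 have lam: "lam = int C.lam" unfolding assms(8) C.int_lam C.int_al by (simp add: power2_eq_square algebra_simps)
 have one: "strongly_semistable X V" if h: "[int p = 1] (mod lam) \<or> [int p = -1] (mod lam)"
 proof -
  obtain u where u: "[int CHAR('k) = u] (mod int C.lam)" "\<bar>u\<bar> = 1" using h unfolding lam assms(2) by auto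
  show ?thesis unfolding strongly_semistable_def using C.frobenius_semistable[OF C.not_near_unit[OF u]] by blast
 qed
 have two: "\<exists>u. [int CHAR('k) = u] (mod int C.lam) \<and> \<bar>u\<bar> = 2" if "[int p = 2] (mod lam) \<or> [int p = -2] (mod lam)"
  using that unfolding lam assms(2) by auto
 show ?thesis unfolding destabilised_def[symmetric] al
 proof (intro conjI impI allI, goal_cases)
  case 1
  then show ?case by (rule one)
 next
  \<comment> \<open>For d = 4 the upper range applies with m = 2, since 3 \<le> d - 1 < 4.\<close>
  case 2
  then show ?case using C.frobenius_HN_even_high(1)[of _ 2] two by fastforce
 next
  case 3
  then show ?case using C.frobenius_HN_even_high(2)[of _ 2] two by fastforce
 next
  case (4 m)
  then show ?case using C.frobenius_HN_even_high(1)[of _ m] two by blast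
 next
  case (5 m)
  then show ?case using C.frobenius_HN_even_high(2)[of _ m] two by blast
 next
  case (6 m)
  then show ?case using C.frobenius_HN_even_low(1)[of _ m] two by blast
 next
  case (7 m)
  then show ?case using C.frobenius_HN_even_low(2)[of _ m] two by blast
 next
  case 8
  then show ?case using C.frobenius_HN_odd(1) two by blast
 next
  case 9
  then show ?case unfolding lam using C.frobenius_HN_odd(2) two lam by blast
 next
  case 10
  then show ?case using C.frobenius_HN_five(1) two by blast
 next
  case 11
  then show ?case using C.frobenius_HN_five(2) two by blast
 qed
qed

end
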